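(* Let $G$ and $G'$ be two vertex-disjoint copies of the augmented square antiprism graph, and let $G\oplus G'$ be the graph obtained from their union by identifying $a_0$ with $a'_0$ and $a_1$ with $a'_1$ (merging the two resulting parallel copies of the edge $(a_0,a_1)$ into one edge) and adding the edge $(b_0,b'_0)$. Then $G\oplus G'$ has a unique RAC combinatorial embedding, i.e., all straight-line RAC drawings of $G\oplus G'$ realize the same combinatorial embedding.
   Context: The augmented square antiprism graph has the $9$ vertices $v_0, a_0,\dots,a_3, b_0,\dots,b_3$ and edges $(a_i,a_{i+1})$, $(b_i,b_{i+1})$, $(a_i,b_i)$, $(a_{i+1},b_i)$ for $i=0,\dots,3$ (indices mod $4$), together with $(v_0,x)$ for every other vertex $x$; in the copy $G'$ the corresponding vertices are denoted with primes. Thus $b_0$ is the common neighbour of $a_0,a_1$ among the $b$-vertices, and similarly $b'_0$ in $G'$. A straight-line drawing maps vertices to distinct points and edges to straight segments between their endpoints, no edge passing through a non-incident vertex and no two edges overlapping; two edges cross if they meet at a point interior to both. A straight-line RAC drawing is one in which any two crossing edges are perpendicular. The combinatorial embedding of a drawing is that of its planarization (crossings replaced by dummy degree-four vertices): the cyclic orders of edges around vertices and crossings and the outer face, with vertices labelled, embeddings differing only by a reflection of the plane being identified. *)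

theory Defs
  imports "HOL-Analysis.Analysis"
begin

section \<open>Straight-line drawings\<close>

text \<open>Simple undirected graphs; the edges are two-element sets of vertices.\<close>

record 'v graph =
  verts :: "'v set"
  edges :: "'v set set"

text \<open>The plane is the type of complex numbers. For an edge \<open>e = {u, v}\<close> this is
  \<open>closed_segment (p u) (p v)\<close>.\<close>

definition edge_segment :: "('v \<Rightarrow> complex) \<Rightarrow> 'v set \<Rightarrow> complex set" where
  "edge_segment p e = convex hull (p ` e)"

definition edge_interior :: "('v \<Rightarrow> complex) \<Rightarrow> 'v set \<Rightarrow> complex set" where
  "edge_interior p e = edge_segment p e - p ` e"

definition overlap :: "('v \<Rightarrow> complex) \<Rightarrow> 'v set \<Rightarrow> 'v set \<Rightarrow> bool" where
  "overlap p e f \<longleftrightarrow>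
     (\<exists>x y. x \<noteq> y \<and> closed_segment x y \<subseteq> edge_segment p e \<inter> edge_segment p f)"

definition cross :: "('v \<Rightarrow> complex) \<Rightarrow> 'v set \<Rightarrow> 'v set \<Rightarrow> bool" where
  "cross p e f \<longleftrightarrow> e \<noteq> f \<and> edge_interior p e \<inter> edge_interior p f \<noteq> {}"

definition perpendicular :: "('v \<Rightarrow> complex) \<Rightarrow> 'v set \<Rightarrow> 'v set \<Rightarrow> bool" where
  "perpendicular p e f \<longleftrightarrow>
     (\<forall>u\<in>e. \<forall>v\<in>e. \<forall>w\<in>f. \<forall>z\<in>f. orthogonal (p v - p u) (p z - p w))"

definition straight_line_drawing :: "'v graph \<Rightarrow> ('v \<Rightarrow> complex) \<Rightarrow> bool" where
  "straight_line_drawing G p \<longleftrightarrow>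
     inj_on p (verts G) \<and>
     (\<forall>e\<in>edges G. \<forall>v\<in>verts G - e. p v \<notin> edge_segment p e) \<and>
     (\<forall>e\<in>edges G. \<forall>f\<in>edges G. e \<noteq> f \<longrightarrow> \<not> overlap p e f)"

definition RAC_drawing :: "'v graph \<Rightarrow> ('v \<Rightarrow> complex) \<Rightarrow> bool" where
  "RAC_drawing G p \<longleftrightarrow>
     straight_line_drawing G p \<and>
     (\<forall>e\<in>edges G. \<forall>f\<in>edges G. cross p e f \<longrightarrow> perpendicular p e f)"


section \<open>Combinatorial embeddings\<close>

text \<open>
  A combinatorial embedding of a planarization with node type \<open>'n\<close>:
  \<^item> \<open>label\<close> says which node is a given vertex of the original graph; the nodes that are
    not labels are the crossings;
  \<^item> \<open>(x, y, z, w) \<in> rotation\<close> means that the edges from \<open>x\<close> to its distinct neighbours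
    \<open>y, z, w\<close> leave \<open>x\<close> in this counterclockwise cyclic order;
  \<^item> \<open>(x, y) \<in> outer_face\<close> means that the outer face lies to the left of the edge between
    \<open>x\<close> and \<open>y\<close> when it is traversed from \<open>x\<close> to \<open>y\<close>.
  The planarization of a straight-line drawing has no parallel edges, so that its edges can
  be represented by pairs of adjacent nodes.
\<close>

record ('v, 'n) embedding =
  nodes :: "'n set"
  label :: "'v \<Rightarrow> 'n"
  adjacent :: "('n \<times> 'n) set"
  rotation :: "('n \<times> 'n \<times> 'n \<times> 'n) set"
  outer_face :: "('n \<times> 'n) set"

definition crossing_points :: "'v graph \<Rightarrow> ('v \<Rightarrow> complex) \<Rightarrow> complex set" where
  "crossing_points G p =
     (\<Union>e\<in>edges G. \<Union>f\<in>edges G - {e}. edge_interior p e \<inter> edge_interior p f)"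

definition planarization_nodes :: "'v graph \<Rightarrow> ('v \<Rightarrow> complex) \<Rightarrow> complex set" where
  "planarization_nodes G p = p ` verts G \<union> crossing_points G p"

text \<open>Two nodes are adjacent if they are consecutive on some edge of the drawing.\<close>

definition planarization_adj ::
    "'v graph \<Rightarrow> ('v \<Rightarrow> complex) \<Rightarrow> complex \<Rightarrow> complex \<Rightarrow> bool" where
  "planarization_adj G p x y \<longleftrightarrow>
     x \<in> planarization_nodes G p \<and> y \<in> planarization_nodes G p \<and> x \<noteq> y \<and>
     (\<exists>e\<in>edges G. x \<in> edge_segment p e \<and> y \<in> edge_segment p e) \<and>
     open_segment x y \<inter> planarization_nodes G p = {}"

definition drawing_image :: "'v graph \<Rightarrow> ('v \<Rightarrow> complex) \<Rightarrow> complex set" where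
  "drawing_image G p = p ` verts G \<union> (\<Union>e\<in>edges G. edge_segment p e)"

definition embedding_of ::
    "'v graph \<Rightarrow> ('v \<Rightarrow> complex) \<Rightarrow> ('v, complex) embedding" where
  "embedding_of G p =
     \<lparr> nodes = planarization_nodes G p,
       label = p,
       adjacent = {(x, y). planarization_adj G p x y},
       rotation = {(x, y, z, w).
         planarization_adj G p x y \<and> planarization_adj G p x z \<and> planarization_adj G p x w \<and>
         0 < Arg2pi ((z - x) / (y - x)) \<and>
         Arg2pi ((z - x) / (y - x)) < Arg2pi ((w - x) / (y - x))},
       outer_face = {(x, y). planarization_adj G p x y \<and>
         (\<forall>\<^sub>F t in at_right 0.
            midpoint x y + of_real t * \<i> * (y - x) \<in> outside (drawing_image G p))} \<rparr>"

text \<open>The embedding of the drawing reflected at a line.\<close>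

definition mirror :: "('v, 'n) embedding \<Rightarrow> ('v, 'n) embedding" where
  "mirror M =
     M \<lparr> rotation := {(x, y, z, w). (x, w, z, y) \<in> rotation M},
         outer_face := {(x, y). (y, x) \<in> outer_face M} \<rparr>"

definition embedding_iso ::
    "'v set \<Rightarrow> ('v, 'm) embedding \<Rightarrow> ('v, 'n) embedding \<Rightarrow> ('m \<Rightarrow> 'n) \<Rightarrow> bool" where
  "embedding_iso V M N h \<longleftrightarrow>
     bij_betw h (nodes M) (nodes N) \<and>
     (\<forall>v\<in>V. h (label M v) = label N v) \<and>
     (\<forall>x\<in>nodes M. \<forall>y\<in>nodes M. (x, y) \<in> adjacent M \<longleftrightarrow> (h x, h y) \<in> adjacent N) \<and>
     (\<forall>x\<in>nodes M. \<forall>y\<in>nodes M. \<forall>z\<in>nodes M. \<forall>w\<in>nodes M.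
        (x, y, z, w) \<in> rotation M \<longleftrightarrow> (h x, h y, h z, h w) \<in> rotation N) \<and>
     (\<forall>x\<in>nodes M. \<forall>y\<in>nodes M. (x, y) \<in> outer_face M \<longleftrightarrow> (h x, h y) \<in> outer_face N)"

text \<open>
  Vertices are labelled and must be preserved. Crossings carry no label, but no freedom is
  gained by this: an isomorphism preserves which edges are opposite at a crossing, so it maps
  the crossing of two given edges to the crossing of the same two edges.
\<close>

definition same_embedding :: "'v graph \<Rightarrow> ('v \<Rightarrow> complex) \<Rightarrow> ('v \<Rightarrow> complex) \<Rightarrow> bool" where
  "same_embedding G p q \<longleftrightarrow>
     (\<exists>h. embedding_iso (verts G) (embedding_of G p) (embedding_of G q) h \<or>
          embedding_iso (verts G) (embedding_of G p) (mirror (embedding_of G q)) h)"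


section \<open>The graphs\<close>

text \<open>Arithmetic in the index type \<open>4\<close> is arithmetic modulo 4.\<close>

datatype antiprism_vertex = V0 | A 4 | B 4

definition augmented_square_antiprism :: "antiprism_vertex graph" where
  "augmented_square_antiprism =
     \<lparr> verts = UNIV,
       edges = (\<Union>i. {{A i, A (i + 1)}, {B i, B (i + 1)}, {A i, B i}, {A (i + 1), B i}}) \<union>
               {{V0, x} | x. x \<noteq> V0} \<rparr>"

definition disjoint_union :: "'a graph \<Rightarrow> 'b graph \<Rightarrow> ('a + 'b) graph" where
  "disjoint_union G H =
     \<lparr> verts = Inl ` verts G \<union> Inr ` verts H,
       edges = image Inl ` edges G \<union> image Inr ` edges H \<rparr>"

text \<open>The identification of the primed vertices \<open>Inr (A 0)\<close> and \<open>Inr (A 1)\<close> with their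
  unprimed counterparts.\<close>

definition glue ::
    "antiprism_vertex + antiprism_vertex \<Rightarrow> antiprism_vertex + antiprism_vertex" where
  "glue x = (if x = Inr (A 0) then Inl (A 0) else if x = Inr (A 1) then Inl (A 1) else x)"

definition antiprism_sum :: "(antiprism_vertex + antiprism_vertex) graph" where
  "antiprism_sum =
     (let U = disjoint_union augmented_square_antiprism augmented_square_antiprism
      in \<lparr> verts = glue ` verts U,
           edges = image glue ` edges U \<union> {{Inl (B 0), Inr (B 0)}} \<rparr>)"

end

theory Submission
  imports Defs
begin

section \<open>Orientation of triples of points\<close>

text \<open>A drawing with right-angle crossings obeys two local rules. An edge cannot cross two
  edges with a common end, because both would be perpendicular to it
  (\<open>no_fan_crossing\<close>). If xy crosses zu and xw crosses zv, then the turn from xy to xw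
  has the same sign as the turn from zu to zv or the opposite one, according to whether the two
  crossings have the same sense (\<open>crossing_rotation\<close>). Apart from these rules, only the
  orientations of triples of points are needed, and these satisfy the axioms of counterclockwise
  systems. Vertices may be collinear, so the signs are read off a small perturbation in general
  position, which keeps every nonzero orientation and creates no crossing
  (\<open>generic_perturbation_exists\<close>); for disjoint edges of the drawing the perturbed
  signs tell exactly which of them meet (\<open>opposite_iff_meeting\<close>). Statements about all
  drawings thereby become propositional, and each is derived from a finite list of instances of the
  axioms and the two rules.

  One antiprism without its hub is the square of an 8-cycle. The hub sees this cycle turning in a
  constant direction (\<open>consecutive_rays\<close>), and of two consecutive hub edges exactly one
  is crossed by the chord between the cycle neighbours of its end (\<open>alternating\<close>). No
  other edges cross. Up to reflection this leaves two pictures, in which the hub edges of the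
  a-vertices or those of the b-vertices are crossed (\<open>standard_positions\<close>).

  For two antiprisms with a common edge, and the first hub positively oriented, eight combinations
  of pictures and orientations remain. All but one contradict the rules
  (\<open>standard_layout\<close>): in both copies the hub edges of the a-vertices are crossed, and
  the hubs lie on opposite sides of the common edge. In this layout the eight triangles spanned by
  the hubs and the two outer quadrilaterals meet only in common corners and sides, the edge between
  the two special b-vertices crosses the common edge and nothing else, and the cyclic order at every
  vertex is forced (\<open>layout0\<close> to \<open>layout9\<close>).

  Every edge is then crossed at most once, so the embedding is determined by the crossing pairs, the
  senses of the crossings, the cyclic orders at the vertices and the boundary of the outer face
  (\<open>one_plane_embedding_iso\<close>). For the outer face, the four triangles at a hub form a
  star-shaped set, and the two such sets share just a segment. By Janiszewski's theorem the
  complement of their union is connected, so it is the outer face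
  (\<open>complement_connected\<close>, \<open>region_outside\<close>). A reflection makes the first
  hub positive (\<open>RAC_drawing_layout\<close>, \<open>same_embedding_cnj\<close>). Existence is
  shown by a drawing on the integer grid (\<open>rac_config_grid\<close>).\<close>

definition orient :: "complex \<Rightarrow> complex \<Rightarrow> complex \<Rightarrow> real" where
  "orient a b c = Re (b - a) * Im (c - a) - Im (b - a) * Re (c - a)"

lemma orient_rotate: "orient b c a = orient a b c"
  by (simp add: orient_def algebra_simps)

lemma orient_swap: "orient b a c = - orient a b c"
  by (simp add: orient_def algebra_simps)

text \<open>\<open>orient\<close> is twice the signed area, and t splits the triangle into three
  signed parts.\<close>

lemma orient_interiority: "orient p q r = orient t q r + orient p t r + orient p q t"
  by (simp add: orient_def algebra_simps)

text \<open>The three-term Grassmann-Pluecker relation for the directions from t to s, p, q and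
  r.\<close>

lemma orient_Pluecker:
  "orient t s q * orient t p r = orient t s p * orient t q r + orient t s r * orient t p q"
  by (simp add: orient_def algebra_simps)

lemma orient_same [simp]: "orient a a b = 0" "orient a b b = 0" "orient a b a = 0"
  by (simp_all add: orient_def)

lemma orient_cnj: "orient (cnj a) (cnj b) (cnj c) = - orient a b c"
  by (simp add: orient_def algebra_simps)

lemma orthogonal_complex_iff:
  "orthogonal (x::complex) y \<longleftrightarrow> Re x * Re y + Im x * Im y = 0"
  by (simp add: orthogonal_def inner_complex_def)

lemma in_segment_orient:
  assumes "c \<in> closed_segment a b"
  shows "orient a b c = 0"
proof -
  obtain u where u: "c = (1 - u) *\<^sub>R a + u *\<^sub>R b"
    using assms by (auto simp: in_segment)
  show ?thesis unfolding u orient_def by (simp add: algebra_simps)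
qed

text \<open>The normalised inner product t satisfies \<open>c = a + t *\<^sub>R (b - a)\<close>. Its
  position relative to 0 and 1 tells which of the three points is the middle one.\<close>

lemma orient_zero_imp_between:
  assumes "orient a b c = 0"
  shows "a \<in> closed_segment b c \<or> b \<in> closed_segment a c \<or> c \<in> closed_segment a b"
proof (cases "a = b")
  case False
  define v where "v = b - a"
  define n where "n = Re v * Re v + Im v * Im v"
  have "v \<noteq> 0" using False by (simp add: v_def)
  then have n: "n > 0"
    unfolding n_def using sum_squares_gt_zero_iff[of "Re v" "Im v"] by (auto simp: complex_eq_iff)
  define t where "t = (Re v * Re (c - a) + Im v * Im (c - a)) / n"
  have o: "Re v * Im (c - a) = Im v * Re (c - a)"
    using assms by (simp add: orient_def v_def)
  have "n * Re (c - a) = Re v * (Re v * Re (c - a)) + Im v * (Im v * Re (c - a))"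
    by (simp add: n_def algebra_simps)
  also have "\<dots> = Re v * (Re v * Re (c - a) + Im v * Im (c - a))"
    unfolding o[symmetric] by (simp only: algebra_simps)
  finally have re: "Re (c - a) = t * Re v" using n by (simp add: t_def field_simps)
  have "n * Im (c - a) = Re v * (Re v * Im (c - a)) + Im v * (Im v * Im (c - a))"
    by (simp add: n_def algebra_simps)
  also have "\<dots> = Im v * (Re v * Re (c - a) + Im v * Im (c - a))"
    unfolding o by (simp only: algebra_simps)
  finally have im: "Im (c - a) = t * Im v" using n by (simp add: t_def field_simps)
  have c: "c = a + t *\<^sub>R (b - a)"
    using re im by (simp add: complex_eq_iff v_def)
  consider "t < 0" | "0 \<le> t" "t \<le> 1" | "t > 1" by linarith
  then show ?thesis
  proof cases
    case 1
    then have "a = (1 - (-t/(1-t))) *\<^sub>R c + (-t/(1-t)) *\<^sub>R b"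
      unfolding c by (simp add: complex_eq_iff divide_simps) (simp add: algebra_simps)
    moreover have "0 \<le> -t/(1-t)" "-t/(1-t) \<le> 1" using 1 by (auto simp: divide_simps)
    ultimately have "a \<in> closed_segment c b" unfolding in_segment by blast
    then show ?thesis by (simp add: closed_segment_commute)
  next
    case 2
    have "c = (1 - t) *\<^sub>R a + t *\<^sub>R b" unfolding c by (simp add: algebra_simps)
    then show ?thesis using 2 unfolding in_segment by blast
  next
    case 3
    then have "b = (1 - 1/t) *\<^sub>R a + (1/t) *\<^sub>R c"
      unfolding c by (simp add: complex_eq_iff divide_simps) (simp add: algebra_simps)
    moreover have "0 \<le> 1/t" "1/t \<le> 1" using 3 by auto
    ultimately show ?thesis unfolding in_segment by blast
  qed
qed auto

text \<open>Perpendicular vectors \<open>p\<^sub>i = k\<^sub>i * \<i> * q\<^sub>i\<close> satisfy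
  \<open>det p\<^sub>1 p\<^sub>2 = k\<^sub>1 * k\<^sub>2 * det q\<^sub>1 q\<^sub>2\<close>.\<close>

lemma det_of_perpendiculars:
  fixes p1 p2 q1 q2 :: complex
  assumes o1: "orthogonal p1 q1" and o2: "orthogonal p2 q2"
  shows "(cmod q1)\<^sup>2 * (cmod q2)\<^sup>2 * orient 0 p1 p2
       = orient 0 p1 q1 * orient 0 p2 q2 * orient 0 q1 q2"
proof -
  \<comment> \<open>In components: if p is orthogonal to q, then |q|^2 p is the multiple of
    \<open>\<i> * q\<close> by minus the determinant of p and q. Multiplying by |q|^2 avoids
    division.\<close>
  have a: "(cmod q)\<^sup>2 * Re p = - orient 0 p q * - Im q \<and> (cmod q)\<^sup>2 * Im p = - orient 0 p q * Re q"
    if "orthogonal p q" for p q :: complex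
  proof -
    have o: "Re p * Re q = - (Im p * Im q)" using that by (simp add: orthogonal_complex_iff)
    have n: "(cmod q)\<^sup>2 = Re q * Re q + Im q * Im q"
      by (simp only: cmod_power2) (simp only: power2_eq_square)
    have "(cmod q)\<^sup>2 * Re p = Re q * (Re p * Re q) + Im q * (Im q * Re p)"
      unfolding n by (simp add: algebra_simps)
    also have "\<dots> = - orient 0 p q * - Im q"
      unfolding o by (simp add: orient_def algebra_simps)
    finally have 1: "(cmod q)\<^sup>2 * Re p = - orient 0 p q * - Im q" .
    have "(cmod q)\<^sup>2 * Im p = Re q * (Re q * Im p) + Im q * (Im p * Im q)"
      unfolding n by (simp add: algebra_simps)
    also have "Im p * Im q = - (Re p * Re q)" using o by simp
    finally have 2: "(cmod q)\<^sup>2 * Im p = - orient 0 p q * Re q"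
      by (simp add: orient_def algebra_simps)
    from 1 2 show ?thesis by blast
  qed
  have "(cmod q1)\<^sup>2 * (cmod q2)\<^sup>2 * orient 0 p1 p2
      = ((cmod q1)\<^sup>2 * Re p1) * ((cmod q2)\<^sup>2 * Im p2) - ((cmod q1)\<^sup>2 * Im p1) * ((cmod q2)\<^sup>2 * Re p2)"
    by (simp add: orient_def algebra_simps)
  also have "\<dots> = orient 0 p1 q1 * orient 0 p2 q2 * orient 0 q1 q2"
    using a[OF o1] a[OF o2] by (simp add: orient_def[of 0 q1 q2] algebra_simps)
  finally show ?thesis .
qed

section \<open>Passing to general position without losing signs or adding crossings\<close>

section \<open>Right-angle configurations and their perturbations\<close>

text \<open>The symmetric relation \<open>E\<close> is the adjacency relation of a graph with vertices
  \<open>0, \<dots>, n - 1\<close>.\<close>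

definition rac_config :: "nat \<Rightarrow> (nat \<Rightarrow> nat \<Rightarrow> bool) \<Rightarrow> (nat \<Rightarrow> complex) \<Rightarrow> bool" where
  "rac_config n E P \<longleftrightarrow>
     inj_on P {..<n} \<and>
     (\<forall>a b c. E a b \<and> c < n \<and> c \<noteq> a \<and> c \<noteq> b \<longrightarrow> P c \<notin> closed_segment (P a) (P b)) \<and>
     (\<forall>a b c d. E a b \<and> E c d \<and> distinct [a, b, c, d] \<and>
        closed_segment (P a) (P b) \<inter> closed_segment (P c) (P d) \<noteq> {} \<longrightarrow>
        orthogonal (P b - P a) (P d - P c))"

text \<open>For points in general position this says that the segments ab and cd cross. Only strict
  positivity is used as an atom, so the condition is propositional in the signs of triples.\<close>

definition opposite :: "(nat \<Rightarrow> complex) \<Rightarrow> nat \<Rightarrow> nat \<Rightarrow> nat \<Rightarrow> nat \<Rightarrow> bool" where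
  "opposite Q a b c d \<longleftrightarrow>
     (0 < orient (Q a) (Q b) (Q c)) \<noteq> (0 < orient (Q a) (Q b) (Q d)) \<and>
     (0 < orient (Q c) (Q d) (Q a)) \<noteq> (0 < orient (Q c) (Q d) (Q b))"

text \<open>A perturbation into general position that neither flips the orientation of a triple nor
  creates crossings.\<close>

definition generic_perturbation ::
    "nat \<Rightarrow> (nat \<Rightarrow> complex) \<Rightarrow> (nat \<Rightarrow> complex) \<Rightarrow> bool" where
  "generic_perturbation n P Q \<longleftrightarrow>
     (\<forall>a<n. \<forall>b<n. \<forall>c<n. distinct [a, b, c] \<longrightarrow> orient (Q a) (Q b) (Q c) \<noteq> 0 \<and>
        (0 < orient (P a) (P b) (P c) \<longrightarrow> 0 < orient (Q a) (Q b) (Q c)) \<and>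
        (orient (P a) (P b) (P c) < 0 \<longrightarrow> orient (Q a) (Q b) (Q c) < 0)) \<and>
     (\<forall>a<n. \<forall>b<n. \<forall>c<n. \<forall>d<n. distinct [a, b, c, d] \<and>
        closed_segment (P a) (P b) \<inter> closed_segment (P c) (P d) = {} \<longrightarrow> \<not> opposite Q a b c d)"

text \<open>The lowest nonzero coefficient decides the behaviour near 0.\<close>

lemma eventually_quadratic_nonzero:
  fixes A B C :: real
  assumes "C \<noteq> 0"
  shows "\<forall>\<^sub>F e in at_right 0. A + e * B + e * e * C \<noteq> 0"
proof -
  consider "A \<noteq> 0" | "A = 0" "B \<noteq> 0" | "A = 0" "B = 0" by blast
  then show ?thesis
  proof cases
    case 1
    have "((\<lambda>e. A + e * B + e * e * C) \<longlongrightarrow> A + 0 * B + 0 * 0 * C) (at_right 0)"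
      by (intro tendsto_intros)
    then show ?thesis using tendsto_imp_eventually_ne[of _ A _ 0] 1 by simp
  next
    case 2
    have "((\<lambda>e. B + e * C) \<longlongrightarrow> B + 0 * C) (at_right 0)"
      by (intro tendsto_intros)
    then have "\<forall>\<^sub>F e in at_right 0. B + e * C \<noteq> 0"
      using tendsto_imp_eventually_ne[of _ B _ 0] 2 by simp
    then show ?thesis using eventually_at_right_less[of 0]
    proof eventually_elim
      case (elim e)
      have "A + e * B + e * e * C = e * (B + e * C)" using 2 by (simp add: algebra_simps)
      then show ?case using elim by simp
    qed
  next
    case 3
    show ?thesis using eventually_at_right_less[of 0]
      by eventually_elim (use 3 assms in auto)
  qed
qed

text \<open>The identities \<open>id\<close> and \<open>AB\<close> express that one point is a
  combination of a and b with weights A and -B, and of c and d with weights -C and D. When the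
  segments cross, the weights on both sides have one common sign, so evaluating v minus k gives
  opposite signs on the two sides of \<open>id\<close>.\<close>

lemma opposite_not_separated:
  assumes opp: "opposite Q a b c d"
    and gen: "orient (Q a) (Q b) (Q c) \<noteq> 0" "orient (Q a) (Q b) (Q d) \<noteq> 0"
      "orient (Q c) (Q d) (Q a) \<noteq> 0" "orient (Q c) (Q d) (Q b) \<noteq> 0"
    and sep: "v \<bullet> Q a < k" "v \<bullet> Q b < k" "k < v \<bullet> Q c" "k < v \<bullet> Q d"
  shows False
proof -
  define A B C D where "A = orient (Q c) (Q d) (Q b)" and "B = orient (Q c) (Q d) (Q a)"
    and "C = orient (Q a) (Q b) (Q d)" and "D = orient (Q a) (Q b) (Q c)"
  have id: "A * (v \<bullet> Q a - k) - B * (v \<bullet> Q b - k) = D * (v \<bullet> Q d - k) - C * (v \<bullet> Q c - k)"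
    by (simp add: A_def B_def C_def D_def orient_def inner_complex_def algebra_simps)
  have AB: "A - B = D - C"
    by (simp add: A_def B_def C_def D_def orient_def algebra_simps)
  have opp': "(0 < D) \<noteq> (0 < C)" "(0 < B) \<noteq> (0 < A)" and ne: "A \<noteq> 0" "B \<noteq> 0" "C \<noteq> 0" "D \<noteq> 0"
    using opp gen by (simp_all add: opposite_def A_def B_def C_def D_def)
  show False
  proof (cases "0 < A")
    case True
    then have "B < 0" using opp' ne by linarith
    then have "D - C > 0" using AB True by linarith
    then have "D > 0" "C < 0" using opp' ne by linarith+
    have "A * (v \<bullet> Q a - k) < 0" using True sep by (simp add: mult_less_0_iff)
    moreover have "B * (v \<bullet> Q b - k) > 0" using \<open>B < 0\<close> sep by (simp add: zero_less_mult_iff)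
    moreover have "D * (v \<bullet> Q d - k) > 0" using \<open>D > 0\<close> sep by simp
    moreover have "C * (v \<bullet> Q c - k) < 0" using \<open>C < 0\<close> sep by (simp add: mult_less_0_iff)
    ultimately show False using id by linarith
  next
    case False
    then have "B > 0" "A < 0" using opp' ne by linarith+
    then have "D - C < 0" using AB by linarith
    then have "D < 0" "C > 0" using opp' ne by linarith+
    have "A * (v \<bullet> Q a - k) > 0" using \<open>A < 0\<close> sep by (simp add: zero_less_mult_iff)
    moreover have "B * (v \<bullet> Q b - k) < 0" using \<open>B > 0\<close> sep by (simp add: mult_less_0_iff)
    moreover have "D * (v \<bullet> Q d - k) < 0" using \<open>D < 0\<close> sep by (simp add: mult_less_0_iff)
    moreover have "C * (v \<bullet> Q c - k) > 0" using \<open>C > 0\<close> sep by simp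
    ultimately show False using id by linarith
  qed
qed

text \<open>Vertex k is moved by e times the point (k, k^2) of a parabola. Each orientation becomes
  a quadratic polynomial in e whose leading coefficient is a Vandermonde product. For small positive
  e it is nonzero and keeps a nonzero sign at e = 0, while disjoint segments stay on their sides of
  a separating line.\<close>

lemma generic_perturbation_exists: "\<exists>Q. generic_perturbation n P Q"
proof -
  define w :: "nat \<Rightarrow> complex" where "w k = Complex (real k) (real k * real k)" for k
  define R where "R e k = P k + of_real e * w k" for e :: real and k
  define A where "A a b c = orient (P a) (P b) (P c)" for a b c
  define C where "C a b c = orient (w a) (w b) (w c)" for a b c
  \<comment> \<open>The mixed coefficient of the quadratic polynomial, obtained from its value at e
    = 1.\<close>
  define B where "B a b c = orient (P a + w a) (P b + w b) (P c + w c) - A a b c - C a b c" for a b c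
  have expand: "orient (R e a) (R e b) (R e c) = A a b c + e * B a b c + e * e * C a b c" for e a b c
    by (simp add: R_def A_def B_def C_def orient_def algebra_simps)
  have C0: "C a b c \<noteq> 0" if "distinct [a, b, c]" for a b c
  proof -
    have "C a b c = (real b - real a) * (real c - real a) * (real c - real b)"
      by (simp add: C_def w_def orient_def algebra_simps)
    then show ?thesis using that by auto
  qed
  have lim: "((\<lambda>e. orient (R e a) (R e b) (R e c)) \<longlongrightarrow> A a b c) (at_right 0)" for a b c
  proof -
    have "((\<lambda>e. A a b c + e * B a b c + e * e * C a b c) \<longlongrightarrow> A a b c + 0 * B a b c + 0 * 0 * C a b c)
      (at_right 0)" by (intro tendsto_intros)
    then show ?thesis by (simp add: expand)
  qed
  have ev1: "\<forall>\<^sub>F e in at_right 0. distinct [a, b, c] \<longrightarrow> orient (R e a) (R e b) (R e c) \<noteq> 0 \<and>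
        (0 < A a b c \<longrightarrow> 0 < orient (R e a) (R e b) (R e c)) \<and>
        (A a b c < 0 \<longrightarrow> orient (R e a) (R e b) (R e c) < 0)" for a b c
  proof (cases "distinct [a, b, c]")
    case True
    have 1: "\<forall>\<^sub>F e in at_right 0. orient (R e a) (R e b) (R e c) \<noteq> 0"
      unfolding expand by (rule eventually_quadratic_nonzero[OF C0[OF True]])
    have 2: "\<forall>\<^sub>F e in at_right 0. 0 < A a b c \<longrightarrow> 0 < orient (R e a) (R e b) (R e c)"
      using order_tendstoD(1)[OF lim, of 0 a b c] by (cases "0 < A a b c") auto
    have 3: "\<forall>\<^sub>F e in at_right 0. A a b c < 0 \<longrightarrow> orient (R e a) (R e b) (R e c) < 0"
      using order_tendstoD(2)[OF lim, of a b c 0] by (cases "A a b c < 0") auto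
    show ?thesis using 1 2 3 by eventually_elim simp
  next
    case False then show ?thesis by (simp only: simp_thms eventually_True)
  qed
  have limR: "((\<lambda>e. v \<bullet> R e k) \<longlongrightarrow> v \<bullet> P k) (at_right 0)" for v k
  proof -
    have "((\<lambda>e. v \<bullet> R e k) \<longlongrightarrow> v \<bullet> (P k + of_real 0 * w k)) (at_right 0)"
      unfolding R_def by (intro tendsto_intros)
    then show ?thesis by simp
  qed
  have ev2: "\<forall>\<^sub>F e in at_right 0. distinct [a, b, c, d] \<and>
        closed_segment (P a) (P b) \<inter> closed_segment (P c) (P d) = {} \<longrightarrow> \<not> opposite (R e) a b c d"
    for a b c d
  proof (cases "distinct [a, b, c, d] \<and> closed_segment (P a) (P b) \<inter> closed_segment (P c) (P d) = {}")
    case True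
    obtain v k where vk: "\<forall>x\<in>closed_segment (P a) (P b). v \<bullet> x < k" "\<forall>x\<in>closed_segment (P c) (P d). k < v \<bullet> x"
      using separating_hyperplane_compact_closed[of "closed_segment (P a) (P b)" "closed_segment (P c) (P d)"] True
      by (auto simp: convex_closed_segment closed_segment compact_segment)
    have "\<forall>\<^sub>F e in at_right 0. v \<bullet> R e a < k" "\<forall>\<^sub>F e in at_right 0. v \<bullet> R e b < k"
      "\<forall>\<^sub>F e in at_right 0. k < v \<bullet> R e c" "\<forall>\<^sub>F e in at_right 0. k < v \<bullet> R e d"
      using order_tendstoD[OF limR] vk by auto
    moreover have "\<forall>\<^sub>F e in at_right 0. orient (R e a) (R e b) (R e c) \<noteq> 0"
      "\<forall>\<^sub>F e in at_right 0. orient (R e a) (R e b) (R e d) \<noteq> 0"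
      "\<forall>\<^sub>F e in at_right 0. orient (R e c) (R e d) (R e a) \<noteq> 0"
      "\<forall>\<^sub>F e in at_right 0. orient (R e c) (R e d) (R e b) \<noteq> 0"
      unfolding expand using True by (auto intro!: eventually_quadratic_nonzero C0)
    ultimately show ?thesis
      by eventually_elim (use opposite_not_separated in blast)
  next
    case False then show ?thesis by (simp only: simp_thms eventually_True)
  qed
  have "\<forall>\<^sub>F e in at_right 0. generic_perturbation n P (R e)"
    unfolding generic_perturbation_def A_def[symmetric]
    by (intro eventually_conj eventually_ball_finite[of "{..<n}", unfolded Ball_def lessThan_iff] allI impI
        ev1 ev2 finite_lessThan)
  then show ?thesis
    using eventually_happens[of _ "at_right (0::real)"] by auto
qed

section \<open>Signs of triples as propositional atoms\<close>

definition pos :: "(nat \<Rightarrow> complex) \<Rightarrow> nat \<Rightarrow> nat \<Rightarrow> nat \<Rightarrow> bool" where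
  "pos Q a b c \<longleftrightarrow> 0 < orient (Q a) (Q b) (Q c)"

lemma opposite_pos:
  "opposite Q a b c d \<longleftrightarrow> (pos Q a b c \<noteq> pos Q a b d) \<and> (pos Q c d a \<noteq> pos Q c d b)"
  by (simp add: opposite_def pos_def)

lemma pos_rotate: "pos Q b c a = pos Q a b c"
  by (simp add: pos_def orient_rotate)

lemma pos_comp: "pos (Q \<circ> f) a b c \<longleftrightarrow> pos Q (f a) (f b) (f c)"
  by (simp add: pos_def)

lemma opposite_comp: "opposite (Q \<circ> f) a b c d \<longleftrightarrow> opposite Q (f a) (f b) (f c) (f d)"
  by (simp add: opposite_def)

text \<open>Knuth's axioms for counterclockwise systems.\<close>

lemma pos_interiority: "pos Q t q r \<Longrightarrow> pos Q p t r \<Longrightarrow> pos Q p q t \<Longrightarrow> pos Q p q r"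
  using orient_interiority[of "Q p" "Q q" "Q r" "Q t"] by (simp add: pos_def)

text \<open>In the Pluecker relation the product of the known sign of t s q with the wanted sign of
  t p r is a sum of two positive products.\<close>

lemma pos_transitivity:
  assumes "pos Q t s p" "pos Q t s q" "pos Q t s r" "pos Q t p q" "pos Q t q r"
  shows "pos Q t p r"
proof -
  have "0 < orient (Q t) (Q s) (Q q) * orient (Q t) (Q p) (Q r)"
    unfolding orient_Pluecker[of "Q t" "Q s" "Q q" "Q p" "Q r"]
    using assms by (simp add: pos_def add_pos_pos)
  then show ?thesis using assms by (simp add: pos_def zero_less_mult_iff)
qed

text \<open>Each axiom scheme is a predicate in the vertex numbers, so that a long list of chosen
  instances can be stated compactly and proved by one introduction rule. Unfolding
  \<open>ax_defs\<close> turns the instances into clauses.\<close>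

definition int_ax :: "(nat \<Rightarrow> complex) \<Rightarrow> nat \<Rightarrow> nat \<Rightarrow> nat \<Rightarrow> nat \<Rightarrow> bool" where
  "int_ax Q t p q r \<longleftrightarrow> \<not> pos Q t q r \<or> \<not> pos Q p t r \<or> \<not> pos Q p q t \<or> pos Q p q r"

definition trans_ax :: "(nat \<Rightarrow> complex) \<Rightarrow> nat \<Rightarrow> nat \<Rightarrow> nat \<Rightarrow> nat \<Rightarrow> nat \<Rightarrow> bool" where
  "trans_ax Q t s p q r \<longleftrightarrow>
    \<not> pos Q t s p \<or> \<not> pos Q t s q \<or> \<not> pos Q t s r \<or> \<not> pos Q t p q \<or> \<not> pos Q t q r \<or> pos Q t p r"

definition opp_ax :: "(nat \<Rightarrow> complex) \<Rightarrow> nat \<Rightarrow> nat \<Rightarrow> nat \<Rightarrow> nat \<Rightarrow> bool" where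
  "opp_ax Q a b c d \<longleftrightarrow>
    (opposite Q a b c d \<longleftrightarrow> (pos Q a b c \<longleftrightarrow> \<not> pos Q a b d) \<and> (pos Q c d a \<longleftrightarrow> \<not> pos Q c d b))"

text \<open>This scheme and \<open>rot_ax\<close> carry the right angles. The other schemes hold for
  arbitrary points in general position or by definition; these two are established only for edges of
  the drawing.\<close>

definition fan_ax :: "(nat \<Rightarrow> complex) \<Rightarrow> nat \<Rightarrow> nat \<Rightarrow> nat \<Rightarrow> nat \<Rightarrow> nat \<Rightarrow> bool" where
  "fan_ax Q a b x y w \<longleftrightarrow> \<not> opposite Q a b x y \<or> \<not> opposite Q a b x w"

definition rot_ax :: "(nat \<Rightarrow> complex) \<Rightarrow> nat \<Rightarrow> nat \<Rightarrow> nat \<Rightarrow> nat \<Rightarrow> nat \<Rightarrow> nat \<Rightarrow> bool" where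
  "rot_ax Q x y w z u v \<longleftrightarrow> \<not> opposite Q x y z u \<or> \<not> opposite Q x w z v \<or>
    ((pos Q x y w \<longleftrightarrow> pos Q z u v) \<longleftrightarrow> (pos Q x y u \<longleftrightarrow> pos Q x w v))"

definition inside :: "(nat \<Rightarrow> complex) \<Rightarrow> nat \<Rightarrow> nat \<Rightarrow> nat \<Rightarrow> nat \<Rightarrow> bool" where
  "inside Q a b c w \<longleftrightarrow> pos Q a b w \<and> pos Q b c w \<and> pos Q c a w"

text \<open>Cyclic order of three directions at v: two left turns out of three is the right
  criterion whether or not the directions fit in a half-plane.\<close>

definition cyc :: "(nat \<Rightarrow> complex) \<Rightarrow> nat \<Rightarrow> nat \<Rightarrow> nat \<Rightarrow> nat \<Rightarrow> bool" where
  "cyc Q v a b c \<longleftrightarrow> (pos Q v a b \<and> pos Q v b c) \<or> (pos Q v b c \<and> pos Q v c a) \<or> (pos Q v c a \<and> pos Q v a b)"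

definition inside_ax :: "(nat \<Rightarrow> complex) \<Rightarrow> nat \<Rightarrow> nat \<Rightarrow> nat \<Rightarrow> nat \<Rightarrow> bool" where
  "inside_ax Q a b c w \<longleftrightarrow> (inside Q a b c w \<longleftrightarrow> pos Q a b w \<and> pos Q b c w \<and> pos Q c a w)"

definition cyc_ax :: "(nat \<Rightarrow> complex) \<Rightarrow> nat \<Rightarrow> nat \<Rightarrow> nat \<Rightarrow> nat \<Rightarrow> bool" where
  "cyc_ax Q v a b c \<longleftrightarrow>
    (cyc Q v a b c \<longleftrightarrow> (pos Q v a b \<and> pos Q v b c) \<or> (pos Q v b c \<and> pos Q v c a) \<or> (pos Q v c a \<and> pos Q v a b))"

lemmas ax_defs = inside_ax_def cyc_ax_def int_ax_def trans_ax_def opp_ax_def fan_ax_def rot_ax_def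

lemma int_ax: "int_ax Q t p q r"
  unfolding int_ax_def using pos_interiority by blast

lemma trans_ax: "trans_ax Q t s p q r"
  unfolding trans_ax_def using pos_transitivity by blast

lemma inside_ax: "inside_ax Q a b c w"
  unfolding inside_ax_def inside_def ..

lemma cyc_ax: "cyc_ax Q v a b c"
  unfolding cyc_ax_def cyc_def ..

lemma opp_ax: "opp_ax Q a b c d"
  unfolding opp_ax_def opposite_pos by blast

lemmas numeral_order = rel_simps zero_less_one not_one_less_zero zero_neq_one one_neq_zero not_not
  not_False_eq_True simp_thms

text \<open>P is the drawing itself, possibly with collinear triples; Q is its generic perturbation.
  Right angles and meeting points are taken from P, signs from Q.\<close>

locale rac_signs =
  fixes n :: nat and E :: "nat \<Rightarrow> nat \<Rightarrow> bool" and P Q :: "nat \<Rightarrow> complex"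
  assumes rac: "rac_config n E P" and perturbed: "generic_perturbation n P Q"
    and E_sym: "E a b \<Longrightarrow> E b a" and E_less: "E a b \<Longrightarrow> a < n" and E_irrefl: "\<not> E a a"
begin

abbreviation "ia \<equiv> int_ax Q"
abbreviation "ta \<equiv> trans_ax Q"
abbreviation "xa \<equiv> opp_ax Q"
abbreviation "na \<equiv> inside_ax Q"
abbreviation "ca \<equiv> cyc_ax Q"
abbreviation "fa \<equiv> fan_ax Q"
abbreviation "ra \<equiv> rot_ax Q"

lemma E_less2: "E a b \<Longrightarrow> b < n"
  using E_sym E_less by blast

lemma not_on_edge: "E a b \<Longrightarrow> c < n \<Longrightarrow> c \<noteq> a \<Longrightarrow> c \<noteq> b \<Longrightarrow> P c \<notin> closed_segment (P a) (P b)"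
  using rac unfolding rac_config_def by blast

lemma P_inj: "a < n \<Longrightarrow> b < n \<Longrightarrow> P a = P b \<longleftrightarrow> a = b"
  using rac unfolding rac_config_def inj_on_def by blast

lemma pos_swap:
  assumes "a < n" "b < n" "c < n" "distinct [a, b, c]"
  shows "pos Q b a c \<longleftrightarrow> \<not> pos Q a b c"
proof -
  have "orient (Q a) (Q b) (Q c) \<noteq> 0"
    using perturbed assms unfolding generic_perturbation_def by blast
  then show ?thesis using orient_swap[of "Q b" "Q a" "Q c"] by (auto simp: pos_def)
qed

lemma pos_cnj:
  assumes "a < n" "b < n" "c < n" "distinct [a, b, c]"
  shows "pos (cnj \<circ> Q) a b c \<longleftrightarrow> \<not> pos Q a b c"
  using pos_swap[OF assms] by (auto simp: pos_def orient_cnj orient_swap[of "Q b" "Q a"])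

lemma pos_iff:
  assumes "a < n" "b < n" "c < n" "orient (P a) (P b) (P c) \<noteq> 0"
  shows "pos Q a b c \<longleftrightarrow> 0 < orient (P a) (P b) (P c)"
proof -
  have d: "distinct [a, b, c]" using assms(4) by auto
  show ?thesis
    using perturbed assms d unfolding generic_perturbation_def pos_def
    by (meson linorder_neqE_linordered_idom order_less_asym)
qed

text \<open>If three mutually adjacent vertices were collinear, the middle one would lie on the edge
  between the other two.\<close>

lemma triangle_orient:
  assumes "E a b" "E b c" "E a c"
  shows "orient (P a) (P b) (P c) \<noteq> 0"
proof -
  have d: "a \<noteq> b" "b \<noteq> c" "a \<noteq> c" and l: "a < n" "b < n" "c < n"
    using assms E_irrefl E_less E_less2 by blast+
  show ?thesis
    using orient_zero_imp_between[of "P a" "P b" "P c"] d l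
      not_on_edge[OF assms(1), of c] not_on_edge[OF assms(2), of a] not_on_edge[OF assms(3), of b] by blast
qed

text \<open>The common point is none of the four ends, since no vertex lies on an edge that does not
  contain it; hence both parameters are strictly between 0 and 1.\<close>

lemma meeting_edges:
  assumes "E a b" "E c d" "distinct [a, b, c, d]"
    and "closed_segment (P a) (P b) \<inter> closed_segment (P c) (P d) \<noteq> {}"
  obtains s t where "0 < s" "s < 1" "0 < t" "t < 1"
    "P a + s *\<^sub>R (P b - P a) = P c + t *\<^sub>R (P d - P c)" "orthogonal (P b - P a) (P d - P c)"
proof -
  obtain m where m: "m \<in> closed_segment (P a) (P b)" "m \<in> closed_segment (P c) (P d)"
    using assms by blast
  have ne: "m \<noteq> P a" "m \<noteq> P b" "m \<noteq> P c" "m \<noteq> P d"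
    using m not_on_edge[OF assms(1), of c] not_on_edge[OF assms(1), of d] not_on_edge[OF assms(2), of a]
      not_on_edge[OF assms(2), of b] assms(3) E_less[OF assms(1)] E_less[OF assms(2)]
      E_less2[OF assms(1)] E_less2[OF assms(2)] by auto
  obtain s where s: "m = (1 - s) *\<^sub>R P a + s *\<^sub>R P b" "0 \<le> s" "s \<le> 1"
    using m(1) by (auto simp: in_segment)
  obtain t where t: "m = (1 - t) *\<^sub>R P c + t *\<^sub>R P d" "0 \<le> t" "t \<le> 1"
    using m(2) by (auto simp: in_segment)
  have "s \<noteq> 0" "s \<noteq> 1" "t \<noteq> 0" "t \<noteq> 1" using ne s(1) t(1) by auto
  then have st: "0 < s" "s < 1" "0 < t" "t < 1" using s(2,3) t(2,3) by auto
  have "P a + s *\<^sub>R (P b - P a) = m" unfolding s(1) by (simp add: algebra_simps)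
  moreover have "P c + t *\<^sub>R (P d - P c) = m" unfolding t(1) by (simp add: algebra_simps)
  moreover have "orthogonal (P b - P a) (P d - P c)"
    using rac assms unfolding rac_config_def by blast
  ultimately show thesis using that[OF st] by simp
qed

text \<open>Applying \<open>det_of_perpendiculars\<close> to p, q and their quarter turns bounds
  nothing but relates the determinants: if that of p and q were zero, so would be that of p and
  \<open>\<i> * p\<close>, which is |p|^2.\<close>

lemma orthogonal_det_nonzero:
  fixes p q :: complex
  assumes "orthogonal p q" "p \<noteq> 0" "q \<noteq> 0"
  shows "orient 0 p q \<noteq> 0"
proof
  assume "orient 0 p q = 0"
  then have "(cmod q)\<^sup>2 * (cmod q)\<^sup>2 * orient 0 p (\<i> * p) = 0"
    using det_of_perpendiculars[of p q "\<i> * p" "\<i> * q"] assms(1)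
    by (simp add: orthogonal_complex_iff norm_mult algebra_simps)
  then have "orient 0 p (\<i> * p) = 0" using assms by simp
  then have "Re p * Re p + Im p * Im p = 0" by (simp add: orient_def)
  then show False using assms(2) by (simp add: sum_squares_eq_zero_iff complex_eq_iff)
qed

text \<open>Let D be the determinant of the two edge vectors and t the parameter of the meeting
  point on cd. Then c and d have orientations -t D and (1 - t) D against ab, and D is nonzero
  because the edges are perpendicular.\<close>

lemma meeting_orient:
  assumes "E a b" "E c d" "distinct [a, b, c, d]"
    and "closed_segment (P a) (P b) \<inter> closed_segment (P c) (P d) \<noteq> {}"
  shows "orient (P a) (P b) (P c) * orient (P a) (P b) (P d) < 0"
    and "0 < orient (P a) (P b) (P d) * orient 0 (P b - P a) (P d - P c)"
    and "orient 0 (P b - P a) (P d - P c) \<noteq> 0"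
proof -
  obtain s t where st: "0 < s" "s < 1" "0 < t" "t < 1"
    and eq: "P a + s *\<^sub>R (P b - P a) = P c + t *\<^sub>R (P d - P c)"
    and orth: "orthogonal (P b - P a) (P d - P c)"
    by (rule meeting_edges[OF assms]) blast
  define D where "D = orient 0 (P b - P a) (P d - P c)"
  show D: "orient 0 (P b - P a) (P d - P c) \<noteq> 0"
    using orthogonal_det_nonzero[OF orth] P_inj[of b a] P_inj[of d c] E_less[OF assms(1)] E_less[OF assms(2)]
      E_less2[OF assms(1)] E_less2[OF assms(2)] assms(3) by auto
  have c: "P c - P a = s *\<^sub>R (P b - P a) - t *\<^sub>R (P d - P c)"
    using eq by (simp add: algebra_simps)
  have d: "P d - P a = s *\<^sub>R (P b - P a) + (1 - t) *\<^sub>R (P d - P c)"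
    using eq by (simp add: algebra_simps)
  have 1: "orient (P a) (P b) (P c) = - t * D"
    unfolding orient_def[of "P a"] c by (simp add: D_def orient_def algebra_simps)
  have 2: "orient (P a) (P b) (P d) = (1 - t) * D"
    unfolding orient_def[of "P a"] d by (simp add: D_def orient_def algebra_simps)
  have D2: "0 < D * D" using D by (metis D_def not_real_square_gt_zero)
  have "orient (P a) (P b) (P c) * orient (P a) (P b) (P d) = - (t * (1 - t)) * (D * D)"
    unfolding 1 2 by (simp add: algebra_simps)
  also have "\<dots> < 0" using D2 st by (simp add: mult_neg_pos)
  finally show "orient (P a) (P b) (P c) * orient (P a) (P b) (P d) < 0" .
  have "orient (P a) (P b) (P d) * D = (1 - t) * (D * D)" unfolding 2 by (simp add: algebra_simps)
  moreover have "0 < (1 - t) * (D * D)" using D2 st by simp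
  ultimately show "0 < orient (P a) (P b) (P d) * orient 0 (P b - P a) (P d - P c)"
    unfolding D_def[symmetric] by (simp only:)
qed

text \<open>The perturbation creates no crossing. Conversely, edges that meet do so at a right angle
  in their interiors, so the four orientations are nonzero with opposite signs in P, and Q inherits
  them.\<close>

lemma opposite_iff_meeting:
  assumes "E a b" "E c d" "distinct [a, b, c, d]"
  shows "opposite Q a b c d \<longleftrightarrow> closed_segment (P a) (P b) \<inter> closed_segment (P c) (P d) \<noteq> {}"
proof
  have less: "a < n" "b < n" "c < n" "d < n" using assms E_less E_less2 by auto
  show "closed_segment (P a) (P b) \<inter> closed_segment (P c) (P d) \<noteq> {}" if "opposite Q a b c d"
    using that perturbed less assms(3) unfolding generic_perturbation_def by blast
  assume m: "closed_segment (P a) (P b) \<inter> closed_segment (P c) (P d) \<noteq> {}"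
  then have m': "closed_segment (P c) (P d) \<inter> closed_segment (P a) (P b) \<noteq> {}" by blast
  have d': "distinct [c, d, a, b]" using assms(3) by auto
  have "orient (P a) (P b) (P c) * orient (P a) (P b) (P d) < 0"
    "orient (P c) (P d) (P a) * orient (P c) (P d) (P b) < 0"
    using meeting_orient(1)[OF assms m] meeting_orient(1)[OF assms(2,1) d' m'] .
  then show "opposite Q a b c d"
    using pos_iff[OF less(1-3)] pos_iff[OF less(1,2,4)] pos_iff[OF less(3,4,1)] pos_iff[OF less(3,4,2)]
    by (auto simp: opposite_pos mult_less_0_iff)
qed

text \<open>Two adjacent edges crossed by a third edge would both be perpendicular to it.\<close>

lemma no_fan_crossing:
  assumes E: "E a b" "E x y" "E x w" and dist: "distinct [a, b, x, y, w]"
  shows "\<not> (opposite Q a b x y \<and> opposite Q a b x w)"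
proof
  assume opp: "opposite Q a b x y \<and> opposite Q a b x w"
  have d1: "distinct [a, b, x, y]" and d2: "distinct [a, b, x, w]" using dist by auto
  obtain s t where st: "0 < s" "s < 1" "0 < t" "t < 1"
    and eq1: "P a + s *\<^sub>R (P b - P a) = P x + t *\<^sub>R (P y - P x)"
    and o1: "orthogonal (P b - P a) (P y - P x)"
    using meeting_edges[OF E(1,2) d1] opposite_iff_meeting[OF E(1,2) d1] opp by blast
  obtain s' t' where st': "0 < s'" "s' < 1" "0 < t'" "t' < 1"
    and eq2: "P a + s' *\<^sub>R (P b - P a) = P x + t' *\<^sub>R (P w - P x)"
    and o2: "orthogonal (P b - P a) (P w - P x)"
    using meeting_edges[OF E(1,3) d2] opposite_iff_meeting[OF E(1,3) d2] opp by blast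
  have "(s - s') *\<^sub>R (P b - P a) = (P a + s *\<^sub>R (P b - P a)) - (P a + s' *\<^sub>R (P b - P a))"
    by (simp add: algebra_simps)
  also have "\<dots> = t *\<^sub>R (P y - P x) - t' *\<^sub>R (P w - P x)" unfolding eq1 eq2 by simp
  finally have diff: "(s - s') *\<^sub>R (P b - P a) = t *\<^sub>R (P y - P x) - t' *\<^sub>R (P w - P x)" .
  \<comment> \<open>The difference of the two crossing points is both parallel and perpendicular to
    ab, so the crossing points coincide.\<close>
  have "(P b - P a) \<bullet> ((s - s') *\<^sub>R (P b - P a)) = (P b - P a) \<bullet> (t *\<^sub>R (P y - P x) - t' *\<^sub>R (P w - P x))"
    unfolding diff ..
  also have "\<dots> = 0" using o1 o2 by (simp add: orthogonal_def inner_diff_right)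
  finally have "s = s'" using P_inj[of b a] E_less[OF E(1)] E_less2[OF E(1)] dist by auto
  then have eq: "t *\<^sub>R (P y - P x) = t' *\<^sub>R (P w - P x)" using eq1 eq2 by simp
  \<comment> \<open>Now y and w lie on one ray from x, and the nearer of them lies on the edge to
    the farther one.\<close>
  have *: False if "t *\<^sub>R (P y - P x) = t' *\<^sub>R (P w - P x)" "t' \<le> t" "0 < t" "0 < t'"
    "E x y" "E x w" "y \<noteq> w" "y \<noteq> x" for t t' y w
  proof -
    have "P y - P x = (1 / t) *\<^sub>R (t *\<^sub>R (P y - P x))" using that(3) by simp
    also have "\<dots> = (t' / t) *\<^sub>R (P w - P x)" unfolding that(1) by simp
    finally have "P y = (1 - t' / t) *\<^sub>R P x + (t' / t) *\<^sub>R P w" by (simp add: algebra_simps)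
    moreover have "0 \<le> t' / t" "t' / t \<le> 1" using that by auto
    ultimately have "P y \<in> closed_segment (P x) (P w)" unfolding in_segment by blast
    then show False using not_on_edge[OF that(6)] E_less2[OF that(5)] that by blast
  qed
  have ne: "y \<noteq> w" "w \<noteq> y" "y \<noteq> x" "w \<noteq> x" using dist by auto
  show False
    using *[OF eq _ st(3) st'(3) E(2,3) ne(1,3)] *[OF eq[symmetric] _ st'(3) st(3) E(3,2) ne(2,4)]
    by linarith
qed

text \<open>The right angles at two crossings turn the angle between \<open>x y\<close> and \<open>x w\<close> into the angle
  between \<open>z u\<close> and \<open>z v\<close>.\<close>

lemma crossing_rotation:
  assumes E: "E x y" "E x w" "E z u" "E z v" and tri: "E y w \<or> E u v"
    and d1: "distinct [x, y, z, u]" and d2: "distinct [x, w, z, v]" and d3: "y \<noteq> w" "u \<noteq> v"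
    and opp: "opposite Q x y z u" "opposite Q x w z v"
  shows "(pos Q x y w \<longleftrightarrow> pos Q z u v) \<longleftrightarrow> (pos Q x y u \<longleftrightarrow> pos Q x w v)"
proof -
  have less: "x < n" "y < n" "w < n" "z < n" "u < n" "v < n" using E E_less E_less2 by auto
  have m1: "closed_segment (P x) (P y) \<inter> closed_segment (P z) (P u) \<noteq> {}"
    and m2: "closed_segment (P x) (P w) \<inter> closed_segment (P z) (P v) \<noteq> {}"
    using opp opposite_iff_meeting[OF E(1,3) d1] opposite_iff_meeting[OF E(2,4) d2] by auto
  have o1: "orthogonal (P y - P x) (P u - P z)" and o2: "orthogonal (P w - P x) (P v - P z)"
    using meeting_edges[OF E(1,3) d1 m1] meeting_edges[OF E(2,4) d2 m2] by blast+
  define A B D1 D2 where "A = orient (P x) (P y) (P w)" and "B = orient (P z) (P u) (P v)"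
    and "D1 = orient 0 (P y - P x) (P u - P z)" and "D2 = orient 0 (P w - P x) (P v - P z)"
  have AB: "orient 0 (P y - P x) (P w - P x) = A" "orient 0 (P u - P z) (P v - P z) = B"
    by (simp_all add: A_def B_def orient_def)
  define k where "k = (cmod (P u - P z))\<^sup>2 * (cmod (P v - P z))\<^sup>2"
  have eq: "k * A = D1 * D2 * B"
    using det_of_perpendiculars[OF o1 o2] by (simp add: AB D1_def D2_def k_def)
  have k: "0 < k"
    unfolding k_def using P_inj[of u z] P_inj[of v z] less d1 d2 by (auto intro!: mult_pos_pos)
  have D: "D1 \<noteq> 0" "D2 \<noteq> 0" "0 < orient (P x) (P y) (P u) * D1" "0 < orient (P x) (P w) (P v) * D2"
    using meeting_orient(2,3)[OF E(1,3) d1 m1] meeting_orient(2,3)[OF E(2,4) d2 m2]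
    by (simp_all add: D1_def D2_def)
  \<comment> \<open>One of the two corners is closed to a triangle by an edge, so A or B is nonzero;
    by \<open>eq\<close> they vanish only together.\<close>
  have "A \<noteq> 0 \<or> B \<noteq> 0"
    using tri triangle_orient[of x y w] triangle_orient[of z u v] E by (auto simp: A_def B_def)
  then have ne: "A \<noteq> 0" "B \<noteq> 0" using eq D k by auto
  have p1: "pos Q x y w \<longleftrightarrow> 0 < A" "pos Q z u v \<longleftrightarrow> 0 < B"
    using pos_iff[of x y w] pos_iff[of z u v] less ne by (simp_all add: A_def B_def)
  have "pos Q x y u \<longleftrightarrow> 0 < orient (P x) (P y) (P u)" "pos Q x w v \<longleftrightarrow> 0 < orient (P x) (P w) (P v)"
    using pos_iff[of x y u] pos_iff[of x w v] less D(3,4) by force+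
  then have p2: "pos Q x y u \<longleftrightarrow> 0 < D1" "pos Q x w v \<longleftrightarrow> 0 < D2"
    using D by (auto simp: zero_less_mult_iff)
  have "0 < A \<longleftrightarrow> 0 < k * A" using k by (simp add: zero_less_mult_iff)
  then have "0 < A \<longleftrightarrow> 0 < D1 * D2 * B" using eq by simp
  then show ?thesis unfolding p1 p2 using D ne by (auto simp: zero_less_mult_iff mult_less_0_iff)
qed

text \<open>Sorting the indices by transpositions leaves one atom per triple, up to
  negation.\<close>

lemma pos_sort:
  "b < a \<Longrightarrow> a < n \<Longrightarrow> c < n \<Longrightarrow> a \<noteq> c \<Longrightarrow> b \<noteq> c \<Longrightarrow> pos Q a b c \<longleftrightarrow> \<not> pos Q b a c"
  "c < b \<Longrightarrow> b < n \<Longrightarrow> a < n \<Longrightarrow> a \<noteq> b \<Longrightarrow> a \<noteq> c \<Longrightarrow> pos Q a b c \<longleftrightarrow> \<not> pos Q a c b"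
  using pos_swap[of b a c] pos_swap[of b c a] pos_rotate[of Q a b c] pos_rotate[of Q a c b] by auto

text \<open>The conjunctions with \<open>True\<close> keep the simplifier from treating these equations as
  permutative, so that it orders numerals by their values.\<close>

lemma opposite_sort:
  "b < a \<Longrightarrow> a < n \<Longrightarrow> c < n \<Longrightarrow> d < n \<Longrightarrow> a \<noteq> c \<Longrightarrow> a \<noteq> d \<Longrightarrow> b \<noteq> c \<Longrightarrow> b \<noteq> d \<Longrightarrow>
     opposite Q a b c d \<longleftrightarrow> True \<and> opposite Q b a c d"
  "d < c \<Longrightarrow> a < n \<Longrightarrow> b < n \<Longrightarrow> c < n \<Longrightarrow> a \<noteq> c \<Longrightarrow> a \<noteq> d \<Longrightarrow> b \<noteq> c \<Longrightarrow> b \<noteq> d \<Longrightarrow>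
     opposite Q a b c d \<longleftrightarrow> True \<and> opposite Q a b d c"
  "c < a \<Longrightarrow> opposite Q a b c d \<longleftrightarrow> True \<and> opposite Q c d a b"
  using pos_swap[of b a c] pos_swap[of b a d] pos_swap[of c d a] pos_swap[of c d b]
  by (auto simp: opposite_pos)

lemma fan_ax:
  assumes "E a b" "E x y" "E x w" "distinct [a, b, x, y, w]"
  shows "fan_ax Q a b x y w"
  unfolding fan_ax_def using no_fan_crossing[OF assms] by blast

lemma rot_ax:
  assumes "E x y" "E x w" "E z u" "E z v" "E y w \<or> E u v"
    "distinct [x, y, z, u]" "distinct [x, w, z, v]" "y \<noteq> w" "u \<noteq> v"
  shows "rot_ax Q x y w z u v"
  unfolding rot_ax_def using crossing_rotation[OF assms] by blast

end

context rac_signs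
begin

text \<open>All conditions speak about single vertices and edges, so they pass to subgraphs along an
  injective renaming. This serves both the symmetries of one antiprism and the two copies inside the
  glued graph.\<close>

lemma rac_signs_relabel:
  assumes f: "inj_on f {..<m}" "\<And>a. a < m \<Longrightarrow> f a < n" and F: "\<And>a b. F a b \<Longrightarrow> E (f a) (f b)"
    and F': "\<And>a b. F a b \<Longrightarrow> F b a" "\<And>a b. F a b \<Longrightarrow> a < m"
  shows "rac_signs m F (P \<circ> f) (Q \<circ> f)"
proof
  have f_eq: "f a = f b \<longleftrightarrow> a = b" if "a < m" "b < m" for a b
    using f(1) that by (auto simp: inj_on_def)
  have l: "a < m" "b < m" if "F a b" for a b using that F' by blast+
  show "rac_config m F (P \<circ> f)"
    unfolding rac_config_def
  proof (intro conjI allI impI)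
    show "inj_on (P \<circ> f) {..<m}"
      using f_eq P_inj f(2) by (auto simp: inj_on_def)
    show "(P \<circ> f) c \<notin> closed_segment ((P \<circ> f) a) ((P \<circ> f) b)"
      if "F a b \<and> c < m \<and> c \<noteq> a \<and> c \<noteq> b" for a b c
      using not_on_edge[OF F, of a b "f c"] that f_eq l f(2) by auto
    show "orthogonal ((P \<circ> f) b - (P \<circ> f) a) ((P \<circ> f) d - (P \<circ> f) c)"
      if "F a b \<and> F c d \<and> distinct [a, b, c, d] \<and>
       closed_segment ((P \<circ> f) a) ((P \<circ> f) b) \<inter> closed_segment ((P \<circ> f) c) ((P \<circ> f) d) \<noteq> {}" for a b c d
    proof -
      have "distinct [f a, f b, f c, f d]" using that f_eq l by auto
      then show ?thesis using rac F that unfolding rac_config_def o_def by meson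
    qed
  qed
  show "generic_perturbation m (P \<circ> f) (Q \<circ> f)"
    unfolding generic_perturbation_def
  proof (intro conjI allI impI)
    fix a b c assume "a < m" "b < m" "c < m" "distinct [a, b, c]"
    then have "f a < n" "f b < n" "f c < n" "distinct [f a, f b, f c]" using f_eq f(2) by auto
    then show "orient ((Q \<circ> f) a) ((Q \<circ> f) b) ((Q \<circ> f) c) \<noteq> 0"
      "0 < orient ((P \<circ> f) a) ((P \<circ> f) b) ((P \<circ> f) c) \<Longrightarrow> 0 < orient ((Q \<circ> f) a) ((Q \<circ> f) b) ((Q \<circ> f) c)"
      "orient ((P \<circ> f) a) ((P \<circ> f) b) ((P \<circ> f) c) < 0 \<Longrightarrow> orient ((Q \<circ> f) a) ((Q \<circ> f) b) ((Q \<circ> f) c) < 0"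
      using perturbed unfolding generic_perturbation_def o_def by blast+
  next
    fix a b c d assume *: "a < m" "b < m" "c < m" "d < m"
      "distinct [a, b, c, d] \<and> closed_segment ((P \<circ> f) a) ((P \<circ> f) b) \<inter> closed_segment ((P \<circ> f) c) ((P \<circ> f) d) = {}"
    then have "f a < n" "f b < n" "f c < n" "f d < n" "distinct [f a, f b, f c, f d]"
      using f_eq f(2) by auto
    then have "\<not> opposite Q (f a) (f b) (f c) (f d)"
      using * perturbed unfolding generic_perturbation_def o_def by blast
    then show "\<not> opposite (Q \<circ> f) a b c d" by (simp add: opposite_def)
  qed
  show "F b a" "a < m" if "F a b" for a b using F' that by blast+
  show "\<not> F a a" for a using F E_irrefl by blast
qed

lemma cnj_segment: "closed_segment (cnj a) (cnj b) = cnj ` closed_segment a b"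
  by (rule closed_segment_linear_image) (simp add: bounded_linear.linear bounded_linear_cnj)

lemma opposite_cnj:
  assumes "a < n" "b < n" "c < n" "d < n" "distinct [a, b, c, d]"
  shows "opposite (cnj \<circ> Q) a b c d \<longleftrightarrow> opposite Q a b c d"
  using pos_swap[of a b c] pos_swap[of a b d] pos_swap[of c d a] pos_swap[of c d b] assms
  by (auto simp: opposite_def pos_def orient_cnj orient_swap[of "Q b" "Q a"] orient_swap[of "Q d" "Q c"])

lemma rac_signs_cnj: "rac_signs n E (cnj \<circ> P) (cnj \<circ> Q)"
proof
  show "rac_config n E (cnj \<circ> P)"
    unfolding rac_config_def
  proof (intro conjI allI impI)
    show "inj_on (cnj \<circ> P) {..<n}" using P_inj by (auto simp: inj_on_def)
    show "(cnj \<circ> P) c \<notin> closed_segment ((cnj \<circ> P) a) ((cnj \<circ> P) b)"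
      if "E a b \<and> c < n \<and> c \<noteq> a \<and> c \<noteq> b" for a b c
      using not_on_edge that by (auto simp: cnj_segment)
    fix a b c d assume *: "E a b \<and> E c d \<and> distinct [a, b, c, d] \<and>
       closed_segment ((cnj \<circ> P) a) ((cnj \<circ> P) b) \<inter> closed_segment ((cnj \<circ> P) c) ((cnj \<circ> P) d) \<noteq> {}"
    then have "closed_segment (P a) (P b) \<inter> closed_segment (P c) (P d) \<noteq> {}"
      unfolding o_def cnj_segment by auto
    then have "orthogonal (P b - P a) (P d - P c)" using * rac unfolding rac_config_def by blast
    then show "orthogonal ((cnj \<circ> P) b - (cnj \<circ> P) a) ((cnj \<circ> P) d - (cnj \<circ> P) c)"
      by (simp add: orthogonal_complex_iff algebra_simps)
  qed
  show "generic_perturbation n (cnj \<circ> P) (cnj \<circ> Q)"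
    unfolding generic_perturbation_def
  proof (intro conjI allI impI)
    fix a b c assume "a < n" "b < n" "c < n" "distinct [a, b, c]"
    then show "orient ((cnj \<circ> Q) a) ((cnj \<circ> Q) b) ((cnj \<circ> Q) c) \<noteq> 0"
      "0 < orient ((cnj \<circ> P) a) ((cnj \<circ> P) b) ((cnj \<circ> P) c) \<Longrightarrow> 0 < orient ((cnj \<circ> Q) a) ((cnj \<circ> Q) b) ((cnj \<circ> Q) c)"
      "orient ((cnj \<circ> P) a) ((cnj \<circ> P) b) ((cnj \<circ> P) c) < 0 \<Longrightarrow> orient ((cnj \<circ> Q) a) ((cnj \<circ> Q) b) ((cnj \<circ> Q) c) < 0"
      using perturbed unfolding generic_perturbation_def o_def orient_cnj by auto
  next
    fix a b c d assume *: "a < n" "b < n" "c < n" "d < n"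
      "distinct [a, b, c, d] \<and> closed_segment ((cnj \<circ> P) a) ((cnj \<circ> P) b) \<inter> closed_segment ((cnj \<circ> P) c) ((cnj \<circ> P) d) = {}"
    then have "closed_segment (P a) (P b) \<inter> closed_segment (P c) (P d) = {}"
      unfolding o_def cnj_segment by blast
    then have "\<not> opposite Q a b c d"
      using * perturbed unfolding generic_perturbation_def by blast
    then show "\<not> opposite (cnj \<circ> Q) a b c d" using opposite_cnj * by blast
  qed
qed (use E_sym E_less E_irrefl in blast)+

end

section \<open>The two right-angle pictures of one antiprism, up to reflection\<close>

section \<open>The augmented square antiprism\<close>

text \<open>The antiprism without its hub is the square of the 8-cycle \<open>a\<^sub>0, b\<^sub>0, a\<^sub>1, b\<^sub>1, \<dots>\<close>, whose
  vertices are numbered \<open>0, \<dots>, 7\<close> in this order; the hub is \<open>8\<close>.\<close>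

definition antiprism_adj :: "nat \<Rightarrow> nat \<Rightarrow> bool" where
  "antiprism_adj a b \<longleftrightarrow> a < 9 \<and> b < 9 \<and> a \<noteq> b \<and> (a = 8 \<or> b = 8 \<or> (a + 8 - b) mod 8 \<in> {1, 2, 6, 7})"

text \<open>Rotation of the 8-cycle, an automorphism that fixes the hub. For odd k it exchanges the
  a-vertices (even numbers) with the b-vertices.\<close>

definition turn :: "nat \<Rightarrow> nat \<Rightarrow> nat" where
  "turn k j = (if j = 8 then 8 else (j + k) mod 8)"

text \<open>The reflection taking j to 2 - j modulo 8: it fixes 1 and exchanges 0 and 2.\<close>

definition flip :: "nat \<Rightarrow> nat" where
  "flip j = (if j = 8 then 8 else (10 - j) mod 8)"

lemma antiprism_adj_turn: "antiprism_adj a b \<Longrightarrow> k < 8 \<Longrightarrow> antiprism_adj (turn k a) (turn k b)"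
proof -
  have "\<forall>k\<in>set [0..<8]. \<forall>a\<in>set [0..<9]. \<forall>b\<in>set [0..<9].
      antiprism_adj a b \<longrightarrow> antiprism_adj (turn k a) (turn k b)" by code_simp
  moreover assume "antiprism_adj a b" "k < 8"
  moreover have "a < 9" "b < 9" using \<open>antiprism_adj a b\<close> by (auto simp: antiprism_adj_def)
  ultimately show ?thesis by simp
qed

lemma antiprism_adj_flip: "antiprism_adj a b \<Longrightarrow> antiprism_adj (flip a) (flip b)"
proof -
  have "\<forall>a\<in>set [0..<9]. \<forall>b\<in>set [0..<9]. antiprism_adj a b \<longrightarrow> antiprism_adj (flip a) (flip b)" by code_simp
  moreover assume "antiprism_adj a b"
  moreover have "a < 9" "b < 9" using \<open>antiprism_adj a b\<close> by (auto simp: antiprism_adj_def)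
  ultimately show ?thesis by simp
qed

lemma antiprism_adj_sym: "antiprism_adj a b \<Longrightarrow> antiprism_adj b a"
proof -
  have "\<forall>a\<in>set [0..<9]. \<forall>b\<in>set [0..<9]. antiprism_adj a b \<longrightarrow> antiprism_adj b a" by code_simp
  moreover assume "antiprism_adj a b"
  moreover have "a < 9" "b < 9" using \<open>antiprism_adj a b\<close> by (auto simp: antiprism_adj_def)
  ultimately show ?thesis by simp
qed

lemma turn_values:
  "turn 0 0 = 0" "turn 0 1 = 1" "turn 0 2 = 2" "turn 0 3 = 3" "turn 0 4 = 4"
    "turn 0 5 = 5" "turn 0 6 = 6" "turn 0 7 = 7" "turn 0 8 = 8" "turn 1 0 = 1" "turn 1 1 = 2" "turn
    1 2 = 3" "turn 1 3 = 4" "turn 1 4 = 5" "turn 1 5 = 6" "turn 1 6 = 7" "turn 1 7 = 0" "turn 1 8 =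
    8" "turn 2 0 = 2" "turn 2 1 = 3" "turn 2 2 = 4" "turn 2 3 = 5" "turn 2 4 = 6" "turn 2 5 = 7"
    "turn 2 6 = 0" "turn 2 7 = 1" "turn 2 8 = 8" "turn 3 0 = 3" "turn 3 1 = 4" "turn 3 2 = 5" "turn
    3 3 = 6" "turn 3 4 = 7" "turn 3 5 = 0" "turn 3 6 = 1" "turn 3 7 = 2" "turn 3 8 = 8" "turn 4 0 =
    4" "turn 4 1 = 5" "turn 4 2 = 6" "turn 4 3 = 7" "turn 4 4 = 0" "turn 4 5 = 1" "turn 4 6 = 2"
    "turn 4 7 = 3" "turn 4 8 = 8" "turn 5 0 = 5" "turn 5 1 = 6" "turn 5 2 = 7" "turn 5 3 = 0" "turn
    5 4 = 1" "turn 5 5 = 2" "turn 5 6 = 3" "turn 5 7 = 4" "turn 5 8 = 8" "turn 6 0 = 6" "turn 6 1 =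
    7" "turn 6 2 = 0" "turn 6 3 = 1" "turn 6 4 = 2" "turn 6 5 = 3" "turn 6 6 = 4" "turn 6 7 = 5"
    "turn 6 8 = 8" "turn 7 0 = 7" "turn 7 1 = 0" "turn 7 2 = 1" "turn 7 3 = 2" "turn 7 4 = 3" "turn
    7 5 = 4" "turn 7 6 = 5" "turn 7 7 = 6" "turn 7 8 = 8"
  by (simp_all add: turn_def)

lemma flip_values: "flip 0 = 2" "flip 1 = 1" "flip 2 = 0" "flip 8 = 8"
  by (simp_all add: flip_def)

lemma less_eight: "(0::nat) < 8" "(1::nat) < 8" "(2::nat) < 8" "(3::nat) < 8" "(4::nat) < 8" "(5::nat) < 8"
  "(6::nat) < 8" "(7::nat) < 8"
  by simp_all


definition positive :: "(nat \<Rightarrow> complex) \<Rightarrow> bool" where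
  "positive Q
    \<longleftrightarrow> pos Q 8 0 1 & pos Q 8 1 2 & pos Q 8 2 3 & pos Q 8 3 4 & pos Q 8 4 5 & pos
    Q 8 5 6 & pos Q 8 6 7 & pos Q 8 7 0 & pos Q 8 0 2 & pos Q 8 1 3 & pos Q 8 2 4 & pos Q 8 3 5 &
    pos Q 8 4 6 & pos Q 8 5 7 & pos Q 8 6 0 & pos Q 8 7 1"

definition negative :: "(nat \<Rightarrow> complex) \<Rightarrow> bool" where
  "negative Q
    \<longleftrightarrow> ~ pos Q 8 0 1 & ~ pos Q 8 1 2 & ~ pos Q 8 2 3 & ~ pos Q 8 3 4 & ~ pos Q 8
    4 5 & ~ pos Q 8 5 6 & ~ pos Q 8 6 7 & ~ pos Q 8 7 0 & ~ pos Q 8 0 2 & ~ pos Q 8 1 3 & ~ pos Q 8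
    2 4 & ~ pos Q 8 3 5 & ~ pos Q 8 4 6 & ~ pos Q 8 5 7 & ~ pos Q 8 6 0 & ~ pos Q 8 7 1"

text \<open>The hub edges at 0, 2, 4 and 6 are crossed by the chords of their cycle neighbours, and
  no other two disjoint edges cross. The conjunction is written out in full, because each pair is
  one propositional atom.\<close>

definition standard_crossings :: "(nat \<Rightarrow> complex) \<Rightarrow> bool" where
 
    "standard_crossings Q \<longleftrightarrow> (opposite Q 0 8 1 7 & opposite Q 1 3 2 8 & opposite
    Q 3 5 4 8 & opposite Q 5 7 6 8 & ~ opposite Q 0 2 1 8 & ~ opposite Q 2 4 3 8 & ~ opposite Q 4 6
    5 8 & ~ opposite Q 0 6 7 8) & ~ opposite Q 0 1 2 3 & ~ opposite Q 0 1 2 4 & ~ opposite Q 0 1 2 8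
    & ~ opposite Q 0 1 3 4 & ~ opposite Q 0 1 3 5 & ~ opposite Q 0 1 3 8 & ~ opposite Q 0 1 4 5 & ~
    opposite Q 0 1 4 6 & ~ opposite Q 0 1 4 8 & ~ opposite Q 0 1 5 6 & ~ opposite Q 0 1 5 7 & ~
    opposite Q 0 1 5 8 & ~ opposite Q 0 1 6 7 & ~ opposite Q 0 1 6 8 & ~ opposite Q 0 1 7 8 & ~
    opposite Q 0 2 1 3 & ~ opposite Q 0 2 1 7 & ~ opposite Q 0 2 3 4 & ~ opposite Q 0 2 3 5 & ~
    opposite Q 0 2 3 8 & ~ opposite Q 0 2 4 5 & ~ opposite Q 0 2 4 6 & ~ opposite Q 0 2 4 8 & ~
    opposite Q 0 2 5 6 & ~ opposite Q 0 2 5 7 & ~ opposite Q 0 2 5 8 & ~ opposite Q 0 2 6 7 & ~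
    opposite Q 0 2 6 8 & ~ opposite Q 0 2 7 8 & ~ opposite Q 0 6 1 2 & ~ opposite Q 0 6 1 3 & ~
    opposite Q 0 6 1 7 & ~ opposite Q 0 6 1 8 & ~ opposite Q 0 6 2 3 & ~ opposite Q 0 6 2 4 & ~
    opposite Q 0 6 2 8 & ~ opposite Q 0 6 3 4 & ~ opposite Q 0 6 3 5 & ~ opposite Q 0 6 3 8 & ~
    opposite Q 0 6 4 5 & ~ opposite Q 0 6 4 8 & ~ opposite Q 0 6 5 7 & ~ opposite Q 0 6 5 8 & ~
    opposite Q 0 7 1 2 & ~ opposite Q 0 7 1 3 & ~ opposite Q 0 7 1 8 & ~ opposite Q 0 7 2 3 & ~
    opposite Q 0 7 2 4 & ~ opposite Q 0 7 2 8 & ~ opposite Q 0 7 3 4 & ~ opposite Q 0 7 3 5 & ~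
    opposite Q 0 7 3 8 & ~ opposite Q 0 7 4 5 & ~ opposite Q 0 7 4 6 & ~ opposite Q 0 7 4 8 & ~
    opposite Q 0 7 5 6 & ~ opposite Q 0 7 5 8 & ~ opposite Q 0 7 6 8 & ~ opposite Q 0 8 1 2 & ~
    opposite Q 0 8 1 3 & ~ opposite Q 0 8 2 3 & ~ opposite Q 0 8 2 4 & ~ opposite Q 0 8 3 4 & ~
    opposite Q 0 8 3 5 & ~ opposite Q 0 8 4 5 & ~ opposite Q 0 8 4 6 & ~ opposite Q 0 8 5 6 & ~
    opposite Q 0 8 5 7 & ~ opposite Q 0 8 6 7 & ~ opposite Q 1 2 3 4 & ~ opposite Q 1 2 3 5 & ~
    opposite Q 1 2 3 8 & ~ opposite Q 1 2 4 5 & ~ opposite Q 1 2 4 6 & ~ opposite Q 1 2 4 8 & ~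
    opposite Q 1 2 5 6 & ~ opposite Q 1 2 5 7 & ~ opposite Q 1 2 5 8 & ~ opposite Q 1 2 6 7 & ~
    opposite Q 1 2 6 8 & ~ opposite Q 1 2 7 8 & ~ opposite Q 1 3 2 4 & ~ opposite Q 1 3 4 5 & ~
    opposite Q 1 3 4 6 & ~ opposite Q 1 3 4 8 & ~ opposite Q 1 3 5 6 & ~ opposite Q 1 3 5 7 & ~
    opposite Q 1 3 5 8 & ~ opposite Q 1 3 6 7 & ~ opposite Q 1 3 6 8 & ~ opposite Q 1 3 7 8 & ~
    opposite Q 1 7 2 3 & ~ opposite Q 1 7 2 4 & ~ opposite Q 1 7 2 8 & ~ opposite Q 1 7 3 4 & ~
    opposite Q 1 7 3 5 & ~ opposite Q 1 7 3 8 & ~ opposite Q 1 7 4 5 & ~ opposite Q 1 7 4 6 & ~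
    opposite Q 1 7 4 8 & ~ opposite Q 1 7 5 6 & ~ opposite Q 1 7 5 8 & ~ opposite Q 1 7 6 8 & ~
    opposite Q 1 8 2 3 & ~ opposite Q 1 8 2 4 & ~ opposite Q 1 8 3 4 & ~ opposite Q 1 8 3 5 & ~
    opposite Q 1 8 4 5 & ~ opposite Q 1 8 4 6 & ~ opposite Q 1 8 5 6 & ~ opposite Q 1 8 5 7 & ~
    opposite Q 1 8 6 7 & ~ opposite Q 2 3 4 5 & ~ opposite Q 2 3 4 6 & ~ opposite Q 2 3 4 8 & ~
    opposite Q 2 3 5 6 & ~ opposite Q 2 3 5 7 & ~ opposite Q 2 3 5 8 & ~ opposite Q 2 3 6 7 & ~
    opposite Q 2 3 6 8 & ~ opposite Q 2 3 7 8 & ~ opposite Q 2 4 3 5 & ~ opposite Q 2 4 5 6 & ~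
    opposite Q 2 4 5 7 & ~ opposite Q 2 4 5 8 & ~ opposite Q 2 4 6 7 & ~ opposite Q 2 4 6 8 & ~
    opposite Q 2 4 7 8 & ~ opposite Q 2 8 3 4 & ~ opposite Q 2 8 3 5 & ~ opposite Q 2 8 4 5 & ~
    opposite Q 2 8 4 6 & ~ opposite Q 2 8 5 6 & ~ opposite Q 2 8 5 7 & ~ opposite Q 2 8 6 7 & ~
    opposite Q 3 4 5 6 & ~ opposite Q 3 4 5 7 & ~ opposite Q 3 4 5 8 & ~ opposite Q 3 4 6 7 & ~
    opposite Q 3 4 6 8 & ~ opposite Q 3 4 7 8 & ~ opposite Q 3 5 4 6 & ~ opposite Q 3 5 6 7 & ~
    opposite Q 3 5 6 8 & ~ opposite Q 3 5 7 8 & ~ opposite Q 3 8 4 5 & ~ opposite Q 3 8 4 6 & ~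
    opposite Q 3 8 5 6 & ~ opposite Q 3 8 5 7 & ~ opposite Q 3 8 6 7 & ~ opposite Q 4 5 6 7 & ~
    opposite Q 4 5 6 8 & ~ opposite Q 4 5 7 8 & ~ opposite Q 4 6 5 7 & ~ opposite Q 4 6 7 8 & ~
    opposite Q 4 8 5 6 & ~ opposite Q 4 8 5 7 & ~ opposite Q 4 8 6 7 & ~ opposite Q 5 6 7 8 & ~
    opposite Q 5 8 6 7"

definition standard :: "(nat \<Rightarrow> complex) \<Rightarrow> bool" where
  "standard Q \<longleftrightarrow> positive Q \<and> standard_crossings Q"

definition antistandard :: "(nat \<Rightarrow> complex) \<Rightarrow> bool" where
  "antistandard Q \<longleftrightarrow> negative Q \<and> standard_crossings Q"

locale antiprism_signs = rac_signs 9 antiprism_adj P Q for P Q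
begin

lemma turned:
  assumes "k < 8"
  shows "antiprism_signs (P \<circ> turn k) (Q \<circ> turn k)"
  unfolding antiprism_signs_def
proof (rule rac_signs_relabel)
  have "\<forall>k\<in>set [0..<8]. distinct (map (turn k) [0..<9])" by code_simp
  then have "distinct (map (turn k) [0..<9])" using assms by simp
  then show "inj_on (turn k) {..<9}" by (simp only: distinct_map set_upt atLeast0LessThan)
  show "turn k a < 9" if "a < 9" for a by (cases "a = 8") (simp_all add: turn_def less_trans[of _ 8 9])
qed (auto simp: antiprism_adj_turn assms antiprism_adj_sym, simp add: antiprism_adj_def)

lemma flipped: "antiprism_signs (P \<circ> flip) (Q \<circ> flip)"
  unfolding antiprism_signs_def
proof (rule rac_signs_relabel)
  have "distinct (map flip [0..<9])" by code_simp
  then show "inj_on flip {..<9}" by (simp only: distinct_map set_upt atLeast0LessThan)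
  show "flip a < 9" if "a < 9" for a by (cases "a = 8") (simp_all add: flip_def less_trans[of _ 8 9])
qed (auto simp: antiprism_adj_flip antiprism_adj_sym, simp add: antiprism_adj_def)

lemma mirrored: "antiprism_signs (cnj \<circ> P) (cnj \<circ> Q)"
  unfolding antiprism_signs_def by (rule rac_signs_cnj)

lemmas norm9 = pos_sort opposite_sort numeral_order

text \<open>Together with the hub lying in the counterclockwise triangle 0 1 2, these instances are
  propositionally contradictory. Here \<open>ia\<close> and \<open>ta\<close> are the order axioms,
  \<open>xa\<close> expresses crossings by signs, and \<open>fa\<close> and \<open>ra\<close> carry
  the right angles. The other lemmas on instances are lists of the same kind.\<close>

lemma hub_not_inside_instances:
"ia 0 1 2 3 & ia 0 1 2 4 & ia 0 1 2 5 & ia 0 1 2 6 & ia 0 1 2 7 & ia 0 1 5 6 & ia 0 1 6 5 & ia 0 1 8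
    2 & ia 0 1 8 3 & ia 0 1 8 4 & ia 0 1 8 5 & ia 0 1 8 6 & ia 0 1 8 7 & ia 0 2 3 8 & ia 0 2 4 8 &
    ia 0 2 5 8 & ia 0 2 6 8 & ia 0 2 7 8 & ia 0 3 4 8 & ia 0 3 8 4 & ia 0 3 8 5 & ia 0 5 6 8 & ia 0
    5 7 8 & ia 0 5 8 6 & ia 0 5 8 7 & ia 0 6 7 8 & ia 0 6 8 7 & ia 1 2 3 5 & ia 1 2 7 3 & ia 1 2 8 3
    & ia 1 2 8 4 & ia 1 2 8 5 & ia 1 2 8 6 & ia 1 2 8 7 & ia 1 3 6 8 & ia 1 3 8 5 & ia 1 3 8 7 & ia
    1 5 6 8 & ia 1 5 7 8 & ia 1 5 8 7 & ia 1 6 8 7 & ia 2 3 4 8 & ia 2 3 5 8 & ia 2 3 7 8 & ia 2 3 8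
    5 & ia 2 5 7 8 & ia 2 5 8 7 & ia 3 4 5 8 & ia 3 5 7 8"
"ta 0 1 2 3 6 & ta 0 1 2 3 8 & ta 0 1 2 4 8 & ta 0 1 2 5 8 & ta 0 1 2 6 5 & ta 0 1 2 6 8 & ta 0 1 2
    7 3 & ta 0 1 2 7 5 & ta 0 1 2 7 8 & ta 0 1 3 4 8 & ta 0 1 3 5 8 & ta 0 1 3 7 8 & ta 0 1 3 8 4 &
    ta 0 1 3 8 5 & ta 0 1 3 8 6 & ta 0 1 4 5 8 & ta 0 1 4 6 8 & ta 0 1 4 8 5 & ta 0 1 5 6 8 & ta 0 1
    5 7 6 & ta 0 1 5 7 8 & ta 0 1 5 8 6 & ta 0 1 5 8 7 & ta 0 1 6 7 8 & ta 0 1 6 8 7 & ta 0 3 2 4 8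
    & ta 0 5 2 4 8 & ta 0 6 5 7 8 & ta 0 7 2 3 8 & ta 0 7 5 6 8 & ta 0 8 2 3 5 & ta 0 8 2 3 7 & ta 0
    8 2 4 3 & ta 0 8 2 4 5 & ta 0 8 2 5 3 & ta 0 8 2 5 4 & ta 0 8 2 5 6 & ta 0 8 2 5 7 & ta 0 8 2 6
    5 & ta 0 8 2 6 7 & ta 0 8 2 7 5 & ta 0 8 2 7 6 & ta 1 2 0 3 8 & ta 1 2 0 4 3 & ta 1 2 0 4 5 & ta
    1 2 0 4 8 & ta 1 2 0 5 6 & ta 1 2 0 5 8 & ta 1 2 0 6 7 & ta 1 2 0 6 8 & ta 1 2 0 7 8 & ta 1 2 3
    4 8 & ta 1 2 3 5 8 & ta 1 2 3 6 5 & ta 1 2 3 7 8 & ta 1 2 3 8 4 & ta 1 2 3 8 5 & ta 1 2 3 8 7 &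
    ta 1 2 4 8 5 & ta 1 2 5 8 6 & ta 1 2 5 8 7 & ta 1 2 6 7 8 & ta 1 2 6 8 7 & ta 1 3 0 6 8 & ta 1 3
    0 7 8 & ta 1 3 4 8 5 & ta 1 3 5 8 7 & ta 1 5 0 6 8 & ta 1 5 0 7 8 & ta 1 5 2 8 7 & ta 1 7 0 6 8
    & ta 1 8 0 3 5 & ta 1 8 0 3 7 & ta 1 8 0 5 3 & ta 1 8 0 5 6 & ta 1 8 0 5 7 & ta 1 8 0 6 5 & ta 1
    8 0 7 3 & ta 1 8 0 7 5 & ta 2 0 1 3 8 & ta 2 0 1 4 8 & ta 2 0 1 5 8 & ta 2 0 1 6 5 & ta 2 0 1 6
    8 & ta 2 0 1 7 8 & ta 2 0 3 4 8 & ta 2 0 3 5 8 & ta 2 0 3 6 8 & ta 2 0 3 8 4 & ta 2 0 3 8 5 & ta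
    2 0 3 8 6 & ta 2 0 4 5 8 & ta 2 0 4 6 8 & ta 2 0 4 8 6 & ta 2 0 5 6 8 & ta 2 0 5 7 8 & ta 2 0 5
    8 6 & ta 2 0 5 8 7 & ta 2 0 6 7 8 & ta 2 0 6 8 7 & ta 2 3 1 7 8 & ta 2 4 3 5 8 & ta 2 5 1 3 8 &
    ta 2 5 1 7 8 & ta 2 6 3 8 5 & ta 2 7 1 3 8 & ta 2 8 1 3 4 & ta 2 8 1 3 5 & ta 2 8 1 4 3 & ta 2 8
    1 5 3 & ta 2 8 1 5 6 & ta 2 8 1 5 7 & ta 2 8 1 6 3 & ta 2 8 1 6 5 & ta 2 8 1 6 7 & ta 2 8 1 7 3
    & ta 2 8 1 7 5 & ta 2 8 1 7 6 & ta 3 0 1 2 8 & ta 3 0 1 5 6 & ta 3 1 0 5 8 & ta 3 1 0 8 2 & ta 3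
    1 0 8 6 & ta 3 1 2 5 8 & ta 3 2 0 1 8 & ta 3 2 0 7 8 & ta 3 2 1 4 8 & ta 3 2 1 5 8 & ta 3 2 1 7
    8 & ta 3 2 1 8 5 & ta 3 2 1 8 7 & ta 3 2 5 6 8 & ta 3 4 0 1 2 & ta 3 4 0 8 2 & ta 3 4 1 2 8 & ta
    3 5 0 1 2 & ta 3 5 0 6 2 & ta 3 5 0 6 8 & ta 3 5 0 8 2 & ta 3 5 1 2 8 & ta 3 5 2 8 4 & ta 3 8 0
    1 2 & ta 3 8 0 1 5 & ta 3 8 0 5 2 & ta 3 8 0 6 2 & ta 3 8 1 2 4 & ta 4 0 1 2 8 & ta 4 0 2 5 8 &
    ta 4 1 0 8 2 & ta 4 2 0 1 8 & ta 4 2 0 3 8 & ta 4 5 0 8 2 & ta 4 8 0 1 2 & ta 4 8 2 3 5 & ta 5 0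
    1 2 8 & ta 5 0 2 3 8 & ta 5 0 2 6 8 & ta 5 0 2 7 8 & ta 5 0 6 7 8 & ta 5 1 0 3 8 & ta 5 1 0 6 2
    & ta 5 1 0 6 8 & ta 5 1 0 7 8 & ta 5 1 0 8 2 & ta 5 1 2 3 8 & ta 5 2 0 1 6 & ta 5 2 0 1 8 & ta 5
    2 1 3 8 & ta 5 2 1 7 8 & ta 5 3 0 1 2 & ta 5 3 0 1 8 & ta 5 3 0 8 2 & ta 5 3 1 2 8 & ta 5 4 0 1
    8 & ta 5 4 0 8 2 & ta 5 6 0 1 2 & ta 5 6 0 1 8 & ta 5 6 0 8 2 & ta 5 6 1 2 8 & ta 5 6 2 3 8 & ta
    5 7 0 1 2 & ta 5 7 1 2 8 & ta 5 8 0 1 2 & ta 5 8 0 4 3 & ta 5 8 1 2 7 & ta 5 8 1 3 7 & ta 5 8 2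
    4 3 & ta 5 8 2 6 3 & ta 6 0 1 2 8 & ta 6 0 1 7 8 & ta 6 0 2 3 8 & ta 6 0 2 5 8 & ta 6 0 2 8 5 &
    ta 6 1 0 5 8 & ta 6 1 0 8 2 & ta 6 2 0 1 8 & ta 6 2 1 3 8 & ta 6 3 1 2 5 & ta 6 4 0 8 2 & ta 6 5
    0 1 2 & ta 6 5 0 1 8 & ta 6 7 0 1 2 & ta 6 8 0 1 2 & ta 6 8 0 1 3 & ta 6 8 0 3 2 & ta 6 8 1 2 5
    & ta 6 8 2 3 5 & ta 7 0 1 2 8 & ta 7 0 1 3 8 & ta 7 0 2 6 8 & ta 7 1 0 5 8 & ta 7 1 0 8 2 & ta 7
    1 0 8 6 & ta 7 1 2 3 8 & ta 7 2 0 1 8 & ta 7 3 0 1 8 & ta 7 5 0 1 2 & ta 7 5 0 1 8 & ta 7 5 1 2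
    8 & ta 7 5 1 8 3 & ta 7 6 0 1 8 & ta 7 6 0 8 2 & ta 7 6 1 2 8 & ta 7 8 0 1 2 & ta 7 8 0 1 5 & ta
    7 8 0 1 6 & ta 7 8 0 5 2 & ta 7 8 1 2 3 & ta 7 8 1 2 5 & ta 8 0 1 3 4 & ta 8 0 1 3 5 & ta 8 0 1
    3 7 & ta 8 0 1 4 3 & ta 8 0 1 4 5 & ta 8 0 1 5 3 & ta 8 0 1 5 6 & ta 8 0 1 5 7 & ta 8 0 1 6 3 &
    ta 8 0 1 6 5 & ta 8 0 1 6 7 & ta 8 0 1 7 3 & ta 8 0 1 7 5 & ta 8 0 1 7 6 & ta 8 0 3 6 5 & ta 8 1
    2 3 5 & ta 8 1 2 3 6 & ta 8 1 2 3 7 & ta 8 1 2 4 3 & ta 8 1 2 5 3 & ta 8 1 2 5 4 & ta 8 1 2 5 7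
    & ta 8 1 2 6 3 & ta 8 1 2 6 5 & ta 8 1 2 6 7 & ta 8 1 2 7 3 & ta 8 1 2 7 5 & ta 8 1 2 7 6 & ta 8
    2 0 3 5 & ta 8 2 0 3 6 & ta 8 2 0 3 7 & ta 8 2 0 4 5 & ta 8 2 0 5 3 & ta 8 2 0 5 4 & ta 8 2 0 5
    6 & ta 8 2 0 6 4 & ta 8 2 0 6 5 & ta 8 2 0 6 7 & ta 8 2 0 7 3 & ta 8 2 0 7 5 & ta 8 2 0 7 6 & ta
    8 3 0 1 2 & ta 8 3 0 1 5 & ta 8 3 0 1 6 & ta 8 3 0 1 7 & ta 8 3 0 4 2 & ta 8 3 0 5 2 & ta 8 3 0
    5 4 & ta 8 3 0 7 2 & ta 8 3 1 2 4 & ta 8 3 1 2 5 & ta 8 3 1 2 7 & ta 8 3 2 5 4 & ta 8 3 2 7 5 &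
    ta 8 4 0 1 2 & ta 8 4 0 1 3 & ta 8 4 0 3 2 & ta 8 4 0 5 2 & ta 8 4 1 2 5 & ta 8 5 0 1 2 & ta 8 5
    0 1 3 & ta 8 5 0 1 4 & ta 8 5 0 1 7 & ta 8 5 0 3 2 & ta 8 5 0 4 6 & ta 8 5 0 6 2 & ta 8 5 0 7 2
    & ta 8 5 0 7 6 & ta 8 5 1 2 3 & ta 8 5 1 2 4 & ta 8 5 1 2 6 & ta 8 5 2 4 3 & ta 8 5 2 6 3 & ta 8
    6 0 1 2 & ta 8 6 0 1 5 & ta 8 6 0 1 7 & ta 8 6 0 7 2 & ta 8 6 1 2 3 & ta 8 6 1 2 5 & ta 8 6 1 2
    7 & ta 8 6 1 5 7 & ta 8 7 0 1 2 & ta 8 7 0 1 5 & ta 8 7 0 1 6 & ta 8 7 0 6 2 & ta 8 7 1 2 3 & ta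
    8 7 1 2 5 & ta 8 7 1 2 6"
"xa 0 1 2 3 & xa 0 1 2 4 & xa 0 1 3 4 & xa 0 1 3 5 & xa 0 1 3 8 & xa 0 1 4 5 & xa 0 1 4 8 & xa 0 1 5
    6 & xa 0 1 5 7 & xa 0 1 5 8 & xa 0 1 6 7 & xa 0 1 6 8 & xa 0 1 7 8 & xa 0 2 1 3 & xa 0 2 1 7 &
    xa 0 2 3 4 & xa 0 2 3 5 & xa 0 2 3 8 & xa 0 2 4 5 & xa 0 2 4 8 & xa 0 2 5 6 & xa 0 2 5 7 & xa 0
    2 5 8 & xa 0 2 6 7 & xa 0 2 6 8 & xa 0 2 7 8 & xa 0 6 1 2 & xa 0 6 1 3 & xa 0 6 1 7 & xa 0 6 1 8
    & xa 0 6 2 3 & xa 0 6 2 8 & xa 0 6 3 8 & xa 0 6 5 7 & xa 0 6 5 8 & xa 0 6 7 8 & xa 0 7 1 2 & xa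
    0 7 1 3 & xa 0 7 1 8 & xa 0 7 2 8 & xa 0 7 3 8 & xa 0 7 5 8 & xa 0 7 6 8 & xa 0 8 1 3 & xa 0 8 1
    7 & xa 0 8 2 3 & xa 0 8 2 4 & xa 0 8 3 4 & xa 0 8 3 5 & xa 0 8 4 5 & xa 0 8 4 6 & xa 0 8 5 6 &
    xa 0 8 5 7 & xa 0 8 6 7 & xa 1 2 3 4 & xa 1 2 3 5 & xa 1 2 3 8 & xa 1 2 4 8 & xa 1 2 5 6 & xa 1
    2 5 7 & xa 1 2 5 8 & xa 1 2 6 7 & xa 1 2 6 8 & xa 1 2 7 8 & xa 1 3 2 4 & xa 1 3 2 8 & xa 1 3 4 8
    & xa 1 3 5 6 & xa 1 3 5 7 & xa 1 3 5 8 & xa 1 3 6 8 & xa 1 3 7 8 & xa 1 7 2 3 & xa 1 7 2 8 & xa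
    1 7 3 8 & xa 1 7 5 8 & xa 1 7 6 8 & xa 1 8 2 3 & xa 1 8 2 4 & xa 1 8 3 4 & xa 1 8 3 5 & xa 1 8 4
    5 & xa 1 8 5 6 & xa 1 8 5 7 & xa 1 8 6 7 & xa 2 3 4 8 & xa 2 3 5 6 & xa 2 3 5 8 & xa 2 3 6 8 &
    xa 2 3 7 8 & xa 2 4 3 5 & xa 2 4 3 8 & xa 2 4 5 8 & xa 2 8 3 4 & xa 2 8 3 5 & xa 2 8 4 5 & xa 2
    8 4 6 & xa 2 8 5 6 & xa 2 8 5 7 & xa 2 8 6 7 & xa 3 5 4 8 & xa 3 5 6 8 & xa 3 8 5 6 & xa 3 8 5
    7"
"fa 0 1 3 2 8 & fa 0 1 3 5 8 & fa 0 1 4 3 8 & fa 0 1 4 5 8 & fa 0 1 5 3 8 & fa 0 1 5 6 8 & fa 0 1 5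
    7 8 & fa 0 1 6 5 8 & fa 0 1 6 7 8 & fa 0 1 7 5 8 & fa 0 1 8 3 5 & fa 0 1 8 3 6 & fa 0 1 8 3 7 &
    fa 0 1 8 5 6 & fa 0 1 8 5 7 & fa 0 1 8 6 7 & fa 0 2 3 1 8 & fa 0 2 3 5 8 & fa 0 2 4 3 8 & fa 0 2
    4 5 8 & fa 0 2 5 3 8 & fa 0 2 5 4 8 & fa 0 2 5 6 8 & fa 0 2 5 7 8 & fa 0 2 6 5 8 & fa 0 2 7 1 8
    & fa 0 2 7 5 8 & fa 0 2 7 6 8 & fa 0 2 8 3 5 & fa 0 2 8 3 6 & fa 0 2 8 3 7 & fa 0 2 8 4 5 & fa 0
    2 8 5 6 & fa 0 2 8 5 7 & fa 0 2 8 6 7 & fa 0 7 8 1 6 & fa 0 7 8 2 6 & fa 0 8 1 3 7 & fa 0 8 3 1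
    5 & fa 0 8 3 2 5 & fa 0 8 3 4 5 & fa 0 8 4 2 3 & fa 0 8 4 2 5 & fa 0 8 4 3 5 & fa 0 8 4 5 6 & fa
    0 8 5 3 4 & fa 0 8 5 4 6 & fa 0 8 5 6 7 & fa 0 8 7 1 5 & fa 0 8 7 1 6 & fa 0 8 7 5 6 & fa 1 2 3
    4 8 & fa 1 2 3 5 8 & fa 1 2 4 3 8 & fa 1 2 5 6 8 & fa 1 2 5 7 8 & fa 1 2 6 0 8 & fa 1 2 6 5 8 &
    fa 1 2 6 7 8 & fa 1 2 7 0 8 & fa 1 2 7 5 8 & fa 1 2 7 6 8 & fa 1 2 8 3 4 & fa 1 2 8 3 5 & fa 1 2
    8 3 6 & fa 1 2 8 3 7 & fa 1 2 8 5 7 & fa 1 2 8 6 7 & fa 1 3 0 7 8 & fa 1 3 2 4 8 & fa 1 3 6 5 8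
    & fa 1 3 8 0 7 & fa 1 3 8 2 4 & fa 1 3 8 5 6 & fa 1 7 0 6 8 & fa 1 7 2 3 8 & fa 1 7 8 0 6 & fa 1
    7 8 2 3 & fa 1 8 0 6 7 & fa 1 8 2 3 4 & fa 1 8 3 2 4 & fa 1 8 3 2 5 & fa 1 8 3 4 5 & fa 1 8 5 3
    4 & fa 1 8 5 3 6 & fa 1 8 5 6 7 & fa 1 8 6 0 7 & fa 1 8 6 5 7 & fa 1 8 7 0 5 & fa 1 8 7 0 6 & fa
    1 8 7 5 6 & fa 2 3 0 6 8 & fa 2 3 8 0 5 & fa 2 3 8 0 6 & fa 2 3 8 1 4 & fa 2 4 0 1 8 & fa 2 8 0
    6 7 & fa 2 8 1 3 7 & fa 2 8 3 1 4 & fa 2 8 3 4 5 & fa 2 8 4 3 6 & fa 2 8 5 3 4 & fa 2 8 5 3 6 &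
    fa 2 8 5 3 7 & fa 2 8 5 6 7 & fa 2 8 6 0 5 & fa 2 8 6 0 7 & fa 2 8 6 5 7 & fa 2 8 7 0 5 & fa 2 8
    7 0 6 & fa 2 8 7 1 5 & fa 2 8 7 5 6 & fa 3 4 8 0 1 & fa 3 5 1 2 8 & fa 3 5 2 4 8 & fa 3 5 8 0 1
    & fa 3 5 8 0 2 & fa 3 5 8 0 4 & fa 3 5 8 1 2 & fa 3 5 8 2 4 & fa 3 5 8 2 6 & fa 3 8 0 1 7 & fa 3
    8 0 2 6 & fa 3 8 0 2 7 & fa 3 8 1 0 7 & fa 3 8 2 1 4 & fa 4 5 8 0 1 & fa 4 5 8 0 2 & fa 5 6 2 3
    8 & fa 5 6 8 0 1 & fa 5 6 8 0 2 & fa 5 6 8 1 2 & fa 5 6 8 2 3 & fa 5 7 0 1 8 & fa 5 7 1 0 8 & fa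
    5 7 1 3 8 & fa 5 7 8 0 2 & fa 5 7 8 1 2 & fa 5 7 8 1 3 & fa 5 8 0 1 6 & fa 5 8 0 1 7 & fa 5 8 0
    2 6 & fa 5 8 0 2 7 & fa 5 8 1 0 3 & fa 5 8 1 0 7 & fa 5 8 1 2 3 & fa 5 8 1 2 7 & fa 5 8 2 0 3 &
    fa 5 8 2 0 4 & fa 5 8 2 1 3 & fa 6 7 8 1 2 & fa 6 8 1 2 3 & fa 6 8 1 2 7 & fa 6 8 2 1 3 & fa 7 8
    0 1 6 & fa 7 8 0 2 6 & fa 7 8 1 0 3 & fa 7 8 1 2 3 & fa 7 8 2 0 3 & fa 7 8 2 1 3"
"ra 0 1 2 3 5 8 & ra 0 1 2 5 3 8 & ra 0 1 2 5 6 8 & ra 0 1 2 5 8 6 & ra 0 1 2 6 5 8 & ra 0 1 2 7 8 5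
    & ra 0 1 2 8 7 3 & ra 0 1 2 8 7 5 & ra 0 2 6 8 7 1 & ra 0 6 7 8 1 2 & ra 0 6 7 8 2 1 & ra 0 6 8
    3 1 2 & ra 0 6 8 7 5 1 & ra 1 0 2 3 5 8 & ra 1 0 2 3 8 5 & ra 1 0 2 4 8 3 & ra 1 0 2 5 6 8 & ra
    1 0 2 6 5 8 & ra 1 0 2 6 8 5 & ra 1 0 2 7 8 5 & ra 1 0 2 8 7 5 & ra 1 0 7 8 3 2 & ra 1 0 8 3 4 2
    & ra 1 3 7 8 0 2 & ra 1 7 3 8 0 2 & ra 2 0 1 3 5 8 & ra 2 0 1 4 5 8 & ra 2 0 1 5 7 8 & ra 2 0 1
    5 8 7 & ra 2 0 1 6 5 8 & ra 2 0 1 6 8 5 & ra 2 0 1 7 5 8 & ra 2 0 1 7 8 5 & ra 2 0 1 8 3 5 & ra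
    2 0 1 8 5 3 & ra 2 1 4 3 8 5 & ra 2 3 1 8 0 5 & ra 2 4 3 8 0 1 & ra 2 4 8 3 1 5 & ra 3 1 2 6 8 5
    & ra 4 3 5 8 0 1"
  subgoal by (intro conjI int_ax)
  subgoal by (intro conjI trans_ax)
  subgoal by (intro conjI opp_ax)
  subgoal by (intro conjI fan_ax; simp add: antiprism_adj_def)
  subgoal by (intro conjI rot_ax; simp add: antiprism_adj_def)
  done

lemma hub_not_inside: "\<not> (pos Q 8 0 1 \<and> pos Q 8 1 2 \<and> pos Q 8 2 0)"
  \<comment> \<open>The instances become clauses over sorted atoms; the rest is
    propositional.\<close>
  using hub_not_inside_instances[simplified ax_defs norm9] apply (simp only: norm9) by sat

text \<open>Rotations of the 8-cycle transport the result to any three consecutive vertices, and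
  reflecting the plane gives the clockwise triangles.\<close>

lemma hub_not_inside_any:
  assumes "k < 8"
  shows "\<not> (pos Q 8 (turn k 0) (turn k 1) \<and> pos Q 8 (turn k 1) (turn k 2) \<and> pos Q 8 (turn k 2) (turn k 0))"
    "\<not> (\<not> pos Q 8 (turn k 0) (turn k 1) \<and> \<not> pos Q 8 (turn k 1) (turn k 2) \<and> \<not> pos Q 8 (turn k 2) (turn k 0))"
proof -
  interpret k: antiprism_signs "P \<circ> turn k" "Q \<circ> turn k" by (rule turned[OF assms])
  interpret c: antiprism_signs "cnj \<circ> (P \<circ> turn k)" "cnj \<circ> (Q \<circ> turn k)" by (rule k.mirrored)
  show "\<not> (pos Q 8 (turn k 0) (turn k 1) \<and> pos Q 8 (turn k 1) (turn k 2) \<and> pos Q 8 (turn k 2) (turn k 0))"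
    using k.hub_not_inside by (simp add: pos_comp turn_def[of k 8])
  show "\<not> (\<not> pos Q 8 (turn k 0) (turn k 1) \<and> \<not> pos Q 8 (turn k 1) (turn k 2) \<and> \<not> pos Q 8 (turn k 2) (turn k 0))"
    using c.hub_not_inside by (simp add: k.pos_cnj pos_comp turn_def[of k 8])
qed

lemmas hub_not_inside_all =
  hub_not_inside_any[OF less_eight(1), unfolded turn_values] hub_not_inside_any[OF less_eight(2), unfolded turn_values]
  hub_not_inside_any[OF less_eight(3), unfolded turn_values] hub_not_inside_any[OF less_eight(4), unfolded turn_values]
  hub_not_inside_any[OF less_eight(5), unfolded turn_values] hub_not_inside_any[OF less_eight(6), unfolded turn_values]
  hub_not_inside_any[OF less_eight(7), unfolded turn_values] hub_not_inside_any[OF less_eight(8), unfolded turn_values]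

lemma not_before_instances:
"ia 0 1 2 3 & ia 0 1 2 5 & ia 0 1 2 6 & ia 0 1 2 7 & ia 0 1 3 6 & ia 0 1 3 7 & ia 0 1 3 8 & ia 0 1 4
    8 & ia 0 1 5 6 & ia 0 1 5 8 & ia 0 1 6 8 & ia 0 1 7 5 & ia 0 1 7 6 & ia 0 2 6 7 & ia 0 2 8 5 &
    ia 0 2 8 6 & ia 0 2 8 7 & ia 0 5 6 7 & ia 1 2 5 3 & ia 1 2 8 4 & ia 1 2 8 5 & ia 1 2 8 6 & ia 1
    2 8 7 & ia 1 3 4 5 & ia 1 3 6 8 & ia 1 3 7 8 & ia 1 3 8 6 & ia 1 3 8 7 & ia 1 5 6 7 & ia 1 5 7 8
    & ia 1 6 7 8 & ia 2 3 6 8 & ia 2 3 7 8 & ia 3 6 7 8"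
"ta 0 1 2 3 6 & ta 0 1 2 3 7 & ta 0 1 2 5 7 & ta 0 1 2 6 5 & ta 0 1 2 6 7 & ta 0 1 2 7 5 & ta 0 1 2
    7 6 & ta 0 2 1 3 8 & ta 0 2 1 6 8 & ta 0 2 1 7 8 & ta 0 2 3 6 8 & ta 0 2 3 8 4 & ta 0 2 5 7 8 &
    ta 0 2 5 8 6 & ta 0 2 5 8 7 & ta 0 2 6 7 8 & ta 0 2 6 8 7 & ta 0 3 1 2 7 & ta 0 3 1 2 8 & ta 0 3
    1 6 8 & ta 0 3 2 8 5 & ta 0 4 1 2 8 & ta 0 5 1 2 8 & ta 0 5 1 3 7 & ta 0 5 1 7 8 & ta 0 5 2 8 6
    & ta 0 5 6 8 7 & ta 0 6 1 2 5 & ta 0 6 1 2 8 & ta 0 6 1 3 2 & ta 0 6 1 3 5 & ta 0 6 1 5 7 & ta 0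
    6 1 5 8 & ta 0 6 1 7 8 & ta 0 6 2 8 3 & ta 0 6 2 8 7 & ta 0 7 1 2 3 & ta 0 7 1 2 5 & ta 0 7 1 2
    8 & ta 0 7 1 3 8 & ta 0 7 2 8 5 & ta 0 7 2 8 6 & ta 0 7 5 6 8 & ta 0 8 1 3 5 & ta 0 8 1 3 7 & ta
    0 8 1 4 5 & ta 0 8 1 4 6 & ta 0 8 1 5 6 & ta 0 8 1 5 7 & ta 0 8 1 6 3 & ta 0 8 1 6 7 & ta 0 8 1
    7 3 & ta 0 8 1 7 5 & ta 0 8 1 7 6 & ta 0 8 3 5 7 & ta 0 8 3 6 7 & ta 0 8 3 7 6 & ta 0 8 5 6 7 &
    ta 0 8 5 7 6 & ta 1 0 2 8 3 & ta 1 0 2 8 6 & ta 1 0 2 8 7 & ta 1 0 3 5 8 & ta 1 0 3 7 6 & ta 1 0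
    3 8 6 & ta 1 0 3 8 7 & ta 1 0 4 5 8 & ta 1 0 5 6 7 & ta 1 0 5 6 8 & ta 1 0 5 7 6 & ta 1 0 5 7 8
    & ta 1 0 6 7 8 & ta 1 0 6 8 7 & ta 1 2 0 3 7 & ta 1 2 0 5 6 & ta 1 2 0 6 7 & ta 1 2 0 7 6 & ta 1
    2 0 8 3 & ta 1 2 0 8 5 & ta 1 2 0 8 6 & ta 1 2 0 8 7 & ta 1 2 4 5 8 & ta 1 2 4 6 8 & ta 1 2 5 7
    8 & ta 1 3 0 2 6 & ta 1 3 0 6 7 & ta 1 3 0 8 6 & ta 1 3 0 8 7 & ta 1 3 2 8 4 & ta 1 3 6 8 7 & ta
    1 5 0 8 3 & ta 1 5 3 4 8 & ta 1 5 3 7 8 & ta 1 6 0 8 3 & ta 1 6 0 8 7 & ta 1 6 2 8 3 & ta 1 6 4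
    5 8 & ta 1 7 0 3 2 & ta 1 7 0 8 5 & ta 1 7 0 8 6 & ta 1 7 2 8 3 & ta 1 7 5 6 8 & ta 2 0 1 7 3 &
    ta 2 0 1 7 6 & ta 2 1 0 3 6 & ta 2 3 0 7 6 & ta 2 6 0 3 8 & ta 2 6 0 7 8 & ta 2 8 0 1 3 & ta 2 8
    0 1 4 & ta 2 8 0 1 5 & ta 2 8 0 1 6 & ta 2 8 0 1 7 & ta 2 8 0 3 1 & ta 2 8 0 3 5 & ta 2 8 0 3 6
    & ta 2 8 0 3 7 & ta 2 8 0 4 3 & ta 2 8 0 5 6 & ta 2 8 0 5 7 & ta 2 8 0 6 1 & ta 2 8 0 6 3 & ta 2
    8 0 6 5 & ta 2 8 0 6 7 & ta 2 8 0 7 1 & ta 2 8 0 7 3 & ta 2 8 0 7 5 & ta 2 8 0 7 6 & ta 2 8 1 3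
    4 & ta 2 8 1 3 5 & ta 2 8 1 3 6 & ta 2 8 1 3 7 & ta 2 8 1 4 6 & ta 2 8 1 5 6 & ta 2 8 1 5 7 & ta
    2 8 1 6 7 & ta 3 0 1 7 6 & ta 3 0 1 7 8 & ta 3 0 1 8 6 & ta 3 0 6 8 7 & ta 3 1 0 2 6 & ta 3 1 0
    2 8 & ta 3 1 0 7 2 & ta 3 2 0 1 7 & ta 3 2 0 5 8 & ta 3 2 0 8 1 & ta 3 2 0 8 6 & ta 3 2 0 8 7 &
    ta 3 2 1 8 7 & ta 3 8 0 1 2 & ta 3 8 0 1 6 & ta 3 8 0 1 7 & ta 3 8 0 2 5 & ta 3 8 0 6 1 & ta 3 8
    0 6 5 & ta 3 8 0 7 1 & ta 3 8 0 7 6 & ta 3 8 1 6 7 & ta 3 8 2 4 5 & ta 4 1 5 8 6 & ta 4 2 1 6 8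
    & ta 4 3 1 2 8 & ta 4 8 0 2 5 & ta 4 8 0 5 1 & ta 4 8 0 5 6 & ta 4 8 1 2 5 & ta 4 8 1 7 5 & ta 5
    0 1 6 8 & ta 5 0 1 7 8 & ta 5 0 3 8 6 & ta 5 1 0 2 8 & ta 5 1 0 7 3 & ta 5 1 0 8 6 & ta 5 1 0 8
    7 & ta 5 1 2 8 7 & ta 5 2 0 8 1 & ta 5 3 0 2 8 & ta 5 3 0 8 1 & ta 5 3 1 2 8 & ta 5 4 0 2 8 & ta
    5 4 0 8 1 & ta 5 4 0 8 6 & ta 5 4 1 2 8 & ta 5 6 0 8 1 & ta 5 7 0 8 1 & ta 5 8 0 1 2 & ta 5 8 0
    1 3 & ta 5 8 0 1 7 & ta 5 8 0 2 6 & ta 5 8 0 2 7 & ta 5 8 0 3 1 & ta 5 8 1 2 7 & ta 5 8 1 4 3 &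
    ta 5 8 1 6 4 & ta 5 8 1 7 3 & ta 5 8 2 6 7 & ta 5 8 3 4 6 & ta 6 0 1 7 8 & ta 6 0 1 8 3 & ta 6 0
    2 7 3 & ta 6 0 3 7 8 & ta 6 0 3 8 5 & ta 6 1 0 2 8 & ta 6 1 0 5 7 & ta 6 1 0 7 5 & ta 6 1 0 8 3
    & ta 6 1 0 8 7 & ta 6 2 0 8 1 & ta 6 3 1 2 8 & ta 6 4 1 2 8 & ta 6 4 1 5 8 & ta 6 5 0 2 8 & ta 6
    5 0 8 1 & ta 6 7 0 1 2 & ta 6 7 0 8 1 & ta 6 8 0 1 2 & ta 6 8 0 1 7 & ta 6 8 0 2 3 & ta 6 8 0 2
    7 & ta 6 8 0 3 2 & ta 6 8 0 5 1 & ta 6 8 0 5 7 & ta 6 8 0 7 1 & ta 6 8 0 7 2 & ta 6 8 0 7 5 & ta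
    6 8 1 2 7 & ta 6 8 1 5 4 & ta 6 8 2 7 3 & ta 7 0 1 2 8 & ta 7 0 1 5 8 & ta 7 0 2 8 3 & ta 7 1 0
    2 3 & ta 7 1 0 2 5 & ta 7 1 0 5 3 & ta 7 1 0 5 6 & ta 7 1 0 6 5 & ta 7 1 0 8 3 & ta 7 1 0 8 6 &
    ta 7 1 3 6 8 & ta 7 2 0 1 3 & ta 7 2 0 8 1 & ta 7 3 0 8 1 & ta 7 5 0 2 8 & ta 7 5 0 8 1 & ta 7 5
    0 8 6 & ta 7 5 1 2 8 & ta 7 5 1 3 8 & ta 7 6 0 8 1 & ta 7 6 1 2 8 & ta 7 6 1 3 2 & ta 7 6 1 5 8
    & ta 7 6 1 8 3 & ta 7 8 0 1 2 & ta 7 8 0 1 3 & ta 7 8 0 1 6 & ta 7 8 0 2 6 & ta 7 8 0 3 1 & ta 7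
    8 0 5 1 & ta 7 8 0 6 1 & ta 7 8 1 3 2 & ta 7 8 1 5 3 & ta 8 0 2 4 5 & ta 8 0 2 5 6 & ta 8 0 2 5
    7 & ta 8 0 2 6 5 & ta 8 0 2 6 7 & ta 8 0 2 7 3 & ta 8 0 2 7 6 & ta 8 1 0 2 3 & ta 8 1 0 2 4 & ta
    8 1 0 2 5 & ta 8 1 0 2 6 & ta 8 1 0 2 7 & ta 8 1 0 3 5 & ta 8 1 0 3 6 & ta 8 1 0 3 7 & ta 8 1 0
    4 6 & ta 8 1 0 5 6 & ta 8 1 0 5 7 & ta 8 1 0 6 5 & ta 8 1 0 7 3 & ta 8 1 0 7 5 & ta 8 1 2 3 5 &
    ta 8 1 3 5 7 & ta 8 1 3 6 5 & ta 8 3 0 2 7 & ta 8 3 1 5 4 & ta 8 5 0 3 4 & ta 8 5 0 4 7 & ta 8 5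
    3 6 7 & ta 8 6 0 4 5 & ta 8 7 0 6 1 & ta 8 7 2 5 6"
"xa 0 1 2 3 & xa 0 1 3 5 & xa 0 1 3 8 & xa 0 1 4 5 & xa 0 1 4 6 & xa 0 1 5 6 & xa 0 1 5 7 & xa 0 1 5
    8 & xa 0 1 6 7 & xa 0 1 6 8 & xa 0 1 7 8 & xa 0 2 1 3 & xa 0 2 1 7 & xa 0 2 3 4 & xa 0 2 3 5 &
    xa 0 2 3 8 & xa 0 2 4 5 & xa 0 2 5 6 & xa 0 2 5 7 & xa 0 2 5 8 & xa 0 2 6 7 & xa 0 2 6 8 & xa 0
    2 7 8 & xa 0 6 1 2 & xa 0 6 1 3 & xa 0 6 1 7 & xa 0 6 1 8 & xa 0 6 2 3 & xa 0 6 2 8 & xa 0 6 3 5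
    & xa 0 6 3 8 & xa 0 6 4 5 & xa 0 6 5 7 & xa 0 6 5 8 & xa 0 6 7 8 & xa 0 7 1 2 & xa 0 7 1 3 & xa
    0 7 1 8 & xa 0 7 2 3 & xa 0 7 2 8 & xa 0 7 3 5 & xa 0 7 3 8 & xa 0 7 5 8 & xa 0 7 6 8 & xa 0 8 1
    2 & xa 0 8 1 3 & xa 0 8 1 7 & xa 0 8 2 3 & xa 0 8 3 4 & xa 0 8 3 5 & xa 0 8 4 5 & xa 0 8 5 6 &
    xa 0 8 5 7 & xa 0 8 6 7 & xa 1 2 3 4 & xa 1 2 3 5 & xa 1 2 3 8 & xa 1 2 4 5 & xa 1 2 4 6 & xa 1
    2 4 8 & xa 1 2 5 6 & xa 1 2 5 7 & xa 1 2 6 7 & xa 1 2 6 8 & xa 1 2 7 8 & xa 1 3 2 4 & xa 1 3 2 8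
    & xa 1 3 6 7 & xa 1 3 6 8 & xa 1 3 7 8 & xa 1 7 2 3 & xa 1 7 2 8 & xa 1 7 3 5 & xa 1 7 3 8 & xa
    1 7 4 5 & xa 1 7 5 6 & xa 1 7 5 8 & xa 1 7 6 8 & xa 1 8 2 3 & xa 1 8 3 4 & xa 1 8 3 5 & xa 1 8 4
    5 & xa 1 8 4 6 & xa 1 8 5 6 & xa 1 8 5 7 & xa 1 8 6 7 & xa 2 3 6 7 & xa 2 3 6 8 & xa 2 3 7 8 &
    xa 2 8 3 4 & xa 2 8 3 5 & xa 2 8 4 5 & xa 2 8 5 6 & xa 2 8 5 7 & xa 2 8 6 7 & xa 3 5 4 8 & xa 3
    5 6 8 & xa 3 5 7 8 & xa 3 8 6 7 & xa 4 5 7 8 & xa 4 6 5 8 & xa 5 6 7 8 & xa 5 7 6 8 & xa 5 8 6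
    7"
"fa 0 1 5 6 7 & fa 0 1 5 7 8 & fa 0 1 6 5 7 & fa 0 1 6 7 8 & fa 0 1 7 5 6 & fa 0 1 7 5 8 & fa 0 1 7
    6 8 & fa 0 1 8 5 7 & fa 0 1 8 6 7 & fa 0 2 1 3 7 & fa 0 2 3 1 4 & fa 0 2 3 5 8 & fa 0 2 5 6 8 &
    fa 0 2 6 5 7 & fa 0 2 6 5 8 & fa 0 2 7 1 5 & fa 0 2 7 1 6 & fa 0 2 7 5 6 & fa 0 2 7 5 8 & fa 0 2
    7 6 8 & fa 0 2 8 5 6 & fa 0 2 8 5 7 & fa 0 2 8 6 7 & fa 0 6 1 2 3 & fa 0 6 1 2 7 & fa 0 6 1 3 8
    & fa 0 6 2 1 3 & fa 0 6 2 3 8 & fa 0 6 3 2 8 & fa 0 6 7 1 5 & fa 0 6 8 1 3 & fa 0 6 8 1 7 & fa 0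
    6 8 2 7 & fa 0 6 8 5 7 & fa 0 7 1 2 3 & fa 0 7 1 3 8 & fa 0 7 2 1 3 & fa 0 7 3 1 8 & fa 0 7 3 2
    8 & fa 0 7 3 5 8 & fa 0 7 8 1 3 & fa 0 7 8 1 6 & fa 0 7 8 2 6 & fa 0 7 8 3 6 & fa 0 7 8 5 6 & fa
    0 8 1 2 3 & fa 0 8 1 2 7 & fa 0 8 1 3 7 & fa 0 8 2 1 3 & fa 0 8 3 4 5 & fa 0 8 5 3 4 & fa 0 8 5
    6 7 & fa 0 8 6 5 7 & fa 0 8 7 1 5 & fa 0 8 7 1 6 & fa 0 8 7 5 6 & fa 1 2 0 6 7 & fa 1 2 0 6 8 &
    fa 1 2 0 7 8 & fa 1 2 4 6 8 & fa 1 2 6 0 7 & fa 1 2 6 0 8 & fa 1 2 7 0 6 & fa 1 2 7 0 8 & fa 1 2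
    8 0 3 & fa 1 2 8 0 6 & fa 1 2 8 0 7 & fa 1 3 0 6 7 & fa 1 3 0 6 8 & fa 1 3 0 7 8 & fa 1 3 6 7 8
    & fa 1 3 7 0 6 & fa 1 3 7 6 8 & fa 1 3 8 0 2 & fa 1 3 8 0 7 & fa 1 7 0 2 6 & fa 1 7 2 0 3 & fa 1
    7 6 0 5 & fa 1 7 8 0 3 & fa 1 7 8 0 5 & fa 1 7 8 0 6 & fa 1 8 0 6 7 & fa 1 8 3 4 5 & fa 1 8 4 5
    6 & fa 1 8 5 3 4 & fa 1 8 5 6 7 & fa 1 8 6 0 7 & fa 1 8 7 0 6 & fa 2 3 0 1 6 & fa 2 3 0 1 7 & fa
    2 3 0 6 8 & fa 2 3 0 7 8 & fa 2 3 1 0 7 & fa 2 3 1 0 8 & fa 2 3 7 0 1 & fa 2 3 7 6 8 & fa 2 3 8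
    0 1 & fa 2 3 8 0 6 & fa 2 3 8 0 7 & fa 2 8 0 6 7 & fa 2 8 3 4 5 & fa 2 8 5 3 4 & fa 2 8 5 6 7 &
    fa 2 8 6 0 7 & fa 2 8 7 0 1 & fa 2 8 7 0 6 & fa 3 5 0 1 7 & fa 3 5 0 2 8 & fa 3 5 0 6 8 & fa 3 5
    1 0 2 & fa 3 5 1 0 7 & fa 3 5 1 0 8 & fa 3 5 1 7 8 & fa 3 5 2 0 1 & fa 3 5 8 0 1 & fa 3 5 8 0 2
    & fa 3 5 8 0 6 & fa 3 5 8 1 6 & fa 3 5 8 1 7 & fa 3 5 8 2 4 & fa 3 8 0 1 7 & fa 3 8 0 6 7 & fa 3
    8 1 0 2 & fa 3 8 1 0 7 & fa 3 8 7 0 6 & fa 4 5 0 1 6 & fa 4 5 1 2 7 & fa 4 5 2 0 1 & fa 4 6 1 0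
    2 & fa 4 6 8 1 5 & fa 5 6 1 0 7 & fa 5 6 8 0 2 & fa 5 6 8 0 7 & fa 5 7 0 1 2 & fa 5 7 1 0 2 & fa
    5 7 2 0 1 & fa 5 7 8 0 1 & fa 5 7 8 0 6 & fa 5 7 8 2 6 & fa 5 8 0 6 7 & fa 5 8 7 0 6 & fa 6 7 0
    1 2 & fa 6 7 1 0 2 & fa 6 7 8 0 1 & fa 6 7 8 0 5 & fa 7 8 0 2 6"
"ra 0 1 2 8 6 7 & ra 0 1 2 8 7 6 & ra 0 1 7 8 6 2 & ra 0 1 8 6 5 7 & ra 0 1 8 6 7 5 & ra 0 2 8 1 3 7
    & ra 0 2 8 1 7 3 & ra 0 6 7 3 8 1 & ra 0 6 7 8 1 2 & ra 0 6 7 8 2 1 & ra 0 6 8 1 2 7 & ra 0 6 8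
    2 3 1 & ra 0 7 8 1 2 3 & ra 0 7 8 1 3 2 & ra 0 7 8 2 3 1 & ra 1 0 2 7 8 5 & ra 1 0 2 7 8 6 & ra
    1 0 7 3 2 8 & ra 1 0 7 5 3 8 & ra 1 0 7 6 5 8 & ra 1 2 3 8 0 6 & ra 1 2 3 8 0 7 & ra 1 2 8 3 4 5
    & ra 1 2 8 5 6 7 & ra 1 2 8 6 0 7 & ra 1 2 8 7 0 6 & ra 1 8 2 7 0 6 & ra 1 8 3 6 0 7 & ra 1 8 3
    7 0 6 & ra 2 0 1 7 6 5 & ra 2 0 1 7 8 5 & ra 2 0 1 7 8 6 & ra 2 0 8 5 6 7 & ra 2 0 8 7 1 5 & ra
    2 1 3 8 0 7 & ra 2 1 8 3 4 5 & ra 2 1 8 7 0 6 & ra 2 4 8 3 1 5 & ra 2 8 3 6 0 7 & ra 3 2 1 8 0 7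
    & ra 5 3 4 8 1 2 & ra 5 3 4 8 1 7 & ra 7 0 1 8 5 6 & ra 7 6 5 8 0 1"
  subgoal by (intro conjI int_ax)
  subgoal by (intro conjI trans_ax)
  subgoal by (intro conjI opp_ax)
  subgoal by (intro conjI fan_ax; simp add: antiprism_adj_def)
  subgoal by (intro conjI rot_ax; simp add: antiprism_adj_def)
  done

text \<open>Excludes that the hub sees 1, 0, 2 counterclockwise in this order within a half-plane,
  that is, that the ray to 0 lies between the other two.\<close>

lemma not_before: "\<not> (pos Q 8 1 0 \<and> pos Q 8 0 2 \<and> pos Q 8 1 2)"
  using not_before_instances[simplified ax_defs norm9] hub_not_inside_all apply (simp only: norm9) by sat

text \<open>There are eight sign patterns for the three turns. \<open>hub_not_inside\<close> and its
  reflection exclude two, and \<open>not_before\<close> with its images under \<open>flip\<close>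
  and reflection excludes four; the two constant patterns remain.\<close>

lemma consecutive_rays:
  "(pos Q 8 0 1 \<longleftrightarrow> pos Q 8 0 2) \<and> (pos Q 8 1 2 \<longleftrightarrow> pos Q 8 0 2)"
proof -
  interpret c: antiprism_signs "cnj \<circ> P" "cnj \<circ> Q" by (rule mirrored)
  interpret f: antiprism_signs "P \<circ> flip" "Q \<circ> flip" by (rule flipped)
  interpret cf: antiprism_signs "cnj \<circ> (P \<circ> flip)" "cnj \<circ> (Q \<circ> flip)" by (rule f.mirrored)
  have "\<not> (\<not> pos Q 8 1 0 \<and> \<not> pos Q 8 0 2 \<and> \<not> pos Q 8 1 2)"
    using c.not_before by (simp add: pos_cnj)
  moreover have "\<not> (pos Q 8 1 2 \<and> pos Q 8 2 0 \<and> pos Q 8 1 0)"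
    using f.not_before unfolding pos_comp flip_values .
  moreover have "\<not> (\<not> pos Q 8 1 2 \<and> \<not> pos Q 8 2 0 \<and> \<not> pos Q 8 1 0)"
  proof -
    have "\<not> (\<not> pos (Q \<circ> flip) 8 1 0 \<and> \<not> pos (Q \<circ> flip) 8 0 2 \<and> \<not> pos (Q \<circ> flip) 8 1 2)"
      using cf.not_before by (simp add: f.pos_cnj)
    then show ?thesis unfolding pos_comp flip_values .
  qed
  ultimately show ?thesis
    using hub_not_inside_all(1,2) not_before by (simp only: norm9) sat
qed

lemma consecutive_rays_any:
  assumes "k < 8"
  shows "(pos Q 8 (turn k 0) (turn k 1) \<longleftrightarrow> pos Q 8 (turn k 0) (turn k 2)) \<and>
    (pos Q 8 (turn k 1) (turn k 2) \<longleftrightarrow> pos Q 8 (turn k 0) (turn k 2))"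
proof -
  interpret k: antiprism_signs "P \<circ> turn k" "Q \<circ> turn k" by (rule turned[OF assms])
  show ?thesis using k.consecutive_rays by (simp add: pos_comp turn_def[of k 8])
qed

text \<open>Neighbouring instances of \<open>consecutive_rays\<close> share a sign, so one sign
  propagates around the whole cycle.\<close>

lemma positiveI:
  assumes "pos Q 8 0 1"
  shows "positive Q"
proof -
  note c = consecutive_rays_any[OF less_eight(1), unfolded turn_values] consecutive_rays_any[OF less_eight(2), unfolded turn_values]
    consecutive_rays_any[OF less_eight(3), unfolded turn_values] consecutive_rays_any[OF less_eight(4), unfolded turn_values]
    consecutive_rays_any[OF less_eight(5), unfolded turn_values] consecutive_rays_any[OF less_eight(6), unfolded turn_values]
    consecutive_rays_any[OF less_eight(7), unfolded turn_values] consecutive_rays_any[OF less_eight(8), unfolded turn_values]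
  show ?thesis unfolding positive_def using c assms by sat
qed

lemma alternating1_instances:
"ta 0 1 2 8 7 & ta 2 8 0 1 7 & ta 7 0 1 8 2"
"xa 0 2 1 7 & xa 0 2 1 8 & xa 0 8 1 7"
"fa 1 7 0 2 8"
  subgoal by (intro conjI trans_ax)
  subgoal by (intro conjI opp_ax)
  subgoal by (intro conjI fan_ax; simp add: antiprism_adj_def)
  done

lemma alternating2_instances:
"ia 0 1 8 3 & ia 0 2 8 6 & ia 0 2 8 7 & ia 0 5 8 7 & ia 1 6 8 7 & ia 2 4 8 6 & ia 3 5 8 7"
"ta 0 2 1 8 7 & ta 0 8 5 6 7 & ta 1 3 0 2 8 & ta 1 5 3 8 7 & ta 1 8 0 7 6 & ta 2 3 1 4 8 & ta 2 8 0
    7 1 & ta 3 5 1 4 8 & ta 3 5 2 4 8 & ta 3 8 0 2 1 & ta 4 5 3 6 8 & ta 5 7 1 8 3 & ta 5 7 3 4 6 &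
    ta 5 7 3 6 8 & ta 5 8 2 4 3 & ta 6 2 0 8 4 & ta 6 7 0 8 5 & ta 7 1 0 8 6 & ta 7 3 1 8 5 & ta 7 8
    4 6 5"
"xa 0 2 1 3 & xa 0 2 1 7 & xa 0 2 1 8 & xa 0 6 1 7 & xa 0 6 5 7 & xa 0 6 7 8 & xa 0 8 1 7 & xa 1 3 2
    4 & xa 1 3 2 8 & xa 1 3 7 8 & xa 2 4 3 5 & xa 2 8 3 5 & xa 3 5 4 6 & xa 3 5 4 8 & xa 4 6 5 7 &
    xa 4 8 5 7"
"fa 0 2 1 3 7 & fa 0 6 7 5 8 & fa 1 3 2 4 8 & fa 1 3 8 2 7 & fa 1 7 0 2 6 & fa 2 8 3 1 5 & fa 3 5 4
    6 8 & fa 4 8 5 3 7"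
"ra 0 2 6 7 1 8 & ra 1 7 3 2 0 8 & ra 2 8 4 3 1 5 & ra 6 0 4 7 8 5"
  subgoal by (intro conjI int_ax)
  subgoal by (intro conjI trans_ax)
  subgoal by (intro conjI opp_ax)
  subgoal by (intro conjI fan_ax; simp add: antiprism_adj_def)
  subgoal by (intro conjI rot_ax; simp add: antiprism_adj_def)
  done

text \<open>If both hub edges were crossed, then 1 7 would cross 0 2 as well as 0 8, which is a fan.
  That they are not both free of these crossings involves vertices around the whole cycle and the
  rule for two right angles.\<close>

lemma alternating:
  assumes "positive Q"
  shows "opposite Q 0 8 1 7 \<longleftrightarrow> \<not> opposite Q 0 2 1 8"
proof -
  note p = assms[unfolded positive_def, simplified norm9]
  have 1: "\<not> (opposite Q 0 8 1 7 \<and> opposite Q 0 2 1 8)"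
    using alternating1_instances[simplified ax_defs norm9] p by sat
  have 2: "\<not> (\<not> opposite Q 0 8 1 7 \<and> \<not> opposite Q 0 2 1 8)"
    using alternating2_instances[simplified ax_defs norm9] p by sat
  show ?thesis using 1 2 by blast
qed

lemma alternating_any:
  assumes "positive Q" "k < 8"
  shows "opposite Q (turn k 0) (turn k 8) (turn k 1) (turn k 7) \<longleftrightarrow>
    \<not> opposite Q (turn k 0) (turn k 2) (turn k 1) (turn k 8)"
proof -
  interpret k: antiprism_signs "P \<circ> turn k" "Q \<circ> turn k" by (rule turned[OF assms(2)])
  have "k = 0 \<or> k = 1 \<or> k = 2 \<or> k = 3 \<or> k = 4 \<or> k = 5 \<or> k = 6 \<or> k = 7" using assms(2) by arith
  then have "pos Q (turn k 8) (turn k 0) (turn k 1)"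
    by (elim disjE) (use assms(1)[unfolded positive_def] in \<open>simp_all only: turn_values\<close>)
  then have "positive (Q \<circ> turn k)" using k.positiveI by (simp add: pos_comp)
  then show ?thesis using k.alternating by (simp add: opposite_comp)
qed

lemma other_crossings_instances:
"ia 0 1 3 2 & ia 0 1 3 4 & ia 0 1 4 2 & ia 0 1 5 2 & ia 0 1 7 2 & ia 0 1 7 3 & ia 0 1 7 5 & ia 0 1 8
    5 & ia 0 2 5 3 & ia 0 2 7 6 & ia 0 2 8 4 & ia 0 2 8 6 & ia 0 3 7 5 & ia 0 3 8 4 & ia 0 4 5 6 &
    ia 0 4 8 6 & ia 0 4 8 7 & ia 0 5 7 6 & ia 0 5 8 6 & ia 1 2 3 4 & ia 1 2 3 5 & ia 1 2 3 7 & ia 1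
    2 4 7 & ia 1 2 5 7 & ia 1 2 8 4 & ia 1 3 5 4 & ia 1 3 5 6 & ia 1 3 7 4 & ia 1 3 7 6 & ia 1 3 8 4
    & ia 1 4 8 5 & ia 2 3 6 4 & ia 2 3 7 5 & ia 2 4 7 5 & ia 2 4 8 5 & ia 2 4 8 6 & ia 2 4 8 7 & ia
    2 5 8 6 & ia 3 4 5 6 & ia 3 4 5 7 & ia 3 4 8 6 & ia 3 5 7 6 & ia 3 5 8 6 & ia 4 5 7 6"
"ta 0 1 3 8 7 & ta 0 2 1 4 3 & ta 0 2 1 8 4 & ta 0 2 1 8 6 & ta 0 2 3 4 6 & ta 0 2 3 8 6 & ta 0 4 2
    8 6 & ta 0 4 2 8 7 & ta 0 4 3 8 6 & ta 0 8 4 7 6 & ta 1 0 2 3 6 & ta 1 3 0 4 5 & ta 1 3 0 5 7 &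
    ta 1 3 4 5 7 & ta 1 4 0 2 8 & ta 1 4 0 3 5 & ta 1 4 0 5 8 & ta 1 4 2 8 7 & ta 1 5 0 2 4 & ta 1 5
    0 2 8 & ta 1 6 0 2 8 & ta 1 7 0 2 6 & ta 1 8 0 5 7 & ta 2 3 1 5 8 & ta 2 3 1 7 6 & ta 2 3 1 7 8
    & ta 2 4 0 3 8 & ta 2 4 0 5 6 & ta 2 4 0 5 8 & ta 2 4 0 7 5 & ta 2 4 3 5 6 & ta 2 4 3 6 5 & ta 2
    4 3 8 6 & ta 2 5 0 3 1 & ta 2 6 0 4 8 & ta 2 6 0 5 8 & ta 2 8 0 6 1 & ta 2 8 1 6 7 & ta 3 0 2 4
    8 & ta 3 0 2 6 8 & ta 3 4 0 6 5 & ta 3 5 1 2 7 & ta 3 6 1 4 5 & ta 3 6 2 4 8 & ta 3 8 1 2 7 & ta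
    4 0 1 6 8 & ta 4 0 1 7 6 & ta 4 0 2 6 8 & ta 4 0 2 7 8 & ta 4 0 3 6 8 & ta 4 1 0 2 6 & ta 4 5 3
    7 8 & ta 4 6 0 2 7 & ta 4 6 0 5 7 & ta 4 6 0 5 8 & ta 4 6 0 7 5 & ta 4 6 2 5 8 & ta 4 7 2 5 3 &
    ta 4 8 0 2 1 & ta 4 8 0 3 2 & ta 5 0 1 4 7 & ta 5 0 1 8 4 & ta 5 0 3 6 8 & ta 5 0 4 6 8 & ta 5 1
    0 4 6 & ta 5 1 3 4 6 & ta 5 2 0 1 3 & ta 5 2 0 3 4 & ta 5 2 3 4 6 & ta 5 2 4 6 8 & ta 5 3 2 4 6
    & ta 5 6 0 1 8 & ta 5 7 0 1 3 & ta 5 7 0 8 4 & ta 5 7 1 3 4 & ta 5 8 1 3 4 & ta 6 0 1 2 4 & ta 6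
    0 1 8 2 & ta 6 0 1 8 4 & ta 6 0 2 7 8 & ta 6 0 4 7 8 & ta 6 2 0 3 1 & ta 6 2 0 8 3 & ta 6 2 0 8
    4 & ta 6 2 0 8 5 & ta 6 2 1 8 4 & ta 6 7 1 8 5 & ta 6 8 1 3 4 & ta 6 8 2 5 4 & ta 7 1 2 8 5 & ta
    7 1 2 8 6 & ta 7 1 3 5 6 & ta 7 2 0 1 6 & ta 7 2 0 8 5 & ta 7 3 0 2 6 & ta 7 4 0 8 6 & ta 7 4 2
    8 6 & ta 7 4 3 5 6 & ta 7 6 0 1 4 & ta 7 8 3 5 6 & ta 8 0 1 2 4 & ta 8 1 2 3 5 & ta 8 1 2 4 6 &
    ta 8 2 3 4 6 & ta 8 2 4 6 7 & ta 8 3 0 4 6 & ta 8 3 4 5 7 & ta 8 4 0 1 6 & ta 8 4 0 5 6 & ta 8 5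
    1 6 7 & ta 8 6 0 2 3 & ta 8 6 0 2 7 & ta 8 7 0 1 3 & ta 8 7 0 2 4"
"xa 0 1 2 3 & xa 0 1 2 4 & xa 0 1 2 8 & xa 0 1 3 4 & xa 0 1 3 5 & xa 0 1 3 8 & xa 0 1 4 5 & xa 0 1 4
    6 & xa 0 1 4 8 & xa 0 1 5 6 & xa 0 1 5 7 & xa 0 1 5 8 & xa 0 1 6 7 & xa 0 1 6 8 & xa 0 1 7 8 &
    xa 0 2 1 8 & xa 0 2 3 4 & xa 0 2 3 5 & xa 0 2 3 8 & xa 0 2 4 5 & xa 0 2 4 6 & xa 0 2 4 8 & xa 0
    2 5 6 & xa 0 2 5 7 & xa 0 2 5 8 & xa 0 2 6 7 & xa 0 2 6 8 & xa 0 2 7 8 & xa 0 6 1 2 & xa 0 6 1 3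
    & xa 0 6 1 7 & xa 0 6 1 8 & xa 0 6 2 3 & xa 0 6 2 4 & xa 0 6 2 8 & xa 0 6 3 4 & xa 0 6 3 5 & xa
    0 6 3 8 & xa 0 6 4 5 & xa 0 6 4 8 & xa 0 6 5 8 & xa 0 6 7 8 & xa 0 7 1 2 & xa 0 7 1 3 & xa 0 7 1
    8 & xa 0 7 2 3 & xa 0 7 2 4 & xa 0 7 2 8 & xa 0 7 3 4 & xa 0 7 3 5 & xa 0 7 3 8 & xa 0 7 4 5 &
    xa 0 7 4 6 & xa 0 7 4 8 & xa 0 7 5 6 & xa 0 7 5 8 & xa 0 7 6 8 & xa 0 8 1 2 & xa 0 8 1 7 & xa 0
    8 2 3 & xa 0 8 2 4 & xa 0 8 3 4 & xa 0 8 4 5 & xa 0 8 4 6 & xa 0 8 5 6 & xa 0 8 6 7 & xa 1 2 3 4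
    & xa 1 2 3 5 & xa 1 2 3 8 & xa 1 2 4 5 & xa 1 2 4 6 & xa 1 2 4 8 & xa 1 2 5 6 & xa 1 2 5 7 & xa
    1 2 5 8 & xa 1 2 6 7 & xa 1 2 6 8 & xa 1 2 7 8 & xa 1 3 2 8 & xa 1 3 4 5 & xa 1 3 4 6 & xa 1 3 5
    6 & xa 1 3 5 7 & xa 1 3 6 7 & xa 1 7 2 3 & xa 1 7 2 4 & xa 1 7 3 4 & xa 1 7 3 5 & xa 1 7 4 5 &
    xa 1 7 4 6 & xa 1 7 5 6 & xa 1 7 6 8 & xa 1 8 2 3 & xa 1 8 2 4 & xa 1 8 3 4 & xa 1 8 4 5 & xa 1
    8 4 6 & xa 1 8 5 6 & xa 1 8 6 7 & xa 2 3 4 5 & xa 2 3 4 6 & xa 2 3 4 8 & xa 2 3 5 6 & xa 2 3 5 7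
    & xa 2 3 5 8 & xa 2 3 6 7 & xa 2 3 6 8 & xa 2 3 7 8 & xa 2 4 3 5 & xa 2 4 3 8 & xa 2 4 5 6 & xa
    2 4 5 7 & xa 2 4 5 8 & xa 2 4 6 7 & xa 2 4 6 8 & xa 2 4 7 8 & xa 2 8 3 4 & xa 2 8 3 5 & xa 2 8 4
    5 & xa 2 8 4 6 & xa 2 8 5 6 & xa 2 8 5 7 & xa 2 8 6 7 & xa 3 4 5 6 & xa 3 4 5 7 & xa 3 4 5 8 &
    xa 3 4 6 7 & xa 3 4 6 8 & xa 3 4 7 8 & xa 3 5 4 8 & xa 3 5 6 7 & xa 3 8 4 5 & xa 3 8 4 6 & xa 3
    8 5 6 & xa 3 8 6 7 & xa 4 5 6 7 & xa 4 5 6 8 & xa 4 5 7 8 & xa 4 6 5 8 & xa 4 6 7 8 & xa 4 8 5 6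
    & xa 4 8 6 7 & xa 5 6 7 8 & xa 5 7 6 8 & xa 5 8 6 7"
"fa 0 8 1 3 7 & fa 0 8 7 1 5 & fa 1 3 2 0 8 & fa 1 3 2 4 8 & fa 1 3 8 2 4 & fa 1 3 8 2 5 & fa 1 3 8
    2 6 & fa 1 3 8 2 7 & fa 1 7 0 2 8 & fa 1 7 0 6 8 & fa 1 7 8 0 2 & fa 1 7 8 0 3 & fa 1 7 8 0 4 &
    fa 1 7 8 0 5 & fa 1 7 8 0 6 & fa 2 8 3 1 5 & fa 3 5 4 2 8 & fa 3 5 4 6 8 & fa 3 5 8 0 4 & fa 3 5
    8 1 4 & fa 3 5 8 4 6 & fa 3 5 8 4 7 & fa 4 8 5 3 7 & fa 5 7 6 0 8 & fa 5 7 6 4 8 & fa 5 7 8 1 6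
    & fa 5 7 8 2 6 & fa 5 7 8 3 6"
"ra 0 1 8 7 5 1 & ra 0 2 8 7 5 1 & ra 0 2 8 7 6 1 & ra 0 6 8 1 3 7 & ra 0 7 8 1 3 7 & ra 1 0 7 8 3 0
    & ra 1 0 7 8 6 0 & ra 1 2 3 8 4 2 & ra 1 3 7 2 8 4 & ra 1 3 8 2 8 4 & ra 1 7 3 8 0 2 & ra 2 0 8
    3 5 1 & ra 2 1 8 3 5 1 & ra 3 1 2 8 2 7 & ra 3 1 5 4 6 8 & ra 3 1 5 8 2 4 & ra 3 2 1 8 0 2 & ra
    4 2 8 5 7 3 & ra 4 3 8 5 7 3 & ra 5 3 4 8 4 7 & ra 5 3 7 6 0 8 & ra 5 3 7 8 4 6 & ra 5 8 7 6 0 8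
    & ra 6 4 8 7 1 5 & ra 6 5 8 7 1 5 & ra 7 0 1 8 2 0 & ra 7 0 1 8 5 0 & ra 7 1 5 8 0 6 & ra 7 6 5
    8 3 6"
  subgoal by (intro conjI int_ax)
  subgoal by (intro conjI trans_ax)
  subgoal by (intro conjI opp_ax)
  subgoal by (intro conjI fan_ax; simp add: antiprism_adj_def)
  subgoal by (intro conjI rot_ax; simp add: antiprism_adj_def)
  done

text \<open>Once the pattern of crossed hub edges is fixed, the axioms and the two rules force all
  other crossing atoms to be false.\<close>

lemma no_other_crossings:
  assumes "positive Q" "opposite Q 0 8 1 7 & opposite Q 1 3 2 8 & opposite
    Q 3 5 4 8 & opposite Q 5 7 6 8 & ~ opposite Q 0 2 1 8 & ~ opposite Q 2 4 3 8 & ~ opposite Q 4 6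
    5 8 & ~ opposite Q 0 6 7 8"
  shows "~ opposite Q 0 1 2 3 & ~ opposite Q 0 1 2 4 & ~ opposite Q
    0 1 2 8 & ~ opposite Q 0 1 3 4 & ~ opposite Q 0 1 3 5 & ~ opposite Q 0 1 3 8 & ~ opposite Q 0 1
    4 5 & ~ opposite Q 0 1 4 6 & ~ opposite Q 0 1 4 8 & ~ opposite Q 0 1 5 6 & ~ opposite Q 0 1 5 7
    & ~ opposite Q 0 1 5 8 & ~ opposite Q 0 1 6 7 & ~ opposite Q 0 1 6 8 & ~ opposite Q 0 1 7 8 & ~
    opposite Q 0 2 1 3 & ~ opposite Q 0 2 1 7 & ~ opposite Q 0 2 3 4 & ~ opposite Q 0 2 3 5 & ~
    opposite Q 0 2 3 8 & ~ opposite Q 0 2 4 5 & ~ opposite Q 0 2 4 6 & ~ opposite Q 0 2 4 8 & ~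
    opposite Q 0 2 5 6 & ~ opposite Q 0 2 5 7 & ~ opposite Q 0 2 5 8 & ~ opposite Q 0 2 6 7 & ~
    opposite Q 0 2 6 8 & ~ opposite Q 0 2 7 8 & ~ opposite Q 0 6 1 2 & ~ opposite Q 0 6 1 3 & ~
    opposite Q 0 6 1 7 & ~ opposite Q 0 6 1 8 & ~ opposite Q 0 6 2 3 & ~ opposite Q 0 6 2 4 & ~
    opposite Q 0 6 2 8 & ~ opposite Q 0 6 3 4 & ~ opposite Q 0 6 3 5 & ~ opposite Q 0 6 3 8 & ~
    opposite Q 0 6 4 5 & ~ opposite Q 0 6 4 8 & ~ opposite Q 0 6 5 7 & ~ opposite Q 0 6 5 8 & ~
    opposite Q 0 7 1 2 & ~ opposite Q 0 7 1 3 & ~ opposite Q 0 7 1 8 & ~ opposite Q 0 7 2 3 & ~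
    opposite Q 0 7 2 4 & ~ opposite Q 0 7 2 8 & ~ opposite Q 0 7 3 4 & ~ opposite Q 0 7 3 5 & ~
    opposite Q 0 7 3 8 & ~ opposite Q 0 7 4 5 & ~ opposite Q 0 7 4 6 & ~ opposite Q 0 7 4 8 & ~
    opposite Q 0 7 5 6 & ~ opposite Q 0 7 5 8 & ~ opposite Q 0 7 6 8 & ~ opposite Q 0 8 1 2 & ~
    opposite Q 0 8 1 3 & ~ opposite Q 0 8 2 3 & ~ opposite Q 0 8 2 4 & ~ opposite Q 0 8 3 4 & ~
    opposite Q 0 8 3 5 & ~ opposite Q 0 8 4 5 & ~ opposite Q 0 8 4 6 & ~ opposite Q 0 8 5 6 & ~
    opposite Q 0 8 5 7 & ~ opposite Q 0 8 6 7 & ~ opposite Q 1 2 3 4 & ~ opposite Q 1 2 3 5 & ~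
    opposite Q 1 2 3 8 & ~ opposite Q 1 2 4 5 & ~ opposite Q 1 2 4 6 & ~ opposite Q 1 2 4 8 & ~
    opposite Q 1 2 5 6 & ~ opposite Q 1 2 5 7 & ~ opposite Q 1 2 5 8 & ~ opposite Q 1 2 6 7 & ~
    opposite Q 1 2 6 8 & ~ opposite Q 1 2 7 8 & ~ opposite Q 1 3 2 4 & ~ opposite Q 1 3 4 5 & ~
    opposite Q 1 3 4 6 & ~ opposite Q 1 3 4 8 & ~ opposite Q 1 3 5 6 & ~ opposite Q 1 3 5 7 & ~
    opposite Q 1 3 5 8 & ~ opposite Q 1 3 6 7 & ~ opposite Q 1 3 6 8 & ~ opposite Q 1 3 7 8 & ~
    opposite Q 1 7 2 3 & ~ opposite Q 1 7 2 4 & ~ opposite Q 1 7 2 8 & ~ opposite Q 1 7 3 4 & ~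
    opposite Q 1 7 3 5 & ~ opposite Q 1 7 3 8 & ~ opposite Q 1 7 4 5 & ~ opposite Q 1 7 4 6 & ~
    opposite Q 1 7 4 8 & ~ opposite Q 1 7 5 6 & ~ opposite Q 1 7 5 8 & ~ opposite Q 1 7 6 8 & ~
    opposite Q 1 8 2 3 & ~ opposite Q 1 8 2 4 & ~ opposite Q 1 8 3 4 & ~ opposite Q 1 8 3 5 & ~
    opposite Q 1 8 4 5 & ~ opposite Q 1 8 4 6 & ~ opposite Q 1 8 5 6 & ~ opposite Q 1 8 5 7 & ~
    opposite Q 1 8 6 7 & ~ opposite Q 2 3 4 5 & ~ opposite Q 2 3 4 6 & ~ opposite Q 2 3 4 8 & ~
    opposite Q 2 3 5 6 & ~ opposite Q 2 3 5 7 & ~ opposite Q 2 3 5 8 & ~ opposite Q 2 3 6 7 & ~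
    opposite Q 2 3 6 8 & ~ opposite Q 2 3 7 8 & ~ opposite Q 2 4 3 5 & ~ opposite Q 2 4 5 6 & ~
    opposite Q 2 4 5 7 & ~ opposite Q 2 4 5 8 & ~ opposite Q 2 4 6 7 & ~ opposite Q 2 4 6 8 & ~
    opposite Q 2 4 7 8 & ~ opposite Q 2 8 3 4 & ~ opposite Q 2 8 3 5 & ~ opposite Q 2 8 4 5 & ~
    opposite Q 2 8 4 6 & ~ opposite Q 2 8 5 6 & ~ opposite Q 2 8 5 7 & ~ opposite Q 2 8 6 7 & ~
    opposite Q 3 4 5 6 & ~ opposite Q 3 4 5 7 & ~ opposite Q 3 4 5 8 & ~ opposite Q 3 4 6 7 & ~
    opposite Q 3 4 6 8 & ~ opposite Q 3 4 7 8 & ~ opposite Q 3 5 4 6 & ~ opposite Q 3 5 6 7 & ~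
    opposite Q 3 5 6 8 & ~ opposite Q 3 5 7 8 & ~ opposite Q 3 8 4 5 & ~ opposite Q 3 8 4 6 & ~
    opposite Q 3 8 5 6 & ~ opposite Q 3 8 5 7 & ~ opposite Q 3 8 6 7 & ~ opposite Q 4 5 6 7 & ~
    opposite Q 4 5 6 8 & ~ opposite Q 4 5 7 8 & ~ opposite Q 4 6 5 7 & ~ opposite Q 4 6 7 8 & ~
    opposite Q 4 8 5 6 & ~ opposite Q 4 8 5 7 & ~ opposite Q 4 8 6 7 & ~ opposite Q 5 6 7 8 & ~
    opposite Q 5 8 6 7"
  using other_crossings_instances[simplified ax_defs norm9] assms(1)[unfolded positive_def, simplified norm9] assms(2)
  by sat

text \<open>By \<open>alternating\<close> around the cycle, the crossed hub edges are those with
  even ends or those with odd ends. One rotation step turns the second possibility into the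
  first.\<close>

lemma standard_positions:
  assumes "pos Q 8 0 1"
  shows "standard Q \<or> standard (Q \<circ> turn 1)"
proof -
  note p = positiveI[OF assms]
  interpret k: antiprism_signs "P \<circ> turn 1" "Q \<circ> turn 1" by (rule turned) simp
  have p': "positive (Q \<circ> turn 1)"
    by (rule k.positiveI) (use p in \<open>simp only: pos_comp turn_values positive_def\<close>)
  note a = alternating_any[OF p less_eight(1), unfolded turn_values] alternating_any[OF p less_eight(2), unfolded turn_values]
    alternating_any[OF p less_eight(3), unfolded turn_values] alternating_any[OF p less_eight(4), unfolded turn_values]
    alternating_any[OF p less_eight(5), unfolded turn_values] alternating_any[OF p less_eight(6), unfolded turn_values]
    alternating_any[OF p less_eight(7), unfolded turn_values] alternating_any[OF p less_eight(8), unfolded turn_values]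
  note a9 = a[simplified norm9]
  show ?thesis
  proof (cases "opposite Q 0 8 1 7")
    case True
    then have F: "opposite Q 0 8 1 7 & opposite Q 1 3 2 8 & opposite Q 3 5 4 8 & opposite Q 5 7 6 8 & ~ opposite Q 0 2
    1 8 & ~ opposite Q 2 4 3 8 & ~ opposite Q 4 6 5 8 & ~ opposite Q 0 6 7 8"
      using a9 by sat
    have "standard Q"
      unfolding standard_def standard_crossings_def by (rule conjI[OF p conjI[OF F no_other_crossings[OF p F]]])
    then show ?thesis ..
  next
    case False
    then have "~ opposite Q 0 8 1 7 & ~ opposite Q 1 3 2 8 & ~ opposite Q 3 5 4 8 & ~ opposite Q 5 7 6 8 & opposite
    Q 0 2 1 8 & opposite Q 2 4 3 8 & opposite Q 4 6 5 8 & opposite Q 0 6 7 8"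
      using a9 by sat
    then have F: "opposite (Q \<circ> turn 1) 0 8 1 7 & opposite (Q \<circ> turn 1) 1 3 2 8 & opposite (Q \<circ> turn
    1) 3 5 4 8 & opposite (Q \<circ> turn 1) 5 7 6 8 & ~ opposite (Q \<circ> turn 1) 0 2 1 8 & ~
    opposite (Q \<circ> turn 1) 2 4 3 8 & ~ opposite (Q \<circ> turn 1) 4 6 5 8 & ~ opposite (Q
    \<circ> turn 1) 0 6 7 8"
      unfolding opposite_comp turn_values by (simp only: norm9 simp_thms)
    have "standard (Q \<circ> turn 1)"
      unfolding standard_def standard_crossings_def by (rule conjI[OF p' conjI[OF F k.no_other_crossings[OF p' F]]])
    then show ?thesis ..
  qed
qed

lemma standard_cnj: "standard (cnj \<circ> Q) \<longleftrightarrow> antistandard Q"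
  by (simp add: standard_def antistandard_def positive_def negative_def standard_crossings_def pos_cnj opposite_cnj)

text \<open>The reflected drawing has a positive hub, and reflection changes every sign of a triple
  but no crossing.\<close>

lemma antistandard_positions:
  assumes "\<not> pos Q 8 0 1"
  shows "antistandard Q \<or> antistandard (Q \<circ> turn 1)"
proof -
  interpret c: antiprism_signs "cnj \<circ> P" "cnj \<circ> Q" by (rule mirrored)
  interpret k: antiprism_signs "P \<circ> turn 1" "Q \<circ> turn 1" by (rule turned) simp
  have "standard (cnj \<circ> Q) \<or> standard (cnj \<circ> (Q \<circ> turn 1))"
    using c.standard_positions assms by (simp add: pos_cnj comp_assoc)
  then show ?thesis by (simp only: standard_cnj k.standard_cnj)
qed

end

section \<open>Excluding all but one combination of the two pictures\<close>

section \<open>Two antiprisms glued along an edge\<close>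

text \<open>The numbering of the second copy inside the glued graph. It keeps 0 and 2, the common
  vertices; the hub becomes 15 and the special b-vertex 9.\<close>

definition second :: "nat \<Rightarrow> nat" where
  "second j = [0, 9, 2, 10, 11, 12, 13, 14, 15] ! j"

definition sum_edges :: "(nat \<times> nat) list" where
  "sum_edges = [(0, 1), (0, 2), (0, 6), (0,
    7), (0, 8), (0, 9), (0, 13), (0, 14), (0, 15), (1, 2), (1, 3), (1, 7), (1, 8), (1, 9), (2, 3),
    (2, 4), (2, 8), (2, 9), (2, 10), (2, 11), (2, 15), (3, 4), (3, 5), (3, 8), (4, 5), (4, 6), (4,
    8), (5, 6), (5, 7), (5, 8), (6, 7), (6, 8), (7, 8), (9, 10), (9, 14), (9, 15), (10, 11), (10,
    12), (10, 15), (11, 12), (11, 13), (11, 15), (12, 13), (12, 14), (12, 15), (13, 14), (13, 15),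
    (14, 15)]"

definition sum_adj :: "nat \<Rightarrow> nat \<Rightarrow> bool" where
  "sum_adj a b \<longleftrightarrow> (a, b) \<in> set sum_edges \<or> (b, a) \<in> set sum_edges"

lemma second_values:
  "second 0 = 0" "second 1 = 9" "second 2 = 2" "second 3 = 10" "second 4 = 11" "second 5 = 12" "second 6 = 13" "second 7 = 14" "second 8 = 15"
  by (simp_all add: second_def)

lemma sum_adj_edges:
  "sum_adj 0 1" "sum_adj 1 0" "sum_adj 0 2" "sum_adj 2 0" "sum_adj 0 6"
    "sum_adj 6 0" "sum_adj 0 7" "sum_adj 7 0" "sum_adj 0 8" "sum_adj 8 0" "sum_adj 0 9" "sum_adj 9
    0" "sum_adj 0 13" "sum_adj 13 0" "sum_adj 0 14" "sum_adj 14 0" "sum_adj 0 15" "sum_adj 15 0"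
    "sum_adj 1 2" "sum_adj 2 1" "sum_adj 1 3" "sum_adj 3 1" "sum_adj 1 7" "sum_adj 7 1" "sum_adj 1
    8" "sum_adj 8 1" "sum_adj 1 9" "sum_adj 9 1" "sum_adj 2 3" "sum_adj 3 2" "sum_adj 2 4" "sum_adj
    4 2" "sum_adj 2 8" "sum_adj 8 2" "sum_adj 2 9" "sum_adj 9 2" "sum_adj 2 10" "sum_adj 10 2"
    "sum_adj 2 11" "sum_adj 11 2" "sum_adj 2 15" "sum_adj 15 2" "sum_adj 3 4" "sum_adj 4 3" "sum_adj
    3 5" "sum_adj 5 3" "sum_adj 3 8" "sum_adj 8 3" "sum_adj 4 5" "sum_adj 5 4" "sum_adj 4 6"
    "sum_adj 6 4" "sum_adj 4 8" "sum_adj 8 4" "sum_adj 5 6" "sum_adj 6 5" "sum_adj 5 7" "sum_adj 7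
    5" "sum_adj 5 8" "sum_adj 8 5" "sum_adj 6 7" "sum_adj 7 6" "sum_adj 6 8" "sum_adj 8 6" "sum_adj
    7 8" "sum_adj 8 7" "sum_adj 9 10" "sum_adj 10 9" "sum_adj 9 14" "sum_adj 14 9" "sum_adj 9 15"
    "sum_adj 15 9" "sum_adj 10 11" "sum_adj 11 10" "sum_adj 10 12" "sum_adj 12 10" "sum_adj 10 15"
    "sum_adj 15 10" "sum_adj 11 12" "sum_adj 12 11" "sum_adj 11 13" "sum_adj 13 11" "sum_adj 11 15"
    "sum_adj 15 11" "sum_adj 12 13" "sum_adj 13 12" "sum_adj 12 14" "sum_adj 14 12" "sum_adj 12 15"
    "sum_adj 15 12" "sum_adj 13 14" "sum_adj 14 13" "sum_adj 13 15" "sum_adj 15 13" "sum_adj 14 15"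
    "sum_adj 15 14"
  by (simp_all add: sum_adj_def sum_edges_def)

lemma sum_adj_antiprism:
  "antiprism_adj a b \<Longrightarrow> sum_adj a b" "antiprism_adj a b \<Longrightarrow> sum_adj (second a) (second b)"
proof -
  have "\<forall>a\<in>set [0..<9]. \<forall>b\<in>set [0..<9]. antiprism_adj a b \<longrightarrow> sum_adj a b \<and> sum_adj (second a) (second b)"
    by code_simp
  moreover assume "antiprism_adj a b"
  moreover have "a < 9" "b < 9" using \<open>antiprism_adj a b\<close> by (auto simp: antiprism_adj_def)
  ultimately show "sum_adj a b" "sum_adj (second a) (second b)" by auto
qed

lemma antiprism_adj_less: "antiprism_adj a b \<Longrightarrow> a < 9"
  by (simp add: antiprism_adj_def)

lemmas standard_facts = standard_def antistandard_def positive_def negative_def standard_crossings_def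
  pos_comp opposite_comp o_apply turn_values second_values

locale sum_signs = rac_signs 16 sum_adj P Q for P Q
begin

lemmas norm16 = pos_sort opposite_sort numeral_order

lemma same_side_instances:
"ia 0 8 15 10 & ia 2 8 10 15"
"ta 0 1 7 9 8 & ta 0 1 7 15 8 & ta 0 2 1 8 9 & ta 0 2 1 9 15 & ta 0 2 1 10 9 & ta 0 9 8 10 15 & ta 0
    9 8 15 14 & ta 1 0 2 10 9 & ta 1 0 2 15 9 & ta 1 9 0 2 8 & ta 2 8 0 10 9 & ta 2 8 1 10 15 & ta 2
    8 1 15 9 & ta 7 0 1 8 9 & ta 7 0 1 8 15 & ta 8 0 1 2 9 & ta 8 0 1 2 15 & ta 8 0 1 9 15 & ta 8 0
    2 10 9 & ta 8 10 0 2 15 & ta 8 15 2 10 9 & ta 9 0 1 2 8 & ta 9 1 0 2 15 & ta 9 2 1 10 15 & ta 9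
    2 8 10 14 & ta 9 2 8 10 15 & ta 9 8 0 1 7 & ta 9 8 0 2 1 & ta 9 8 0 10 15 & ta 9 14 0 2 8 & ta
    10 15 0 2 8 & ta 15 0 1 9 2 & ta 15 0 2 8 9 & ta 15 8 0 1 7"
"xa 0 1 2 9 & xa 0 1 9 10 & xa 0 1 9 15 & xa 0 2 1 8 & xa 0 2 9 15 & xa 0 8 1 7 & xa 0 8 1 9 & xa 0
    8 2 15 & xa 0 8 9 10 & xa 0 8 9 14 & xa 0 8 9 15 & xa 0 8 10 15 & xa 0 9 1 7 & xa 0 15 1 7 & xa
    0 15 1 9 & xa 0 15 9 14 & xa 1 2 9 10 & xa 1 8 2 9 & xa 1 8 2 15 & xa 1 8 9 15 & xa 1 9 2 8 & xa
    1 9 2 15 & xa 2 8 9 10 & xa 2 15 9 10"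
"fa 0 1 9 10 15 & fa 0 8 1 7 9 & fa 0 8 10 9 15 & fa 0 8 15 2 9 & fa 0 15 9 1 14 & fa 1 7 0 8 9 & fa
    1 7 0 8 15 & fa 1 8 2 9 15 & fa 1 8 15 2 9 & fa 2 8 1 3 9 & fa 2 15 9 1 10 & fa 9 10 2 1 15 & fa
    9 10 2 8 15 & fa 9 14 0 8 15"
"ra 1 0 8 2 9 15 & ra 9 14 10 15 0 2"
  subgoal by (intro conjI int_ax)
  subgoal by (intro conjI trans_ax)
  subgoal by (intro conjI opp_ax)
  subgoal by (intro conjI fan_ax; simp add: sum_adj_edges del: One_nat_def)
  subgoal by (intro conjI rot_ax; simp add: sum_adj_edges del: One_nat_def)
  done

text \<open>Both hubs lie on the same side of 0 2, with 1 in the triangle 8 0 2 and 9 in the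
  triangle 15 0 2. The edge 1 9 cannot cross 8 0 or 8 2, which already cross other edges at 1, and
  likewise at 9. So 9 is also in the first triangle and 1 in the second; the final contradiction
  uses \<open>rot_ax\<close>.\<close>

lemma same_side: "\<not> (standard Q \<and> standard (Q \<circ> second))"
proof
  assume a: "standard Q \<and> standard (Q \<circ> second)"
  show False
    using same_side_instances[simplified ax_defs norm16] a[unfolded standard_facts, simplified norm16] by sat
qed

lemma case_pab_instances:
"ia 0 2 8 9"
"ta 1 9 0 2 8 & ta 2 8 0 9 1 & ta 8 0 1 2 9 & ta 9 2 0 1 8"
"xa 0 2 1 8 & xa 0 2 1 9 & xa 0 2 9 15 & xa 0 8 1 9 & xa 1 9 2 8"
"fa 0 2 9 1 15 & fa 0 8 1 7 9 & fa 2 8 1 3 9"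
  subgoal by (intro conjI int_ax)
  subgoal by (intro conjI trans_ax)
  subgoal by (intro conjI opp_ax)
  subgoal by (intro conjI fan_ax; simp add: sum_adj_edges del: One_nat_def)
  done

text \<open>The letters of these cases are the orientation of the second copy and then, for the
  first and the second copy, the class of vertices whose hub edges are crossed. Here 1 lies in the
  triangle 8 0 2, and 1 9 crosses none of its sides: 8 0 and 8 2 cross other edges at 1, and 0 2
  crosses 9 15. So 9 lies in the triangle too, but 9 15 crosses 0 2 and puts 9 on the other
  side.\<close>

lemma case_pab: "\<not> (standard Q \<and> standard (Q \<circ> second \<circ> turn 1))"
proof
  assume a: "standard Q \<and> standard (Q \<circ> second \<circ> turn 1)"
  show False
    using case_pab_instances[simplified ax_defs norm16] a[unfolded standard_facts, simplified norm16] by sat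
qed

lemma case_nab_instances:
"ia 0 2 8 10 & ia 0 2 8 15 & ia 2 3 8 9 & ia 2 3 8 15 & ia 2 8 15 10 & ia 8 9 15 14"
"ta 0 2 8 10 9 & ta 2 3 1 10 8 & ta 2 3 1 15 8 & ta 2 3 8 9 15 & ta 2 3 8 15 10 & ta 2 8 0 10 9 & ta
    2 8 9 15 10 & ta 2 9 0 15 8 & ta 2 10 3 8 9 & ta 3 1 2 15 10 & ta 3 8 1 2 15 & ta 3 8 2 9 15 &
    ta 3 8 2 10 9 & ta 3 15 1 10 8 & ta 8 0 1 2 15 & ta 8 0 2 9 15 & ta 8 0 2 10 9 & ta 8 0 2 15 10
    & ta 8 2 3 15 10 & ta 8 9 2 15 10 & ta 8 15 2 10 9 & ta 9 2 3 10 8 & ta 9 14 0 15 8 & ta 14 15 0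
    9 8 & ta 15 2 0 8 9 & ta 15 8 1 2 3"
"xa 0 2 9 15 & xa 0 8 9 10 & xa 0 8 9 14 & xa 0 8 9 15 & xa 0 15 9 14 & xa 1 3 2 8 & xa 1 3 2 10 &
    xa 1 3 2 15 & xa 2 3 9 10 & xa 2 3 9 15 & xa 2 3 10 15 & xa 2 8 9 10 & xa 2 8 9 15 & xa 2 8 10
    15 & xa 2 15 9 10 & xa 3 8 9 10 & xa 3 8 10 15"
"fa 0 8 9 10 14 & fa 1 3 2 8 10 & fa 1 3 2 8 15 & fa 9 10 2 3 8 & fa 9 10 8 2 3 & fa 9 15 0 2 8 & fa
    9 15 2 0 3 & fa 9 15 2 0 8 & fa 10 15 2 3 11 & fa 10 15 2 8 11"
"ra 8 2 3 10 9 15"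
  subgoal by (intro conjI int_ax)
  subgoal by (intro conjI trans_ax)
  subgoal by (intro conjI opp_ax)
  subgoal by (intro conjI fan_ax; simp add: sum_adj_edges del: One_nat_def)
  subgoal by (intro conjI rot_ax; simp add: sum_adj_edges del: One_nat_def)
  done

text \<open>Since 9 15 crosses 0 2, it crosses neither 8 0 nor 8 2, so 9 lies in the triangle 8 0 2.
  The contradiction comes from the neighbours of 9 and uses \<open>rot_ax\<close>.\<close>

lemma case_nab: "\<not> (standard Q \<and> antistandard (Q \<circ> second \<circ> turn 1))"
proof
  assume a: "standard Q \<and> antistandard (Q \<circ> second \<circ> turn 1)"
  show False
    using case_nab_instances[simplified ax_defs norm16] a[unfolded standard_facts, simplified norm16] by sat
qed

lemma case_pba_instances:
"ia 0 1 2 15"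
"ta 1 2 0 9 15 & ta 2 15 0 1 9 & ta 9 1 0 2 15 & ta 15 0 1 9 2"
"xa 0 2 1 8 & xa 0 2 1 9 & xa 0 2 9 15 & xa 0 15 1 9 & xa 1 9 2 15"
"fa 0 2 1 8 9 & fa 0 15 9 1 14 & fa 2 15 9 1 10"
  subgoal by (intro conjI int_ax)
  subgoal by (intro conjI trans_ax)
  subgoal by (intro conjI opp_ax)
  subgoal by (intro conjI fan_ax; simp add: sum_adj_edges del: One_nat_def)
  done

text \<open>The argument of \<open>case_pab\<close> with the copies exchanged: 9 is caught in the
  triangle 15 0 2, while 1 lies beyond 0 2.\<close>

lemma case_pba: "\<not> (standard (Q \<circ> turn 1) \<and> standard (Q \<circ> second))"
proof
  assume a: "standard (Q \<circ> turn 1) \<and> standard (Q \<circ> second)"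
  show False
    using case_pba_instances[simplified ax_defs norm16] a[unfolded standard_facts, simplified norm16] by sat
qed

lemma case_nba_instances:
"ia 0 1 8 15 & ia 0 2 8 15 & ia 0 7 13 8 & ia 0 7 15 8 & ia 0 8 11 15 & ia 0 8 13 15 & ia 1 2 11 15
    & ia 1 3 8 15 & ia 2 4 8 15 & ia 3 8 15 11"
"ta 0 1 2 8 15 & ta 0 7 1 13 15 & ta 0 13 7 15 8 & ta 0 15 1 8 7 & ta 0 15 2 8 11 & ta 1 2 0 15 8 &
    ta 1 3 0 15 8 & ta 1 3 2 8 15 & ta 1 15 2 11 3 & ta 2 3 4 8 11 & ta 2 8 0 1 11 & ta 3 2 1 15 11
    & ta 3 8 0 15 1 & ta 3 8 1 11 2 & ta 3 8 1 15 2 & ta 3 8 1 15 11 & ta 4 8 2 15 11 & ta 8 0 1 2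
    15 & ta 8 0 1 15 13 & ta 8 0 2 15 11 & ta 8 1 2 3 15 & ta 8 1 2 15 11 & ta 8 2 3 15 11 & ta 8 15
    2 4 11 & ta 11 2 4 8 15 & ta 13 8 0 7 1 & ta 15 3 1 11 2 & ta 15 3 2 8 11 & ta 15 8 0 7 1 & ta
    15 8 0 11 2 & ta 15 8 0 13 11 & ta 15 8 1 3 2"
"xa 0 1 3 8 & xa 0 2 1 8 & xa 0 8 1 7 & xa 0 13 1 7 & xa 0 15 1 3 & xa 0 15 1 7 & xa 0 15 1 8 & xa 1
    3 2 8 & xa 1 3 2 11 & xa 1 3 2 15 & xa 1 3 11 15 & xa 1 8 2 11 & xa 1 8 2 15 & xa 2 4 3 8 & xa 2
    11 3 8 & xa 2 15 3 8"
"fa 0 15 1 3 7 & fa 1 3 2 11 15 & fa 1 3 15 2 11 & fa 1 7 0 13 15 & fa 1 8 0 2 15 & fa 1 8 2 0 11 &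
    fa 1 8 2 0 15 & fa 3 8 2 4 11 & fa 3 8 2 4 15"
"ra 2 15 4 3 1 8"
  subgoal by (intro conjI int_ax)
  subgoal by (intro conjI trans_ax)
  subgoal by (intro conjI opp_ax)
  subgoal by (intro conjI fan_ax; simp add: sum_adj_edges del: One_nat_def)
  subgoal by (intro conjI rot_ax; simp add: sum_adj_edges del: One_nat_def)
  done

lemma case_nba: "\<not> (standard (Q \<circ> turn 1) \<and> antistandard (Q \<circ> second))"
proof
  assume a: "standard (Q \<circ> turn 1) \<and> antistandard (Q \<circ> second)"
  show False
    using case_nba_instances[simplified ax_defs norm16] a[unfolded standard_facts, simplified norm16] by sat
qed

lemma case_pbb_instances:
"ta 1 2 0 15 8 & ta 2 8 0 1 15 & ta 2 15 0 9 8 & ta 8 0 2 15 9 & ta 9 2 0 8 15 & ta 15 0 1 2 8"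
"xa 0 2 1 8 & xa 0 2 9 15 & xa 0 8 9 15 & xa 0 15 1 8 & xa 1 8 2 15 & xa 2 8 9 15"
"fa 1 8 0 2 15 & fa 1 8 2 0 15 & fa 9 15 0 2 8 & fa 9 15 2 0 8"
  subgoal by (intro conjI trans_ax)
  subgoal by (intro conjI opp_ax)
  subgoal by (intro conjI fan_ax; simp add: sum_adj_edges del: One_nat_def)
  done

text \<open>Both hubs lie on the same side of 0 2, and 8 1 and 15 9 cross 0 2. As 8 1 cannot also
  cross 15 0 or 15 2, the hub 8 lies in the triangle 15 0 2. By symmetry 15 lies in the triangle 8 0
  2, which is impossible.\<close>

lemma case_pbb: "\<not> (standard (Q \<circ> turn 1) \<and> standard (Q \<circ> second \<circ> turn 1))"
proof
  assume a: "standard (Q \<circ> turn 1) \<and> standard (Q \<circ> second \<circ> turn 1)"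
  show False
    using case_pbb_instances[simplified ax_defs norm16] a[unfolded standard_facts, simplified norm16] by sat
qed

lemma case_nbb_instances:
"ia 1 2 8 9"
"ta 0 1 2 8 15 & ta 0 15 1 2 9 & ta 1 2 0 9 8 & ta 2 8 0 1 9 & ta 2 9 0 15 8 & ta 8 0 1 9 15 & ta 9
    0 1 15 2"
"xa 0 1 9 15 & xa 0 2 1 8 & xa 0 2 1 9 & xa 0 2 9 15 & xa 0 8 9 15 & xa 0 15 1 8 & xa 1 2 9 15 & xa
    1 8 2 9 & xa 1 8 2 15 & xa 2 8 9 15"
"fa 0 2 1 8 9 & fa 1 8 0 2 15 & fa 1 8 2 0 9 & fa 1 8 2 0 15 & fa 9 15 0 1 2 & fa 9 15 0 2 8 & fa 9
    15 2 0 1 & fa 9 15 2 0 8"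
  subgoal by (intro conjI int_ax)
  subgoal by (intro conjI trans_ax)
  subgoal by (intro conjI opp_ax)
  subgoal by (intro conjI fan_ax; simp add: sum_adj_edges del: One_nat_def)
  done

text \<open>As 15 9 crosses 0 2, it crosses neither 8 0 nor 8 2, so 9 lies in the triangle 8 0 2.
  Because 1 8 crosses 0 2, the vertex 1 sees this triangle through the segment 0 2; then 1 9 would
  cross 0 2 besides 1 8.\<close>

lemma case_nbb: "\<not> (standard (Q \<circ> turn 1) \<and> antistandard (Q \<circ> second \<circ> turn 1))"
proof
  assume a: "standard (Q \<circ> turn 1) \<and> antistandard (Q \<circ> second \<circ> turn 1)"
  show False
    using case_nbb_instances[simplified ax_defs norm16] a[unfolded standard_facts, simplified norm16] by sat
qed

lemma first_copy: "antiprism_signs P Q"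
proof -
  have "rac_signs 9 antiprism_adj (P \<circ> id) (Q \<circ> id)"
    by (rule rac_signs_relabel) (auto simp: sum_adj_antiprism antiprism_adj_sym antiprism_adj_less)
  then show ?thesis by (simp add: antiprism_signs_def)
qed

lemma second_copy: "antiprism_signs (P \<circ> second) (Q \<circ> second)"
  unfolding antiprism_signs_def
proof (rule rac_signs_relabel)
  have "distinct (map second [0..<9]) \<and> (\<forall>j\<in>set [0..<9]. second j < 16)" by code_simp
  then show "inj_on second {..<9}" "\<And>j. j < 9 \<Longrightarrow> second j < 16"
    by (auto simp: distinct_map lessThan_atLeast0)
qed (auto simp: sum_adj_antiprism antiprism_adj_sym antiprism_adj_less)

lemma standard_layout:
  assumes "pos Q 8 0 1"
  shows "standard Q \<and> antistandard (Q \<circ> second)"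
proof -
  interpret a: antiprism_signs P Q by (rule first_copy)
  interpret b: antiprism_signs "P \<circ> second" "Q \<circ> second" by (rule second_copy)
  have "standard Q \<or> standard (Q \<circ> turn 1)" by (rule a.standard_positions[OF assms])
  moreover have "standard (Q \<circ> second) \<or> standard (Q \<circ> second \<circ> turn 1) \<or>
      antistandard (Q \<circ> second) \<or> antistandard (Q \<circ> second \<circ> turn 1)"
    using b.standard_positions b.antistandard_positions by blast
  ultimately show ?thesis
    using same_side case_pab case_nab case_pba case_nba case_pbb case_nbb by blast
qed

end

section \<open>The surviving layout: crossings, enclosed vertices and cyclic orders\<close>

locale sum_layout = sum_signs +
  assumes standard1: "standard Q" and standard2: "antistandard (Q \<circ> second)"
begin

lemmas layout_facts = standard1[unfolded standard_facts, simplified norm16]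
  standard2[unfolded standard_facts, simplified norm16]

lemma layout1_instances:
"ia 0 1 9 2 & ia 0 1 15 2 & ia 0 1 15 9 & ia 0 2 8 4 & ia 0 2 8 9 & ia 0 2 8 15 & ia 0 2 11 15 & ia
    0 2 13 15 & ia 1 2 3 9 & ia 1 2 11 9 & ia 1 3 5 9 & ia 1 3 8 9 & ia 1 9 12 14 & ia 1 9 15 14 &
    ia 2 3 8 9 & ia 2 6 8 15 & ia 2 8 13 11 & ia 2 8 13 15"
"ta 0 1 7 9 8 & ta 0 2 1 8 11 & ta 0 15 1 9 2 & ta 0 15 2 8 9 & ta 0 15 8 10 11 & ta 1 0 2 9 15 & ta
    1 0 2 15 11 & ta 1 2 3 8 9 & ta 1 3 5 7 9 & ta 1 9 0 2 8 & ta 1 15 0 9 14 & ta 2 0 6 9 15 & ta 2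
    0 9 15 11 & ta 2 1 0 15 11 & ta 2 4 0 15 8 & ta 2 8 0 9 1 & ta 2 8 0 15 1 & ta 2 8 0 15 6 & ta 2
    8 0 15 11 & ta 2 9 1 10 11 & ta 2 9 1 15 10 & ta 2 13 0 15 11 & ta 2 15 1 11 8 & ta 3 8 1 2 9 &
    ta 4 8 0 15 2 & ta 8 0 1 2 9 & ta 8 0 2 15 11 & ta 8 0 4 9 15 & ta 8 1 2 3 9 & ta 9 0 1 14 15 &
    ta 9 1 0 15 2 & ta 9 4 0 15 8 & ta 9 14 1 12 10 & ta 9 15 1 10 2 & ta 10 8 0 15 11 & ta 11 2 0
    13 8 & ta 11 2 8 10 15 & ta 11 10 0 15 8 & ta 13 11 2 8 15 & ta 13 15 0 2 8 & ta 15 2 0 1 9 & ta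
    15 2 0 4 9 & ta 15 2 0 8 6 & ta 15 2 0 8 9 & ta 15 2 0 13 8 & ta 15 9 0 4 8 & ta 15 9 0 8 6 & ta
    15 9 0 14 1 & ta 15 11 0 10 2"
"xa 0 1 2 11 & xa 0 1 14 15 & xa 0 2 1 8 & xa 0 2 1 9 & xa 0 2 9 15 & xa 0 2 11 13 & xa 0 6 2 9 & xa
    0 6 2 15 & xa 0 6 9 15 & xa 0 7 1 9 & xa 0 8 1 7 & xa 0 8 1 9 & xa 0 8 11 13 & xa 0 8 13 15 & xa
    0 9 2 4 & xa 0 14 1 9 & xa 0 15 1 9 & xa 0 15 2 4 & xa 0 15 9 14 & xa 1 2 9 10 & xa 1 2 11 15 &
    xa 1 3 2 8 & xa 1 3 2 9 & xa 1 9 2 3 & xa 1 9 2 8 & xa 1 9 2 10 & xa 1 9 2 11 & xa 1 9 2 15 & xa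
    1 9 3 5 & xa 1 9 3 8 & xa 1 9 12 14 & xa 1 9 14 15 & xa 2 4 9 15 & xa 2 8 10 11 & xa 2 8 10 15 &
    xa 2 8 11 15 & xa 2 9 3 8 & xa 2 11 10 15 & xa 2 11 13 15 & xa 2 15 9 10 & xa 3 5 4 8 & xa 5 7 6
    8 & xa 10 12 11 15 & xa 12 14 13 15"
"fa 0 6 2 9 15 & fa 0 6 15 2 9 & fa 0 8 1 7 9 & fa 0 8 13 11 15 & fa 0 15 9 1 14 & fa 1 3 2 8 9 & fa
    1 9 0 2 6 & fa 1 9 2 0 4 & fa 1 9 2 0 10 & fa 1 9 3 5 8 & fa 2 4 0 9 15 & fa 2 4 15 0 9 & fa 2 8
    1 3 9 & fa 2 8 11 10 15 & fa 2 8 15 10 11 & fa 2 11 1 0 9 & fa 2 15 9 1 10 & fa 3 8 9 1 2 & fa 9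
    10 2 1 15 & fa 11 15 2 1 8 & fa 14 15 1 0 9"
"ra 0 2 8 1 9 7 & ra 0 2 15 9 1 14 & ra 0 7 8 1 9 7 & ra 0 14 15 9 1 14 & ra 1 7 3 8 0 2 & ra 2 10
    15 9 1 10 & ra 2 11 15 9 1 10 & ra 3 1 5 8 2 4 & ra 7 1 5 8 0 6 & ra 9 14 10 15 0 2 & ra 10 9 12
    15 2 11 & ra 14 9 12 15 0 13"
"na 8 0 2 11 & na 8 0 2 13 & na 8 2 4 15 & na 8 6 0 15"
  subgoal by (intro conjI int_ax)
  subgoal by (intro conjI trans_ax)
  subgoal by (intro conjI opp_ax)
  subgoal by (intro conjI fan_ax; simp add: sum_adj_edges del: One_nat_def)
  subgoal by (intro conjI rot_ax; simp add: sum_adj_edges del: One_nat_def)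
  subgoal by (intro conjI inside_ax cyc_ax)
  done

text \<open>The forced atoms are derived in stages, and later stages take conclusions of earlier
  ones as unit clauses. Jointly they supply what is needed for the disjointness of the wheel
  triangles, for the crossings of 1 9 and for the rotations.\<close>

lemma layout1:
  "~ opposite Q 0 6 1 9 & ~ opposite Q 0 7 1 9 & ~ opposite Q 0 8 1 9 & ~ opposite Q
    0 14 1 9 & ~ opposite Q 0 15 1 9 & ~ opposite Q 1 9 2 3 & ~ opposite Q 1 9 2 4 & ~ opposite Q 1
    9 2 8 & ~ opposite Q 1 9 2 10 & ~ opposite Q 1 9 2 11 & ~ opposite Q 1 9 2 15 & ~ opposite Q 1 9
    3 5 & ~ opposite Q 1 9 3 8 & ~ opposite Q 1 9 12 14 & ~ opposite Q 1 9 14 15 & ~ inside Q 8 0 2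
    11 & ~ inside Q 8 0 2 13 & ~ inside Q 8 2 4 15 & ~ inside Q 8 6 0 15"
  using layout1_instances[simplified ax_defs norm16] layout_facts  by sat

lemma layout2_instances:
"ia 0 1 9 2 & ia 0 1 15 2 & ia 0 2 6 11 & ia 0 2 6 15 & ia 0 2 8 6 & ia 0 2 8 9 & ia 0 2 8 13 & ia 0
    2 8 15 & ia 0 2 10 15 & ia 0 2 11 6 & ia 0 2 11 15 & ia 0 4 6 15 & ia 0 4 8 6 & ia 0 4 8 15 & ia
    0 6 13 15 & ia 0 6 15 8 & ia 0 8 11 15 & ia 0 8 15 11 & ia 0 10 11 15 & ia 1 8 15 13 & ia 2 3 8
    6 & ia 2 4 8 15 & ia 2 4 15 11 & ia 2 8 15 11 & ia 3 4 8 6"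
"ta 0 2 1 8 11 & ta 0 2 6 11 8 & ta 0 4 2 8 6 & ta 0 11 2 8 15 & ta 0 13 2 8 15 & ta 0 13 2 14 15 &
    ta 0 15 1 9 2 & ta 0 15 2 8 6 & ta 0 15 2 8 11 & ta 0 15 2 10 11 & ta 1 13 2 8 15 & ta 2 0 6 9
    15 & ta 2 0 6 15 11 & ta 2 4 0 3 8 & ta 2 6 0 15 8 & ta 2 8 0 7 6 & ta 2 8 0 9 1 & ta 2 8 0 15 1
    & ta 2 8 0 15 6 & ta 4 6 0 15 8 & ta 4 8 0 15 2 & ta 4 11 2 15 10 & ta 6 0 2 4 15 & ta 6 0 2 7 8
    & ta 6 0 2 8 15 & ta 6 0 2 15 8 & ta 6 0 7 8 15 & ta 6 2 0 8 15 & ta 6 2 0 11 15 & ta 6 2 0 15 9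
    & ta 6 8 2 4 3 & ta 6 15 0 13 14 & ta 8 0 1 2 9 & ta 8 0 1 2 13 & ta 8 0 1 2 15 & ta 8 0 2 4 15
    & ta 8 0 2 15 11 & ta 8 1 2 13 15 & ta 8 1 2 15 11 & ta 8 2 3 4 15 & ta 8 6 0 2 11 & ta 8 15 0 2
    6 & ta 10 0 2 15 11 & ta 11 0 2 6 8 & ta 11 0 2 15 8 & ta 11 2 0 10 8 & ta 11 2 4 10 15 & ta 11
    2 8 10 15 & ta 11 10 0 15 8 & ta 13 8 0 2 1 & ta 15 0 6 14 13 & ta 15 2 0 1 9 & ta 15 6 0 8 7 &
    ta 15 8 0 11 2 & ta 15 8 2 4 3 & ta 15 11 0 6 2"
"xa 0 1 2 11 & xa 0 2 1 8 & xa 0 2 4 6 & xa 0 2 4 8 & xa 0 2 6 7 & xa 0 2 9 15 & xa 0 6 2 9 & xa 0 6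
    2 11 & xa 0 6 2 15 & xa 0 6 7 8 & xa 0 6 9 15 & xa 0 6 11 15 & xa 0 6 13 14 & xa 0 6 13 15 & xa
    0 6 14 15 & xa 0 7 2 8 & xa 0 8 1 7 & xa 0 8 2 11 & xa 0 8 2 15 & xa 0 8 11 15 & xa 0 13 1 2 &
    xa 0 13 1 8 & xa 0 13 2 8 & xa 0 13 14 15 & xa 0 15 1 9 & xa 0 15 2 8 & xa 0 15 6 7 & xa 0 15 6
    8 & xa 0 15 7 8 & xa 1 3 2 8 & xa 1 8 2 11 & xa 1 9 2 8 & xa 2 3 4 6 & xa 2 4 3 8 & xa 2 4 10 11
    & xa 2 4 10 15 & xa 2 4 11 15 & xa 2 8 11 15 & xa 2 11 6 8 & xa 2 11 10 15 & xa 2 15 3 4 & xa 2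
    15 3 8 & xa 2 15 4 6 & xa 2 15 4 8 & xa 2 15 6 8 & xa 3 5 4 8 & xa 4 6 5 8 & xa 11 13 12 15"
"fa 0 6 2 9 15 & fa 0 6 2 11 15 & fa 0 6 11 2 15 & fa 0 6 13 14 15 & fa 0 6 15 2 9 & fa 0 6 15 13 14
    & fa 0 8 11 2 15 & fa 0 13 2 1 8 & fa 0 13 8 1 2 & fa 0 15 6 7 8 & fa 0 15 8 6 7 & fa 2 4 11 10
    15 & fa 2 4 15 10 11 & fa 2 11 0 1 8 & fa 2 11 0 6 8 & fa 2 11 6 0 8 & fa 2 11 8 0 1 & fa 2 15 4
    3 8 & fa 2 15 4 6 8 & fa 2 15 8 3 4 & fa 6 8 15 0 2"
"na 15 2 0 4 & na 15 2 0 6 & na 15 11 2 8 & na 15 0 13 8 & ca 0 2 1 8 & ca 0 2 7 6 & ca 0 2 13 14 &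
    ca 0 2 15 9 & ca 1 2 3 8 & ca 1 2 7 0 & ca 1 2 0 9 & ca 2 0 9 15 & ca 2 0 10 11 & ca 2 0 4 3 &
    ca 2 0 8 1 & ca 3 4 5 8 & ca 3 4 1 2 & ca 4 6 5 8 & ca 4 6 3 2 & na 8 6 0 15 & na 8 0 2 13 & na
    8 0 2 11"
  subgoal by (intro conjI int_ax)
  subgoal by (intro conjI trans_ax)
  subgoal by (intro conjI opp_ax)
  subgoal by (intro conjI fan_ax; simp add: sum_adj_edges del: One_nat_def)
  subgoal by (intro conjI inside_ax cyc_ax)
  done

lemma layout2:
  "~ pos Q 0 1 2 & ~ pos Q 0 2 9 & ~ pos Q 2 3 4 & pos Q 2 10 11 & ~ pos Q 4 5 6 &
    pos Q 11 12 13 & ~ pos Q 0 6 7 & pos Q 0 13 14 & ~ opposite Q 2 4 11 15 & ~ opposite Q 0 6 2 11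
    & ~ opposite Q 0 6 2 15 & ~ opposite Q 0 6 13 15 & ~ opposite Q 0 8 2 15 & ~ opposite Q 0 8 11
    15 & ~ opposite Q 0 13 2 8 & ~ opposite Q 0 15 2 8 & ~ opposite Q 2 8 11 15 & ~ opposite Q 2 15
    4 8 & ~ opposite Q 0 15 6 8 & ~ opposite Q 2 15 6 8 & ~ inside Q 15 2 0 4 & ~ inside Q 15 2 0 6
    & ~ inside Q 15 11 2 8 & ~ inside Q 15 0 13 8 & cyc Q 0 2 1 8 & cyc Q 0 2 7 6 & cyc Q 0 2 13 14
    & cyc Q 0 2 15 9 & cyc Q 1 2 3 8 & cyc Q 1 2 7 0 & cyc Q 1 2 0 9 & cyc Q 2 0 9 15 & cyc Q 2 0 10
    11 & cyc Q 2 0 4 3 & cyc Q 2 0 8 1 & cyc Q 3 4 5 8 & cyc Q 3 4 1 2 & cyc Q 4 6 5 8 & cyc Q 4 6 3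
    2"
  using layout2_instances[simplified ax_defs norm16] layout_facts layout1 by sat

lemma layout3_instances:
"ia 0 1 8 9 & ia 0 1 9 2 & ia 0 2 8 15 & ia 0 4 8 5 & ia 0 8 11 13 & ia 0 8 13 15 & ia 0 11 14 15 &
    ia 1 4 8 9 & ia 1 5 7 9 & ia 1 6 7 9 & ia 1 9 10 12 & ia 1 9 10 15 & ia 1 9 11 15 & ia 1 9 12 15
    & ia 1 9 13 14 & ia 2 4 8 15 & ia 2 4 15 6 & ia 2 9 10 11 & ia 2 9 15 11 & ia 2 11 12 15 & ia 11
    12 14 15 & ia 11 13 14 15"
"ta 0 8 4 6 5 & ta 0 13 2 8 15 & ta 0 13 6 15 8 & ta 0 13 8 11 15 & ta 0 15 4 8 6 & ta 0 15 4 11 8 &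
    ta 1 7 0 9 6 & ta 2 4 6 8 15 & ta 2 4 8 15 11 & ta 2 15 11 12 13 & ta 4 6 0 15 8 & ta 4 8 2 15
    11 & ta 5 7 4 6 8 & ta 6 0 7 8 13 & ta 6 0 8 15 13 & ta 6 1 0 7 9 & ta 6 2 4 13 8 & ta 6 13 2 8
    15 & ta 7 0 1 8 9 & ta 7 8 4 6 5 & ta 8 0 4 15 13 & ta 8 0 11 15 13 & ta 8 2 4 15 11 & ta 8 3 0
    4 5 & ta 8 3 0 5 7 & ta 8 4 0 5 6 & ta 8 4 0 15 6 & ta 8 7 0 1 3 & ta 8 9 1 2 4 & ta 8 15 0 2 6
    & ta 8 15 0 2 13 & ta 8 15 2 4 6 & ta 9 10 1 11 2 & ta 9 11 1 15 2 & ta 9 12 1 15 10 & ta 9 13 1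
    14 15 & ta 9 15 1 12 10 & ta 11 0 4 15 13 & ta 11 2 1 10 9 & ta 11 4 0 15 8 & ta 11 9 1 2 10 &
    ta 11 15 0 13 14 & ta 12 2 11 15 13 & ta 12 10 1 15 9 & ta 13 6 0 8 7 & ta 13 11 2 8 15 & ta 13
    11 12 15 14 & ta 13 15 0 1 14 & ta 13 15 0 8 6 & ta 14 9 0 13 1 & ta 14 12 10 15 11 & ta 15 0 6
    13 8 & ta 15 2 4 6 8 & ta 15 6 4 13 8 & ta 15 8 0 4 2 & ta 15 8 0 11 2 & ta 15 8 0 13 6 & ta 15
    8 0 13 11 & ta 15 10 2 9 14 & ta 15 13 2 8 11"
"xa 0 1 13 14 & xa 0 2 1 9 & xa 0 6 1 9 & xa 0 6 4 5 & xa 0 6 13 15 & xa 0 8 1 7 & xa 0 8 2 15 & xa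
    0 8 5 6 & xa 0 8 11 15 & xa 0 9 7 8 & xa 0 13 2 8 & xa 0 13 6 7 & xa 0 13 6 8 & xa 0 13 7 8 & xa
    0 13 11 15 & xa 0 14 11 13 & xa 0 15 6 8 & xa 0 15 9 14 & xa 1 9 2 8 & xa 1 9 2 11 & xa 1 9 4 8
    & xa 1 9 5 7 & xa 1 9 6 7 & xa 1 9 7 8 & xa 1 9 10 11 & xa 1 9 10 12 & xa 1 9 10 15 & xa 1 9 11
    15 & xa 1 9 12 15 & xa 1 9 13 14 & xa 1 9 13 15 & xa 2 4 6 8 & xa 2 4 11 15 & xa 2 11 13 15 & xa
    2 15 4 8 & xa 2 15 6 8 & xa 2 15 9 10 & xa 2 15 12 13 & xa 4 5 7 8 & xa 4 6 5 7 & xa 4 6 13 15 &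
    xa 4 8 11 13 & xa 4 8 11 15 & xa 6 8 13 15 & xa 9 14 13 15 & xa 10 11 14 15 & xa 10 12 11 15 &
    xa 11 13 12 14 & xa 12 14 13 15"
"fa 0 13 6 7 8 & fa 0 13 8 6 7 & fa 1 9 0 2 13 & fa 1 9 13 14 15 & fa 4 8 11 13 15 & fa 7 8 9 0 1 &
    fa 13 14 1 0 9 & fa 13 15 6 4 8"
"ra 0 2 8 1 9 7 & ra 0 2 15 9 1 14 & ra 1 3 9 8 2 4 & ra 1 9 3 2 0 8 & ra 2 0 15 9 1 10 & ra 7 1 5 8
    0 6 & ra 9 1 10 15 11 2 & ra 10 9 12 15 2 11 & ra 12 10 14 15 11 13"
"ca 5 6 7 8 & ca 5 6 3 4 & ca 6 0 7 8 & ca 6 0 5 4 & ca 7 0 1 8 & ca 7 0 5 6 & ca 8 0 3 4 & ca 8 0 4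
    5 & ca 9 0 14 15 & ca 9 0 10 2 & ca 9 0 2 1 & ca 10 2 9 15 & ca 10 2 12 11 & ca 11 2 10 15 & ca
    11 2 12 13 & ca 12 11 10 15 & ca 12 11 14 13 & ca 13 11 12 15 & ca 13 11 14 0 & ca 14 13 12 15 &
    ca 14 13 9 0 & ca 15 14 11 10 & ca 15 14 10 2 & na 8 2 4 11 & na 8 4 6 15 & na 8 6 0 13 & na 15
    13 11 8 & na 15 0 13 6 & ca 3 4 5 8 & ca 1 2 0 9 & ca 1 2 3 8 & na 8 2 4 15 & na 8 6 0 15 & na 8
    0 2 13"
  subgoal by (intro conjI int_ax)
  subgoal by (intro conjI trans_ax)
  subgoal by (intro conjI opp_ax)
  subgoal by (intro conjI fan_ax; simp add: sum_adj_edges del: One_nat_def)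
  subgoal by (intro conjI rot_ax; simp add: sum_adj_edges del: One_nat_def)
  subgoal by (intro conjI inside_ax cyc_ax)
  done

text \<open>The edge 1 9 crosses 0 2: the vertices 1 and 9 lie in the triangles 8 0 2 and 15 2 0 on
  opposite sides of 0 2, and 1 9 crosses none of the other sides of these by
  \<open>layout1\<close>.\<close>

lemma layout3:
  "opposite Q 0 2 1 9 & ~ opposite Q 0 13 1 9 & ~ opposite Q 1 9 4 8 & ~ opposite Q 1
    9 5 7 & ~ opposite Q 1 9 6 7 & ~ opposite Q 1 9 7 8 & ~ opposite Q 1 9 10 11 & ~ opposite Q 1 9
    10 12 & ~ opposite Q 1 9 10 15 & ~ opposite Q 1 9 11 15 & ~ opposite Q 1 9 12 15 & ~ opposite Q
    1 9 13 14 & cyc Q 5 6 7 8 & cyc Q 5 6 3 4 & cyc Q 6 0 7 8 & cyc Q 6 0 5 4 & cyc Q 7 0 1 8 & cyc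
    Q 7 0 5 6 & cyc Q 8 0 3 4 & cyc Q 8 0 4 5 & cyc Q 9 0 14 15 & cyc Q 9 0 10 2 & cyc Q 9 0 2 1 &
    cyc Q 10 2 9 15 & cyc Q 10 2 12 11 & cyc Q 11 2 10 15 & cyc Q 11 2 12 13 & cyc Q 12 11 10 15 &
    cyc Q 12 11 14 13 & cyc Q 13 11 12 15 & cyc Q 13 11 14 0 & cyc Q 14 13 12 15 & cyc Q 14 13 9 0 &
    cyc Q 15 14 11 10 & cyc Q 15 14 10 2 & ~ inside Q 8 2 4 11 & ~ inside Q 8 4 6 15 & ~ inside Q 8
    6 0 13 & ~ inside Q 15 13 11 8 & ~ inside Q 15 0 13 6"
  using layout3_instances[simplified ax_defs norm16] layout_facts layout1 layout2 by sat

lemma layout4_instances: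
"ia 0 2 4 13 & ia 0 2 8 4 & ia 0 2 13 4 & ia 0 4 6 13 & ia 0 4 8 6 & ia 0 8 13 15 & ia 1 2 3 4 & ia
    1 2 11 15 & ia 1 3 5 9 & ia 1 3 8 9 & ia 1 5 7 9 & ia 1 5 8 9 & ia 1 5 9 6 & ia 1 5 9 8 & ia 1 6
    9 8 & ia 1 7 9 8 & ia 1 9 11 12 & ia 1 9 12 11 & ia 1 9 15 11 & ia 1 9 15 13 & ia 1 9 15 14 & ia
    3 5 8 9 & ia 5 6 7 9"
"ta 0 2 4 6 13 & ta 0 2 4 8 13 & ta 0 4 2 8 6 & ta 0 4 2 8 15 & ta 0 4 6 15 8 & ta 0 6 2 13 15 & ta
    0 13 2 4 15 & ta 1 5 6 8 9 & ta 1 5 7 9 8 & ta 1 6 0 9 8 & ta 1 6 5 7 9 & ta 1 8 5 7 9 & ta 1 8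
    6 7 9 & ta 1 15 9 10 11 & ta 2 0 4 13 15 & ta 2 1 9 15 11 & ta 2 4 0 13 8 & ta 2 4 1 9 8 & ta 2
    4 3 8 9 & ta 2 8 0 15 11 & ta 2 11 0 4 8 & ta 3 1 2 4 9 & ta 3 5 1 9 8 & ta 4 0 2 13 6 & ta 4 0
    6 8 13 & ta 4 2 0 13 15 & ta 4 6 0 13 2 & ta 4 8 0 13 2 & ta 4 13 2 15 6 & ta 6 0 4 13 15 & ta 6
    0 7 8 13 & ta 6 1 5 9 7 & ta 6 7 5 9 8 & ta 6 8 1 5 9 & ta 8 1 3 5 9 & ta 8 2 3 4 11 & ta 8 5 1
    6 7 & ta 8 5 6 7 9 & ta 8 9 1 3 5 & ta 8 9 1 5 6 & ta 8 15 0 13 14 & ta 9 2 1 4 3 & ta 9 3 1 4 2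
    & ta 9 3 1 8 5 & ta 9 8 1 7 6 & ta 9 10 1 11 2 & ta 9 11 1 12 10 & ta 9 12 1 11 10 & ta 11 8 2 4
    3 & ta 11 9 1 15 12 & ta 11 10 1 15 12 & ta 13 0 2 4 8 & ta 13 2 0 4 15 & ta 13 6 0 8 7 & ta 13
    15 0 2 4 & ta 15 0 8 14 13 & ta 15 1 2 9 11 & ta 15 1 9 14 13 & ta 15 2 0 4 8 & ta 15 11 1 10 2"
"xa 0 2 4 6 & xa 0 2 13 15 & xa 0 6 1 8 & xa 0 6 2 4 & xa 0 6 2 15 & xa 0 6 13 15 & xa 0 8 13 14 &
    xa 0 8 13 15 & xa 0 8 14 15 & xa 0 13 2 4 & xa 0 13 2 8 & xa 0 13 4 6 & xa 0 13 4 8 & xa 0 13 6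
    7 & xa 0 13 6 8 & xa 0 13 7 8 & xa 0 15 2 4 & xa 0 15 4 8 & xa 1 7 5 6 & xa 1 9 2 4 & xa 1 9 2
    15 & xa 1 9 3 4 & xa 1 9 5 6 & xa 1 9 5 8 & xa 1 9 6 8 & xa 1 9 11 12 & xa 1 9 11 15 & xa 1 9 13
    15 & xa 2 4 13 15 & xa 2 8 11 15 & xa 2 11 3 4 & xa 2 11 3 8 & xa 2 11 4 8 & xa 2 15 9 10 & xa 4
    6 13 15 & xa 9 10 11 12 & xa 10 12 11 15"
"fa 0 8 13 14 15 & fa 0 8 15 13 14 & fa 0 13 4 2 6 & fa 0 13 4 6 8 & fa 0 13 6 7 8 & fa 0 13 8 6 7 &
    fa 0 15 4 2 8 & fa 1 9 6 5 8 & fa 2 4 0 13 15 & fa 2 4 13 0 15 & fa 2 11 4 3 8 & fa 2 11 8 3 4 &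
    fa 13 15 4 2 6"
"ra 0 2 8 1 9 7 & ra 0 2 15 9 1 14 & ra 1 7 9 8 0 6 & ra 1 9 3 2 0 8 & ra 2 0 15 9 1 10 & ra 3 1 5 8
    2 4 & ra 7 1 5 8 0 6 & ra 9 14 1 15 0 13 & ra 10 9 12 15 2 11"
"ca 0 2 6 13 & na 8 2 4 13 & na 15 0 13 4 & na 15 2 0 6 & na 15 0 13 6 & na 8 0 2 13 & na 8 6 0 13 &
    na 15 11 2 8 & na 8 2 4 11 & ca 9 0 14 15 & na 15 2 0 4 & na 8 2 4 15 & ca 1 2 3 8 & ca 1 2 0 9
    & ca 7 0 1 8 & ca 5 6 7 8 & ca 3 4 5 8"
  subgoal by (intro conjI int_ax)
  subgoal by (intro conjI trans_ax)
  subgoal by (intro conjI opp_ax)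
  subgoal by (intro conjI fan_ax; simp add: sum_adj_edges del: One_nat_def)
  subgoal by (intro conjI rot_ax; simp add: sum_adj_edges del: One_nat_def)
  subgoal by (intro conjI inside_ax cyc_ax)
  done

text \<open>The two final disjunctions relate the positions of 4 and 11; they are intermediate
  clauses handed to the following stages.\<close>

lemma layout4:
  "~ opposite Q 0 8 13 15 & ~ opposite Q 1 9 13 15 & ~ opposite Q 0 13 2 4 & ~
    opposite Q 1 9 3 4 & ~ opposite Q 1 9 5 6 & ~ opposite Q 1 9 5 8 & ~ opposite Q 1 9 6 8 & ~
    opposite Q 1 9 11 12 & cyc Q 0 2 6 13 & ~ inside Q 8 2 4 13 & ~ inside Q 15 0 13 4 & (~ pos Q 0
    2 11 | ~ pos Q 2 4 11) & (~ pos Q 0 2 11 | pos Q 0 2 4)"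
  using layout4_instances[simplified ax_defs norm16] layout_facts layout1 layout2 layout3 by sat

lemma layout5_instances:
"ia 0 2 4 15 & ia 0 2 8 4 & ia 0 2 8 6 & ia 0 2 8 11 & ia 0 2 8 13 & ia 0 2 8 15 & ia 0 2 11 15 & ia
    0 2 13 15 & ia 0 4 8 6 & ia 0 4 13 6 & ia 0 6 11 15 & ia 0 6 13 8 & ia 0 6 15 8 & ia 1 2 11 9 &
    ia 1 2 11 15 & ia 1 9 11 13 & ia 1 9 12 13 & ia 1 9 13 11 & ia 1 9 13 12 & ia 2 4 6 11 & ia 2 4
    8 13 & ia 2 4 8 15 & ia 2 4 11 6 & ia 2 4 13 15 & ia 2 4 15 13 & ia 2 11 13 15 & ia 4 8 15 11"
"ta 0 2 4 6 13 & ta 0 13 2 4 15 & ta 0 15 2 6 11 & ta 0 15 2 11 9 & ta 1 11 9 13 15 & ta 1 12 9 13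
    14 & ta 2 0 9 11 13 & ta 2 0 9 15 11 & ta 2 0 9 15 13 & ta 2 1 0 15 11 & ta 2 4 0 13 6 & ta 2 4
    0 15 6 & ta 2 4 0 15 8 & ta 2 4 6 8 11 & ta 2 6 0 11 8 & ta 2 6 0 15 11 & ta 2 6 4 8 11 & ta 2 8
    0 11 6 & ta 2 8 0 15 11 & ta 2 15 4 8 11 & ta 4 0 2 6 13 & ta 4 0 2 13 8 & ta 4 6 0 13 8 & ta 4
    6 2 11 8 & ta 4 8 2 15 11 & ta 4 15 0 2 13 & ta 4 15 0 9 2 & ta 6 0 2 11 8 & ta 6 0 2 13 4 & ta
    6 0 2 15 11 & ta 6 2 4 11 8 & ta 6 11 2 15 4 & ta 6 15 0 8 11 & ta 8 2 3 4 11 & ta 8 2 4 6 11 &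
    ta 8 4 0 13 6 & ta 8 6 0 2 11 & ta 8 15 0 2 6 & ta 8 15 2 4 11 & ta 9 2 0 13 1 & ta 9 11 1 13 2
    & ta 9 12 1 13 2 & ta 9 13 0 15 1 & ta 9 13 1 11 2 & ta 9 13 1 12 10 & ta 9 14 10 13 12 & ta 9
    15 2 12 10 & ta 11 0 2 15 4 & ta 11 0 9 15 13 & ta 11 2 0 8 6 & ta 11 2 1 15 13 & ta 11 2 6 15 8
    & ta 11 4 0 2 6 & ta 11 8 2 4 3 & ta 11 8 2 6 4 & ta 11 9 1 15 13 & ta 12 9 1 14 13 & ta 12 15 9
    14 13 & ta 13 0 4 6 8 & ta 13 2 0 4 6 & ta 13 2 0 8 4 & ta 13 4 0 6 15 & ta 13 8 0 4 2 & ta 13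
    15 0 2 4 & ta 15 2 0 4 9 & ta 15 2 0 13 4 & ta 15 2 0 13 9 & ta 15 2 4 6 13 & ta 15 4 0 13 2 &
    ta 15 8 0 6 2 & ta 15 11 0 6 2 & ta 15 11 2 8 6"
"xa 0 2 13 15 & xa 0 6 2 11 & xa 0 6 2 15 & xa 0 6 11 15 & xa 0 9 2 4 & xa 0 9 11 15 & xa 0 9 13 15
    & xa 0 13 2 4 & xa 0 13 4 6 & xa 0 13 11 15 & xa 0 15 2 4 & xa 1 9 2 15 & xa 1 9 11 13 & xa 1 9
    11 15 & xa 1 9 12 13 & xa 1 9 13 14 & xa 1 9 13 15 & xa 2 4 6 8 & xa 2 4 9 15 & xa 2 4 13 15 &
    xa 2 8 11 15 & xa 2 9 11 13 & xa 2 11 3 4 & xa 2 11 3 8 & xa 2 11 4 6 & xa 2 11 4 8 & xa 2 11 6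
    8 & xa 2 15 6 8 & xa 2 15 9 10 & xa 4 6 11 15 & xa 4 6 13 15 & xa 6 8 11 15 & xa 9 15 12 13 & xa
    10 12 11 15"
"fa 2 4 0 9 15 & fa 2 4 15 0 9 & fa 2 11 4 3 8 & fa 2 11 4 6 8 & fa 2 11 6 4 8 & fa 2 11 8 3 4 & fa
    4 6 11 2 15 & fa 4 6 13 0 15 & fa 11 15 6 0 8"
"ra 0 2 15 9 1 14 & ra 2 0 15 9 1 10 & ra 9 14 10 15 0 2 & ra 10 9 12 15 2 11 & ra 14 9 12 15 0 13"
"na 8 4 6 13 & na 8 6 0 11 & na 15 11 2 4 & na 15 11 2 6 & ca 1 2 0 9 & ca 9 0 14 15 & ca 14 13 12
    15 & ca 0 2 6 13 & na 15 11 2 8 & na 8 2 4 11 & na 15 0 13 4"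
  subgoal by (intro conjI int_ax)
  subgoal by (intro conjI trans_ax)
  subgoal by (intro conjI opp_ax)
  subgoal by (intro conjI fan_ax; simp add: sum_adj_edges del: One_nat_def)
  subgoal by (intro conjI rot_ax; simp add: sum_adj_edges del: One_nat_def)
  subgoal by (intro conjI inside_ax cyc_ax)
  done

lemma layout5:
  "~ opposite Q 1 9 11 13 & ~ opposite Q 1 9 12 13 & ~ opposite Q 0 15 2 4 & ~
    opposite Q 2 4 13 15 & ~ opposite Q 2 11 4 6 & ~ inside Q 8 4 6 13 & ~ inside Q 8 6 0 11 & ~
    inside Q 15 11 2 4 & ~ inside Q 15 11 2 6"
  using layout5_instances[simplified ax_defs norm16] layout_facts layout1 layout2 layout3 layout4 by sat

lemma layout6_instances:
"ia 0 2 4 15 & ia 0 2 6 15 & ia 0 2 8 4 & ia 0 2 8 6 & ia 0 2 8 11 & ia 0 2 8 13 & ia 0 2 8 15 & ia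
    0 2 11 15 & ia 0 4 6 15 & ia 0 4 8 11 & ia 0 4 8 13 & ia 0 4 13 8 & ia 0 4 15 6 & ia 0 6 11 13 &
    ia 0 6 11 15 & ia 0 6 13 11 & ia 0 6 15 11 & ia 2 4 8 11 & ia 2 6 8 11 & ia 2 6 11 8 & ia 2 8 11
    13 & ia 2 8 13 11 & ia 2 8 13 15 & ia 2 8 15 11 & ia 2 11 13 15 & ia 6 8 13 15 & ia 6 8 15 13"
"ta 0 2 1 8 11 & ta 0 4 2 8 11 & ta 0 4 6 13 15 & ta 0 11 2 6 13 & ta 0 11 2 6 15 & ta 0 11 2 8 6 &
    ta 0 11 2 13 15 & ta 0 13 2 4 15 & ta 0 13 2 6 11 & ta 0 13 2 8 15 & ta 0 13 6 11 15 & ta 0 13 6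
    15 8 & ta 0 15 2 6 11 & ta 2 4 0 13 8 & ta 2 6 0 4 8 & ta 2 8 0 11 6 & ta 2 13 0 11 8 & ta 2 13
    0 15 11 & ta 4 6 2 11 8 & ta 4 8 0 11 2 & ta 4 15 0 2 6 & ta 6 0 2 4 15 & ta 6 0 11 15 13 & ta 6
    2 0 8 4 & ta 6 2 0 8 11 & ta 6 2 0 8 13 & ta 6 8 2 11 4 & ta 6 13 0 8 15 & ta 6 13 0 11 2 & ta 6
    15 0 2 4 & ta 6 15 0 8 13 & ta 6 15 0 11 2 & ta 8 0 2 4 11 & ta 8 0 2 4 13 & ta 8 0 2 13 15 & ta
    8 2 3 4 11 & ta 8 2 4 6 11 & ta 8 4 0 11 6 & ta 8 11 0 2 6 & ta 8 11 2 4 6 & ta 8 11 2 13 12 &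
    ta 8 13 0 2 4 & ta 11 0 1 2 8 & ta 11 0 2 13 6 & ta 11 0 2 15 6 & ta 11 0 2 15 13 & ta 11 2 0 4
    8 & ta 11 2 0 8 13 & ta 11 2 4 6 8 & ta 11 2 8 10 13 & ta 11 2 10 15 13 & ta 11 8 2 4 3 & ta 11
    8 2 6 4 & ta 11 8 2 15 13 & ta 11 10 8 12 13 & ta 11 15 0 6 13 & ta 12 13 2 8 11 & ta 13 8 0 4 2
    & ta 13 11 0 6 15 & ta 13 11 0 8 15 & ta 15 2 0 13 8 & ta 15 6 0 4 2 & ta 15 6 0 13 8 & ta 15 8
    0 13 2 & ta 15 8 0 13 6"
"xa 0 1 2 11 & xa 0 2 4 8 & xa 0 2 11 13 & xa 0 2 13 15 & xa 0 6 2 4 & xa 0 6 2 11 & xa 0 6 2 15 &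
    xa 0 6 11 13 & xa 0 6 11 15 & xa 0 6 13 15 & xa 0 8 2 11 & xa 0 13 2 4 & xa 0 13 2 8 & xa 0 13 2
    11 & xa 0 13 4 8 & xa 0 13 6 8 & xa 0 13 11 15 & xa 0 15 4 6 & xa 0 15 6 8 & xa 1 8 2 11 & xa 2
    4 6 8 & xa 2 8 11 12 & xa 2 8 11 13 & xa 2 8 12 13 & xa 2 8 13 15 & xa 2 11 3 4 & xa 2 11 3 8 &
    xa 2 11 4 6 & xa 2 11 4 8 & xa 2 11 6 8 & xa 2 11 13 15 & xa 2 15 4 6 & xa 6 8 11 13 & xa 6 8 13
    15 & xa 10 12 11 15"
"fa 2 8 11 12 13 & fa 2 8 13 11 12 & fa 2 11 0 1 8 & fa 2 11 4 3 8 & fa 2 11 8 0 1 & fa 2 11 8 3 4 &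
    fa 4 6 15 0 2 & fa 6 8 13 0 15 & fa 11 13 6 0 8"
"ca 2 0 11 4 & na 8 4 6 11 & na 15 13 11 6 & ca 0 2 6 13 & na 8 6 0 11 & na 15 2 0 6 & na 15 11 2 6
    & na 15 13 11 8 & ca 11 2 12 13 & na 8 2 4 13 & na 8 2 4 11 & na 15 0 13 6 & na 8 6 0 15"
  subgoal by (intro conjI int_ax)
  subgoal by (intro conjI trans_ax)
  subgoal by (intro conjI opp_ax)
  subgoal by (intro conjI fan_ax; simp add: sum_adj_edges del: One_nat_def)
  subgoal by (intro conjI inside_ax cyc_ax)
  done

lemma layout6:
  "~ opposite Q 0 15 4 6 & ~ opposite Q 0 6 11 13 & ~ opposite Q 0 6 11 15 & ~
    opposite Q 0 8 2 11 & ~ opposite Q 2 8 11 13 & ~ opposite Q 2 8 13 15 & ~ opposite Q 2 11 4 8 &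
    ~ opposite Q 0 13 4 8 & ~ opposite Q 2 11 6 8 & ~ opposite Q 6 8 13 15 & cyc Q 2 0 11 4 & ~
    inside Q 8 4 6 11 & ~ inside Q 15 13 11 6"
  using layout6_instances[simplified ax_defs norm16] layout_facts layout1 layout2 layout3 layout4 layout5 by sat

lemma layout7_instances:
"ia 0 1 6 4 & ia 0 1 6 9 & ia 0 2 4 11 & ia 0 2 6 11 & ia 0 2 8 4 & ia 0 2 8 6 & ia 0 2 11 15 & ia 0
    2 13 15 & ia 0 4 6 13 & ia 0 4 8 6 & ia 0 4 8 13 & ia 0 4 11 6 & ia 0 4 13 6 & ia 0 4 13 11 & ia
    0 6 11 13 & ia 0 6 13 8 & ia 0 6 13 11 & ia 1 2 8 4 & ia 1 4 6 9 & ia 1 4 9 6 & ia 2 4 6 15 & ia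
    2 4 8 6 & ia 2 4 11 13 & ia 2 4 13 11 & ia 2 4 15 6 & ia 2 11 13 15 & ia 4 6 11 13 & ia 4 6 13
    11 & ia 4 11 13 15"
"ta 0 2 1 6 4 & ta 0 2 1 8 6 & ta 0 4 2 8 11 & ta 0 11 2 6 15 & ta 0 11 4 13 6 & ta 0 11 6 13 15 &
    ta 0 13 2 4 11 & ta 0 13 2 6 11 & ta 0 13 4 11 6 & ta 1 0 2 4 9 & ta 1 4 0 9 6 & ta 1 4 2 8 9 &
    ta 1 6 0 9 4 & ta 2 0 4 13 11 & ta 2 0 4 15 11 & ta 2 4 6 8 15 & ta 2 6 0 15 8 & ta 2 6 4 8 15 &
    ta 2 8 0 6 1 & ta 2 10 4 13 11 & ta 2 15 4 10 11 & ta 2 15 4 13 10 & ta 4 0 2 6 8 & ta 4 0 6 8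
    11 & ta 4 2 0 13 11 & ta 4 2 11 15 13 & ta 4 3 0 13 2 & ta 4 6 0 2 11 & ta 4 8 0 3 2 & ta 4 8 0
    13 2 & ta 4 11 0 6 13 & ta 4 11 0 15 6 & ta 4 11 2 13 12 & ta 4 13 2 11 3 & ta 4 13 3 11 8 & ta
    6 0 4 9 8 & ta 6 0 4 11 15 & ta 6 0 4 13 8 & ta 6 0 4 15 13 & ta 6 1 0 4 9 & ta 6 1 0 8 4 & ta 6
    2 0 4 13 & ta 6 2 1 8 4 & ta 6 2 4 15 8 & ta 6 11 0 2 4 & ta 6 11 0 4 13 & ta 6 11 2 4 13 & ta 6
    13 0 4 11 & ta 6 13 0 4 15 & ta 6 13 0 8 4 & ta 6 13 4 11 15 & ta 8 0 4 13 11 & ta 8 4 0 13 6 &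
    ta 9 6 1 4 8 & ta 11 0 2 15 6 & ta 11 0 6 15 13 & ta 11 2 4 12 13 & ta 11 4 0 13 2 & ta 11 4 0
    13 6 & ta 11 4 2 13 6 & ta 11 4 2 15 13 & ta 11 6 0 13 4 & ta 11 6 2 13 4 & ta 11 6 4 15 13 & ta
    12 13 2 4 11 & ta 13 0 4 6 8 & ta 13 0 6 8 11 & ta 13 2 0 11 15 & ta 13 4 0 11 6 & ta 13 6 0 4 8
    & ta 13 6 0 11 4 & ta 13 11 0 4 15 & ta 13 11 0 6 15 & ta 13 11 2 4 15 & ta 13 15 0 4 6 & ta 15
    13 2 4 11"
"xa 0 1 4 6 & xa 0 2 4 6 & xa 0 2 11 13 & xa 0 6 1 9 & xa 0 6 2 11 & xa 0 6 11 13 & xa 0 6 13 15 &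
    xa 0 13 4 6 & xa 0 13 4 8 & xa 0 13 6 8 & xa 0 13 11 15 & xa 0 15 4 6 & xa 1 2 6 8 & xa 1 9 4 6
    & xa 1 9 4 8 & xa 2 4 6 8 & xa 2 4 11 12 & xa 2 4 11 13 & xa 2 4 11 15 & xa 2 4 12 13 & xa 2 4
    13 15 & xa 2 11 4 6 & xa 2 15 4 6 & xa 2 15 4 8 & xa 2 15 6 8 & xa 4 6 11 13 & xa 4 6 11 15 & xa
    4 6 13 15 & xa 4 8 11 13"
"fa 0 13 6 4 8 & fa 2 4 11 12 13 & fa 2 4 13 11 12 & fa 4 6 11 13 15 & fa 4 6 13 0 11 & fa 4 6 13 11
    15 & fa 11 13 4 2 8 & fa 11 13 4 6 8"
"na 15 13 11 4 & ca 1 2 0 9 & ca 11 2 12 13 & ca 2 0 11 4 & ca 0 2 6 13 & na 15 0 13 6 & na 8 4 6 13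
    & na 8 2 4 15"
  subgoal by (intro conjI int_ax)
  subgoal by (intro conjI trans_ax)
  subgoal by (intro conjI opp_ax)
  subgoal by (intro conjI fan_ax; simp add: sum_adj_edges del: One_nat_def)
  subgoal by (intro conjI inside_ax cyc_ax)
  done

lemma layout7:
  "~ opposite Q 1 9 4 6 & ~ opposite Q 2 4 11 13 & ~ opposite Q 4 6 11 13 & ~
    opposite Q 0 13 4 6 & ~ opposite Q 2 15 4 6 & ~ inside Q 15 13 11 4"
  using layout7_instances[simplified ax_defs norm16] layout_facts layout1 layout2 layout3 layout4 layout5 layout6 by sat

lemma layout8_instances:
"ia 0 2 8 11 & ia 0 2 8 15 & ia 0 2 11 15 & ia 0 4 8 15 & ia 0 4 15 8 & ia 0 6 11 8 & ia 0 6 13 8 &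
    ia 0 6 15 8 & ia 0 8 11 13 & ia 0 8 13 11 & ia 2 4 8 15 & ia 2 6 15 11 & ia 4 6 8 11 & ia 4 6 8
    15 & ia 4 6 11 15 & ia 4 6 13 15 & ia 4 6 15 11 & ia 4 6 15 13 & ia 4 8 11 13 & ia 4 8 11 15 &
    ia 4 8 13 11 & ia 4 8 13 15 & ia 4 8 15 11 & ia 4 8 15 13 & ia 6 8 11 15 & ia 6 8 15 11 & ia 8
    11 13 15"
"ta 0 2 6 13 8 & ta 0 6 4 13 15 & ta 0 8 6 15 11 & ta 0 11 2 8 13 & ta 0 11 2 8 15 & ta 0 13 2 8 11
    & ta 0 13 2 8 15 & ta 0 13 4 15 6 & ta 0 13 4 15 8 & ta 2 15 4 6 11 & ta 4 11 2 6 15 & ta 4 11 6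
    8 15 & ta 4 11 8 13 15 & ta 4 13 0 6 15 & ta 4 13 8 11 15 & ta 4 15 0 6 13 & ta 4 15 0 8 13 & ta
    4 15 2 6 11 & ta 4 15 6 8 11 & ta 6 0 7 8 13 & ta 6 8 4 11 15 & ta 6 8 4 15 11 & ta 6 11 0 8 15
    & ta 6 11 2 4 15 & ta 6 13 0 4 15 & ta 6 15 0 4 13 & ta 6 15 0 8 11 & ta 6 15 2 4 11 & ta 8 0 2
    4 15 & ta 8 11 2 4 13 & ta 8 11 4 13 15 & ta 8 13 2 4 15 & ta 8 13 4 11 15 & ta 8 15 0 2 4 & ta
    8 15 0 4 13 & ta 11 0 2 13 8 & ta 11 0 2 15 13 & ta 11 2 0 8 15 & ta 11 2 4 15 8 & ta 11 4 2 15
    6 & ta 11 4 2 15 8 & ta 11 4 6 15 8 & ta 11 4 8 15 13 & ta 11 6 0 15 8 & ta 11 6 2 15 4 & ta 11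
    8 0 15 6 & ta 11 8 4 6 15 & ta 11 8 4 15 13 & ta 13 6 0 8 7 & ta 15 4 0 13 6 & ta 15 4 0 13 8 &
    ta 15 4 6 11 8 & ta 15 6 0 11 8 & ta 15 6 0 13 4 & ta 15 8 0 4 2 & ta 15 8 0 11 2 & ta 15 8 0 11
    6 & ta 15 8 0 13 4 & ta 15 8 0 13 11 & ta 15 8 4 6 11 & ta 15 13 2 8 11 & ta 15 13 4 11 8"
"xa 0 2 11 13 & xa 0 2 13 15 & xa 0 6 11 15 & xa 0 6 13 15 & xa 0 8 2 11 & xa 0 8 2 15 & xa 0 8 11
    13 & xa 0 8 11 15 & xa 0 8 13 15 & xa 0 13 2 8 & xa 0 13 4 6 & xa 0 13 4 8 & xa 0 13 6 7 & xa 0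
    13 6 8 & xa 0 13 7 8 & xa 0 13 11 15 & xa 0 15 4 6 & xa 0 15 4 8 & xa 2 4 11 15 & xa 2 4 13 15 &
    xa 2 8 11 15 & xa 2 8 13 15 & xa 2 11 4 6 & xa 2 11 4 8 & xa 2 11 13 15 & xa 2 15 4 6 & xa 2 15
    4 8 & xa 4 6 11 15 & xa 4 6 13 15 & xa 4 8 11 13 & xa 4 8 11 15 & xa 4 8 13 15 & xa 6 8 11 15"
"fa 0 13 6 7 8 & fa 0 13 8 6 7 & fa 4 8 11 13 15 & fa 4 8 13 11 15 & fa 11 15 8 4 6"
"na 15 11 2 6 & na 15 11 2 4 & na 15 0 13 6 & na 15 0 13 4 & na 8 0 2 13 & na 15 13 11 8 & na 8 2 4
    11 & na 15 13 11 4 & na 8 4 6 11 & na 8 4 6 15 & ca 0 2 6 13 & na 8 2 4 13 & na 8 6 0 11 & na 8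
    6 0 15"
  subgoal by (intro conjI int_ax)
  subgoal by (intro conjI trans_ax)
  subgoal by (intro conjI opp_ax)
  subgoal by (intro conjI fan_ax; simp add: sum_adj_edges del: One_nat_def)
  subgoal by (intro conjI inside_ax cyc_ax)
  done

lemma layout8:
  "~ opposite Q 4 6 11 15 & ~ opposite Q 4 6 13 15 & ~ opposite Q 0 8 11 13 & ~
    opposite Q 4 8 11 13 & ~ opposite Q 0 15 4 8 & ~ opposite Q 4 8 11 15 & ~ opposite Q 4 8 13 15 &
    ~ opposite Q 0 13 6 8 & ~ opposite Q 6 8 11 15"
  using layout8_instances[simplified ax_defs norm16] layout_facts layout1 layout2 layout3 layout4 layout5 layout6 layout7 by sat

lemma layout9_instances:
"ia 0 1 5 9 & ia 0 1 7 6 & ia 0 2 4 9 & ia 0 2 8 4 & ia 0 2 8 6 & ia 0 4 5 6 & ia 0 4 6 9 & ia 0 4 8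
    6 & ia 0 6 11 8 & ia 1 4 5 9 & ia 1 5 7 6 & ia 6 8 11 13 & ia 6 8 11 15 & ia 6 8 13 11 & ia 6 11
    13 15 & ia 8 11 13 15"
"ta 0 2 1 8 4 & ta 0 2 1 8 5 & ta 0 2 1 8 6 & ta 0 4 1 5 6 & ta 0 5 1 6 9 & ta 0 11 2 8 15 & ta 0 11
    8 13 15 & ta 1 0 5 6 9 & ta 1 4 0 9 5 & ta 1 5 0 9 4 & ta 1 9 2 3 5 & ta 1 9 2 5 6 & ta 2 4 0 9
    5 & ta 2 8 0 6 1 & ta 2 8 0 15 11 & ta 4 0 1 5 9 & ta 4 0 2 5 8 & ta 4 6 0 1 5 & ta 4 6 0 5 8 &
    ta 4 6 0 9 5 & ta 4 6 1 5 8 & ta 5 0 4 6 8 & ta 5 8 1 3 4 & ta 6 0 1 4 9 & ta 6 0 1 5 4 & ta 6 0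
    1 8 4 & ta 6 2 1 8 4 & ta 6 2 4 13 8 & ta 6 11 8 13 15 & ta 6 13 2 8 11 & ta 8 0 1 2 4 & ta 8 5
    1 6 7 & ta 8 11 0 2 6 & ta 8 11 2 4 6 & ta 8 13 6 11 15 & ta 9 1 0 4 6 & ta 9 2 1 4 5 & ta 9 5 1
    4 6 & ta 11 6 0 13 8 & ta 11 6 4 13 8 & ta 11 6 8 15 13 & ta 11 8 6 15 13 & ta 13 8 0 11 6 & ta
    15 8 0 11 2 & ta 15 13 6 11 8"
"xa 0 1 4 6 & xa 0 1 5 6 & xa 0 2 4 5 & xa 0 6 11 13 & xa 0 8 2 15 & xa 0 8 11 15 & xa 0 9 4 5 & xa
    0 9 5 6 & xa 0 13 11 15 & xa 1 9 4 5 & xa 1 9 4 6 & xa 2 4 6 8 & xa 2 8 11 15 & xa 2 11 6 8 & xa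
    4 6 11 13 & xa 6 8 11 13 & xa 6 8 11 15 & xa 6 8 13 15"
"fa 4 5 9 0 1"
"ra 1 9 3 2 0 8 & ra 3 1 5 8 2 4 & ra 5 6 4 9 0 1 & ra 7 1 5 8 0 6"
"ca 1 2 0 9 & ca 7 0 1 8 & ca 5 6 7 8 & ca 6 0 5 4 & ca 1 2 3 8 & ca 8 0 4 5 & ca 3 4 5 8 & na 15 13
    11 8 & na 15 13 11 6 & na 8 4 6 11"
  subgoal by (intro conjI int_ax)
  subgoal by (intro conjI trans_ax)
  subgoal by (intro conjI opp_ax)
  subgoal by (intro conjI fan_ax; simp add: sum_adj_edges del: One_nat_def)
  subgoal by (intro conjI rot_ax; simp add: sum_adj_edges del: One_nat_def)
  subgoal by (intro conjI inside_ax cyc_ax)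
  done

lemma layout9:
  "~ opposite Q 1 9 4 5 & ~ opposite Q 6 8 11 13"
  using layout9_instances[simplified ax_defs norm16] layout_facts layout2 layout3 layout6 layout7 layout8 by sat

lemma layout0_instances:
  "na 8 0 2 4 & na 8 0 2 6 & na 8 0 2 15 & na 8 2 4 0 & na 8 2 4 6 & na 8 4
    6 0 & na 8 4 6 2 & na 8 6 0 2 & na 8 6 0 4 & na 15 2 0 8 & na 15 2 0 11 & na 15 2 0 13 & na 15
    11 2 0 & na 15 11 2 13 & na 15 13 11 0 & na 15 13 11 2 & na 15 0 13 2 & na 15 0 13 11 & ca 0 2 8
    7 & ca 0 2 14 15 & ca 1 2 8 7 & ca 2 0 15 10 & ca 2 0 3 8 & ca 3 4 8 1 & ca 4 6 8 3 & ca 5 6 8 3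
    & ca 6 0 8 5 & ca 7 0 8 5 & ca 8 0 1 2 & ca 8 0 2 3 & ca 8 0 5 6 & ca 8 0 6 7 & ca 9 0 15 10 &
    ca 10 2 15 12 & ca 11 2 15 12 & ca 12 11 15 14 & ca 13 11 15 14 & ca 14 13 15 9 & ca 15 14 13 12
    & ca 15 14 12 11 & ca 15 14 2 9 & ca 15 14 9 0"
  by (intro conjI inside_ax cyc_ax)

text \<open>These facts need no axiom: they follow from the signs of the two pictures and the
  definitions of \<open>inside\<close> and \<open>cyc\<close>.\<close>

lemma layout0:
  "~ inside Q 8 0 2 4 & ~ inside Q 8 0 2 6 & ~ inside Q 8 0 2 15 & ~ inside Q 8 2 4 0
    & ~ inside Q 8 2 4 6 & ~ inside Q 8 4 6 0 & ~ inside Q 8 4 6 2 & ~ inside Q 8 6 0 2 & ~ inside Q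
    8 6 0 4 & ~ inside Q 15 2 0 8 & ~ inside Q 15 2 0 11 & ~ inside Q 15 2 0 13 & ~ inside Q 15 11 2
    0 & ~ inside Q 15 11 2 13 & ~ inside Q 15 13 11 0 & ~ inside Q 15 13 11 2 & ~ inside Q 15 0 13 2
    & ~ inside Q 15 0 13 11 & cyc Q 0 2 8 7 & cyc Q 0 2 14 15 & cyc Q 1 2 8 7 & cyc Q 2 0 15 10 &
    cyc Q 2 0 3 8 & cyc Q 3 4 8 1 & cyc Q 4 6 8 3 & cyc Q 5 6 8 3 & cyc Q 6 0 8 5 & cyc Q 7 0 8 5 &
    cyc Q 8 0 1 2 & cyc Q 8 0 2 3 & cyc Q 8 0 5 6 & cyc Q 8 0 6 7 & cyc Q 9 0 15 10 & cyc Q 10 2 15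
    12 & cyc Q 11 2 15 12 & cyc Q 12 11 15 14 & cyc Q 13 11 15 14 & cyc Q 14 13 15 9 & cyc Q 15 14
    13 12 & cyc Q 15 14 12 11 & cyc Q 15 14 2 9 & cyc Q 15 14 9 0"
  using layout0_instances[simplified ax_defs norm16] layout_facts by sat

end

section \<open>From angles to signs of turns\<close>

section \<open>Cyclic orders of directions\<close>

lemma orient_zero_eq_Im: "orient 0 a b = Im (cnj a * b)"
  by (simp add: orient_def)

lemma orient_divide:
  assumes "a \<noteq> 0"
  shows "orient 0 a b = (cmod a)\<^sup>2 * Im (b / a)"
    and "orient 0 b c = (cmod a)\<^sup>2 * orient 0 (b / a) (c / a)"
proof -
  have 1: "b = a * (b / a)" "c = a * (c / a)" using assms by auto
  have n: "(cmod a)\<^sup>2 = Re a * Re a + Im a * Im a"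
    by (simp only: cmod_power2) (simp only: power2_eq_square)
  have m: "orient 0 (a * u) (a * v) = (cmod a)\<^sup>2 * orient 0 u v" for u v
    by (simp add: n orient_def algebra_simps)
  then show "orient 0 b c = (cmod a)\<^sup>2 * orient 0 (b / a) (c / a)"
    using 1 by metis
  have "orient 0 (a * 1) (a * (b / a)) = (cmod a)\<^sup>2 * Im (b / a)"
    unfolding m by (simp add: orient_def)
  then show "orient 0 a b = (cmod a)\<^sup>2 * Im (b / a)" using assms by simp
qed

lemma zero_less_scale_iff: "0 < (k::real) \<Longrightarrow> 0 < k * x \<longleftrightarrow> 0 < x"
  by (simp add: zero_less_mult_iff)

text \<open>Three directions are in counterclockwise order iff at least two of the three successive
  turns are left turns; this also covers opposite directions.\<close>

definition ccw3 :: "complex \<Rightarrow> complex \<Rightarrow> complex \<Rightarrow> bool" where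
  "ccw3 a b c \<longleftrightarrow>
     (0 < orient 0 a b \<and> 0 < orient 0 b c) \<or> (0 < orient 0 b c \<and> 0 < orient 0 c a) \<or>
     (0 < orient 0 c a \<and> 0 < orient 0 a b)"

lemma ccw3_angles:
  fixes \<beta> \<gamma> :: real
  assumes "0 \<le> \<beta>" "\<beta> < 2 * pi" "0 \<le> \<gamma>" "\<gamma> < 2 * pi"
  shows "0 < \<beta> \<and> \<beta> < \<gamma> \<longleftrightarrow>
     (0 < sin \<beta> \<and> 0 < sin (\<gamma> - \<beta>)) \<or> (0 < sin (\<gamma> - \<beta>) \<and> sin \<gamma> < 0) \<or> (sin \<gamma> < 0 \<and> 0 < sin \<beta>)"
proof -
  have pos: "0 < sin x \<longleftrightarrow> (0 < x \<and> x < pi)" if "0 \<le> x" "x < 2 * pi" for x :: real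
    using that sin_gt_zero[of x] sin_ge_zero[of "x - pi"] sin_le_zero[of x]
    by (cases "x < pi"; cases "x = 0") auto
  have neg: "sin x < 0 \<longleftrightarrow> pi < x" if "0 \<le> x" "x < 2 * pi" for x :: real
    using that sin_lt_zero[of x] sin_ge_zero[of x] by (cases "x \<le> pi") auto
  have dif: "0 < sin (\<gamma> - \<beta>) \<longleftrightarrow> (0 < \<gamma> - \<beta> \<and> \<gamma> - \<beta> < pi) \<or> \<gamma> - \<beta> < - pi"
  proof (cases "\<beta> \<le> \<gamma>")
    case True
    then show ?thesis using pos[of "\<gamma> - \<beta>"] assms by auto
  next
    case False
    have "sin (\<gamma> - \<beta>) = - sin (\<beta> - \<gamma>)" by (metis minus_diff_eq sin_minus)
    then show ?thesis using neg[of "\<beta> - \<gamma>"] assms False by auto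
  qed
  show ?thesis unfolding dif pos[OF assms(1,2)] neg[OF assms(3,4)] using assms by linarith
qed

text \<open>With \<beta> and \<gamma> the angles of b and c measured from a, the three turns have
  the signs of sin \<beta>, sin (\<gamma> - \<beta>) and -sin \<gamma>. This replaces the angles in
  the definition of rotations by orientations.\<close>

lemma ccw3_Arg2pi:
  assumes "a \<noteq> 0" "b \<noteq> 0" "c \<noteq> 0"
  shows "0 < Arg2pi (b / a) \<and> Arg2pi (b / a) < Arg2pi (c / a) \<longleftrightarrow> ccw3 a b c"
proof -
  define \<beta> \<gamma> where "\<beta> = Arg2pi (b / a)" and "\<gamma> = Arg2pi (c / a)"
  have r: "0 < cmod (b / a)" "0 < cmod (c / a)" "0 < (cmod a)\<^sup>2" using assms by auto
  have sb: "Im (b / a) = cmod (b / a) * sin \<beta>" "Re (b / a) = cmod (b / a) * cos \<beta>"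
    "Im (c / a) = cmod (c / a) * sin \<gamma>" "Re (c / a) = cmod (c / a) * cos \<gamma>"
    by (simp_all only: \<beta>_def \<gamma>_def sin_Arg2pi cos_Arg2pi)
  have 1: "0 < orient 0 a b \<longleftrightarrow> 0 < sin \<beta>"
    unfolding orient_divide(1)[OF assms(1)] sb using r by (simp add: zero_less_mult_iff)
  have "orient 0 c a = - orient 0 a c" by (simp add: orient_def)
  then have 2: "0 < orient 0 c a \<longleftrightarrow> sin \<gamma> < 0"
    unfolding orient_divide(1)[OF assms(1)] sb using r by (simp add: mult_less_0_iff)
  have "orient 0 (b / a) (c / a) = cmod (b / a) * cmod (c / a) * sin (\<gamma> - \<beta>)"
    unfolding orient_def diff_zero sb sin_diff by (simp add: algebra_simps)
  then have 3: "0 < orient 0 b c \<longleftrightarrow> 0 < sin (\<gamma> - \<beta>)"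
    unfolding orient_divide(2)[OF assms(1), of b c]
    by (simp only: zero_less_scale_iff[OF r(3)] zero_less_scale_iff[OF mult_pos_pos[OF r(1,2)]])
  have "0 \<le> \<beta>" "\<beta> < 2 * pi" "0 \<le> \<gamma>" "\<gamma> < 2 * pi"
    by (simp_all add: \<beta>_def \<gamma>_def Arg2pi_ge_0 Arg2pi_lt_2pi)
  from ccw3_angles[OF this] show ?thesis
    unfolding ccw3_def 1 2 3 \<beta>_def[symmetric] \<gamma>_def[symmetric] by blast
qed

lemma Arg2pi_divide':
  assumes "x \<noteq> 0" "y \<noteq> 0"
  shows "Arg2pi (y / x) = (if Arg2pi x \<le> Arg2pi y then Arg2pi y - Arg2pi x else Arg2pi y - Arg2pi x + 2 * pi)"
  using Arg2pi_diff[of y x] assms by (auto split: if_splits)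

text \<open>If the directions \<open>d 0, d 1, \<dots>\<close> occur in this order when turning around once from \<open>d 0\<close>,
  then the cyclic order of any three of them is that of their indices.\<close>

lemma ccw3_sorted:
  fixes d :: "nat \<Rightarrow> complex"
  assumes nz: "\<And>i. i < n \<Longrightarrow> d i \<noteq> 0"
    and steps: "\<And>i. 0 < i \<Longrightarrow> Suc i < n \<Longrightarrow> ccw3 (d 0) (d i) (d (Suc i))"
    and n: "2 < n"
    and ijk: "i < n" "j < n" "k < n"
  shows "ccw3 (d i) (d j) (d k) \<longleftrightarrow> (i < j \<and> j < k) \<or> (j < k \<and> k < i) \<or> (k < i \<and> i < j)"
proof -
  define \<alpha> where "\<alpha> i = Arg2pi (d i / d 0)" for i
  have \<alpha>0: "\<alpha> 0 = 0" using nz[of 0] n by (simp add: \<alpha>_def Arg2pi_of_real[of 1, simplified])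
  have st: "0 < \<alpha> i \<and> \<alpha> i < \<alpha> (Suc i)" if "0 < i" "Suc i < n" for i
    using steps[OF that] ccw3_Arg2pi[of "d 0" "d i" "d (Suc i)"] nz that by (auto simp: \<alpha>_def)
  have st': "\<alpha> i < \<alpha> (Suc i)" if "Suc i < n" for i
    using st[of i] st[of 1] \<alpha>0 that n by (cases i) auto
  have mono: "\<alpha> i < \<alpha> j" if "i < j" "j < n" for i j
    using that
  proof (induction j)
    case (Suc j)
    then show ?case using st'[of j] by (cases "i = j") (auto intro: less_trans)
  qed simp
  have iff: "\<alpha> i < \<alpha> j \<longleftrightarrow> i < j" "\<alpha> i \<le> \<alpha> j \<longleftrightarrow> i \<le> j" if "i < n" "j < n" for i j
    using mono[of i j] mono[of j i] that by (metis less_asym linorder_less_linear not_le order_less_irrefl)+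
  have bd: "0 \<le> \<alpha> i" "\<alpha> i < 2 * pi" for i by (simp_all add: \<alpha>_def Arg2pi_ge_0 Arg2pi_lt_2pi)
  have dv: "Arg2pi (d b / d a) = (if \<alpha> a \<le> \<alpha> b then \<alpha> b - \<alpha> a else \<alpha> b - \<alpha> a + 2 * pi)"
    if "a < n" "b < n" for a b
  proof -
    have "d b / d a = (d b / d 0) / (d a / d 0)" using nz[of 0] nz that by simp
    then show ?thesis
      using Arg2pi_divide'[of "d a / d 0" "d b / d 0"] nz[of 0] nz that by (simp add: \<alpha>_def)
  qed
  have "ccw3 (d i) (d j) (d k) \<longleftrightarrow> 0 < Arg2pi (d j / d i) \<and> Arg2pi (d j / d i) < Arg2pi (d k / d i)"
    using ccw3_Arg2pi nz ijk by blast
  also have "\<dots> \<longleftrightarrow> (\<alpha> i < \<alpha> j \<and> \<alpha> j < \<alpha> k) \<or> (\<alpha> j < \<alpha> k \<and> \<alpha> k < \<alpha> i) \<or> (\<alpha> k < \<alpha> i \<and> \<alpha> i < \<alpha> j)"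
    unfolding dv[OF ijk(1,2)] dv[OF ijk(1,3)]
    using bd[of i] bd[of j] bd[of k] by (auto split: if_splits)
  also have "\<dots> \<longleftrightarrow> (i < j \<and> j < k) \<or> (j < k \<and> k < i) \<or> (k < i \<and> i < j)"
    using iff ijk by simp
  finally show ?thesis .
qed

lemma ccw3_scale:
  assumes "0 < r" "0 < s" "0 < t"
  shows "ccw3 (r *\<^sub>R a) (s *\<^sub>R b) (t *\<^sub>R c) \<longleftrightarrow> ccw3 a b c"
proof -
  have "0 < orient 0 (r *\<^sub>R a) (s *\<^sub>R b) \<longleftrightarrow> 0 < orient 0 a b" if "0 < r" "0 < s" for r s a b
  proof -
    have "orient 0 (r *\<^sub>R a) (s *\<^sub>R b) = (r * s) * orient 0 a b" by (simp add: orient_def algebra_simps)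
    then show ?thesis by (simp only: zero_less_scale_iff[OF mult_pos_pos[OF that]])
  qed
  then show ?thesis unfolding ccw3_def using assms by simp
qed


section \<open>A combinatorial description of the embedding of a 1-plane drawing\<close>

section \<open>Drawings in which every edge is crossed at most once\<close>

text \<open>Names for the nodes of the planarization that mention no coordinates: a vertex, or the
  pair of crossing edges. Two drawings are compared by means of them.\<close>

type_synonym 'v code = "'v + 'v set set"

definition crossing_point :: "('v \<Rightarrow> complex) \<Rightarrow> 'v set set \<Rightarrow> complex" where
  "crossing_point p S = (THE x. \<forall>e\<in>S. x \<in> edge_interior p e)"

definition node :: "('v \<Rightarrow> complex) \<Rightarrow> 'v code \<Rightarrow> complex" where
  "node p c = (case c of Inl v \<Rightarrow> p v | Inr S \<Rightarrow> crossing_point p S)"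

definition node_codes :: "'v graph \<Rightarrow> ('v \<Rightarrow> complex) \<Rightarrow> 'v code set" where
  "node_codes G p = Inl ` verts G \<union> Inr ` {{e, f} | e f. e \<in> edges G \<and> f \<in> edges G \<and> cross p e f}"

text \<open>When an edge is crossed at most once, it contributes either itself or two halves to the
  planarization.\<close>

definition code_adj :: "'v graph \<Rightarrow> ('v \<Rightarrow> complex) \<Rightarrow> 'v code \<Rightarrow> 'v code \<Rightarrow> bool" where
  "code_adj G p a b \<longleftrightarrow>
     (\<exists>u v. {u, v} \<in> edges G \<and> (\<forall>f\<in>edges G. \<not> cross p {u, v} f) \<and> a = Inl u \<and> b = Inl v) \<or>
     (\<exists>u e f. e \<in> edges G \<and> f \<in> edges G \<and> cross p e f \<and> u \<in> e \<and>
        (a = Inl u \<and> b = Inr {e, f} \<or> a = Inr {e, f} \<and> b = Inl u))"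

lemma edge_segment_pair: "edge_segment p {u, v} = closed_segment (p u) (p v)"
  by (simp add: edge_segment_def segment_convex_hull)

lemma edge_interior_pair: "edge_interior p {u, v} = open_segment (p u) (p v)"
  by (simp add: edge_interior_def edge_segment_pair open_segment_def)

lemma cross_sym: "cross p e f \<longleftrightarrow> cross p f e"
  by (auto simp: cross_def)

locale one_plane =
  fixes G :: "'v graph" and p :: "'v \<Rightarrow> complex"
  assumes drawing: "straight_line_drawing G p"
    and edge_ends: "e \<in> edges G \<Longrightarrow> \<exists>u v. e = {u, v} \<and> u \<noteq> v \<and> u \<in> verts G \<and> v \<in> verts G"
    and crossed_once: "\<lbrakk>e \<in> edges G; f \<in> edges G; g \<in> edges G; cross p e f; cross p e g\<rbrakk> \<Longrightarrow> f = g"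
begin

lemma p_eq_iff: "u \<in> verts G \<Longrightarrow> v \<in> verts G \<Longrightarrow> p u = p v \<longleftrightarrow> u = v"
  using drawing by (auto simp: straight_line_drawing_def inj_on_eq_iff)

lemma edge_verts: "e \<in> edges G \<Longrightarrow> u \<in> e \<Longrightarrow> u \<in> verts G"
  using edge_ends[of e] by auto

lemma not_in_edge: "e \<in> edges G \<Longrightarrow> v \<in> verts G \<Longrightarrow> v \<notin> e \<Longrightarrow> p v \<notin> edge_segment p e"
  using drawing unfolding straight_line_drawing_def by blast

lemma vertex_not_interior: "e \<in> edges G \<Longrightarrow> v \<in> verts G \<Longrightarrow> p v \<notin> edge_interior p e"
  using not_in_edge by (auto simp: edge_interior_def)

text \<open>Two common points would give a common segment, hence an overlap.\<close>

lemma interiors_meet_once: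
  assumes "e \<in> edges G" "f \<in> edges G" "e \<noteq> f"
    "x \<in> edge_interior p e" "x \<in> edge_interior p f" "y \<in> edge_interior p e" "y \<in> edge_interior p f"
  shows "x = y"
proof (rule ccontr)
  assume "x \<noteq> y"
  have "closed_segment x y \<subseteq> edge_segment p g" if "x \<in> edge_interior p g" "y \<in> edge_interior p g" for g
    using that unfolding edge_interior_def edge_segment_def
    by (intro closed_segment_subset) (auto simp: convex_convex_hull)
  then have "overlap p e f" unfolding overlap_def using assms \<open>x \<noteq> y\<close> by blast
  then show False using drawing assms unfolding straight_line_drawing_def by blast
qed

lemma crossing_point:
  assumes "e \<in> edges G" "f \<in> edges G" "cross p e f"
  shows "crossing_point p {e, f} \<in> edge_interior p e" "crossing_point p {e, f} \<in> edge_interior p f"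
    and "x \<in> edge_interior p e \<Longrightarrow> x \<in> edge_interior p f \<Longrightarrow> x = crossing_point p {e, f}"
proof -
  obtain m where m: "m \<in> edge_interior p e" "m \<in> edge_interior p f" and ne: "e \<noteq> f"
    using assms(3) by (auto simp: cross_def)
  have u: "y = m" if "y \<in> edge_interior p e" "y \<in> edge_interior p f" for y
    using interiors_meet_once[OF assms(1,2) ne that m] .
  have "crossing_point p {e, f} = m"
    unfolding crossing_point_def
  proof (rule the_equality)
    show "\<forall>g\<in>{e, f}. m \<in> edge_interior p g" using m by blast
    show "y = m" if "\<forall>g\<in>{e, f}. y \<in> edge_interior p g" for y using u that by blast
  qed
  then show "crossing_point p {e, f} \<in> edge_interior p e" "crossing_point p {e, f} \<in> edge_interior p f"
    and "x \<in> edge_interior p e \<Longrightarrow> x \<in> edge_interior p f \<Longrightarrow> x = crossing_point p {e, f}"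
    using m u[of x] by simp_all
qed

text \<open>A third edge through the common point of e and f would be a second edge that crosses
  e.\<close>

lemma interior_in_three:
  assumes "e \<in> edges G" "f \<in> edges G" "g \<in> edges G" "e \<noteq> f"
    "x \<in> edge_interior p e" "x \<in> edge_interior p f" "x \<in> edge_interior p g"
  shows "g = e \<or> g = f"
proof (rule ccontr)
  assume *: "\<not> (g = e \<or> g = f)"
  then have "cross p e f" "cross p e g" using assms by (auto simp: cross_def)
  then show False using crossed_once assms * by blast
qed

lemma nodes_eq: "planarization_nodes G p = node p ` node_codes G p"
proof -
  have "crossing_points G p = crossing_point p ` {{e, f} | e f. e \<in> edges G \<and> f \<in> edges G \<and> cross p e f}"
  proof (intro equalityI subsetI)
    fix x assume "x \<in> crossing_points G p"
    then obtain e f where ef: "e \<in> edges G" "f \<in> edges G" "f \<noteq> e" "x \<in> edge_interior p e" "x \<in> edge_interior p f"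
      by (auto simp: crossing_points_def)
    then have c: "cross p e f" by (auto simp: cross_def)
    then have "x = crossing_point p {e, f}" using crossing_point(3) ef by blast
    then show "x \<in> crossing_point p ` {{e, f} | e f. e \<in> edges G \<and> f \<in> edges G \<and> cross p e f}"
      using ef c by blast
  next
    fix x assume "x \<in> crossing_point p ` {{e, f} | e f. e \<in> edges G \<and> f \<in> edges G \<and> cross p e f}"
    then obtain e f where ef: "e \<in> edges G" "f \<in> edges G" "cross p e f" "x = crossing_point p {e, f}" by blast
    then have "f \<noteq> e" by (auto simp: cross_def)
    then show "x \<in> crossing_points G p"
      unfolding crossing_points_def using crossing_point(1,2)[OF ef(1-3)] ef by auto
  qed
  then show ?thesis
    unfolding planarization_nodes_def node_codes_def image_Un image_image by (simp add: node_def)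
qed

lemma node_inj: "inj_on (node p) (node_codes G p)"
proof (rule inj_onI)
  fix a b assume a: "a \<in> node_codes G p" and b: "b \<in> node_codes G p" and eq: "node p a = node p b"
  have A: False if "v \<in> verts G" "e \<in> edges G" "f \<in> edges G" "cross p e f" "p v = crossing_point p {e, f}" for v e f
    using crossing_point(1)[OF that(2-4)] vertex_not_interior[OF that(2,1)] that(5) by simp
  have B: "{e, f} = {g, h}"
    if e: "e \<in> edges G" "f \<in> edges G" "cross p e f" and g: "g \<in> edges G" "h \<in> edges G" "cross p g h"
      and x: "crossing_point p {e, f} = crossing_point p {g, h}" for e f g h
  proof -
    have ne: "e \<noteq> f" "g \<noteq> h" using e g by (auto simp: cross_def)
    have "g = e \<or> g = f" "h = e \<or> h = f"
      using interior_in_three[OF e(1,2) g(1) ne(1) crossing_point(1,2)[OF e]]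
        interior_in_three[OF e(1,2) g(2) ne(1) crossing_point(1,2)[OF e]] crossing_point(1,2)[OF g]
      by (simp_all add: x)
    then show ?thesis using ne by auto
  qed
  consider (VV) u v where "a = Inl u" "b = Inl v" "u \<in> verts G" "v \<in> verts G"
    | (VC) u S where "a = Inl u" "b = Inr S" | (CV) u S where "b = Inl u" "a = Inr S"
    | (CC) S T where "a = Inr S" "b = Inr T"
    using a b by (auto simp: node_codes_def)
  then show "a = b"
  proof cases
    case VV then show ?thesis using eq p_eq_iff by (simp add: node_def)
  next
    case VC
    then obtain e f where "S = {e, f}" "e \<in> edges G" "f \<in> edges G" "cross p e f" "u \<in> verts G"
      using a b by (auto simp: node_codes_def)
    then show ?thesis using A[of u e f] VC eq by (simp add: node_def)
  next
    case CV
    then obtain e f where "S = {e, f}" "e \<in> edges G" "f \<in> edges G" "cross p e f" "u \<in> verts G"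
      using a b by (auto simp: node_codes_def)
    then show ?thesis using A[of u e f] CV eq by (simp add: node_def)
  next
    case CC
    then obtain e f g h where "S = {e, f}" "e \<in> edges G" "f \<in> edges G" "cross p e f"
      "T = {g, h}" "g \<in> edges G" "h \<in> edges G" "cross p g h"
      using a b by (auto simp: node_codes_def)
    then show ?thesis using CC B eq by (simp add: node_def)
  qed
qed

lemma node_on_edge:
  assumes x: "x \<in> planarization_nodes G p" and e: "e \<in> edges G" and xe: "x \<in> edge_segment p e"
  shows "(\<exists>u\<in>e. x = p u) \<or> (\<exists>f\<in>edges G. cross p e f \<and> x = crossing_point p {e, f})"
proof (cases "x \<in> p ` verts G")
  case True
  then show ?thesis using not_in_edge[OF e] xe by blast
next
  case False
  then obtain f g where fg: "f \<in> edges G" "g \<in> edges G" "g \<noteq> f" "x \<in> edge_interior p f" "x \<in> edge_interior p g"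
    using x by (auto simp: planarization_nodes_def crossing_points_def)
  have xi: "x \<in> edge_interior p e"
    using xe False edge_verts[OF e] by (auto simp: edge_interior_def)
  have c: "cross p f g" "cross p g f" using fg by (auto simp: cross_def)
  have "e = f \<or> e = g" using interior_in_three[OF fg(1,2) e fg(3)[symmetric] fg(4,5) xi] .
  then show ?thesis
    using crossing_point(3)[OF fg(1,2) c(1) fg(4,5)] crossing_point(3)[OF fg(2,1) c(2) fg(5,4)] c fg by blast
qed

lemma code_adj_imp_adj:
  assumes "code_adj G p a b"
  shows "planarization_adj G p (node p a) (node p b)"
proof -
  have nodesI: "c \<in> node_codes G p \<Longrightarrow> node p c \<in> planarization_nodes G p" for c
    by (simp add: nodes_eq)
  have half: "planarization_adj G p (p u) (crossing_point p {e, f})"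
    if e: "e \<in> edges G" "f \<in> edges G" "cross p e f" and u: "u \<in> e" for u e f
  proof -
    obtain w where w: "e = {u, w}" "u \<noteq> w" "u \<in> verts G" "w \<in> verts G" using edge_ends[OF e(1)] u by auto
    let ?c = "crossing_point p {e, f}"
    have c: "?c \<in> open_segment (p u) (p w)" using crossing_point(1)[OF e] w by (simp add: edge_interior_pair)
    have cl: "?c \<in> closed_segment (p u) (p w)" "?c \<noteq> p u" using c by (auto simp: open_segment_def)
    have "z \<notin> planarization_nodes G p" if z: "z \<in> open_segment (p u) ?c" for z
    proof
      assume zn: "z \<in> planarization_nodes G p"
      have "z \<in> closed_segment (p u) ?c" using z by (auto simp: open_segment_def)
      then have "z \<in> edge_segment p e"
        unfolding w edge_segment_pair using cl subset_closed_segment[of "p u" ?c "p u" "p w"] w by auto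
      then have "(\<exists>v\<in>e. z = p v) \<or> (\<exists>f\<in>edges G. cross p e f \<and> z = crossing_point p {e, f})"
        by (rule node_on_edge[OF zn e(1)])
      then have "z = p u \<or> z = p w \<or> z = ?c" using w crossed_once[OF e(1,2) _ e(3)] by blast
      moreover have "z \<noteq> p u" "z \<noteq> ?c" using z by (auto simp: open_segment_def)
      \<comment> \<open>Distances from \<open>p u\<close> increase along the edge: z comes before
        the crossing, and the crossing before \<open>p w\<close>.\<close>
      moreover have "z \<noteq> p w"
        using dist_in_open_segment[OF z] dist_in_open_segment[OF c] by (auto simp: dist_commute)
      ultimately show False by blast
    qed
    moreover have "p u \<in> edge_segment p e" "?c \<in> edge_segment p e" using cl w by (auto simp: edge_segment_pair)
    moreover have "p u \<in> planarization_nodes G p" "?c \<in> planarization_nodes G p"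
      using nodesI[of "Inl u"] nodesI[of "Inr {e, f}"] w e by (auto simp: node_codes_def node_def)
    ultimately show ?thesis unfolding planarization_adj_def using cl e by (auto intro!: bexI[of _ e])
  qed
  have sym: "planarization_adj G p y x" if "planarization_adj G p x y" for x y
    using that unfolding planarization_adj_def by (auto simp: open_segment_commute)
  from assms show ?thesis
    unfolding code_adj_def
  proof (elim disjE exE conjE)
    fix u v assume e: "{u, v} \<in> edges G" and un: "\<forall>f\<in>edges G. \<not> cross p {u, v} f" and ab: "a = Inl u" "b = Inl v"
    have uv: "u \<noteq> v" "u \<in> verts G" "v \<in> verts G" using edge_ends[OF e] by (auto simp: doubleton_eq_iff)
    have "z \<notin> planarization_nodes G p" if z: "z \<in> open_segment (p u) (p v)" for z
    proof
      assume "z \<in> planarization_nodes G p"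
      moreover have "z \<in> edge_segment p {u, v}" using z by (auto simp: edge_segment_pair open_segment_def)
      ultimately have "z = p u \<or> z = p v" using node_on_edge[OF _ e] un by blast
      then show False using z by (auto simp: open_segment_def)
    qed
    moreover have "p u \<noteq> p v" using p_eq_iff uv by blast
    moreover have "p u \<in> planarization_nodes G p" "p v \<in> planarization_nodes G p"
      using nodesI[of "Inl u"] nodesI[of "Inl v"] uv by (auto simp: node_codes_def node_def)
    ultimately have "planarization_adj G p (p u) (p v)"
      unfolding planarization_adj_def using e by (auto simp: edge_segment_pair intro!: bexI[OF _ e])
    then show ?thesis by (simp add: ab node_def)
  next
    fix u e f assume "e \<in> edges G" "f \<in> edges G" "cross p e f" "u \<in> e" "a = Inl u" "b = Inr {e, f}"
    then show ?thesis using half[of e f u] by (simp add: node_def)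
  next
    fix u e f assume "e \<in> edges G" "f \<in> edges G" "cross p e f" "u \<in> e" "a = Inr {e, f}" "b = Inl u"
    then show ?thesis using sym[OF half[of e f u]] by (simp add: node_def)
  qed
qed

lemma adj_imp_code_adj:
  assumes a: "a \<in> node_codes G p" and b: "b \<in> node_codes G p"
    and adj: "planarization_adj G p (node p a) (node p b)"
  shows "code_adj G p a b"
proof -
  obtain e where e: "e \<in> edges G" "node p a \<in> edge_segment p e" "node p b \<in> edge_segment p e"
    and ne: "node p a \<noteq> node p b" and between: "open_segment (node p a) (node p b) \<inter> planarization_nodes G p = {}"
    and ab: "node p a \<in> planarization_nodes G p" "node p b \<in> planarization_nodes G p"
    using adj unfolding planarization_adj_def by blast
  have code: "(\<exists>u\<in>e. c = Inl u) \<or> (\<exists>f\<in>edges G. cross p e f \<and> c = Inr {e, f})"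
    if c: "c \<in> node_codes G p" "node p c \<in> edge_segment p e" "node p c \<in> planarization_nodes G p" for c
    using node_on_edge[OF c(3) e(1) c(2)]
  proof (elim disjE bexE conjE)
    fix u assume u: "u \<in> e" "node p c = p u"
    have "Inl u \<in> node_codes G p" using edge_verts[OF e(1) u(1)] by (auto simp: node_codes_def)
    then have "c = Inl u" using inj_onD[OF node_inj _ c(1)] u by (simp add: node_def)
    then show ?thesis using u by blast
  next
    fix f assume f: "f \<in> edges G" "cross p e f" "node p c = crossing_point p {e, f}"
    have "Inr {e, f} \<in> node_codes G p" using e f by (auto simp: node_codes_def)
    then have "c = Inr {e, f}" using inj_onD[OF node_inj _ c(1)] f by (simp add: node_def)
    then show ?thesis using f by blast
  qed
  have un: "\<not> cross p {u, v} f" if uv: "a = Inl u" "b = Inl v" "e = {u, v}" and f: "f \<in> edges G" for u v f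
  proof
    assume c: "cross p {u, v} f"
    have "crossing_point p {e, f} \<in> open_segment (p u) (p v)"
      using crossing_point(1)[OF e(1) f] c uv by (simp add: edge_interior_pair)
    moreover have "crossing_point p {e, f} \<in> planarization_nodes G p"
      unfolding nodes_eq using e f c uv by (auto simp: node_codes_def node_def intro!: image_eqI[of _ _ "Inr {e, f}"])
    ultimately show False using between uv by (auto simp: node_def)
  qed
  show ?thesis
    using code[OF a e(2) ab(1)] code[OF b e(3) ab(2)]
  proof (elim disjE bexE conjE)
    fix u v assume uv: "u \<in> e" "v \<in> e" "a = Inl u" "b = Inl v"
    have "u \<noteq> v" using ne uv by auto
    then have "e = {u, v}" using edge_ends[OF e(1)] uv by auto
    then show ?thesis unfolding code_adj_def using un uv e(1) by blast
  next
    fix u f assume "u \<in> e" "a = Inl u" "f \<in> edges G" "cross p e f" "b = Inr {e, f}"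
    then show ?thesis unfolding code_adj_def using e(1) by blast
  next
    fix u f assume "u \<in> e" "b = Inl u" "f \<in> edges G" "cross p e f" "a = Inr {e, f}"
    then show ?thesis unfolding code_adj_def using e(1) by blast
  next
    fix f g assume "f \<in> edges G" "cross p e f" "a = Inr {e, f}" "g \<in> edges G" "cross p e g" "b = Inr {e, g}"
    then show ?thesis using crossed_once[OF e(1)] ne by blast
  qed
qed

lemma adj_iff:
  "a \<in> node_codes G p \<Longrightarrow> b \<in> node_codes G p \<Longrightarrow>
    planarization_adj G p (node p a) (node p b) \<longleftrightarrow> code_adj G p a b"
  using code_adj_imp_adj adj_imp_code_adj by blast

end

lemma rotation_ccw3:
  "(x, y, z, w) \<in> rotation (embedding_of G p) \<longleftrightarrow>
     planarization_adj G p x y \<and> planarization_adj G p x z \<and> planarization_adj G p x w \<and>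
     ccw3 (y - x) (z - x) (w - x)"
proof (cases "planarization_adj G p x y \<and> planarization_adj G p x z \<and> planarization_adj G p x w")
  case True
  then have "y - x \<noteq> 0" "z - x \<noteq> 0" "w - x \<noteq> 0" unfolding planarization_adj_def by auto
  from ccw3_Arg2pi[OF this] True show ?thesis by (simp add: embedding_of_def)
next
  case False
  then show ?thesis by (auto simp: embedding_of_def)
qed

text \<open>Here b is the first node met on the way from u along the edge to v: the far end, or the
  crossing on that edge.\<close>

definition edge_toward :: "'v graph \<Rightarrow> ('v \<Rightarrow> complex) \<Rightarrow> 'v \<Rightarrow> 'v code \<Rightarrow> 'v \<Rightarrow> bool" where
  "edge_toward G p u b v \<longleftrightarrow> {u, v} \<in> edges G \<and>
     (b = Inl v \<or> (\<exists>f\<in>edges G. cross p {u, v} f \<and> b = Inr {{u, v}, f}))"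

context one_plane
begin

lemma code_adj_vertex:
  assumes "code_adj G p (Inl u) b"
  shows "\<exists>v. edge_toward G p u b v"
  using assms unfolding code_adj_def
proof (elim disjE exE conjE)
  fix u' e f assume *: "e \<in> edges G" "f \<in> edges G" "cross p e f" "u' \<in> e" "Inl u = Inl u'" "b = Inr {e, f}"
  then obtain v where "e = {u, v}" using edge_ends[OF *(1)] by auto
  then show ?thesis unfolding edge_toward_def using * by blast
qed (auto simp: edge_toward_def)

lemma edge_toward_direction:
  assumes "edge_toward G p u b v"
  shows "\<exists>t>0. node p b - p u = t *\<^sub>R (p v - p u)"
proof (cases "b = Inl v")
  case True
  then show ?thesis by (auto simp: node_def intro!: exI[of _ 1])
next
  case False
  then obtain f where f: "f \<in> edges G" "cross p {u, v} f" "b = Inr {{u, v}, f}" and e: "{u, v} \<in> edges G"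
    using assms by (auto simp: edge_toward_def)
  have "node p b \<in> open_segment (p u) (p v)"
    using crossing_point(1)[OF e f(1,2)] f(3) by (simp add: node_def edge_interior_pair)
  then obtain t where "0 < t" "node p b = (1 - t) *\<^sub>R p u + t *\<^sub>R p v" by (auto simp: in_segment)
  then show ?thesis by (intro exI[of _ t]) (simp add: algebra_simps)
qed

lemma code_adj_crossing:
  assumes "code_adj G p (Inr S) b"
  shows "\<exists>u v. b = Inl u \<and> {u, v} \<in> S"
  using assms unfolding code_adj_def
proof (elim disjE exE conjE)
  fix u e f assume *: "e \<in> edges G" "u \<in> e" "Inr S = Inr {e, f}" "b = Inl u"
  then obtain v where "e = {u, v}" using edge_ends[OF *(1)] by auto
  then show ?thesis using * by blast
qed auto

lemma crossing_direction:
  assumes "e \<in> edges G" "f \<in> edges G" "cross p e f" "{u, v} \<in> {e, f}"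
  shows "\<exists>t>0. p u - crossing_point p {e, f} = t *\<^sub>R (p u - p v)"
proof -
  have "crossing_point p {e, f} \<in> open_segment (p u) (p v)"
    using crossing_point(1,2)[OF assms(1-3)] assms(4) by (auto simp: edge_interior_pair[symmetric])
  then obtain t where t: "0 < t" "crossing_point p {e, f} = (1 - t) *\<^sub>R p u + t *\<^sub>R p v" by (auto simp: in_segment)
  have "p u - crossing_point p {e, f} = t *\<^sub>R (p u - p v)" unfolding t(2) by (simp add: algebra_simps)
  with t(1) show ?thesis by (intro exI[of _ t] conjI)
qed

end

text \<open>A combinatorial criterion for two drawings with the same crossings to have isomorphic embeddings.\<close>

theorem one_plane_embedding_iso:
  assumes p: "one_plane G p" and q: "one_plane G q"
    and cr: "\<And>e f. e \<in> edges G \<Longrightarrow> f \<in> edges G \<Longrightarrow> cross p e f \<longleftrightarrow> cross q e f"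
    and vertex: "\<And>u v1 v2 v3. {u, v1} \<in> edges G \<Longrightarrow> {u, v2} \<in> edges G \<Longrightarrow> {u, v3} \<in> edges G \<Longrightarrow>
      ccw3 (p v1 - p u) (p v2 - p u) (p v3 - p u) \<longleftrightarrow> ccw3 (q v1 - q u) (q v2 - q u) (q v3 - q u)"
    and crossing: "\<And>u v w z. {u, v} \<in> edges G \<Longrightarrow> {w, z} \<in> edges G \<Longrightarrow> cross p {u, v} {w, z} \<Longrightarrow>
      0 < orient 0 (p u - p v) (p w - p z) \<longleftrightarrow> 0 < orient 0 (q u - q v) (q w - q z)"
    and outer: "\<And>a b. code_adj G p a b \<Longrightarrow>
      (node p a, node p b) \<in> outer_face (embedding_of G p) \<longleftrightarrow> (node q a, node q b) \<in> outer_face (embedding_of G q)"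
  shows "\<exists>h. embedding_iso (verts G) (embedding_of G p) (embedding_of G q) h"
proof -
  interpret p: one_plane G p by (rule p)
  interpret q: one_plane G q by (rule q)
  define C where "C = node_codes G p"
  have Cq: "node_codes G q = C" unfolding C_def node_codes_def by (simp add: cr cong: conj_cong)
  have adjq: "code_adj G q a b \<longleftrightarrow> code_adj G p a b" for a b
    unfolding code_adj_def by (simp add: cr cong: conj_cong)
  have tow: "edge_toward G q u b v \<longleftrightarrow> edge_toward G p u b v" for u b v
    unfolding edge_toward_def by (simp add: cr cong: conj_cong)
  \<comment> \<open>Each node goes to the node of the other drawing with the same code.\<close>
  define h where "h = node q \<circ> inv_into C (node p)"
  have h: "h (node p a) = node q a" if "a \<in> C" for a
    using that p.node_inj by (simp add: h_def C_def)
  have bij: "bij_betw h (node p ` C) (node q ` C)"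
    unfolding h_def
    by (rule bij_betw_trans[OF bij_betw_inv_into])
       (use p.node_inj q.node_inj Cq in \<open>auto simp: C_def bij_betw_def\<close>)
  have rot: "(node p a, node p b, node p c, node p d) \<in> rotation (embedding_of G p) \<longleftrightarrow>
      (node q a, node q b, node q c, node q d) \<in> rotation (embedding_of G q)"
    if abcd: "a \<in> C" "b \<in> C" "c \<in> C" "d \<in> C" for a b c d
  proof -
    have "ccw3 (node p b - node p a) (node p c - node p a) (node p d - node p a) \<longleftrightarrow>
      ccw3 (node q b - node q a) (node q c - node q a) (node q d - node q a)"
      if ad: "code_adj G p a b" "code_adj G p a c" "code_adj G p a d"
    proof (cases a)
      case (Inl u)
      obtain v1 v2 v3 where v: "edge_toward G p u b v1" "edge_toward G p u c v2" "edge_toward G p u d v3"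
        using ad p.code_adj_vertex Inl by blast
      have E: "{u, v1} \<in> edges G" "{u, v2} \<in> edges G" "{u, v3} \<in> edges G"
        using v by (auto simp: edge_toward_def)
      have "ccw3 (node p b - p u) (node p c - p u) (node p d - p u) \<longleftrightarrow> ccw3 (p v1 - p u) (p v2 - p u) (p v3 - p u)"
        using p.edge_toward_direction[OF v(1)] p.edge_toward_direction[OF v(2)] p.edge_toward_direction[OF v(3)]
        by (auto simp: ccw3_scale)
      moreover have "ccw3 (node q b - q u) (node q c - q u) (node q d - q u) \<longleftrightarrow> ccw3 (q v1 - q u) (q v2 - q u) (q v3 - q u)"
        using q.edge_toward_direction[OF v(1)[folded tow]] q.edge_toward_direction[OF v(2)[folded tow]]
          q.edge_toward_direction[OF v(3)[folded tow]]
        by (auto simp: ccw3_scale)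
      ultimately show ?thesis using vertex[OF E] by (simp add: Inl node_def)
    next
      case (Inr S)
      then obtain e f where S: "S = {e, f}" and ef: "e \<in> edges G" "f \<in> edges G" "cross p e f"
        using abcd(1) by (auto simp: C_def node_codes_def)
      obtain u1 v1 u2 v2 u3 v3 where uv: "b = Inl u1" "{u1, v1} \<in> S" "c = Inl u2" "{u2, v2} \<in> S" "d = Inl u3" "{u3, v3} \<in> S"
        using ad p.code_adj_crossing unfolding Inr by meson
      have efq: "cross q e f" using cr ef by blast
      \<comment> \<open>The four directions at a crossing are those of the two edges and their
        negatives. Directions along one edge have determinant zero in both drawings; for the others
        \<open>crossing\<close> applies.\<close>
      have d: "0 < orient 0 (p u - p v) (p w - p z) \<longleftrightarrow> 0 < orient 0 (q u - q v) (q w - q z)"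
        if "{u, v} \<in> S" "{w, z} \<in> S" for u v w z
      proof (cases "{u, v} = {w, z}")
        case True
        then have "(u = w \<and> v = z) \<or> (u = z \<and> v = w)" by (auto simp: doubleton_eq_iff)
        then have "orient 0 (p u - p v) (p w - p z) = 0" "orient 0 (q u - q v) (q w - q z) = 0"
          by (auto simp: orient_def algebra_simps)
        then show ?thesis by simp
      next
        case False
        then have "cross p {u, v} {w, z}" "{u, v} \<in> edges G" "{w, z} \<in> edges G"
          using that ef cross_sym S by auto
        then show ?thesis using crossing by blast
      qed
      have "ccw3 (p u1 - p v1) (p u2 - p v2) (p u3 - p v3) \<longleftrightarrow> ccw3 (q u1 - q v1) (q u2 - q v2) (q u3 - q v3)"
        unfolding ccw3_def using d uv by blast
      moreover have "ccw3 (node p b - node p a) (node p c - node p a) (node p d - node p a) \<longleftrightarrow>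
          ccw3 (p u1 - p v1) (p u2 - p v2) (p u3 - p v3)"
        using p.crossing_direction[OF ef, of u1 v1] p.crossing_direction[OF ef, of u2 v2] p.crossing_direction[OF ef, of u3 v3]
          uv by (auto simp: ccw3_scale node_def Inr S)
      moreover have "ccw3 (node q b - node q a) (node q c - node q a) (node q d - node q a) \<longleftrightarrow>
          ccw3 (q u1 - q v1) (q u2 - q v2) (q u3 - q v3)"
        using q.crossing_direction[OF ef(1,2) efq, of u1 v1] q.crossing_direction[OF ef(1,2) efq, of u2 v2]
          q.crossing_direction[OF ef(1,2) efq, of u3 v3] uv by (auto simp: ccw3_scale node_def Inr S)
      ultimately show ?thesis by blast
    qed
    then show ?thesis
      unfolding rotation_ccw3
      using abcd p.adj_iff q.adj_iff adjq Cq unfolding C_def[symmetric] by (metis (no_types, lifting))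
  qed
  have adj: "(node p a, node p b) \<in> adjacent (embedding_of G p) \<longleftrightarrow> (node q a, node q b) \<in> adjacent (embedding_of G q)"
    if "a \<in> C" "b \<in> C" for a b
    using that p.adj_iff q.adj_iff adjq Cq by (simp add: embedding_of_def C_def)
  have out: "(node p a, node p b) \<in> outer_face (embedding_of G p) \<longleftrightarrow> (node q a, node q b) \<in> outer_face (embedding_of G q)"
    if "a \<in> C" "b \<in> C" for a b
  proof (cases "code_adj G p a b")
    case False
    then show ?thesis using that p.adj_iff q.adj_iff adjq Cq by (simp add: embedding_of_def C_def)
  qed (rule outer)
  have nodes: "nodes (embedding_of G p) = node p ` C" "nodes (embedding_of G q) = node q ` C"
    using p.nodes_eq q.nodes_eq Cq by (auto simp: embedding_of_def C_def)
  have "h (p v) = q v" if "v \<in> verts G" for v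
    using h[of "Inl v"] that by (simp add: C_def node_codes_def node_def)
  then have "embedding_iso (verts G) (embedding_of G p) (embedding_of G q) h"
    unfolding embedding_iso_def nodes ball_simps
    using bij h rot adj out by (simp add: embedding_of_def[of G p, THEN arg_cong, of label] embedding_of_def[of G q, THEN arg_cong, of label])
  then show ?thesis by blast
qed

section \<open>Replacing a drawing by its mirror image\<close>

section \<open>Reflection\<close>

lemma cnj_closed_segment: "closed_segment (cnj a) (cnj b) = cnj ` closed_segment a b"
  by (rule closed_segment_linear_image) (simp add: bounded_linear.linear bounded_linear_cnj)

text \<open>Conjugation preserves connectedness and boundedness, so it maps components of the
  complement to components. One inclusion suffices, applied to the set and to its
  reflection.\<close>

lemma cnj_outside: "cnj x \<in> outside (cnj ` S) \<longleftrightarrow> x \<in> outside S"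
proof -
  have im: "cnj ` (cnj ` T) = T" for T by (auto simp: image_image)
  have 1: "cnj ` connected_component_set (- T) x \<subseteq> connected_component_set (- cnj ` T) (cnj x)" for T x
  proof
    fix y assume "y \<in> cnj ` connected_component_set (- T) x"
    then obtain z U where z: "y = cnj z" "connected U" "U \<subseteq> - T" "x \<in> U" "z \<in> U"
      by (auto simp: connected_component_def)
    have "connected (cnj ` U)" using z(2) by (intro connected_continuous_image continuous_intros)
    moreover have "cnj ` U \<subseteq> - cnj ` T" using z(3) by auto
    ultimately show "y \<in> connected_component_set (- cnj ` T) (cnj x)"
      using z unfolding connected_component_def by blast
  qed
  have "connected_component_set (- cnj ` S) (cnj x) \<subseteq> cnj ` connected_component_set (- S) x"
    using image_mono[OF 1[of "cnj ` S" "cnj x"], of cnj] by (simp add: im)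
  then have "connected_component_set (- cnj ` S) (cnj x) = cnj ` connected_component_set (- S) x" using 1 by blast
  moreover have "bounded (cnj ` T) \<longleftrightarrow> bounded T" for T
    by (simp add: bounded_iff)
  ultimately show ?thesis by (simp add: outside)
qed

lemma edge_segment_cnj: "edge_segment (cnj \<circ> p) e = cnj ` edge_segment p e"
  unfolding edge_segment_def image_comp[symmetric]
  by (rule convex_hull_linear_image[symmetric]) (simp add: bounded_linear.linear bounded_linear_cnj)

lemma edge_interior_cnj: "edge_interior (cnj \<circ> p) e = cnj ` edge_interior p e"
  unfolding edge_interior_def edge_segment_cnj by (auto simp: image_iff)

lemma cnj_mem_image: "cnj x \<in> cnj ` S \<longleftrightarrow> x \<in> S"
  by (auto simp: image_iff)

lemma planarization_nodes_cnj: "planarization_nodes G (cnj \<circ> p) = cnj ` planarization_nodes G p"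
proof -
  have "crossing_points G (cnj \<circ> p) = cnj ` crossing_points G p"
    unfolding crossing_points_def edge_interior_cnj image_UN
    by (simp add: image_Int[of cnj] inj_def)
  then show ?thesis by (auto simp: planarization_nodes_def image_Un image_comp)
qed

lemma planarization_adj_cnj: "planarization_adj G (cnj \<circ> p) (cnj x) (cnj y) \<longleftrightarrow> planarization_adj G p x y"
proof -
  have "open_segment (cnj x) (cnj y) = cnj ` open_segment x y"
    by (auto simp: open_segment_def cnj_closed_segment)
  then show ?thesis
    unfolding planarization_adj_def planarization_nodes_cnj edge_segment_cnj cnj_mem_image
    by (simp add: image_Int[of cnj, symmetric] inj_def)
qed

lemma drawing_image_cnj: "drawing_image G (cnj \<circ> p) = cnj ` drawing_image G p"
  by (auto simp: drawing_image_def edge_segment_cnj)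

lemma ccw3_cnj: "ccw3 (cnj a) (cnj b) (cnj c) \<longleftrightarrow> ccw3 c b a"
  by (auto simp: ccw3_def orient_def algebra_simps)

text \<open>Reflection exchanges left and right: cyclic orders are reversed, and a dart of the outer
  face is traversed backwards.\<close>

lemma embedding_of_cnj:
  "nodes (embedding_of G (cnj \<circ> p)) = cnj ` nodes (embedding_of G p)"
  "(cnj x, cnj y) \<in> adjacent (embedding_of G (cnj \<circ> p)) \<longleftrightarrow> (x, y) \<in> adjacent (embedding_of G p)"
  "(cnj x, cnj y, cnj z, cnj w) \<in> rotation (embedding_of G (cnj \<circ> p)) \<longleftrightarrow> (x, w, z, y) \<in> rotation (embedding_of G p)"
  "(cnj x, cnj y) \<in> outer_face (embedding_of G (cnj \<circ> p)) \<longleftrightarrow> (y, x) \<in> outer_face (embedding_of G p)"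
proof -
  show "nodes (embedding_of G (cnj \<circ> p)) = cnj ` nodes (embedding_of G p)"
    by (simp add: embedding_of_def planarization_nodes_cnj)
  show "(cnj x, cnj y) \<in> adjacent (embedding_of G (cnj \<circ> p)) \<longleftrightarrow> (x, y) \<in> adjacent (embedding_of G p)"
    by (simp add: embedding_of_def planarization_adj_cnj)
  show "(cnj x, cnj y, cnj z, cnj w) \<in> rotation (embedding_of G (cnj \<circ> p)) \<longleftrightarrow> (x, w, z, y) \<in> rotation (embedding_of G p)"
    unfolding rotation_ccw3 planarization_adj_cnj complex_cnj_diff[symmetric] ccw3_cnj by blast
  have mid: "midpoint (cnj x) (cnj y) + of_real t * \<i> * (cnj y - cnj x) = cnj (midpoint y x + of_real t * \<i> * (x - y))" for t
    by (simp add: midpoint_def complex_eq_iff algebra_simps)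
  have sym: "planarization_adj G p x y \<longleftrightarrow> planarization_adj G p y x"
    unfolding planarization_adj_def by (auto simp: open_segment_commute)
  show "(cnj x, cnj y) \<in> outer_face (embedding_of G (cnj \<circ> p)) \<longleftrightarrow> (y, x) \<in> outer_face (embedding_of G p)"
    unfolding embedding_of_def
    by (simp only: embedding.simps mem_Collect_eq case_prod_conv planarization_adj_cnj mid drawing_image_cnj
        cnj_outside sym)
qed

lemma mirror_simps [simp]:
  "nodes (mirror M) = nodes M" "label (mirror M) = label M" "adjacent (mirror M) = adjacent M"
  "(x, y, z, w) \<in> rotation (mirror M) \<longleftrightarrow> (x, w, z, y) \<in> rotation M"
  "(x, y) \<in> outer_face (mirror M) \<longleftrightarrow> (y, x) \<in> outer_face M"
  by (simp_all add: mirror_def)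

lemma mirror_mirror: "mirror (mirror M) = M"
  by (simp add: mirror_def)

lemma embedding_iso_cnj_left:
  assumes "embedding_iso V (embedding_of G (cnj \<circ> p)) N h"
  shows "embedding_iso V (embedding_of G p) (mirror N) (h \<circ> cnj)"
proof -
  have "bij_betw (h \<circ> cnj) (nodes (embedding_of G p)) (nodes N)"
    using assms unfolding embedding_iso_def embedding_of_cnj
    by (intro bij_betw_trans[of cnj]) (auto simp: bij_betw_def inj_on_def)
  moreover have "label (embedding_of G (cnj \<circ> p)) v = cnj (label (embedding_of G p) v)" for v
    by (simp add: embedding_of_def)
  ultimately show ?thesis
    using assms unfolding embedding_iso_def
    by (simp add: embedding_of_cnj)
qed

lemma embedding_iso_cnj_right:
  assumes "embedding_iso V M (embedding_of G (cnj \<circ> q)) h"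
  shows "embedding_iso V M (mirror (embedding_of G q)) (cnj \<circ> h)"
proof -
  have "bij_betw (cnj \<circ> h) (nodes M) (nodes (embedding_of G q))"
  proof (rule bij_betw_trans[of h _ "nodes (embedding_of G (cnj \<circ> q))"])
    show "bij_betw h (nodes M) (nodes (embedding_of G (cnj \<circ> q)))" using assms by (simp add: embedding_iso_def)
    show "bij_betw cnj (nodes (embedding_of G (cnj \<circ> q))) (nodes (embedding_of G q))"
      unfolding embedding_of_cnj by (auto simp: bij_betw_def inj_on_def image_image)
  qed
  moreover have "label (embedding_of G (cnj \<circ> q)) v = cnj (label (embedding_of G q) v)" for v
    by (simp add: embedding_of_def)
  moreover have "(x, y) \<in> adjacent (embedding_of G (cnj \<circ> q)) \<longleftrightarrow> (cnj x, cnj y) \<in> adjacent (embedding_of G q)"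
    "(x, y, z, w) \<in> rotation (embedding_of G (cnj \<circ> q)) \<longleftrightarrow> (cnj x, cnj w, cnj z, cnj y) \<in> rotation (embedding_of G q)"
    "(x, y) \<in> outer_face (embedding_of G (cnj \<circ> q)) \<longleftrightarrow> (cnj y, cnj x) \<in> outer_face (embedding_of G q)" for x y z w
    using embedding_of_cnj(2)[where x = "cnj x" and y = "cnj y" and p = q]
      embedding_of_cnj(3)[where x = "cnj x" and y = "cnj y" and z = "cnj z" and w = "cnj w" and p = q]
      embedding_of_cnj(4)[where x = "cnj x" and y = "cnj y" and p = q] by auto
  ultimately show ?thesis
    using assms unfolding embedding_iso_def by simp
qed

text \<open>Since embeddings are taken up to reflection, either of the two drawings may be replaced
  by its mirror image.\<close>

lemma same_embedding_cnj:
  "same_embedding G (cnj \<circ> p) q \<Longrightarrow> same_embedding G p q"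
  "same_embedding G p (cnj \<circ> q) \<Longrightarrow> same_embedding G p q"
proof -
  show "same_embedding G p q" if "same_embedding G (cnj \<circ> p) q"
    using that embedding_iso_cnj_left mirror_mirror unfolding same_embedding_def by metis
  have m: "embedding_iso V M (mirror N) h \<longleftrightarrow> embedding_iso V (mirror M) N h"
    for V and M :: "('v, complex) embedding" and N :: "('v, complex) embedding" and h
    unfolding embedding_iso_def by auto
  show "same_embedding G p q" if "same_embedding G p (cnj \<circ> q)"
    using that embedding_iso_cnj_right mirror_mirror m unfolding same_embedding_def by metis
qed

section \<open>Triangles, outer regions and points close to a side\<close>

section \<open>Triangles\<close>

text \<open>Barycentric coordinates are ratios of signed areas.\<close>

lemma in_triangle_coords:
  assumes "x = u *\<^sub>R a + v *\<^sub>R b + w *\<^sub>R c" "u + v + w = 1"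
  shows "orient a b x = w * orient a b c" "orient b c x = u * orient a b c" "orient c a x = v * orient a b c"
proof -
  have u: "u = 1 - v - w" using assms(2) by simp
  show "orient a b x = w * orient a b c" "orient b c x = u * orient a b c" "orient c a x = v * orient a b c"
    unfolding assms(1) u orient_def by (simp_all add: algebra_simps)
qed

lemma in_triangleI:
  assumes "0 < orient a b c" "0 \<le> orient a b x" "0 \<le> orient b c x" "0 \<le> orient c a x"
  shows "x \<in> convex hull {a, b, c}"
proof -
  define D where "D = orient a b c"
  define u v w where "u = orient b c x / D" and "v = orient c a x / D" and "w = orient a b x / D"
  have D: "0 < D" using assms(1) by (simp add: D_def)
  have "orient b c x + orient c a x + orient a b x = D"
    by (simp add: D_def orient_def algebra_simps)
  then have sum: "u + v + w = 1" using D by (simp add: u_def v_def w_def add_divide_distrib[symmetric])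
  have "D * Re x = orient b c x * Re a + orient c a x * Re b + orient a b x * Re c"
    "D * Im x = orient b c x * Im a + orient c a x * Im b + orient a b x * Im c"
    by (simp_all add: D_def orient_def algebra_simps)
  then have "x = u *\<^sub>R a + v *\<^sub>R b + w *\<^sub>R c"
    using D by (simp add: complex_eq_iff u_def v_def w_def field_simps)
  moreover have "0 \<le> u" "0 \<le> v" "0 \<le> w" using assms D by (simp_all add: u_def v_def w_def)
  ultimately show ?thesis using sum unfolding convex_hull_3 by blast
qed

lemma in_triangleD:
  assumes "0 < orient a b c" "x \<in> convex hull {a, b, c}"
  shows "0 \<le> orient a b x" "0 \<le> orient b c x" "0 \<le> orient c a x"
proof -
  obtain u v w where x: "x = u *\<^sub>R a + v *\<^sub>R b + w *\<^sub>R c" "u + v + w = 1" "0 \<le> u" "0 \<le> v" "0 \<le> w"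
    using assms(2) unfolding convex_hull_3 by blast
  show "0 \<le> orient a b x" "0 \<le> orient b c x" "0 \<le> orient c a x"
    using in_triangle_coords[OF x(1,2)] x(3-5) assms(1) by simp_all
qed

lemma tendsto_orient: "(f \<longlongrightarrow> x) F \<Longrightarrow> ((\<lambda>t. orient a b (f t)) \<longlongrightarrow> orient a b x) F"
  unfolding orient_def by (intro tendsto_intros)

lemma in_interior_triangle:
  assumes "0 < orient a b c" "0 < orient a b x" "0 < orient b c x" "0 < orient c a x"
  shows "x \<in> interior (convex hull {a, b, c})"
proof -
  define U where "U = {x. 0 < orient a b x} \<inter> {x. 0 < orient b c x} \<inter> {x. 0 < orient c a x}"
  have "open {x. 0 < orient a b x}" for a b
    unfolding orient_def by (intro open_Collect_less continuous_intros)
  then have "open U" unfolding U_def by blast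
  moreover have "U \<subseteq> convex hull {a, b, c}" using in_triangleI[OF assms(1)] by (auto simp: U_def)
  moreover have "x \<in> U" using assms by (simp add: U_def)
  ultimately show ?thesis by (meson interiorI)
qed

text \<open>Extremality is local. A segment of T around x, shrunk towards x, fits into the
  neighbourhood of x contained in S.\<close>

lemma extreme_point_Int_interior:
  fixes x :: complex
  assumes x: "x extreme_point_of (S \<inter> T)" and int: "x \<in> interior S" and "convex T"
  shows "x extreme_point_of T"
  unfolding extreme_point_of_def
proof (intro conjI ballI notI)
  show "x \<in> T" using x by (simp add: extreme_point_of_def)
  fix y z assume yz: "y \<in> T" "z \<in> T" "x \<in> open_segment y z"
  then obtain u where u: "0 < u" "u < 1" "x = (1 - u) *\<^sub>R y + u *\<^sub>R z" and "y \<noteq> z"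
    by (auto simp: in_segment)
  obtain \<delta> where \<delta>: "0 < \<delta>" "ball x \<delta> \<subseteq> S" using int unfolding mem_interior by blast
  define K where "K = norm (y - x) + norm (z - x) + 1"
  define r where "r = min 1 (\<delta> / K)"
  have K: "0 < K" "norm (y - x) < K" "norm (z - x) < K"
    unfolding K_def using norm_ge_zero[of "y - x"] norm_ge_zero[of "z - x"] by linarith+
  have r: "0 < r" "r \<le> 1" "r * K \<le> \<delta>" using K \<delta> by (auto simp: r_def min_def field_simps)
  have near: "x + r *\<^sub>R (y' - x) \<in> S \<inter> T" if "y' \<in> T" "norm (y' - x) < K" for y'
  proof
    have "r * norm (y' - x) < r * K" using that r by simp
    then have "norm (r *\<^sub>R (y' - x)) < \<delta>" using r by (simp only: norm_scaleR abs_of_pos)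
    then have "x + r *\<^sub>R (y' - x) \<in> ball x \<delta>" by (simp add: dist_norm)
    then show "x + r *\<^sub>R (y' - x) \<in> S" using \<delta> by blast
    have "x + r *\<^sub>R (y' - x) = (1 - r) *\<^sub>R x + r *\<^sub>R y'" by (simp add: algebra_simps)
    then show "x + r *\<^sub>R (y' - x) \<in> T"
      using convexD_alt[OF \<open>convex T\<close> \<open>x \<in> T\<close> that(1), of r] r by simp
  qed
  have z0: "(1 - u) *\<^sub>R (y - x) + u *\<^sub>R (z - x) = 0"
    using u(3) by (simp add: algebra_simps)
  have "(1 - u) *\<^sub>R (x + r *\<^sub>R (y - x)) + u *\<^sub>R (x + r *\<^sub>R (z - x)) =
      x + r *\<^sub>R ((1 - u) *\<^sub>R (y - x) + u *\<^sub>R (z - x))"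
    by (simp add: algebra_simps)
  then have "x = (1 - u) *\<^sub>R (x + r *\<^sub>R (y - x)) + u *\<^sub>R (x + r *\<^sub>R (z - x))" using z0 by simp
  moreover have "x + r *\<^sub>R (y - x) \<noteq> x + r *\<^sub>R (z - x)" using r \<open>y \<noteq> z\<close> by simp
  ultimately have "x \<in> open_segment (x + r *\<^sub>R (y - x)) (x + r *\<^sub>R (z - x))"
    unfolding in_segment using u by blast
  then show False
    using x near[OF yz(1) K(2)] near[OF yz(2) K(3)] unfolding extreme_point_of_def by blast
qed

text \<open>A point of the complement can move radially away from z without entering S, and far away
  all such points are connected outside a ball.\<close>

lemma star_complement_connected:
  fixes S :: "complex set"
  assumes "compact S" "z \<in> S" and star: "\<And>x. x \<in> S \<Longrightarrow> closed_segment z x \<subseteq> S"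
  shows "connected (- S)"
proof -
  obtain B where B: "0 < B" "S \<subseteq> ball z B"
    using compact_imp_bounded[OF assms(1)] bounded_subset_ballD by blast
  have far: "connected (- ball z B)"
    by (rule connected_complement_bounded_convex) (auto simp: bounded_ball convex_ball)
  have reach: "\<exists>w\<in>- ball z B. connected_component (- S) y w" if y: "y \<in> - S" for y
  proof -
    have yz: "y \<noteq> z" using y assms(2) by auto
    define t where "t = max 1 (B / norm (y - z))"
    define w where "w = z + t *\<^sub>R (y - z)"
    have t: "1 \<le> t" "B \<le> t * norm (y - z)" using yz by (auto simp: t_def max_def field_simps)
    have "w \<notin> ball z B" using t by (simp add: w_def dist_norm)
    moreover have "closed_segment y w \<subseteq> - S"
    proof
      fix x assume "x \<in> closed_segment y w"
      then obtain u where u: "0 \<le> u" "u \<le> 1" "x = (1 - u) *\<^sub>R y + u *\<^sub>R w" by (auto simp: in_segment)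
      \<comment> \<open>The distance factor from z along the ray. As it is at least 1, a point of S
        reached this way would force y into S by the star property.\<close>
      define s where "s = 1 + u * (t - 1)"
      have s: "1 \<le> s" using u t by (simp add: s_def)
      have x: "x = z + s *\<^sub>R (y - z)" unfolding u(3) w_def s_def by (simp add: algebra_simps)
      show "x \<in> - S"
      proof
        assume "x \<in> S"
        have "y = (1 - 1 / s) *\<^sub>R z + (1 / s) *\<^sub>R x" unfolding x using s by (simp add: algebra_simps)
        moreover have "0 \<le> 1 / s" "1 / s \<le> 1" using s by auto
        ultimately have "y \<in> closed_segment z x" unfolding in_segment by blast
        then show False using star[OF \<open>x \<in> S\<close>] y by blast
      qed
    qed
    ultimately show ?thesis unfolding connected_component_def
      by (intro bexI[of _ w] exI[of _ "closed_segment y w"]) auto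
  qed
  have farc: "connected_component (- S) w w'" if "w \<in> - ball z B" "w' \<in> - ball z B" for w w'
    unfolding connected_component_def using far B(2) that by blast
  show ?thesis
    unfolding connected_iff_connected_component
    using reach farc connected_component_sym connected_component_trans by meson
qed

text \<open>The connected set \<open>- D\<close> is unbounded and avoids K. Conversely, an unbounded
  component of the complement of K leaves D, so if it met D it would meet the frontier of D, which
  is part of K.\<close>

lemma outside_eq_complement:
  fixes D :: "complex set"
  assumes "compact D" "K \<subseteq> D" "frontier D \<subseteq> K" "connected (- D)"
  shows "outside K = - D"
proof (intro equalityI subsetI)
  fix x assume x: "x \<in> - D"
  have "- D \<subseteq> connected_component_set (- K) x"
    by (rule connected_component_maximal[OF x assms(4)]) (use assms(2) in blast)
  moreover have "\<not> bounded (- D)"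
    using cobounded_imp_unbounded[of "- D"] compact_imp_bounded[OF assms(1)] by auto
  ultimately have "\<not> bounded (connected_component_set (- K) x)" using bounded_subset by blast
  then show "x \<in> outside K" by (simp add: outside)
next
  fix x assume x: "x \<in> outside K"
  define C where "C = connected_component_set (- K) x"
  have ub: "\<not> bounded C" using x by (simp add: outside C_def)
  then have "C \<noteq> {}" by auto
  then have "x \<in> - K" using connected_component_eq_empty[of "- K" x] unfolding C_def by blast
  then have xC: "x \<in> C" by (simp add: C_def connected_component_refl)
  have CK: "C \<inter> K = {}" using connected_component_subset[of "- K" x] by (auto simp: C_def)
  show "x \<in> - D"
  proof
    assume "x \<in> D"
    have "\<not> C \<subseteq> D" using ub bounded_subset[OF compact_imp_bounded[OF assms(1)]] by blast
    then have "C - D \<noteq> {}" by blast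
    moreover have "C \<inter> D \<noteq> {}" using xC \<open>x \<in> D\<close> by blast
    moreover have "connected C" unfolding C_def by (rule connected_connected_component)
    ultimately have "C \<inter> frontier D \<noteq> {}" using connected_Int_frontier[of C D] by blast
    then show False using CK assms(3) by blast
  qed
qed

lemma eventually_left_in_interior:
  fixes m :: complex
  assumes "m \<in> interior S"
  shows "\<forall>\<^sub>F t in at_right 0. m + of_real t * c \<in> S"
proof -
  have "((\<lambda>t::real. m + of_real t * c) \<longlongrightarrow> m + of_real 0 * c) (at_right 0)" by (intro tendsto_intros)
  then have "\<forall>\<^sub>F t in at_right 0. m + of_real t * c \<in> interior S"
    using topological_tendstoD[of _ m _ "interior S"] assms by simp
  then show ?thesis by eventually_elim (use interior_subset in blast)
qed

lemma eventually_left_not_in: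
  fixes m :: complex
  assumes "closed S" "m \<notin> S"
  shows "\<forall>\<^sub>F t in at_right 0. m + of_real t * c \<notin> S"
  using eventually_left_in_interior[of m "- S" c] assms by (simp add: interior_open open_Compl)

text \<open>The midpoint of a piece of the side ab is strictly inside with respect to the other two
  sides, which persists for small r, and a move to the left is a move to the inner side of
  ab.\<close>

lemma eventually_left_in_triangle:
  assumes o: "0 < orient a b c" and st: "0 \<le> s" "s < t" "t \<le> 1"
    and x: "x = a + s *\<^sub>R (b - a)" and y: "y = a + t *\<^sub>R (b - a)"
  shows "\<forall>\<^sub>F r in at_right 0. midpoint x y + of_real r * \<i> * (y - x) \<in> convex hull {a, b, c}"
proof -
  define z where "z r = midpoint x y + of_real r * \<i> * (y - x)" for r
  define \<mu> where "\<mu> = (s + t) / 2"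
  have m: "midpoint x y = a + \<mu> *\<^sub>R (b - a)"
    unfolding x y midpoint_def \<mu>_def by (simp add: complex_eq_iff field_simps)
  have lim: "(z \<longlongrightarrow> midpoint x y) (at_right 0)"
  proof -
    have "(z \<longlongrightarrow> midpoint x y + of_real 0 * \<i> * (y - x)) (at_right 0)"
      unfolding z_def by (intro tendsto_intros)
    then show ?thesis by simp
  qed
  have "orient b c (midpoint x y) = (1 - \<mu>) * orient a b c" "orient c a (midpoint x y) = \<mu> * orient a b c"
    unfolding m orient_def by (simp_all add: algebra_simps)
  moreover have "0 < \<mu>" "\<mu> < 1" using st by (auto simp: \<mu>_def)
  ultimately have "0 < orient b c (midpoint x y)" "0 < orient c a (midpoint x y)"
    using o by simp_all
  then have "\<forall>\<^sub>F r in at_right 0. 0 < orient b c (z r)" "\<forall>\<^sub>F r in at_right 0. 0 < orient c a (z r)"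
    using order_tendstoD(1)[OF tendsto_orient[OF lim]] by blast+
  then have "\<forall>\<^sub>F r in at_right 0. z r \<in> convex hull {a, b, c}" using eventually_at_right_less[of 0]
  proof eventually_elim
    case (elim r)
    have "orient a b (z r) = r * ((t - s) * ((Re (b - a))\<^sup>2 + (Im (b - a))\<^sup>2))"
      unfolding z_def m unfolding x y orient_def by (simp add: power2_eq_square algebra_simps)
    also have "0 \<le> \<dots>" using elim st by simp
    finally show ?case using in_triangleI[OF o] elim by simp
  qed
  then show ?thesis by (simp add: z_def)
qed

lemma eventually_right_not_in_triangle:
  assumes o: "0 < orient a b c"
  shows "\<forall>\<^sub>F r in at_right 0. midpoint b a + of_real r * \<i> * (a - b) \<notin> convex hull {a, b, c}"
  using eventually_at_right_less[of 0]
proof eventually_elim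
  case (elim r)
  have "a \<noteq> b" using o by auto
  then have "0 < (Re (b - a))\<^sup>2 + (Im (b - a))\<^sup>2"
    by (auto simp: complex_eq_iff sum_power2_gt_zero_iff)
  moreover have "orient a b (midpoint b a + of_real r * \<i> * (a - b)) = - (r * ((Re (b - a))\<^sup>2 + (Im (b - a))\<^sup>2))"
    unfolding midpoint_def orient_def by (simp add: power2_eq_square field_simps)
  ultimately have "orient a b (midpoint b a + of_real r * \<i> * (a - b)) < 0" using elim by simp
  then show ?case using in_triangleD(1)[OF o] by (meson not_le)
qed

definition triangle :: "(nat \<Rightarrow> complex) \<Rightarrow> nat \<times> nat \<times> nat \<Rightarrow> complex set" where
  "triangle P = (\<lambda>(a, b, c). convex hull {P a, P b, P c})"

text \<open>A certificate in signs for two triangles to meet only in common faces: no foreign corner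
  of one lies inside the other, and disjoint sides do not cross.\<close>

definition apart :: "(nat \<Rightarrow> complex) \<Rightarrow> nat \<times> nat \<times> nat \<Rightarrow> nat \<times> nat \<times> nat \<Rightarrow> bool" where
  "apart Q = (\<lambda>(a, b, c) (d, e, f).
     list_all (\<lambda>w. w = a \<or> w = b \<or> w = c \<or> \<not> inside Q a b c w) [d, e, f] \<and>
     list_all (\<lambda>w. w = d \<or> w = e \<or> w = f \<or> \<not> inside Q d e f w) [a, b, c] \<and>
     list_all (\<lambda>(x, y). list_all (\<lambda>(z, u). x = z \<or> x = u \<or> y = z \<or> y = u \<or> \<not> opposite Q x y z u)
       [(d, e), (e, f), (f, d)]) [(a, b), (b, c), (c, a)])"

context rac_signs
begin

text \<open>Of two edges along one ray, the longer would contain the end of the shorter.\<close>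

lemma rays_distinct:
  assumes eq: "t *\<^sub>R (P y - P x) = t' *\<^sub>R (P w - P x)" and t: "0 < t" "0 < t'" and E: "E x y" "E x w"
  shows "y = w"
proof (rule ccontr)
  assume ne: "y \<noteq> w"
  have *: False if "t *\<^sub>R (P y - P x) = t' *\<^sub>R (P w - P x)" "t' \<le> t" "0 < t" "0 < t'"
    "E x y" "E x w" "y \<noteq> w" for t t' y w
  proof -
    have "P y - P x = (1 / t) *\<^sub>R (t *\<^sub>R (P y - P x))" using that(3) by simp
    also have "\<dots> = (t' / t) *\<^sub>R (P w - P x)" unfolding that(1) by simp
    finally have "P y = (1 - t' / t) *\<^sub>R P x + (t' / t) *\<^sub>R P w" by (simp add: algebra_simps)
    moreover have "0 \<le> t' / t" "t' / t \<le> 1" using that by auto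
    ultimately have "P y \<in> closed_segment (P x) (P w)" unfolding in_segment by blast
    moreover have "y \<noteq> x" using that(5) E_irrefl by auto
    ultimately show False using not_on_edge[OF that(6)] E_less2[OF that(5)] that(7) by blast
  qed
  show False
    using *[OF eq _ t E ne] *[OF eq[symmetric] _ t(2,1) E(2,1) ne[symmetric]] by linarith
qed

lemma adjacent_edges_meet:
  assumes "E w y" "E w z" "y \<noteq> z" "x \<in> closed_segment (P w) (P y)" "x \<in> closed_segment (P w) (P z)"
  shows "x = P w"
proof -
  obtain s where s: "0 \<le> s" "x = (1 - s) *\<^sub>R P w + s *\<^sub>R P y" using assms(4) by (auto simp: in_segment)
  obtain t where t: "0 \<le> t" "x = (1 - t) *\<^sub>R P w + t *\<^sub>R P z" using assms(5) by (auto simp: in_segment)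
  have xs: "x - P w = s *\<^sub>R (P y - P w)" unfolding s(2) by (simp add: algebra_simps)
  have xt: "x - P w = t *\<^sub>R (P z - P w)" unfolding t(2) by (simp add: algebra_simps)
  have "s = 0 \<or> t = 0" using rays_distinct[of s y w t z] xs xt s(1) t(1) assms(1-3) by force
  then show ?thesis using xs xt by auto
qed

text \<open>The barycentric coordinates are all nonzero because the vertex lies on no side; hence
  the orientations are positive in P and so also in Q.\<close>

lemma vertex_in_triangle:
  assumes E: "E a b" "E b c" "E c a" and pos: "pos Q a b c"
    and w: "w < n" "w \<notin> {a, b, c}" "P w \<in> convex hull {P a, P b, P c}"
  shows "inside Q a b c w"
proof -
  have less: "a < n" "b < n" "c < n" using E E_less by auto
  have o: "0 < orient (P a) (P b) (P c)"
    using pos_iff[OF less] triangle_orient[OF E(1,2) E_sym[OF E(3)]] pos by simp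
  obtain u v t where x: "P w = u *\<^sub>R P a + v *\<^sub>R P b + t *\<^sub>R P c" "u + v + t = 1" "0 \<le> u" "0 \<le> v" "0 \<le> t"
    using w(3) unfolding convex_hull_3 by blast
  have seg: "P w \<in> closed_segment (P d) (P e)"
    if "P w = r *\<^sub>R P d + s *\<^sub>R P e" "r + s = 1" "0 \<le> r" "0 \<le> s" for d e r s
  proof -
    have "r = 1 - s" using that by simp
    then show ?thesis unfolding in_segment using that by (intro exI[of _ s]) auto
  qed
  have "t \<noteq> 0" using seg[of u a v b] x not_on_edge[OF E(1) w(1)] w(2) by auto
  moreover have "u \<noteq> 0" using seg[of v b t c] x not_on_edge[OF E(2) w(1)] w(2) by auto
  moreover have "v \<noteq> 0" using seg[of t c u a] x not_on_edge[OF E(3) w(1)] w(2) by (auto simp: add.commute)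
  ultimately have "0 < u" "0 < v" "0 < t" using x by auto
  then have "0 < orient (P a) (P b) (P w)" "0 < orient (P b) (P c) (P w)" "0 < orient (P c) (P a) (P w)"
    using in_triangle_coords[OF x(1,2)] o by simp_all
  then show ?thesis
    unfolding inside_def using pos_iff[of a b w] pos_iff[of b c w] pos_iff[of c a w] less w(1) by simp
qed

text \<open>An extreme point of the intersection of two triangles is a vertex of one of them or lies on
  two of their sides.\<close>

lemma triangles_meet:
  assumes E: "E a b" "E b c" "E c a" and F: "E d e" "E e f" "E f d"
    and p: "pos Q a b c" "pos Q d e f" and apart: "apart Q (a, b, c) (d, e, f)"
  shows "triangle P (a, b, c) \<inter> triangle P (d, e, f) \<subseteq> convex hull (P ` ({a, b, c} \<inter> {d, e, f}))"
    (is "?S \<inter> ?T \<subseteq> ?H")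
proof -
  have cc: "compact (triangle P t)" "convex (triangle P t)" for t
    unfolding triangle_def by (auto simp: split_beta intro!: finite_imp_compact_convex_hull)
  \<comment> \<open>By Krein and Milman it is enough to find each extreme point of the intersection
    among the common corners or on a common side.\<close>
  have KM: "?S \<inter> ?T = convex hull {x. x extreme_point_of (?S \<inter> ?T)}"
    by (intro Krein_Milman_Minkowski compact_Int convex_Int cc)
  have less: "a < n" "b < n" "c < n" "d < n" "e < n" "f < n" using E F E_less by auto
  note ap = apart[unfolded apart_def prod.case list_all_iff]
  have ins: "\<not> inside Q a b c w" if "w \<in> {d, e, f}" "w \<notin> {a, b, c}" for w
    using bspec[OF ap[THEN conjunct1], of w] that by simp
  have ins': "\<not> inside Q d e f w" if "w \<in> {a, b, c}" "w \<notin> {d, e, f}" for w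
    using bspec[OF ap[THEN conjunct2, THEN conjunct1], of w] that by simp
  have opp: "\<not> opposite Q x y z u"
    if "(x, y) \<in> set [(a, b), (b, c), (c, a)]" "(z, u) \<in> set [(d, e), (e, f), (f, d)]" "distinct [x, y, z, u]" for x y z u
    using bspec[OF bspec[OF ap[THEN conjunct2, THEN conjunct2] that(1), unfolded prod.case] that(2)] that(3)
    by simp
  have "x \<in> ?H" if x: "x extreme_point_of (?S \<inter> ?T)" for x
  proof -
    have xS: "x \<in> ?S" and xT: "x \<in> ?T" using x by (auto simp: extreme_point_of_def)
    consider "x \<in> interior ?S" | "x \<in> interior ?T" | "x \<in> frontier ?S" "x \<in> frontier ?T"
      using xS xT closure_subset unfolding frontier_def by blast
    then show ?thesis
    proof cases
      case 1
      have "x extreme_point_of ?T"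
        by (rule extreme_point_Int_interior[OF x 1]) (simp add: triangle_def convex_convex_hull)
      then have "x \<in> {P d, P e, P f}" using extreme_point_of_convex_hull unfolding triangle_def prod.case by blast
      then obtain w where w: "x = P w" "w \<in> {d, e, f}" by blast
      have "P w \<in> convex hull {P a, P b, P c}" "w < n" using xS w less unfolding triangle_def by auto
      then have "w \<in> {a, b, c}" using vertex_in_triangle[OF E p(1), of w] ins[OF w(2)] by blast
      then show ?thesis using w by (auto intro: hull_inc)
    next
      case 2
      have "x extreme_point_of (?T \<inter> ?S)" using x by (simp add: Int_commute)
      then have "x extreme_point_of ?S"
        by (rule extreme_point_Int_interior[OF _ 2]) (simp add: triangle_def convex_convex_hull)
      then have "x \<in> {P a, P b, P c}" using extreme_point_of_convex_hull unfolding triangle_def prod.case by blast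
      then obtain w where w: "x = P w" "w \<in> {a, b, c}" by blast
      have "P w \<in> convex hull {P d, P e, P f}" "w < n" using xT w less unfolding triangle_def by auto
      then have "w \<in> {d, e, f}" using vertex_in_triangle[OF F p(2), of w] ins'[OF w(2)] by blast
      then show ?thesis using w by (auto intro: hull_inc)
    next
      case 3
      have fr: "frontier (triangle P (a, b, c)) =
          closed_segment (P a) (P b) \<union> closed_segment (P b) (P c) \<union> closed_segment (P c) (P a)" for a b c
        unfolding triangle_def prod.case by (rule frontier_of_triangle) simp
      obtain y z where yz: "(y, z) \<in> {(a, b), (b, c), (c, a)}" "x \<in> closed_segment (P y) (P z)"
        using 3(1) unfolding fr by blast
      obtain u v where uv: "(u, v) \<in> {(d, e), (e, f), (f, d)}" "x \<in> closed_segment (P u) (P v)"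
        using 3(2) unfolding fr by blast
      have Ey: "E y z" and Eu: "E u v" using yz uv E F by auto
      have mem: "y \<in> {a, b, c}" "z \<in> {a, b, c}" "u \<in> {d, e, f}" "v \<in> {d, e, f}" using yz uv by auto
      have ne: "y \<noteq> z" "u \<noteq> v" using Ey Eu E_irrefl by auto
      have "\<not> distinct [y, z, u, v]"
      proof
        assume d: "distinct [y, z, u, v]"
        then have "\<not> opposite Q y z u v" using opp yz(1) uv(1) by simp
        then show False using opposite_iff_meeting[OF Ey Eu d] yz uv by blast
      qed
      then consider "{y, z} = {u, v}" | "y = u" "z \<noteq> v" | "y = v" "z \<noteq> u" | "z = u" "y \<noteq> v" | "z = v" "y \<noteq> u"
        using ne by auto
      then show ?thesis
      proof cases
        case 1
        then have "{y, z} \<subseteq> {a, b, c} \<inter> {d, e, f}" using mem by blast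
        then have "convex hull {P y, P z} \<subseteq> ?H" by (intro hull_mono) auto
        then show ?thesis using yz by (simp add: segment_convex_hull subset_iff)
      next
        case 2
        then have "x = P y" using adjacent_edges_meet[of y z v x] Ey Eu yz uv by auto
        then show ?thesis using mem 2 by (auto intro: hull_inc)
      next
        case 3
        then have "x = P y" using adjacent_edges_meet[of y z u x] Ey E_sym[OF Eu] yz uv closed_segment_commute by blast
        then show ?thesis using mem 3 by (auto intro: hull_inc)
      next
        case 4
        then have "x = P z" using adjacent_edges_meet[of z y v x] E_sym[OF Ey] Eu yz uv closed_segment_commute by blast
        then show ?thesis using mem 4 by (auto intro: hull_inc)
      next
        case 5
        then have "x = P z" using adjacent_edges_meet[of z y u x] E_sym[OF Ey] E_sym[OF Eu] yz uv closed_segment_commute by blast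
        then show ?thesis using mem 5 by (auto intro: hull_inc)
      qed
    qed
  qed
  then show ?thesis by (subst KM) (intro hull_minimal convex_convex_hull, blast)
qed

end

section \<open>The eight triangles around the two hubs\<close>

section \<open>The regions covered by the two antiprisms\<close>

text \<open>Each hub with the sides of its outer quadrilateral. All triangles are listed
  counterclockwise, so the ones at 15 run through the second copy backwards.\<close>

definition wheel :: "(nat \<times> nat \<times> nat) list" where
  "wheel = [(8, 0, 2), (8, 2, 4), (8, 4, 6), (8, 6, 0), (15, 2, 0), (15, 11, 2), (15, 13, 11), (15, 0, 13)]"

text \<open>Each triangle of the wheels with the vertex that lies in its interior.\<close>

definition inner :: "((nat \<times> nat \<times> nat) \<times> nat) list" where
  "inner = [((8, 0, 2), 1), ((8, 2, 4), 3), ((8, 4, 6), 5), ((8, 6, 0), 7), ((15, 2, 0), 9), ((15, 0, 13), 14), ((15, 13, 11), 12), ((15, 11, 2), 10)]"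

text \<open>Four crossings in each antiprism, and the crossing of the common edge with 1 9.\<close>

definition crossing_edges :: "((nat \<times> nat) \<times> (nat \<times> nat)) list" where
  "crossing_edges = [((0, 8), (1, 7)), ((1, 3), (2, 8)), ((3, 5), (4, 8)), ((5, 7), (6, 8)), ((0, 15), (9, 14)), ((2, 15), (9, 10)), ((10, 12), (11, 15)), ((12, 14), (13, 15)), ((0, 2), (1, 9))]"

text \<open>The crossings once more; \<open>(a, b, c, d)\<close> means that \<open>c d\<close> crosses \<open>a b\<close> from right to left.\<close>

definition oriented_crossings :: "(nat \<times> nat \<times> nat \<times> nat) list" where
  "oriented_crossings = [(0, 8, 1, 7), (1, 3, 2, 8), (3, 5, 4, 8), (5, 7, 6, 8), (0, 15, 14, 9), (2, 15, 9, 10), (10, 12, 15, 11), (12, 14, 15, 13), (0, 2, 9, 1)]"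

text \<open>The boundary of the region covered by the wheel, traversed clockwise so that the outer
  face is on the left.\<close>

definition outer_darts :: "(nat \<times> nat) list" where
  "outer_darts = [(4, 2), (6, 4), (0, 6), (13, 0), (11, 13), (2, 11)]"

text \<open>The neighbours of each vertex in counterclockwise order.\<close>

definition rotations :: "nat list list" where
  "rotations =
    [[2, 1, 8, 7, 6, 13, 14, 15, 9],
     [2, 3, 8, 7, 0, 9],
     [0, 9, 15, 10, 11, 4, 3, 8, 1],
     [4, 5, 8, 1, 2],
     [6, 5, 8, 3, 2],
     [6, 7, 8, 3, 4],
     [0, 7, 8, 5, 4],
     [0, 1, 8, 5, 6],
     [0, 1, 2, 3, 4, 5, 6, 7],
     [0, 14, 15, 10, 2, 1],
     [2, 9, 15, 12, 11],
     [2, 10, 15, 12, 13],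
     [11, 10, 15, 14, 13],
     [11, 12, 15, 14, 0],
     [13, 12, 15, 9, 0],
     [14, 13, 12, 11, 10, 2, 9, 0]]"

definition antiprism_edges :: "(nat \<times> nat) list" where
  "antiprism_edges = [(0, 1), (0, 2), (0, 6), (0, 7), (0, 8), (1, 2), (1, 3), (1, 7), (1, 8), (2, 3), (2, 4), (2, 8), (3,
    4), (3, 5), (3, 8), (4, 5), (4, 6), (4, 8), (5, 6), (5, 7), (5, 8), (6, 7), (6, 8), (7, 8)]"

lemma antiprism_edges: "antiprism_adj a b \<Longrightarrow> a < b \<Longrightarrow> (a, b) \<in> set antiprism_edges"
proof -
  have "\<forall>a\<in>set [0..<9]. \<forall>b\<in>set [0..<9]. antiprism_adj a b \<longrightarrow> a < b \<longrightarrow> (a, b) \<in> set antiprism_edges"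
    by code_simp
  moreover assume "antiprism_adj a b" "a < b"
  moreover have "a < 9" "b < 9" using \<open>antiprism_adj a b\<close> by (auto simp: antiprism_adj_def)
  ultimately show ?thesis by simp
qed

lemma disjoint_antiprism_edges:
  "filter (\<lambda>((a, b), c, d). a < c \<and> distinct [a, b, c, d]) (List.product antiprism_edges antiprism_edges) =
   [((0, 1), 2, 3), ((0, 1), 2, 4), ((0, 1), 2, 8), ((0, 1), 3, 4), ((0, 1), 3, 5), ((0, 1), 3, 8),
    ((0, 1), 4, 5), ((0, 1), 4, 6), ((0, 1), 4, 8), ((0, 1), 5, 6), ((0, 1), 5, 7), ((0, 1), 5, 8),
    ((0, 1), 6, 7), ((0, 1), 6, 8), ((0, 1), 7, 8), ((0, 2), 1, 3), ((0, 2), 1, 7), ((0, 2), 1, 8),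
    ((0, 2), 3, 4), ((0, 2), 3, 5), ((0, 2), 3, 8), ((0, 2), 4, 5), ((0, 2), 4, 6), ((0, 2), 4, 8),
    ((0, 2), 5, 6), ((0, 2), 5, 7), ((0, 2), 5, 8), ((0, 2), 6, 7), ((0, 2), 6, 8), ((0, 2), 7, 8),
    ((0, 6), 1, 2), ((0, 6), 1, 3), ((0, 6), 1, 7), ((0, 6), 1, 8), ((0, 6), 2, 3), ((0, 6), 2, 4),
    ((0, 6), 2, 8), ((0, 6), 3, 4), ((0, 6), 3, 5), ((0, 6), 3, 8), ((0, 6), 4, 5), ((0, 6), 4, 8),
    ((0, 6), 5, 7), ((0, 6), 5, 8), ((0, 6), 7, 8), ((0, 7), 1, 2), ((0, 7), 1, 3), ((0, 7), 1, 8),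
    ((0, 7), 2, 3), ((0, 7), 2, 4), ((0, 7), 2, 8), ((0, 7), 3, 4), ((0, 7), 3, 5), ((0, 7), 3, 8),
    ((0, 7), 4, 5), ((0, 7), 4, 6), ((0, 7), 4, 8), ((0, 7), 5, 6), ((0, 7), 5, 8), ((0, 7), 6, 8),
    ((0, 8), 1, 2), ((0, 8), 1, 3), ((0, 8), 1, 7), ((0, 8), 2, 3), ((0, 8), 2, 4), ((0, 8), 3, 4),
    ((0, 8), 3, 5), ((0, 8), 4, 5), ((0, 8), 4, 6), ((0, 8), 5, 6), ((0, 8), 5, 7), ((0, 8), 6, 7),
    ((1, 2), 3, 4), ((1, 2), 3, 5), ((1, 2), 3, 8), ((1, 2), 4, 5), ((1, 2), 4, 6), ((1, 2), 4, 8),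
    ((1, 2), 5, 6), ((1, 2), 5, 7), ((1, 2), 5, 8), ((1, 2), 6, 7), ((1, 2), 6, 8), ((1, 2), 7, 8),
    ((1, 3), 2, 4), ((1, 3), 2, 8), ((1, 3), 4, 5), ((1, 3), 4, 6), ((1, 3), 4, 8), ((1, 3), 5, 6),
    ((1, 3), 5, 7), ((1, 3), 5, 8), ((1, 3), 6, 7), ((1, 3), 6, 8), ((1, 3), 7, 8), ((1, 7), 2, 3),
    ((1, 7), 2, 4), ((1, 7), 2, 8), ((1, 7), 3, 4), ((1, 7), 3, 5), ((1, 7), 3, 8), ((1, 7), 4, 5),
    ((1, 7), 4, 6), ((1, 7), 4, 8), ((1, 7), 5, 6), ((1, 7), 5, 8), ((1, 7), 6, 8), ((1, 8), 2, 3),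
    ((1, 8), 2, 4), ((1, 8), 3, 4), ((1, 8), 3, 5), ((1, 8), 4, 5), ((1, 8), 4, 6), ((1, 8), 5, 6),
    ((1, 8), 5, 7), ((1, 8), 6, 7), ((2, 3), 4, 5), ((2, 3), 4, 6), ((2, 3), 4, 8), ((2, 3), 5, 6),
    ((2, 3), 5, 7), ((2, 3), 5, 8), ((2, 3), 6, 7), ((2, 3), 6, 8), ((2, 3), 7, 8), ((2, 4), 3, 5),
    ((2, 4), 3, 8), ((2, 4), 5, 6), ((2, 4), 5, 7), ((2, 4), 5, 8), ((2, 4), 6, 7), ((2, 4), 6, 8),
    ((2, 4), 7, 8), ((2, 8), 3, 4), ((2, 8), 3, 5), ((2, 8), 4, 5), ((2, 8), 4, 6), ((2, 8), 5, 6),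
    ((2, 8), 5, 7), ((2, 8), 6, 7), ((3, 4), 5, 6), ((3, 4), 5, 7), ((3, 4), 5, 8), ((3, 4), 6, 7),
    ((3, 4), 6, 8), ((3, 4), 7, 8), ((3, 5), 4, 6), ((3, 5), 4, 8), ((3, 5), 6, 7), ((3, 5), 6, 8),
    ((3, 5), 7, 8), ((3, 8), 4, 5), ((3, 8), 4, 6), ((3, 8), 5, 6), ((3, 8), 5, 7), ((3, 8), 6, 7),
    ((4, 5), 6, 7), ((4, 5), 6, 8), ((4, 5), 7, 8), ((4, 6), 5, 7), ((4, 6), 5, 8), ((4, 6), 7, 8),
    ((4, 8), 5, 6), ((4, 8), 5, 7), ((4, 8), 6, 7), ((5, 6), 7, 8), ((5, 7), 6, 8), ((5, 8), 6, 7)]"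
  by code_simp

lemma standard_crossings_iff:
  assumes "standard_crossings Q" "antiprism_adj a b" "antiprism_adj c d" "distinct [a, b, c, d]"
    "a < b" "c < d" "a < c"
  shows "opposite Q a b c d \<longleftrightarrow>
    ((a, b), (c, d)) \<in> {((0, 8), (1, 7)), ((1, 3), (2, 8)), ((3, 5), (4, 8)), ((5, 7), (6, 8))}"
proof -
  have m: "((a, b), (c, d)) \<in> set (filter (\<lambda>((a, b), c, d). a < c \<and> distinct [a, b, c, d])
      (List.product antiprism_edges antiprism_edges))"
    using antiprism_edges assms by simp
  have "list_all (\<lambda>((a, b), (c, d)). opposite Q a b c d \<longleftrightarrow>
    ((a, b), (c, d)) \<in> {((0, 8), (1, 7)), ((1, 3), (2, 8)), ((3, 5), (4, 8)), ((5, 7), (6, 8))})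
    (filter (\<lambda>((a, b), c, d). a < c \<and> distinct [a, b, c, d]) (List.product antiprism_edges antiprism_edges))"
    unfolding disjoint_antiprism_edges
    by (simp only: list.pred_inject prod.case prod.inject insert_iff empty_iff numeral_order
        assms(1)[unfolded standard_crossings_def])
  from bspec[OF this[unfolded list_all_iff] m] show ?thesis by (simp only: prod.case)
qed

text \<open>The list form of the hypothesis on consecutive directions in \<open>ccw3_sorted\<close>,
  with d the first direction.\<close>

fun cyc_chain :: "(nat \<Rightarrow> complex) \<Rightarrow> nat \<Rightarrow> nat \<Rightarrow> nat list \<Rightarrow> bool" where
  "cyc_chain Q v d (x # y # L) \<longleftrightarrow> cyc Q v d x y \<and> cyc_chain Q v d (y # L)"
| "cyc_chain Q v d L \<longleftrightarrow> True"

context sum_layout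
begin

lemmas layout = layout0 layout1 layout2 layout3 layout4 layout5 layout6 layout7 layout8 layout9

lemma wheel_ok: "\<forall>(a, b, c)\<in>set wheel. sum_adj a b \<and> sum_adj b c \<and> sum_adj c a \<and> pos Q a b c"
proof -
  have "pos Q 8 0 2 & pos Q 8 2 4 & pos Q 8 4 6 & pos Q 8 6 0 & pos Q 15 2 0 & pos Q 15 11 2 &
      pos Q 15 13 11 & pos Q 15 0 13"
    using layout_facts by (simp only: norm16)
  then show ?thesis by (simp add: wheel_def sum_adj_edges del: One_nat_def)
qed

lemma apart_pairs:
  "list_all (\<lambda>(s, t). apart Q s t)
   [((8, 0, 2), 8, 2, 4), ((8, 0, 2), 8, 4, 6), ((8, 0, 2), 8, 6, 0), ((8, 0, 2), 15, 2, 0), ((8, 0,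
    2), 15, 11, 2), ((8, 0, 2), 15, 13, 11), ((8, 0, 2), 15, 0, 13), ((8, 2, 4), 8, 4, 6), ((8, 2,
    4), 8, 6, 0), ((8, 2, 4), 15, 2, 0), ((8, 2, 4), 15, 11, 2), ((8, 2, 4), 15, 13, 11), ((8, 2,
    4), 15, 0, 13), ((8, 4, 6), 8, 6, 0), ((8, 4, 6), 15, 2, 0), ((8, 4, 6), 15, 11, 2), ((8, 4, 6),
    15, 13, 11), ((8, 4, 6), 15, 0, 13), ((8, 6, 0), 15, 2, 0), ((8, 6, 0), 15, 11, 2), ((8, 6, 0),
    15, 13, 11), ((8, 6, 0), 15, 0, 13), ((15, 2, 0), 15, 11, 2), ((15, 2, 0), 15, 13, 11), ((15, 2,
    0), 15, 0, 13), ((15, 11, 2), 15, 13, 11), ((15, 11, 2), 15, 0, 13), ((15, 13, 11), 15, 0, 13)]"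
  by (simp only: apart_def list.pred_inject prod.case norm16 layout layout_facts)

lemma wheel_apart:
  assumes "s \<in> set wheel" "t \<in> set wheel" "s \<noteq> t"
  shows "apart Q s t \<or> apart Q t s"
proof -
  let ?L = "[((8, 0, 2), 8, 2, 4), ((8, 0, 2), 8, 4, 6), ((8, 0, 2), 8, 6, 0), ((8, 0, 2), 15, 2, 0), ((8, 0,
    2), 15, 11, 2), ((8, 0, 2), 15, 13, 11), ((8, 0, 2), 15, 0, 13), ((8, 2, 4), 8, 4, 6), ((8, 2,
    4), 8, 6, 0), ((8, 2, 4), 15, 2, 0), ((8, 2, 4), 15, 11, 2), ((8, 2, 4), 15, 13, 11), ((8, 2,
    4), 15, 0, 13), ((8, 4, 6), 8, 6, 0), ((8, 4, 6), 15, 2, 0), ((8, 4, 6), 15, 11, 2), ((8, 4, 6),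
    15, 13, 11), ((8, 4, 6), 15, 0, 13), ((8, 6, 0), 15, 2, 0), ((8, 6, 0), 15, 11, 2), ((8, 6, 0),
    15, 13, 11), ((8, 6, 0), 15, 0, 13), ((15, 2, 0), 15, 11, 2), ((15, 2, 0), 15, 13, 11), ((15, 2,
    0), 15, 0, 13), ((15, 11, 2), 15, 13, 11), ((15, 11, 2), 15, 0, 13), ((15, 13, 11), 15, 0, 13)] :: ((nat \<times> nat \<times> nat) \<times> (nat \<times> nat \<times> nat)) list"
  have "\<forall>s\<in>set wheel. \<forall>t\<in>set wheel. s \<noteq> t \<longrightarrow> (s, t) \<in> set ?L \<or> (t, s) \<in> set ?L" by code_simp
  then have "(s, t) \<in> set ?L \<or> (t, s) \<in> set ?L" using assms by blast
  then show ?thesis using apart_pairs unfolding list_all_iff by fast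
qed

lemma inner_ok: "\<forall>((a, b, c), w)\<in>set inner. (a, b, c) \<in> set wheel \<and>
    sum_adj a w \<and> sum_adj b w \<and> sum_adj c w \<and> pos Q a b w \<and> pos Q b c w \<and> pos Q c a w"
  unfolding inner_def wheel_def
  by (simp add: layout layout_facts sum_adj_edges pos_sort del: One_nat_def)

lemma crossing_edges_opposite: "\<forall>((a, b), (c, d))\<in>set crossing_edges. opposite Q a b c d"
  unfolding crossing_edges_def
  by (simp add: layout layout_facts del: One_nat_def)

lemma oriented_crossings_pos: "\<forall>(a, b, c, d)\<in>set oriented_crossings. pos Q a b d"
proof -
  \<comment> \<open>For these two crossings the triple asked for contains no hub, so its sign is
    obtained from the crossing itself.\<close>
  have "opposite Q 10 12 11 15" "opposite Q 12 14 13 15" by (simp_all only: layout_facts simp_thms)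
  then have "\<not> pos Q 10 11 12 \<and> \<not> pos Q 12 13 14"
    unfolding opposite_pos by (simp add: layout_facts pos_sort del: One_nat_def)
  then show ?thesis
    unfolding oriented_crossings_def by (simp add: layout layout_facts pos_sort del: One_nat_def)
qed

lemma long_edge_crossings:
  "list_all (\<lambda>(c, d). c = 1 \<or> c = 9 \<or> d = 1 \<or> d = 9 \<or> (opposite Q 1 9 c d \<longleftrightarrow> c = 0 \<and> d = 2)) sum_edges"
  by (simp only: sum_edges_def list.pred_inject prod.case norm16 layout layout_facts)

lemma rotations_cyc:
  "list_all2 (\<lambda>v L. cyc_chain Q v (hd L) (tl L)) [0, 1, 2, 3, 4, 5, 6, 7, 8, 9, 10, 11, 12, 13, 14, 15] rotations"
  by (simp only: rotations_def list.rel_inject list.sel cyc_chain.simps layout simp_thms)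

end

definition corners :: "nat \<times> nat \<times> nat \<Rightarrow> nat set" where
  "corners = (\<lambda>(a, b, c). {a, b, c})"

definition region :: "(nat \<Rightarrow> complex) \<Rightarrow> (nat \<times> nat \<times> nat) list \<Rightarrow> complex set" where
  "region P L = (\<Union>t\<in>set L. triangle P t)"

definition rim1 :: "(nat \<times> nat \<times> nat) list" where "rim1 = take 4 wheel"

definition rim2 :: "(nat \<times> nat \<times> nat) list" where "rim2 = drop 4 wheel"

text \<open>Reasons for the segment between two vertices to lie in a union of triangles: it is a side, it joins
  an inner vertex to a corner, or it joins two inner vertices across a common side.\<close>

definition covered :: "(nat \<times> nat \<times> nat) list \<Rightarrow> nat \<times> nat \<Rightarrow> bool" where
  "covered L = (\<lambda>(a, b).
     (\<exists>t\<in>set L. a \<in> corners t \<and> b \<in> corners t) \<or>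
     (\<exists>(t, w)\<in>set inner. t \<in> set L \<and> (w = a \<and> b \<in> corners t \<or> w = b \<and> a \<in> corners t)) \<or>
     (\<exists>((c, d), (e, f))\<in>set crossing_edges. \<exists>(t, w)\<in>set inner. \<exists>(t', w')\<in>set inner.
        t \<in> set L \<and> t' \<in> set L \<and> w = a \<and> w' = b \<and>
        ((a, b) = (e, f) \<and> c \<in> corners t \<inter> corners t' \<and> d \<in> corners t \<inter> corners t' \<or>
         (a, b) = (c, d) \<and> e \<in> corners t \<inter> corners t' \<and> f \<in> corners t \<inter> corners t')))"

definition sort_pair :: "nat \<times> nat \<Rightarrow> nat \<times> nat" where
  "sort_pair = (\<lambda>(a, b). (min a b, max a b))"

definition second_pair :: "nat \<times> nat \<Rightarrow> nat \<times> nat" where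
  "second_pair = (\<lambda>(a, b). sort_pair (second a, second b))"

lemma covered_edges:
  "\<forall>s\<in>set antiprism_edges. covered rim1 s \<and> covered rim2 (second_pair s)" "covered wheel (1, 9)"
  by code_simp+

lemma sum_edges_cases:
  assumes "s \<in> set sum_edges"
  obtains "s \<in> set antiprism_edges" | i where "i \<in> set antiprism_edges" "s = second_pair i" | "s = (1, 9)"
proof -
  have "\<forall>s\<in>set sum_edges. s \<in> set antiprism_edges \<or> s \<in> second_pair ` set antiprism_edges \<or> s = (1, 9)"
    by code_simp
  then show thesis using assms that by blast
qed

lemma sum_edges_adj: "(a, b) \<in> set sum_edges \<Longrightarrow> sum_adj a b"
  by (simp add: sum_adj_def)

lemma sum_edges_sorted: "(a, b) \<in> set sum_edges \<Longrightarrow> a < b \<and> b < 16"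
proof -
  have "\<forall>(a, b)\<in>set sum_edges. a < b \<and> b < 16" by code_simp
  then show "(a, b) \<in> set sum_edges \<Longrightarrow> a < b \<and> b < 16" by blast
qed

lemma antiprism_edges_adj: "(a, b) \<in> set antiprism_edges \<Longrightarrow> antiprism_adj a b \<and> a < b"
proof -
  have "\<forall>(a, b)\<in>set antiprism_edges. antiprism_adj a b \<and> a < b" by code_simp
  then show "(a, b) \<in> set antiprism_edges \<Longrightarrow> antiprism_adj a b \<and> a < b" by blast
qed

lemma crossing_edges_in: "(s, t) \<in> set crossing_edges \<Longrightarrow> s \<in> set sum_edges \<and> t \<in> set sum_edges \<and> distinct [fst s, snd s, fst t, snd t]"
proof -
  have "\<forall>(s, t)\<in>set crossing_edges. s \<in> set sum_edges \<and> t \<in> set sum_edges \<and> distinct [fst s, snd s, fst t, snd t]"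
    by code_simp
  then show "(s, t) \<in> set crossing_edges \<Longrightarrow> s \<in> set sum_edges \<and> t \<in> set sum_edges \<and> distinct [fst s, snd s, fst t, snd t]"
    by blast
qed

lemma corners_hull: "a \<in> corners t \<Longrightarrow> P a \<in> triangle P t"
  by (auto simp: corners_def triangle_def intro: hull_inc split: prod.splits)

lemma triangle_convex: "convex (triangle P t)"
  by (auto simp: triangle_def split: prod.splits)

lemma triangle_compact: "compact (triangle P t)"
  by (auto simp: triangle_def intro!: finite_imp_compact_convex_hull split: prod.splits)

lemma region_compact: "compact (region P L)"
  unfolding region_def by (intro compact_UN triangle_compact) auto

lemma triangle_segment:
  "x \<in> triangle P t \<Longrightarrow> y \<in> triangle P t \<Longrightarrow> t \<in> set L \<Longrightarrow> closed_segment x y \<subseteq> region P L"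
  using closed_segment_subset[OF _ _ triangle_convex[of P t]] unfolding region_def by blast

context sum_layout
begin

lemma wheel_orient: "(a, b, c) \<in> set wheel \<Longrightarrow> 0 < orient (P a) (P b) (P c)"
proof -
  assume "(a, b, c) \<in> set wheel"
  then have E: "sum_adj a b" "sum_adj b c" "sum_adj c a" "pos Q a b c" using wheel_ok by fast+
  then show ?thesis
    using pos_iff[of a b c] triangle_orient[OF E(1,2) E_sym[OF E(3)]] E_less by simp
qed

lemma wheel_meet:
  assumes "s \<in> set wheel" "t \<in> set wheel" "s \<noteq> t"
  shows "triangle P s \<inter> triangle P t \<subseteq> convex hull (P ` (corners s \<inter> corners t))"
proof -
  have *: "triangle P s \<inter> triangle P t \<subseteq> convex hull (P ` (corners s \<inter> corners t))"
    if "s \<in> set wheel" "t \<in> set wheel" "apart Q s t" for s t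
  proof -
    obtain a b c d e f where st: "s = (a, b, c)" "t = (d, e, f)" by (metis prod_cases3)
    have E: "sum_adj a b" "sum_adj b c" "sum_adj c a" "pos Q a b c"
      and F: "sum_adj d e" "sum_adj e f" "sum_adj f d" "pos Q d e f"
      using bspec[OF wheel_ok that(1)] bspec[OF wheel_ok that(2)] by (simp_all add: st)
    show ?thesis
      using triangles_meet[OF E(1-3) F(1-3) E(4) F(4)] that(3) by (simp add: st corners_def)
  qed
  show ?thesis using wheel_apart[OF assms] *[OF assms(1,2)] *[OF assms(2,1)] by (auto simp: Int_commute)
qed

text \<open>Triangles of different hubs share at most the corners 0 and 2, and they meet only in the
  hull of their common corners.\<close>

lemma rims_meet: "region P rim1 \<inter> region P rim2 = closed_segment (P 0) (P 2)"
proof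
  have chk: "\<forall>s\<in>set rim1. \<forall>t\<in>set rim2. s \<in> set wheel \<and> t \<in> set wheel \<and> s \<noteq> t \<and> corners s \<inter> corners t \<subseteq> {0, 2}"
    unfolding rim1_def rim2_def wheel_def corners_def by (simp add: numeral_eq_Suc)
  show "region P rim1 \<inter> region P rim2 \<subseteq> closed_segment (P 0) (P 2)"
  proof
    fix x assume "x \<in> region P rim1 \<inter> region P rim2"
    then obtain s t where st: "s \<in> set rim1" "t \<in> set rim2" "x \<in> triangle P s \<inter> triangle P t"
      by (auto simp: region_def)
    then have "x \<in> convex hull (P ` (corners s \<inter> corners t))" using wheel_meet chk by blast
    moreover have "P ` (corners s \<inter> corners t) \<subseteq> {P 0, P 2}" using chk st by blast
    ultimately show "x \<in> closed_segment (P 0) (P 2)"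
      unfolding segment_convex_hull using hull_mono by blast
  qed
  have "closed_segment (P 0) (P 2) \<subseteq> region P rim1"
    by (rule triangle_segment[OF corners_hull corners_hull, of _ "(8, 0, 2)"]) (simp_all add: corners_def rim1_def wheel_def)
  moreover have "closed_segment (P 0) (P 2) \<subseteq> region P rim2"
    by (rule triangle_segment[OF corners_hull corners_hull, of _ "(15, 2, 0)"]) (simp_all add: corners_def rim2_def wheel_def)
  ultimately show "closed_segment (P 0) (P 2) \<subseteq> region P rim1 \<inter> region P rim2" by blast
qed

lemma rim_complement_connected:
  assumes "\<forall>t\<in>set L. h \<in> corners t" "L \<noteq> []"
  shows "connected (- region P L)"
proof (rule star_complement_connected[of _ "P h"])
  show "compact (region P L)" by (rule region_compact)
  show "P h \<in> region P L" unfolding region_def using assms corners_hull[of h "hd L" P] hd_in_set[of L] by blast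
  show "closed_segment (P h) x \<subseteq> region P L" if x: "x \<in> region P L" for x
  proof -
    obtain t where t: "t \<in> set L" "x \<in> triangle P t" using x unfolding region_def by blast
    show ?thesis by (rule triangle_segment[OF corners_hull t(2,1)]) (use assms(1) t(1) in blast)
  qed
qed

text \<open>Each half of the wheel is star-shaped about its hub, so its complement is connected. The
  halves meet in a segment, which is connected, and Janiszewski's theorem gives the union.\<close>

lemma complement_connected: "connected (- region P wheel)"
proof -
  have eq: "region P wheel = region P rim1 \<union> region P rim2"
    unfolding region_def rim1_def rim2_def
    by (metis UN_Un append_take_drop_id set_append)
  have "\<forall>t\<in>set rim1. 8 \<in> corners t" "\<forall>t\<in>set rim2. 15 \<in> corners t" "rim1 \<noteq> []" "rim2 \<noteq> []"
    by (simp_all add: rim1_def rim2_def wheel_def corners_def)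
  then show ?thesis
    unfolding eq by (intro Janiszewski_connected rim_complement_connected region_compact
        compact_imp_closed[OF region_compact]) (auto simp: rims_meet)
qed

lemma inner_interior:
  assumes "(t, w) \<in> set inner"
  shows "P w \<in> interior (triangle P t)"
proof -
  obtain a b c where t: "t = (a, b, c)" by (cases t)
  have *: "(a, b, c) \<in> set wheel" "sum_adj a w" "sum_adj b w" "sum_adj c w" "pos Q a b w" "pos Q b c w" "pos Q c a w"
    using bspec[OF inner_ok assms] by (simp_all add: t)
  have E: "sum_adj a b" "sum_adj b c" "sum_adj c a" using bspec[OF wheel_ok *(1)] by simp_all
  have less: "a < 16" "b < 16" "c < 16" "w < 16" using E_less[OF E(1)] E_less[OF E(2)] E_less[OF E(3)] E_less2[OF *(2)] by auto
  have "0 < orient (P a) (P b) (P w)" "0 < orient (P b) (P c) (P w)" "0 < orient (P c) (P a) (P w)"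
    using pos_iff[OF less(1,2,4)] pos_iff[OF less(2,3,4)] pos_iff[OF less(3,1,4)] *(5-7)
      triangle_orient[OF E(1) *(3,2)] triangle_orient[OF E(2) *(4,3)] triangle_orient[OF E(3) *(2,4)] by simp_all
  then show ?thesis
    using in_interior_triangle[OF wheel_orient[OF *(1)]] by (simp add: t triangle_def)
qed

lemma crossing_meets:
  assumes "((a, b), (c, d)) \<in> set crossing_edges"
  obtains x where "x \<in> closed_segment (P a) (P b)" "x \<in> closed_segment (P c) (P d)"
proof -
  have in': "(a, b) \<in> set sum_edges" "(c, d) \<in> set sum_edges" "distinct [a, b, c, d]"
    using crossing_edges_in[OF assms] by auto
  have "opposite Q a b c d" using bspec[OF crossing_edges_opposite assms] by simp
  then have "closed_segment (P a) (P b) \<inter> closed_segment (P c) (P d) \<noteq> {}"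
    using opposite_iff_meeting[OF sum_edges_adj[OF in'(1)] sum_edges_adj[OF in'(2)] in'(3)] by blast
  then show thesis using that by blast
qed

lemma covered_segment:
  assumes "covered L (a, b)"
  shows "closed_segment (P a) (P b) \<subseteq> region P L"
proof -
  have tri: "P w \<in> triangle P t" if "(t, w) \<in> set inner" for t w
    using inner_interior[OF that] interior_subset by blast
  \<comment> \<open>An edge between two inner vertices crosses the common side of their triangles at
    x, and each of its halves stays in one triangle.\<close>
  have cross: "closed_segment (P a) (P b) \<subseteq> region P L"
    if "(t, a) \<in> set inner" "(t', b) \<in> set inner" "t \<in> set L" "t' \<in> set L"
      and cd: "c \<in> corners t \<inter> corners t'" "d \<in> corners t \<inter> corners t'"
      and x: "x \<in> closed_segment (P a) (P b)" "x \<in> closed_segment (P c) (P d)" for t t' c d x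
  proof -
    have "x \<in> triangle P t" "x \<in> triangle P t'"
      using closed_segment_subset[OF corners_hull corners_hull triangle_convex, of c t d P]
        closed_segment_subset[OF corners_hull corners_hull triangle_convex, of c t' d P] cd x(2) by auto
    then have "closed_segment (P a) x \<subseteq> region P L" "closed_segment x (P b) \<subseteq> region P L"
      using triangle_segment[OF tri[OF that(1)] _ that(3), of x] triangle_segment[OF _ tri[OF that(2)] that(4), of x] by simp_all
    then show ?thesis using Un_closed_segment[OF x(1)] by blast
  qed
  from assms show ?thesis
    unfolding covered_def prod.case
  proof (elim disjE)
    assume "\<exists>t\<in>set L. a \<in> corners t \<and> b \<in> corners t"
    then obtain t where "t \<in> set L" "a \<in> corners t" "b \<in> corners t" by blast
    then show ?thesis using triangle_segment[OF corners_hull corners_hull, of a t b L P] by blast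
  next
    assume "\<exists>(t, w)\<in>set inner. t \<in> set L \<and> (w = a \<and> b \<in> corners t \<or> w = b \<and> a \<in> corners t)"
    then obtain t w where tw: "(t, w) \<in> set inner" "t \<in> set L" "w = a \<and> b \<in> corners t \<or> w = b \<and> a \<in> corners t" by blast
    then have "P a \<in> triangle P t" "P b \<in> triangle P t" using tri corners_hull by blast+
    then show ?thesis using triangle_segment[of "P a" P t "P b" L] tw(2) by simp
  next
    assume "\<exists>((c, d), (e, f))\<in>set crossing_edges. \<exists>(t, w)\<in>set inner. \<exists>(t', w')\<in>set inner.
        t \<in> set L \<and> t' \<in> set L \<and> w = a \<and> w' = b \<and>
        ((a, b) = (e, f) \<and> c \<in> corners t \<inter> corners t' \<and> d \<in> corners t \<inter> corners t' \<or>
         (a, b) = (c, d) \<and> e \<in> corners t \<inter> corners t' \<and> f \<in> corners t \<inter> corners t')"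
    then obtain c d e f t t' where *: "((c, d), (e, f)) \<in> set crossing_edges" "(t, a) \<in> set inner" "(t', b) \<in> set inner"
      "t \<in> set L" "t' \<in> set L"
      and d: "(a = e \<and> b = f) \<and> c \<in> corners t \<inter> corners t' \<and> d \<in> corners t \<inter> corners t' \<or>
         (a = c \<and> b = d) \<and> e \<in> corners t \<inter> corners t' \<and> f \<in> corners t \<inter> corners t'"
      by auto
    obtain x where "x \<in> closed_segment (P c) (P d)" "x \<in> closed_segment (P e) (P f)"
      using crossing_meets[OF *(1)] by blast
    then show ?thesis using cross[OF *(2-5)] d by blast
  qed
qed

end

section \<open>Determining which disjoint edges meet\<close>

definition seg :: "(nat \<Rightarrow> complex) \<Rightarrow> nat \<times> nat \<Rightarrow> complex set" where
  "seg P = (\<lambda>(a, b). closed_segment (P a) (P b))"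

definition disjoint_pairs :: "nat \<times> nat \<Rightarrow> nat \<times> nat \<Rightarrow> bool" where
  "disjoint_pairs s t \<longleftrightarrow> distinct [fst s, snd s, fst t, snd t]"

definition cross_pair :: "nat \<times> nat \<Rightarrow> nat \<times> nat \<Rightarrow> bool" where
  "cross_pair s t \<longleftrightarrow> (s, t) \<in> set crossing_edges \<or> (t, s) \<in> set crossing_edges"

lemma seg_second_pair: "seg P (second_pair s) = seg (P \<circ> second) s"
  by (auto simp: seg_def second_pair_def sort_pair_def min_def max_def closed_segment_commute split: prod.splits)

lemma second_inj: "i < 9 \<Longrightarrow> j < 9 \<Longrightarrow> second i = second j \<longleftrightarrow> i = j"
proof -
  have "\<forall>i\<in>set [0..<9]. \<forall>j\<in>set [0..<9]. second i = second j \<longleftrightarrow> i = j" by code_simp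
  then show "i < 9 \<Longrightarrow> j < 9 \<Longrightarrow> second i = second j \<longleftrightarrow> i = j" by simp
qed

text \<open>The crossings of one antiprism in its own numbering, transported to the second copy by
  \<open>second_pair\<close>.\<close>

definition antiprism_crossings :: "((nat \<times> nat) \<times> (nat \<times> nat)) list" where
  "antiprism_crossings = [((0, 8), (1, 7)), ((1, 3), (2, 8)), ((3, 5), (4, 8)), ((5, 7), (6, 8))]"

lemma (in antiprism_signs) antiprism_meet:
  assumes "standard_crossings Q" "s \<in> set antiprism_edges" "t \<in> set antiprism_edges" "disjoint_pairs s t"
    "seg P s \<inter> seg P t \<noteq> {}"
  shows "(s, t) \<in> set antiprism_crossings \<or>
    (t, s) \<in> set antiprism_crossings"
proof -
  have *: "(s, t) \<in> set antiprism_crossings"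
    if "s \<in> set antiprism_edges" "t \<in> set antiprism_edges" "disjoint_pairs s t" "seg P s \<inter> seg P t \<noteq> {}" "fst s < fst t" for s t
  proof -
    obtain a b c d where st: "s = (a, b)" "t = (c, d)" by (cases s, cases t)
    have E: "antiprism_adj a b" "a < b" "antiprism_adj c d" "c < d" 
      using antiprism_edges_adj[of a b] antiprism_edges_adj[of c d] that(1,2) by (simp_all add: st)
    have d: "distinct [a, b, c, d]" using that(3) by (simp add: disjoint_pairs_def st)
    have "opposite Q a b c d" using opposite_iff_meeting[OF E(1,3) d] that(4) by (simp add: seg_def st)
    then show ?thesis
      using standard_crossings_iff[OF assms(1) E(1,3) d E(2,4)] that(5)
      by (simp only: st fst_conv antiprism_crossings_def list.set)
  qed
  have sym: "disjoint_pairs t s" "seg P t \<inter> seg P s \<noteq> {}" using assms by (auto simp: disjoint_pairs_def)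
  have "fst s < fst t \<or> fst t < fst s" using assms(4) by (auto simp: disjoint_pairs_def)
  then show ?thesis using *[OF assms(2-5)] *[OF assms(3,2) sym] by blast
qed

lemma four_crossings:
  "\<forall>(s, t)\<in>set antiprism_crossings.
     cross_pair s t \<and> cross_pair (second_pair s) (second_pair t) \<and> s \<noteq> (0, 2) \<and> t \<noteq> (0, 2)"
  by code_simp

context sum_layout
begin

lemma meet_first:
  assumes "s \<in> set antiprism_edges" "t \<in> set antiprism_edges" "disjoint_pairs s t" "seg P s \<inter> seg P t \<noteq> {}"
  shows "cross_pair s t \<and> s \<noteq> (0, 2) \<and> t \<noteq> (0, 2)"
proof -
  interpret a: antiprism_signs P Q by (rule first_copy)
  have "standard_crossings Q" using standard1 by (simp add: standard_def)
  from a.antiprism_meet[OF this assms] show ?thesis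
    using four_crossings unfolding cross_pair_def by fast
qed

lemma meet_second:
  assumes "s \<in> set antiprism_edges" "t \<in> set antiprism_edges" "disjoint_pairs (second_pair s) (second_pair t)"
    "seg P (second_pair s) \<inter> seg P (second_pair t) \<noteq> {}"
  shows "cross_pair (second_pair s) (second_pair t) \<and> s \<noteq> (0, 2) \<and> t \<noteq> (0, 2)"
proof -
  interpret b: antiprism_signs "P \<circ> second" "Q \<circ> second" by (rule second_copy)
  have sc: "standard_crossings (Q \<circ> second)" using standard2 by (simp add: antistandard_def)
  have "disjoint_pairs s t"
  proof -
    obtain a b c d where st: "s = (a, b)" "t = (c, d)" by (cases s, cases t)
    have "antiprism_adj a b" "a < b" "antiprism_adj c d" "c < d" 
      using antiprism_edges_adj[of a b] antiprism_edges_adj[of c d] assms(1,2) by (simp_all add: st)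
    then show ?thesis using assms(3)
      by (auto simp: disjoint_pairs_def second_pair_def sort_pair_def st min_def max_def split: if_splits)
  qed
  from b.antiprism_meet[OF sc assms(1,2) this] show ?thesis
    using assms(4) four_crossings unfolding seg_second_pair cross_pair_def by fast
qed

text \<open>An edge that does not cross 0 2 can only meet it when they share a vertex, and then only
  at that vertex.\<close>

lemma meet_shared_edge:
  assumes s: "(a, b) \<in> set sum_edges" "(a, b) \<noteq> (0, 2)" and x: "x \<in> seg P (a, b)" "x \<in> closed_segment (P 0) (P 2)"
    and dis: "disjoint_pairs (a, b) (0, 2) \<Longrightarrow> seg P (a, b) \<inter> seg P (0, 2) \<noteq> {} \<Longrightarrow> False"
  shows "\<exists>w\<in>{a, b}. x = P w \<and> w < 16"
proof -
  have E: "sum_adj a b" "a < b" "b < 16" using sum_edges_adj[OF s(1)] sum_edges_sorted[OF s(1)] by auto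
  have E02: "sum_adj 0 2" "sum_adj 2 0" by (simp_all add: sum_adj_edges)
  have xs: "x \<in> closed_segment (P a) (P b)" "x \<in> closed_segment (P b) (P a)"
    "x \<in> closed_segment (P 2) (P 0)" using x by (auto simp: seg_def closed_segment_commute)
  have "\<not> disjoint_pairs (a, b) (0, 2)" using dis x by (auto simp: seg_def)
  then consider "a = 0" "b \<noteq> 2" | "a = 2" "b \<noteq> 0" | "b = 0" "a \<noteq> 2" | "b = 2" "a \<noteq> 0"
    using s(2) E by (auto simp: disjoint_pairs_def)
  then show ?thesis
  proof cases
    case 1
    then show ?thesis using adjacent_edges_meet[of 0 b 2 x] E E02 xs x by auto
  next
    case 2
    then show ?thesis using adjacent_edges_meet[of 2 b 0 x] E E02 xs x by auto
  next
    case 3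
    then show ?thesis using adjacent_edges_meet[of 0 a 2 x] E_sym[OF E(1)] E E02 xs x by auto
  next
    case 4
    then show ?thesis using adjacent_edges_meet[of 2 a 0 x] E_sym[OF E(1)] E E02 xs x by auto
  qed
qed

text \<open>The edges lie in different halves of the wheel, so a common point is on 0 2. By
  \<open>meet_shared_edge\<close> it is then an end of s, but no vertex lies on the disjoint edge
  t.\<close>

lemma no_mixed_meet:
  assumes s: "s \<in> set antiprism_edges" "s \<noteq> (0, 2)" "s \<in> set sum_edges"
    and t: "i \<in> set antiprism_edges" "t = second_pair i" "t \<noteq> (0, 2)" "t \<in> set sum_edges" and dis: "disjoint_pairs s t"
  shows "seg P s \<inter> seg P t = {}"
proof (rule ccontr)
  assume "seg P s \<inter> seg P t \<noteq> {}"
  then obtain x where x: "x \<in> seg P s" "x \<in> seg P t" by blast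
  obtain a b where ab: "s = (a, b)" by (cases s)
  obtain c d where cd: "t = (c, d)" by (cases t)
  have "covered rim1 (a, b)" "covered rim2 (c, d)"
    using bspec[OF covered_edges(1) s(1)] bspec[OF covered_edges(1) t(1)] unfolding t(2)[symmetric] ab cd by simp_all
  from this[THEN covered_segment] have "seg P s \<subseteq> region P rim1" "seg P t \<subseteq> region P rim2"
    unfolding seg_def ab cd by simp_all
  then have x02: "x \<in> closed_segment (P 0) (P 2)" using rims_meet x by blast
  have 02: "(0, 2) \<in> set antiprism_edges" by (simp add: antiprism_edges_def)
  have "\<exists>w\<in>{a, b}. x = P w \<and> w < 16"
  proof (rule meet_shared_edge[OF _ _ _ x02])
    show "(a, b) \<in> set sum_edges" "(a, b) \<noteq> (0, 2)" "x \<in> seg P (a, b)" using s x(1) unfolding ab by simp_all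
    show False if "disjoint_pairs (a, b) (0, 2)" "seg P (a, b) \<inter> seg P (0, 2) \<noteq> {}"
      using meet_first[OF s(1) 02] that unfolding ab by simp
  qed
  then obtain w where w: "w \<in> {a, b}" "x = P w" "w < 16" by blast
  then have "w \<noteq> c" "w \<noteq> d" using dis by (auto simp: disjoint_pairs_def ab cd)
  then have "P w \<notin> closed_segment (P c) (P d)"
    using not_on_edge[OF sum_edges_adj[of c d] w(3)] t(4) unfolding cd by blast
  then show False using w(2) x(2) by (simp add: cd seg_def)
qed

text \<open>An edge belongs to the first copy, to the second copy, or is 1 9. Within a copy its
  picture decides, between the copies nothing meets, and 1 9 meets only 0 2. The edge 0 2 belongs to
  both copies and is treated in whichever copy contains the other edge.\<close>

lemma meet_iff:
  assumes s: "s \<in> set sum_edges" and t: "t \<in> set sum_edges" and dis: "disjoint_pairs s t"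
  shows "seg P s \<inter> seg P t \<noteq> {} \<longleftrightarrow> cross_pair s t"
proof
  have cm: "seg P s \<inter> seg P t \<noteq> {}" if "(s, t) \<in> set crossing_edges" for s t
  proof -
    obtain a b c d where st: "s = (a, b)" "t = (c, d)" by (cases s, cases t)
    obtain x where "x \<in> closed_segment (P a) (P b)" "x \<in> closed_segment (P c) (P d)"
      using crossing_meets[of a b c d] \<open>(s, t) \<in> set crossing_edges\<close> unfolding st by metis
    then show ?thesis unfolding seg_def st by auto
  qed
  assume "cross_pair s t"
  then show "seg P s \<inter> seg P t \<noteq> {}" using cm[of s t] cm[of t s] unfolding cross_pair_def by blast
next
  assume m: "seg P s \<inter> seg P t \<noteq> {}"
  have m': "seg P t \<inter> seg P s \<noteq> {}" using m by blast
  have dis': "disjoint_pairs t s" using dis by (auto simp: disjoint_pairs_def)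
  have csym: "cross_pair t s \<longleftrightarrow> cross_pair s t" for s t by (auto simp: cross_pair_def)
  have 02: "(0, 2) \<in> set antiprism_edges" "second_pair (0, 2) = (0, 2)"
    by (simp_all add: antiprism_edges_def second_pair_def sort_pair_def second_def)
  have long: "cross_pair (1, 9) t" if "t \<in> set sum_edges" "disjoint_pairs (1, 9) t" "seg P (1, 9) \<inter> seg P t \<noteq> {}" for t
  proof -
    obtain c d where cd: "t = (c, d)" by (cases t)
    have "distinct [1, 9, c, d]" using that(2) by (simp add: disjoint_pairs_def cd)
    moreover have "sum_adj 1 9" by (simp add: sum_adj_edges del: One_nat_def)
    ultimately have "opposite Q 1 9 c d"
      using opposite_iff_meeting[OF _ sum_edges_adj, of 1 9 c d] that(1,3) unfolding seg_def cd prod.case by blast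
    moreover have "c \<noteq> 1" "c \<noteq> 9" "d \<noteq> 1" "d \<noteq> 9" using \<open>distinct [1, 9, c, d]\<close> by auto
    ultimately have "c = 0 \<and> d = 2"
      using bspec[OF long_edge_crossings[unfolded list_all_iff] that(1)] unfolding cd prod.case by blast
    then show ?thesis by (simp add: cd cross_pair_def crossing_edges_def)
  qed
  have mixed: False if "s \<in> set antiprism_edges" "s \<noteq> (0, 2)" "i \<in> set antiprism_edges" "t = second_pair i" "t \<noteq> (0, 2)"
    "s \<in> set sum_edges" "t \<in> set sum_edges" "disjoint_pairs s t" "seg P s \<inter> seg P t \<noteq> {}" for s t i
    using no_mixed_meet[OF that(1,2,6,3,4,5,7,8)] that(9) by blast
  show "cross_pair s t"
  proof (cases rule: sum_edges_cases[OF s])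
    case 1
    show ?thesis
    proof (cases rule: sum_edges_cases[OF t])
      case 1 then show ?thesis using meet_first[OF \<open>s \<in> set antiprism_edges\<close> 1 dis m] by blast
    next
      case (2 j)
      show ?thesis
      proof (cases "s = (0, 2)")
        case True
        show ?thesis
          using meet_second[OF 02(1) 2(1), unfolded 02(2), folded 2(2)] dis m unfolding True by blast
      next
        case s02: False
        show ?thesis
        proof (cases "t = (0, 2)")
          case True
          show ?thesis using meet_first[OF 1 02(1)] dis m unfolding True by blast
        next
          case False
          then show ?thesis using mixed[OF 1 s02 2 False s t dis m] by blast
        qed
      qed
    next
      case 3
      show ?thesis using long[OF s] dis' m' csym[of t s] unfolding 3 by blast
    qed
  next
    case (2 i)
    show ?thesis
    proof (cases rule: sum_edges_cases[OF t])
      case 1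
      show ?thesis
      proof (cases "t = (0, 2)")
        case True
        show ?thesis
          using meet_second[OF 2(1) 02(1), unfolded 02(2), folded 2(2)] dis m unfolding True by blast
      next
        case t02: False
        show ?thesis
        proof (cases "s = (0, 2)")
          case True
          show ?thesis using meet_first[OF 02(1) 1] dis m unfolding True by blast
        next
          case False
          then show ?thesis using mixed[OF 1 t02 2 False t s dis' m'] by blast
        qed
      qed
    next
      case (2 j)
      show ?thesis
        using meet_second[OF \<open>i \<in> set antiprism_edges\<close> 2(1)] dis m
        unfolding \<open>s = second_pair i\<close>[symmetric] 2(2)[symmetric] by blast
    next
      case 3
      show ?thesis using long[OF s] dis' m' csym[of t s] unfolding 3 by blast
    qed
  next
    case 3
    show ?thesis using long[OF t] dis m unfolding 3 by blast
  qed
qed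

end

section \<open>Cyclic orders at the vertices of the actual drawing\<close>

section \<open>Rotations\<close>

context rac_signs
begin

text \<open>Collinear edges at v do not lie on one ray, by \<open>rays_distinct\<close>, so they
  point in opposite directions.\<close>

lemma opposite_ray:
  assumes "E v a" "E v b" "a \<noteq> b" "orient (P v) (P a) (P b) = 0"
  shows "\<exists>k>0. P b - P v = - k *\<^sub>R (P a - P v)"
proof -
  have ne: "P a - P v \<noteq> 0" "P b - P v \<noteq> 0"
    using P_inj[of a v] P_inj[of b v] E_less[OF assms(1)] E_less2[OF assms(1)] E_less2[OF assms(2)] E_irrefl assms(1,2)
    by auto
  define x where "x = P a - P v"
  define y where "y = P b - P v"
  have det: "Re x * Im y = Im x * Re y" using assms(4) by (simp add: orient_def x_def y_def)
  define n where "n = Re x * Re x + Im x * Im x"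
  have n: "0 < n" using ne(1) sum_squares_gt_zero_iff[of "Re x" "Im x"] by (auto simp: n_def x_def complex_eq_iff)
  define r where "r = (Re x * Re y + Im x * Im y) / n"
  have "n * Re y = Re x * (Re x * Re y) + Im x * (Im x * Re y)" by (simp add: n_def algebra_simps)
  also have "\<dots> = Re x * (Re x * Re y + Im x * Im y)" unfolding det[symmetric] by (simp add: algebra_simps)
  finally have 1: "Re y = r * Re x" using n by (simp add: r_def field_simps)
  have "n * Im y = Re x * (Re x * Im y) + Im x * (Im x * Im y)" by (simp add: n_def algebra_simps)
  also have "\<dots> = Im x * (Re x * Re y + Im x * Im y)" unfolding det by (simp add: algebra_simps)
  finally have 2: "Im y = r * Im x" using n by (simp add: r_def field_simps)
  have y: "y = r *\<^sub>R x" using 1 2 by (simp add: complex_eq_iff)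
  have "r \<noteq> 0" using y ne(2) by (auto simp: y_def)
  moreover have "\<not> 0 < r"
  proof
    assume "0 < r"
    then have "b = a"
      using rays_distinct[of 1 b v r a] y assms(1,2) by (simp add: x_def y_def)
    then show False using assms(3) by simp
  qed
  ultimately have "0 < - r" by simp
  moreover have "y = - (- r) *\<^sub>R x" using y by simp
  ultimately show ?thesis unfolding x_def y_def by blast
qed

text \<open>Passing from Q back to P, a left turn may degenerate to zero. The two directions are
  then opposite, which makes the two other turns agree in sign, and two strict left turns
  remain.\<close>

lemma cyc_ccw3:
  assumes E: "E v a" "E v b" "E v c" and d: "a \<noteq> b" "b \<noteq> c" "c \<noteq> a" and cyc: "cyc Q v a b c"
  shows "ccw3 (P a - P v) (P b - P v) (P c - P v)"
proof -
  have less: "v < n" "a < n" "b < n" "c < n" using E E_less E_less2 by blast+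
  have o: "orient 0 (P x - P v) (P y - P v) = orient (P v) (P x) (P y)" for x y by (simp add: orient_def)
  have weak: "0 \<le> orient (P v) (P x) (P y)" if "pos Q v x y" "x < n" "y < n" for x y
    using pos_iff[OF less(1) that(2,3)] that(1) by fastforce
  have main: "ccw3 (P a - P v) (P b - P v) (P c - P v)"
    if p: "pos Q v a b" "pos Q v b c" and E: "E v a" "E v b" "E v c" and d: "a \<noteq> b" "b \<noteq> c" "c \<noteq> a" for a b c
  proof -
    have less: "a < n" "b < n" "c < n" using E E_less2 by blast+
    define \<alpha> \<beta> \<gamma> where "\<alpha> = orient (P v) (P a) (P b)" and "\<beta> = orient (P v) (P b) (P c)" and "\<gamma> = orient (P v) (P c) (P a)"
    have ge: "0 \<le> \<alpha>" "0 \<le> \<beta>" using weak p less by (simp_all add: \<alpha>_def \<beta>_def)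
    have "(0 < \<alpha> \<and> 0 < \<beta>) \<or> (0 < \<beta> \<and> 0 < \<gamma>) \<or> (0 < \<gamma> \<and> 0 < \<alpha>)"
    proof (cases "\<alpha> = 0")
      case True
      obtain k where k: "0 < k" "P b - P v = - k *\<^sub>R (P a - P v)"
        using opposite_ray[OF E(1,2) d(1)] True by (auto simp: \<alpha>_def)
      have \<beta>: "\<beta> = k * \<gamma>"
        unfolding \<beta>_def \<gamma>_def orient_def k(2) by (simp add: algebra_simps)
      have "\<beta> \<noteq> 0"
      proof
        assume "\<beta> = 0"
        then obtain l where l: "0 < l" "P c - P v = - l *\<^sub>R (P b - P v)"
          using opposite_ray[OF E(2,3) d(2)] by (auto simp: \<beta>_def)
        have "1 *\<^sub>R (P c - P v) = (l * k) *\<^sub>R (P a - P v)" unfolding l(2) k(2) by simp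
        then show False using rays_distinct[of 1 c v "l * k" a] E k l d(3) by auto
      qed
      then have "0 < \<beta>" using ge by simp
      moreover have "0 < \<gamma>" using \<open>0 < \<beta>\<close> \<beta> k by (simp add: zero_less_mult_iff)
      ultimately show ?thesis by blast
    next
      case False
      then have a: "0 < \<alpha>" using ge by simp
      show ?thesis
      proof (cases "\<beta> = 0")
        case True
        obtain k where k: "0 < k" "P c - P v = - k *\<^sub>R (P b - P v)"
          using opposite_ray[OF E(2,3) d(2)] True by (auto simp: \<beta>_def)
        have "\<gamma> = k * \<alpha>" unfolding \<alpha>_def \<gamma>_def orient_def k(2) by (simp add: algebra_simps)
        then show ?thesis using a k by simp
      next
        case False
        then show ?thesis using a ge by simp
      qed
    qed
    then show ?thesis unfolding ccw3_def o \<alpha>_def \<beta>_def \<gamma>_def .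
  qed
  have rot: "ccw3 x y z \<longleftrightarrow> ccw3 y z x" for x y z by (auto simp: ccw3_def)
  from cyc show ?thesis
    unfolding cyc_def
    using main[of a b c] main[of b c a] main[of c a b] E d rot by metis
qed

end

lemma cyc_chain_nth: "cyc_chain Q v d L \<Longrightarrow> Suc i < length L \<Longrightarrow> cyc Q v d (L ! i) (L ! Suc i)"
proof (induction Q v d L arbitrary: i rule: cyc_chain.induct)
  case (1 Q v d x y L)
  then show ?case by (cases i) auto
qed auto

lemma rotations_adj:
  "\<forall>v\<in>set [0..<16]. (\<forall>u\<in>set [0..<16]. sum_adj v u \<longleftrightarrow> u \<in> set (rotations ! v)) \<and> distinct (rotations ! v) \<and>
     2 < length (rotations ! v) \<and> set (rotations ! v) \<subseteq> set [0..<16]"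
  by code_simp

lemma (in sum_layout) rotation_order:
  assumes "v < 16" "i < length (rotations ! v)" "j < length (rotations ! v)" "k < length (rotations ! v)"
  shows "ccw3 (P (rotations ! v ! i) - P v) (P (rotations ! v ! j) - P v) (P (rotations ! v ! k) - P v) \<longleftrightarrow>
    (i < j \<and> j < k) \<or> (j < k \<and> k < i) \<or> (k < i \<and> i < j)"
proof -
  define L where "L = rotations ! v"
  have L: "distinct L" "2 < length L" "\<And>u. u \<in> set L \<Longrightarrow> sum_adj v u \<and> u < 16"
    using bspec[OF rotations_adj, of v] assms(1) by (auto simp: L_def)
  have E: "sum_adj v (L ! i)" "L ! i < 16" if "i < length L" for i using L(3) that by auto
  have ch: "cyc_chain Q v (hd L) (tl L)"
    using list_all2_nthD[OF rotations_cyc, of v] assms(1) nth_upt[of 0 v 16]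
    by (simp add: L_def upt_rec numeral_eq_Suc)
  have hd: "hd L = L ! 0" using L(2) by (cases L) auto
  have tl: "tl L ! i = L ! Suc i" if "Suc i < length L" for i using that by (cases L) auto
  show ?thesis
    unfolding L_def[symmetric]
  proof (rule ccw3_sorted[where d = "\<lambda>i. P (L ! i) - P v" and n = "length L"])
    show "P (L ! i) - P v \<noteq> 0" if "i < length L" for i
      using P_inj[of "L ! i" v] E[OF that] assms(1) E_irrefl by fastforce
    show "ccw3 (P (L ! 0) - P v) (P (L ! i) - P v) (P (L ! Suc i) - P v)" if i: "0 < i" "Suc i < length L" for i
    proof (rule cyc_ccw3)
      obtain m where m: "i = Suc m" using i by (cases i) auto
      show "cyc Q v (L ! 0) (L ! i) (L ! Suc i)"
        using cyc_chain_nth[OF ch, of m] i tl[of m] tl[of "Suc m"] by (simp add: m hd)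
      have l: "0 < length L" "i < length L" using i by linarith+
      show "sum_adj v (L ! 0)" "sum_adj v (L ! i)" "sum_adj v (L ! Suc i)"
        by (rule E(1)[OF l(1)], rule E(1)[OF l(2)], rule E(1)[OF i(2)])
      show "L ! 0 \<noteq> L ! i" "L ! i \<noteq> L ! Suc i" "L ! Suc i \<noteq> L ! 0"
        using nth_eq_iff_index_eq[OF L(1) l(1,2)] nth_eq_iff_index_eq[OF L(1) l(2) i(2)]
          nth_eq_iff_index_eq[OF L(1) i(2) l(1)] i(1) by simp_all
    qed
  qed (use L(2) assms in \<open>auto simp: L_def\<close>)
qed

section \<open>Translating the glued graph into numbered vertices\<close>

section \<open>Drawings of the graph\<close>

definition vx :: "nat \<Rightarrow> antiprism_vertex + antiprism_vertex" where
  "vx i = [Inl (A 0), Inl (B 0), Inl (A 1), Inl (B 1), Inl (A 2), Inl (B 2), Inl (A 3), Inl (B 3), Inl V0,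
     Inr (B 0), Inr (B 1), Inr (A 2), Inr (B 2), Inr (A 3), Inr (B 3), Inr V0] ! i"

lemma UNIV_4: "(UNIV :: 4 set) = {0, 1, 2, 3}"
proof -
  have "x \<in> {0, 1, 2, 3}" for x :: 4 using exhaust_4[of x] by auto
  then show ?thesis by blast
qed

lemma UNIV_antiprism_vertex: "UNIV = {V0, A 0, A 1, A 2, A 3, B 0, B 1, B 2, B 3}"
proof -
  have "x \<in> {V0} \<union> A ` UNIV \<union> B ` UNIV" for x by (cases x) auto
  then show ?thesis unfolding UNIV_4 by auto
qed

lemma lessThan_16: "{..<16} = set [0, 1, 2, 3, 4, 5, 6, 7, 8, 9, 10, 11, 12, 13, 14, 15::nat]"
  by (simp add: lessThan_Suc numeral_eq_Suc insert_commute)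

lemma vx_values: "map vx [0, 1, 2, 3, 4, 5, 6, 7, 8, 9, 10, 11, 12, 13, 14, 15] =
  [Inl (A 0), Inl (B 0), Inl (A 1), Inl (B 1), Inl (A 2), Inl (B 2), Inl (A 3), Inl (B 3), Inl V0,
     Inr (B 0), Inr (B 1), Inr (A 2), Inr (B 2), Inr (A 3), Inr (B 3), Inr V0]"
  by (simp add: vx_def del: One_nat_def)

lemma vx_inj: "i < 16 \<Longrightarrow> j < 16 \<Longrightarrow> vx i = vx j \<longleftrightarrow> i = j"
proof -
  have "distinct [Inl (A 0), Inl (B 0), Inl (A 1), Inl (B 1), Inl (A 2), Inl (B 2), Inl (A 3), Inl (B 3), Inl V0,
     Inr (B 0), Inr (B 1), Inr (A 2), Inr (B 2), Inr (A 3), Inr (B 3), Inr V0]"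
    by simp
  then show "i < 16 \<Longrightarrow> j < 16 \<Longrightarrow> vx i = vx j \<longleftrightarrow> i = j"
    unfolding vx_def by (subst nth_eq_iff_index_eq) simp_all
qed

lemma verts_sum: "verts antiprism_sum = vx ` {..<16}"
proof -
  have "vx ` {..<16} = set (map vx [0, 1, 2, 3, 4, 5, 6, 7, 8, 9, 10, 11, 12, 13, 14, 15])"
    unfolding lessThan_16 by simp
  then show ?thesis
    unfolding vx_values antiprism_sum_def Let_def disjoint_union_def augmented_square_antiprism_def graph.simps
      UNIV_antiprism_vertex
    by (simp add: glue_def insert_commute)
qed

lemma edges_sum: "edges antiprism_sum = (\<lambda>(a, b). {vx a, vx b}) ` set sum_edges"
proof -
  have star: "{{V0, x} | x. x \<noteq> V0} = (\<lambda>x. {V0, x}) ` {A 0, A 1, A 2, A 3, B 0, B 1, B 2, B 3}"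
    using UNIV_antiprism_vertex by auto
  have four: "(4::4) = 0" "(3::4) + 1 = 0" "(2::4) + 1 = 3" "(1::4) + 1 = 2" "(0::4) + 1 = 1" by simp_all
  note vals = vx_values[unfolded list.map list.inject]
  show ?thesis
    unfolding antiprism_sum_def Let_def disjoint_union_def augmented_square_antiprism_def graph.simps
      UNIV_4 star sum_edges_def list.set image_insert image_empty prod.case
    by (simp add: glue_def vals four del: One_nat_def)
       (intro equalityI; simp add: doubleton_eq_iff)
qed

lemma edge_iff:
  assumes "i < 16" "j < 16"
  shows "{vx i, vx j} \<in> edges antiprism_sum \<longleftrightarrow> sum_adj i j"
proof
  assume "{vx i, vx j} \<in> edges antiprism_sum"
  then obtain a b where ab: "(a, b) \<in> set sum_edges" "{vx i, vx j} = {vx a, vx b}" unfolding edges_sum by auto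
  have "a < 16" "b < 16" using sum_edges_sorted[OF ab(1)] by auto
  then have "i = a \<and> j = b \<or> i = b \<and> j = a" using ab(2) assms vx_inj by (simp add: doubleton_eq_iff)
  then show "sum_adj i j" using ab(1) unfolding sum_adj_def by blast
next
  assume "sum_adj i j"
  then show "{vx i, vx j} \<in> edges antiprism_sum"
    unfolding sum_adj_def edges_sum using insert_commute[of "vx i" "vx j"] by (metis (no_types, lifting) case_prod_conv image_eqI)
qed

lemma edge_indices:
  assumes "{u, v} \<in> edges antiprism_sum"
  obtains i j where "u = vx i" "v = vx j" "sum_adj i j" "i < 16" "j < 16"
proof -
  obtain a b where ab: "(a, b) \<in> set sum_edges" "{u, v} = {vx a, vx b}" using assms unfolding edges_sum by auto
  have less: "a < 16" "b < 16" using sum_edges_sorted[OF ab(1)] by auto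
  have E: "sum_adj a b" "sum_adj b a" using ab(1) by (auto simp: sum_adj_def)
  show thesis using that[of a b] that[of b a] ab(2) less E by (auto simp: doubleton_eq_iff)
qed

lemma edge_pair:
  assumes "e \<in> edges antiprism_sum"
  obtains i j where "e = {vx i, vx j}" "sum_adj i j" "i < 16" "j < 16"
proof -
  obtain a b where ab: "(a, b) \<in> set sum_edges" "e = {vx a, vx b}" using assms unfolding edges_sum by auto
  then show thesis using that[of a b] sum_edges_sorted[OF ab(1)] sum_edges_adj[OF ab(1)] by auto
qed

lemma sum_adj_less: "sum_adj i j \<Longrightarrow> i < 16 \<and> j < 16 \<and> i \<noteq> j"
  using sum_edges_sorted[of i j] sum_edges_sorted[of j i] unfolding sum_adj_def by auto

lemma sum_adj_sym: "sum_adj i j \<Longrightarrow> sum_adj j i"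
  unfolding sum_adj_def by blast

lemma rac_signs_sum:
  assumes "rac_config 16 sum_adj P" "generic_perturbation 16 P Q"
  shows "sum_signs P Q"
  unfolding sum_signs_def
  by unfold_locales (use assms sum_adj_less sum_adj_sym in blast)+

context rac_signs
begin

lemma open_segments_meet:
  assumes E: "E a b" "E c d" and ne: "{a, b} \<noteq> {c, d}"
    and x: "x \<in> open_segment (P a) (P b)" "x \<in> open_segment (P c) (P d)"
  shows "distinct [a, b, c, d]"
proof -
  have cl: "x \<in> closed_segment (P a) (P b)" "x \<in> closed_segment (P b) (P a)"
      "x \<in> closed_segment (P c) (P d)" "x \<in> closed_segment (P d) (P c)"
    and xne: "x \<noteq> P a" "x \<noteq> P b"
    using x by (auto simp: open_segment_def closed_segment_commute)
  have "a \<noteq> b" "c \<noteq> d" using E E_irrefl by auto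
  moreover have "a \<noteq> c" using adjacent_edges_meet[of a b d x] E cl xne ne by auto
  moreover have "a \<noteq> d" using adjacent_edges_meet[of a b c x] E E_sym[OF E(2)] cl xne ne by auto
  moreover have "b \<noteq> c" using adjacent_edges_meet[of b a d x] E E_sym[OF E(1)] cl xne ne by auto
  moreover have "b \<noteq> d" using adjacent_edges_meet[of b a c x] E_sym[OF E(2)] E_sym[OF E(1)] cl xne ne by auto
  ultimately show ?thesis by auto
qed

lemma segments_meet_once:
  assumes E: "E a b" "E c d" and ne: "{a, b} \<noteq> {c, d}"
    and x: "x \<in> closed_segment (P a) (P b)" "x \<in> closed_segment (P c) (P d)"
    and y: "y \<in> closed_segment (P a) (P b)" "y \<in> closed_segment (P c) (P d)"
  shows "x = y"
proof (cases "distinct [a, b, c, d]")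
  case True
  have par: "\<exists>k. z' - z = k *\<^sub>R (v - u)" if z: "z \<in> closed_segment u v" "z' \<in> closed_segment u v" for z z' u v :: complex
  proof -
    obtain s where s: "z = (1 - s) *\<^sub>R u + s *\<^sub>R v" using z(1) unfolding in_segment by blast
    obtain t where t: "z' = (1 - t) *\<^sub>R u + t *\<^sub>R v" using z(2) unfolding in_segment by blast
    have "z' - z = (t - s) *\<^sub>R (v - u)" unfolding s t by (simp add: algebra_simps)
    then show ?thesis by blast
  qed
  obtain k where k: "y - x = k *\<^sub>R (P b - P a)" using par[OF x(1) y(1)] by blast
  obtain l where l: "y - x = l *\<^sub>R (P d - P c)" using par[OF x(2) y(2)] by blast
  have "(P b - P a) \<bullet> (P d - P c) = 0"
    using rac E True x unfolding rac_config_def orthogonal_def by blast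
  then have "(k *\<^sub>R (P b - P a)) \<bullet> (l *\<^sub>R (P d - P c)) = 0" by simp
  \<comment> \<open>The difference y - x is parallel to both of two perpendicular edges, so it is
    orthogonal to itself.\<close>
  then have "(y - x) \<bullet> (y - x) = 0" unfolding k[symmetric] l[symmetric] .
  then show ?thesis by simp
next
  case False
  have cl: "x \<in> closed_segment (P b) (P a)" "x \<in> closed_segment (P d) (P c)"
    "y \<in> closed_segment (P b) (P a)" "y \<in> closed_segment (P d) (P c)"
    using x y by (simp_all add: closed_segment_commute)
  have "a \<noteq> b" "c \<noteq> d" using E E_irrefl by auto
  then consider "a = c" "b \<noteq> d" | "a = d" "b \<noteq> c" | "b = c" "a \<noteq> d" | "b = d" "a \<noteq> c" using False ne by auto
  then show ?thesis
  proof cases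
    case 1 then show ?thesis using adjacent_edges_meet[of a b d x] adjacent_edges_meet[of a b d y] E x y by simp
  next
    case 2 then show ?thesis using adjacent_edges_meet[of a b c x] adjacent_edges_meet[of a b c y] E E_sym[OF E(2)] x y cl by simp
  next
    case 3 then show ?thesis using adjacent_edges_meet[of b a d x] adjacent_edges_meet[of b a d y] E E_sym[OF E(1)] x y cl by simp
  next
    case 4 then show ?thesis
      using adjacent_edges_meet[of b a c x] adjacent_edges_meet[of b a c y] E_sym[OF E(1)] E_sym[OF E(2)] x y cl by simp
  qed
qed

end

text \<open>Since no vertex lies on a foreign edge, disjoint edges that meet do so in their
  interiors and are perpendicular, while adjacent edges meet only at the common end. So overlaps
  cannot occur and only disjoint pairs can cross.\<close>

lemma RAC_drawing_sum_iff: "RAC_drawing antiprism_sum p \<longleftrightarrow> rac_config 16 sum_adj (p \<circ> vx)"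
proof
  assume R: "RAC_drawing antiprism_sum p"
  then have S: "straight_line_drawing antiprism_sum p"
    and perp: "\<And>e f. e \<in> edges antiprism_sum \<Longrightarrow> f \<in> edges antiprism_sum \<Longrightarrow> cross p e f \<Longrightarrow> perpendicular p e f"
    by (auto simp: RAC_drawing_def)
  have inj: "inj_on (p \<circ> vx) {..<16}"
    by (rule comp_inj_on) (use S vx_inj in \<open>auto simp: straight_line_drawing_def verts_sum inj_on_def\<close>)
  have off: "(p \<circ> vx) c \<notin> closed_segment ((p \<circ> vx) a) ((p \<circ> vx) b)"
    if "sum_adj a b" "c < 16" "c \<noteq> a" "c \<noteq> b" for a b c
  proof -
    have "a < 16" "b < 16" using sum_adj_less[OF that(1)] by auto
    then have "{vx a, vx b} \<in> edges antiprism_sum" "vx c \<in> verts antiprism_sum - {vx a, vx b}"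
      using that edge_iff[of a b] vx_inj[of c] by (auto simp: verts_sum)
    then have "p (vx c) \<notin> edge_segment p {vx a, vx b}"
      using S unfolding straight_line_drawing_def by blast
    then show ?thesis by (simp add: edge_segment_pair)
  qed
  show "rac_config 16 sum_adj (p \<circ> vx)"
    unfolding rac_config_def
  proof (intro conjI allI impI)
    show "inj_on (p \<circ> vx) {..<16}" by (rule inj)
    show "(p \<circ> vx) c \<notin> closed_segment ((p \<circ> vx) a) ((p \<circ> vx) b)" if "sum_adj a b \<and> c < 16 \<and> c \<noteq> a \<and> c \<noteq> b" for a b c
      using off that by blast
    fix a b c d
    assume *: "sum_adj a b \<and> sum_adj c d \<and> distinct [a, b, c, d] \<and>
      closed_segment ((p \<circ> vx) a) ((p \<circ> vx) b) \<inter> closed_segment ((p \<circ> vx) c) ((p \<circ> vx) d) \<noteq> {}"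
    then obtain x where x: "x \<in> closed_segment (p (vx a)) (p (vx b))" "x \<in> closed_segment (p (vx c)) (p (vx d))" by auto
    have less: "a < 16" "b < 16" "c < 16" "d < 16" using * sum_adj_less by blast+
    have ne: "x \<noteq> p (vx a)" "x \<noteq> p (vx b)" "x \<noteq> p (vx c)" "x \<noteq> p (vx d)"
      using off[of c d a] off[of c d b] off[of a b c] off[of a b d] * less x by auto
    have e: "{vx a, vx b} \<in> edges antiprism_sum" "{vx c, vx d} \<in> edges antiprism_sum"
      using * less edge_iff by auto
    have "{vx a, vx b} \<noteq> {vx c, vx d}" using * less vx_inj by (auto simp: doubleton_eq_iff)
    moreover have "x \<in> edge_interior p {vx a, vx b} \<inter> edge_interior p {vx c, vx d}"
      using x ne by (simp add: edge_interior_pair open_segment_def)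
    ultimately have "cross p {vx a, vx b} {vx c, vx d}" unfolding cross_def by blast
    then have "perpendicular p {vx a, vx b} {vx c, vx d}" by (rule perp[OF e])
    then show "orthogonal ((p \<circ> vx) b - (p \<circ> vx) a) ((p \<circ> vx) d - (p \<circ> vx) c)"
      by (simp add: perpendicular_def)
  qed
next
  assume rac: "rac_config 16 sum_adj (p \<circ> vx)"
  obtain Q where "generic_perturbation 16 (p \<circ> vx) Q" using generic_perturbation_exists by blast
  then interpret sum_signs "p \<circ> vx" Q using rac_signs_sum rac by blast
  show "RAC_drawing antiprism_sum p"
    unfolding RAC_drawing_def straight_line_drawing_def
  proof (intro conjI ballI impI)
    show "inj_on p (verts antiprism_sum)"
      using P_inj unfolding verts_sum inj_on_def by auto
    show "p v \<notin> edge_segment p e" if e: "e \<in> edges antiprism_sum" and v: "v \<in> verts antiprism_sum - e" for e v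
    proof -
      obtain i j where ij: "e = {vx i, vx j}" "sum_adj i j" using edge_pair[OF e] by blast
      obtain c where c: "v = vx c" "c < 16" using v by (auto simp: verts_sum)
      have "c \<noteq> i" "c \<noteq> j" using v c ij by auto
      then show ?thesis using not_on_edge[OF ij(2) c(2)] by (simp add: ij c edge_segment_pair)
    qed
    show "\<not> overlap p e f" if ef: "e \<in> edges antiprism_sum" "f \<in> edges antiprism_sum" "e \<noteq> f" for e f
    proof
      obtain i j where ij: "e = {vx i, vx j}" "sum_adj i j" using edge_pair[OF ef(1)] by blast
      obtain k l where kl: "f = {vx k, vx l}" "sum_adj k l" using edge_pair[OF ef(2)] by blast
      have ne: "{i, j} \<noteq> {k, l}" using ef(3) unfolding ij kl by (auto simp: doubleton_eq_iff)
      assume "overlap p e f"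
      then obtain x y where "x \<noteq> y" "closed_segment x y \<subseteq> edge_segment p e \<inter> edge_segment p f"
        unfolding overlap_def by blast
      moreover have "x \<in> closed_segment x y" "y \<in> closed_segment x y" by simp_all
      ultimately show False
        using segments_meet_once[OF ij(2) kl(2) ne, of x y] unfolding ij kl edge_segment_pair comp_def by blast
    qed
    show "perpendicular p e f" if ef: "e \<in> edges antiprism_sum" "f \<in> edges antiprism_sum" "cross p e f" for e f
    proof -
      obtain i j where ij: "e = {vx i, vx j}" "sum_adj i j" using edge_pair[OF ef(1)] by blast
      obtain k l where kl: "f = {vx k, vx l}" "sum_adj k l" using edge_pair[OF ef(2)] by blast
      have ne: "{i, j} \<noteq> {k, l}" using ef(3) unfolding ij kl cross_def by (auto simp: doubleton_eq_iff)
      obtain x where x: "x \<in> open_segment (p (vx i)) (p (vx j))" "x \<in> open_segment (p (vx k)) (p (vx l))"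
        using ef(3) unfolding cross_def ij kl edge_interior_pair by blast
      have d: "distinct [i, j, k, l]" using open_segments_meet[OF ij(2) kl(2) ne] x by simp
      have "orthogonal (p (vx j) - p (vx i)) (p (vx l) - p (vx k))"
        using rac ij(2) kl(2) d x segment_open_subset_closed unfolding rac_config_def comp_def by blast
      then have o: "(p (vx j) - p (vx i)) \<bullet> (p (vx l) - p (vx k)) = 0" by (simp add: orthogonal_def)
      then show ?thesis
        unfolding perpendicular_def ij kl orthogonal_def by (auto simp: inner_diff_left inner_diff_right)
    qed
  qed
qed

section \<open>Existence on the integer grid\<close>

section \<open>A drawing\<close>

lemma separated_segments:
  fixes v :: "'a::real_inner"
  assumes "v \<bullet> a < v \<bullet> c" "v \<bullet> a < v \<bullet> d" "v \<bullet> b < v \<bullet> c" "v \<bullet> b < v \<bullet> d"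
  shows "closed_segment a b \<inter> closed_segment c d = {}"
proof -
  define k where "k = max (v \<bullet> a) (v \<bullet> b)"
  have "closed_segment a b \<subseteq> {x. v \<bullet> x \<le> k}" "closed_segment c d \<subseteq> {x. v \<bullet> x > k}"
    by (intro closed_segment_subset convex_halfspace_le convex_halfspace_gt; use assms in \<open>simp add: k_def\<close>)+
  then show ?thesis by fastforce
qed

text \<open>Two squares of side 4 share the segment from (0, -2) to (0, 2). The hubs are the
  centres, and the four b-vertices form a diamond around each hub whose sides are crossed at right
  angles by the half-diagonals.\<close>

definition pts :: "nat \<Rightarrow> int \<times> int" where
  "pts i = [(0, -2), (-1, 0), (0, 2), (-2, 1), (-4, 2), (-3, 0), (-4, -2), (-2, -1), (-2, 0),
     (1, 0), (2, 1), (4, 2), (3, 0), (4, -2), (2, -1), (2, 0)] ! i"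

text \<open>Normal vectors that suffice to separate every vertex from each edge not containing it
  and every two disjoint edges that do not cross perpendicularly.\<close>

definition directions :: "(int \<times> int) list" where
  "directions = [(3, 1), (-3, 1), (-1, -3), (-1, 4), (1, -1), (1, 1), (-1, -1)]"

definition dot :: "int \<times> int \<Rightarrow> int \<times> int \<Rightarrow> int" where
  "dot = (\<lambda>(a, b) (c, d). a * c + b * d)"

definition separated :: "nat list \<Rightarrow> nat list \<Rightarrow> bool" where
  "separated I J \<longleftrightarrow> (\<exists>v\<in>set directions. \<forall>i\<in>set I. \<forall>j\<in>set J. dot v (pts i) < dot v (pts j))"

lemma pts_checks:
  "distinct (map pts [0..<16])"
  "\<forall>(a, b)\<in>set sum_edges. \<forall>c\<in>set [0..<16]. c = a \<or> c = b \<or> separated [a, b] [c]"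
  "\<forall>(a, b)\<in>set sum_edges. \<forall>(c, d)\<in>set sum_edges. a < c \<longrightarrow> distinct [a, b, c, d] \<longrightarrow>
     separated [a, b] [c, d] \<or>
     (fst (pts b) - fst (pts a)) * (fst (pts d) - fst (pts c)) + (snd (pts b) - snd (pts a)) * (snd (pts d) - snd (pts c)) = 0"
  by code_simp+

definition grid :: "nat \<Rightarrow> complex" where
  "grid i = Complex (of_int (fst (pts i))) (of_int (snd (pts i)))"

lemma separated_grid:
  assumes "separated [a, b] J" "c \<in> set J" "d \<in> set J"
  shows "closed_segment (grid a) (grid b) \<inter> closed_segment (grid c) (grid d) = {}"
proof -
  obtain v where v: "\<forall>i\<in>set [a, b]. \<forall>j\<in>set J. dot v (pts i) < dot v (pts j)"
    using assms(1) unfolding separated_def by blast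
  define w where "w = Complex (of_int (fst v)) (of_int (snd v))"
  have w: "w \<bullet> grid i = of_int (dot v (pts i))" for i
    by (simp add: w_def grid_def dot_def inner_complex_def split_beta)
  show ?thesis by (rule separated_segments[of w]) (use v assms in \<open>simp_all add: w\<close>)
qed

lemma rac_config_cong:
  assumes "\<And>i. i < n \<Longrightarrow> P i = P' i" "\<And>a b. E a b \<Longrightarrow> a < n \<and> b < n" "rac_config n E P"
  shows "rac_config n E P'"
proof -
  have "inj_on P' {..<n}" using assms(1,3) inj_on_cong[of "{..<n}" P P'] by (simp add: rac_config_def)
  then show ?thesis using assms unfolding rac_config_def by (metis (no_types, lifting))
qed

lemma rac_config_grid: "rac_config 16 sum_adj grid"
  unfolding rac_config_def
proof (intro conjI allI impI)
  have "inj_on pts (set [0..<16])" using pts_checks(1) by (simp only: distinct_map)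
  then show "inj_on grid {..<16}"
    unfolding inj_on_def grid_def by (simp add: atLeast0LessThan prod_eq_iff)
  show "grid c \<notin> closed_segment (grid a) (grid b)" if "sum_adj a b \<and> c < 16 \<and> c \<noteq> a \<and> c \<noteq> b" for a b c
  proof -
    have *: "grid c \<notin> closed_segment (grid a) (grid b)" if "(a, b) \<in> set sum_edges" "c < 16" "c \<noteq> a" "c \<noteq> b" for a b
    proof -
      have "separated [a, b] [c]" using bspec[OF pts_checks(2) that(1)] that(2-4) by auto
      from separated_grid[OF this, of c c] show ?thesis by simp
    qed
    show ?thesis using *[of a b] *[of b a] that unfolding sum_adj_def by (auto simp: closed_segment_commute)
  qed
  fix a b c d
  assume A: "sum_adj a b \<and> sum_adj c d \<and> distinct [a, b, c, d] \<and>
    closed_segment (grid a) (grid b) \<inter> closed_segment (grid c) (grid d) \<noteq> {}"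
  have sorted: "(grid b - grid a) \<bullet> (grid d - grid c) = 0"
    if "(a, b) \<in> set sum_edges" "(c, d) \<in> set sum_edges" "distinct [a, b, c, d]" "a < c"
      "closed_segment (grid a) (grid b) \<inter> closed_segment (grid c) (grid d) \<noteq> {}" for a b c d
  proof -
    have "\<not> separated [a, b] [c, d]" using separated_grid[of a b "[c, d]" c d] that(5) by auto
    then have "(fst (pts b) - fst (pts a)) * (fst (pts d) - fst (pts c)) + (snd (pts b) - snd (pts a)) * (snd (pts d) - snd (pts c)) = 0"
      using bspec[OF bspec[OF pts_checks(3) that(1), unfolded prod.case] that(2)] that(3,4) by simp
    then have "real_of_int ((fst (pts b) - fst (pts a)) * (fst (pts d) - fst (pts c)) + (snd (pts b) - snd (pts a)) * (snd (pts d) - snd (pts c))) = 0"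
      by (simp only: of_int_0)
    then show ?thesis by (simp add: grid_def inner_complex_def)
  qed
  have half: "(grid b - grid a) \<bullet> (grid d - grid c) = 0"
    if "(a, b) \<in> set sum_edges" "(c, d) \<in> set sum_edges" "distinct [a, b, c, d]"
      "closed_segment (grid a) (grid b) \<inter> closed_segment (grid c) (grid d) \<noteq> {}" for a b c d
  proof (cases "a < c")
    case True
    then show ?thesis using sorted that by blast
  next
    case False
    then have "c < a" using that(3) by auto
    moreover have "distinct [c, d, a, b]" using that(3) by auto
    ultimately have "(grid d - grid c) \<bullet> (grid b - grid a) = 0"
      using sorted[of c d a b] that by (simp add: Int_commute)
    then show ?thesis by (simp add: inner_commute)
  qed
  have "(grid b - grid a) \<bullet> (grid d - grid c) = 0"
  proof -
    have m: "closed_segment (grid a) (grid b) \<inter> closed_segment (grid c) (grid d) \<noteq> {}"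
      "closed_segment (grid b) (grid a) \<inter> closed_segment (grid c) (grid d) \<noteq> {}"
      "closed_segment (grid a) (grid b) \<inter> closed_segment (grid d) (grid c) \<noteq> {}"
      "closed_segment (grid b) (grid a) \<inter> closed_segment (grid d) (grid c) \<noteq> {}"
      using A by (simp_all add: closed_segment_commute)
    have d: "distinct [a, b, c, d]" "distinct [b, a, c, d]" "distinct [a, b, d, c]" "distinct [b, a, d, c]" using A by auto
    have "(a, b) \<in> set sum_edges \<or> (b, a) \<in> set sum_edges" "(c, d) \<in> set sum_edges \<or> (d, c) \<in> set sum_edges"
      using A by (auto simp: sum_adj_def)
    then show ?thesis
      using half[OF _ _ d(1) m(1)] half[OF _ _ d(2) m(2)] half[OF _ _ d(3) m(3)] half[OF _ _ d(4) m(4)]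
      by (auto simp: inner_diff_left inner_diff_right)
  qed
  then show "orthogonal (grid b - grid a) (grid d - grid c)" by (simp add: orthogonal_def)
qed

lemma RAC_drawing_sum_exists: "\<exists>p. RAC_drawing antiprism_sum p"
proof -
  define p where "p = grid \<circ> inv_into {..<16} vx"
  have "inj_on vx {..<16}" using vx_inj by (auto simp: inj_on_def)
  then have "grid i = (p \<circ> vx) i" if "i < 16" for i using that by (simp add: p_def)
  then have "rac_config 16 sum_adj (p \<circ> vx)"
    using rac_config_cong[of 16 grid "p \<circ> vx" sum_adj] sum_adj_less rac_config_grid by blast
  then show ?thesis using RAC_drawing_sum_iff by blast
qed

section \<open>Crossing senses, outer face and the uniqueness argument\<close>

section \<open>The embedding is determined\<close>

text \<open>All ways to write an oriented crossing: reversing both edges, or exchanging the edges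
  and reversing one, preserves the sign of the determinant.\<close>

definition orientations :: "(nat \<times> nat \<times> nat \<times> nat) list" where
  "orientations = concat (map (\<lambda>(i, j, k, l). [(i, j, k, l), (j, i, l, k), (k, l, j, i), (l, k, i, j)]) oriented_crossings)"

definition sides :: "(nat \<times> nat \<times> nat) list" where
  "sides = concat (map (\<lambda>(a, b, c). [(a, b, c), (b, c, a), (c, a, b)]) wheel)"

text \<open>Some wheel triangle has the directed side i j, so it lies to the left of it.\<close>

definition left_side :: "nat \<Rightarrow> nat \<Rightarrow> bool" where
  "left_side i j \<longleftrightarrow> (\<exists>(a, b, c)\<in>set sides. a = i \<and> b = j)"

definition inner_at :: "nat \<Rightarrow> nat \<Rightarrow> nat \<Rightarrow> bool" where
  "inner_at w i j \<longleftrightarrow> (\<exists>(t, v)\<in>set inner. v = w \<and> i \<in> corners t \<and> j \<in> corners t)"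

definition crosses :: "nat \<Rightarrow> nat \<Rightarrow> nat \<Rightarrow> nat \<Rightarrow> bool" where
  "crosses a b c d \<longleftrightarrow> cross_pair (sort_pair (a, b)) (sort_pair (c, d))"

lemma crossing_lists:
  "\<forall>(s, t)\<in>set crossing_edges. \<forall>(a, b)\<in>set [s, prod.swap s]. \<forall>(c, d)\<in>set [t, prod.swap t].
     ((a, b, c, d) \<in> set orientations \<or> (a, b, d, c) \<in> set orientations) \<and>
     ((c, d, a, b) \<in> set orientations \<or> (c, d, b, a) \<in> set orientations) \<and>
     (left_side a b \<and> left_side b a \<or> inner_at a c d) \<and> (left_side c d \<and> left_side d c \<or> inner_at c a b)"
  "\<forall>(s, t)\<in>set (crossing_edges @ map prod.swap crossing_edges).
    \<forall>(s', t')\<in>set (crossing_edges @ map prod.swap crossing_edges). s = s' \<longrightarrow> t = t'"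
  "\<forall>(i, j, k, l)\<in>set oriented_crossings. sum_adj i j \<and> sum_adj k l \<and> distinct [i, j, k, l] \<and> crosses i j k l"
  by code_simp+

text \<open>Each directed edge that is neither crossed nor on the outer boundary has a reason for
  the region to lie on its left: it is a side of a triangle or ends at an inner vertex. An outer
  dart belongs to just one triangle, on its right.\<close>

lemma dart_lists:
  "\<forall>i\<in>set [0..<16]. \<forall>j\<in>set [0..<16]. sum_adj i j \<longrightarrow>
     (i, j) \<in> set outer_darts \<or> left_side i j \<or> inner_at i j j \<or> inner_at j i i \<or>
     (\<exists>(s, t)\<in>set crossing_edges. sort_pair (i, j) = s \<or> sort_pair (i, j) = t)"
  "\<forall>(i, j)\<in>set outer_darts. sum_adj i j \<and> (\<exists>(a, b, c)\<in>set sides. a = j \<and> b = i) \<and>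
    (\<forall>s\<in>set wheel. \<forall>t\<in>set wheel. i \<in> corners s \<and> j \<in> corners s \<and> i \<in> corners t \<and> j \<in> corners t \<longrightarrow> s = t)"
  "\<forall>s\<in>set sum_edges. covered wheel s"
  "\<forall>i\<in>set [0..<16]. \<exists>s\<in>set sum_edges. fst s = i \<or> snd s = i"
  by code_simp+

lemma sides_wheel:
  assumes "(i, j, k) \<in> set sides"
  obtains t where "t \<in> set wheel" "triangle P t = convex hull {P i, P j, P k}" "corners t = {i, j, k}"
    "t = (i, j, k) \<or> t = (k, i, j) \<or> t = (j, k, i)"
proof -
  obtain a b c where abc: "(a, b, c) \<in> set wheel" "(i, j, k) = (a, b, c) \<or> (i, j, k) = (b, c, a) \<or> (i, j, k) = (c, a, b)"
    using assms unfolding sides_def by auto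
  show thesis
    by (rule that[OF abc(1)]) (use abc(2) in \<open>auto simp: triangle_def corners_def insert_commute\<close>)
qed

lemma sort_pair_seg: "seg P (sort_pair (a, b)) = closed_segment (P a) (P b)"
  by (auto simp: seg_def sort_pair_def min_def max_def closed_segment_commute)

lemma sort_pair_edge: "sum_adj a b \<Longrightarrow> sort_pair (a, b) \<in> set sum_edges"
  using sum_edges_sorted by (fastforce simp: sum_adj_def sort_pair_def min_def max_def)

lemma crosses_distinct: "crosses a b c d \<Longrightarrow> distinct [a, b, c, d]"
  using crossing_edges_in[of "sort_pair (a, b)" "sort_pair (c, d)"] crossing_edges_in[of "sort_pair (c, d)" "sort_pair (a, b)"]
  by (auto simp: crosses_def cross_pair_def sort_pair_def min_def max_def split: if_splits)

lemma crosses_cases: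
  assumes "crosses a b c d"
  shows "((a, b, c, d) \<in> set orientations \<or> (a, b, d, c) \<in> set orientations) \<and>
     (left_side a b \<and> left_side b a \<or> inner_at a c d)"
proof -
  have sp: "(a, b) \<in> set [sort_pair (a, b), prod.swap (sort_pair (a, b))]" for a b
    by (auto simp: sort_pair_def min_def max_def)
  from assms consider "(sort_pair (a, b), sort_pair (c, d)) \<in> set crossing_edges" |
    "(sort_pair (c, d), sort_pair (a, b)) \<in> set crossing_edges" by (auto simp: crosses_def cross_pair_def)
  then show ?thesis
  proof cases
    case 1
    from bspec[OF bspec[OF bspec[OF crossing_lists(1) 1, unfolded prod.case] sp[of a b], unfolded prod.case] sp[of c d], unfolded prod.case]
    show ?thesis by blast
  next
    case 2
    from bspec[OF bspec[OF bspec[OF crossing_lists(1) 2, unfolded prod.case] sp[of c d], unfolded prod.case] sp[of a b], unfolded prod.case]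
    show ?thesis by blast
  qed
qed

locale sum_drawing = sum_layout "p \<circ> vx" Q for p :: "antiprism_vertex + antiprism_vertex \<Rightarrow> complex" and Q +
  assumes drawing: "straight_line_drawing antiprism_sum p"
begin

abbreviation P :: "nat \<Rightarrow> complex" where "P \<equiv> p \<circ> vx"

lemma cross_iff:
  assumes "sum_adj a b" "sum_adj c d"
  shows "cross p {vx a, vx b} {vx c, vx d} \<longleftrightarrow> crosses a b c d"
proof
  have less: "a < 16" "b < 16" "c < 16" "d < 16" using assms sum_adj_less by blast+
  assume c: "cross p {vx a, vx b} {vx c, vx d}"
  then obtain x where x: "x \<in> open_segment (P a) (P b)" "x \<in> open_segment (P c) (P d)"
    by (auto simp: cross_def edge_interior_pair)
  have "{a, b} \<noteq> {c, d}" using c by (auto simp: cross_def doubleton_eq_iff)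
  then have d: "distinct [a, b, c, d]" using open_segments_meet[OF assms _ x] by blast
  have "seg P (sort_pair (a, b)) \<inter> seg P (sort_pair (c, d)) \<noteq> {}"
    using x segment_open_subset_closed unfolding sort_pair_seg by blast
  moreover have "disjoint_pairs (sort_pair (a, b)) (sort_pair (c, d))"
    using d by (auto simp: disjoint_pairs_def sort_pair_def min_def max_def)
  ultimately show "crosses a b c d"
    unfolding crosses_def using meet_iff[OF sort_pair_edge[OF assms(1)] sort_pair_edge[OF assms(2)]] by blast
next
  have less: "a < 16" "b < 16" "c < 16" "d < 16" using assms sum_adj_less by blast+
  assume cr: "crosses a b c d"
  have d: "distinct [a, b, c, d]" by (rule crosses_distinct[OF cr])
  have "disjoint_pairs (sort_pair (a, b)) (sort_pair (c, d))"
    using d by (auto simp: disjoint_pairs_def sort_pair_def min_def max_def)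
  then have "seg P (sort_pair (a, b)) \<inter> seg P (sort_pair (c, d)) \<noteq> {}"
    using meet_iff[OF sort_pair_edge[OF assms(1)] sort_pair_edge[OF assms(2)]] cr unfolding crosses_def by blast
  then obtain x where x: "x \<in> closed_segment (P a) (P b)" "x \<in> closed_segment (P c) (P d)"
    unfolding sort_pair_seg by blast
  then have "x \<noteq> P a" "x \<noteq> P b" "x \<noteq> P c" "x \<noteq> P d"
    using not_on_edge[OF assms(1), of c] not_on_edge[OF assms(1), of d] not_on_edge[OF assms(2), of a]
      not_on_edge[OF assms(2), of b] less d by auto
  then have "x \<in> edge_interior p {vx a, vx b} \<inter> edge_interior p {vx c, vx d}"
    using x by (simp add: edge_interior_pair open_segment_def)
  moreover have "{vx a, vx b} \<noteq> {vx c, vx d}" using d less vx_inj by (auto simp: doubleton_eq_iff)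
  ultimately show "cross p {vx a, vx b} {vx c, vx d}" unfolding cross_def by blast
qed

sublocale one_plane antiprism_sum p
proof
  show "straight_line_drawing antiprism_sum p" by (rule drawing)
  show "\<exists>u v. e = {u, v} \<and> u \<noteq> v \<and> u \<in> verts antiprism_sum \<and> v \<in> verts antiprism_sum" if e: "e \<in> edges antiprism_sum" for e
  proof -
    obtain i j where ij: "e = {vx i, vx j}" "sum_adj i j" "i < 16" "j < 16" using edge_pair[OF e] by blast
    have "vx i \<noteq> vx j" using vx_inj[OF ij(3,4)] sum_adj_less[OF ij(2)] by simp
    then show ?thesis using ij by (auto simp: verts_sum)
  qed
  show "f = g" if efg: "e \<in> edges antiprism_sum" "f \<in> edges antiprism_sum" "g \<in> edges antiprism_sum" "cross p e f" "cross p e g" for e f g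
  proof -
    obtain i j where ij: "e = {vx i, vx j}" "sum_adj i j" using edge_pair[OF efg(1)] by blast
    obtain k l where kl: "f = {vx k, vx l}" "sum_adj k l" using edge_pair[OF efg(2)] by blast
    obtain m n where mn: "g = {vx m, vx n}" "sum_adj m n" using edge_pair[OF efg(3)] by blast
    have "crosses i j k l" "crosses i j m n" using cross_iff efg(4,5) ij kl mn by simp_all
    then have "(sort_pair (i, j), sort_pair (k, l)) \<in> set (crossing_edges @ map prod.swap crossing_edges)"
      "(sort_pair (i, j), sort_pair (m, n)) \<in> set (crossing_edges @ map prod.swap crossing_edges)"
      unfolding crosses_def cross_pair_def by force+
    from bspec[OF bspec[OF crossing_lists(2) this(1), unfolded prod.case] this(2), unfolded prod.case]
    have "sort_pair (k, l) = sort_pair (m, n)" by simp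
    then have "{k, l} = {m, n}" by (auto simp: sort_pair_def min_def max_def split: if_splits)
    then show ?thesis unfolding kl mn by (auto simp: doubleton_eq_iff)
  qed
qed

text \<open>\<open>oriented_crossings_pos\<close> fixes the sense of each crossing in the
  perturbation, and \<open>meeting_orient\<close> carries it to the determinant of the edge vectors
  in the drawing.\<close>

lemma crossing_sign:
  assumes E: "sum_adj a b" "sum_adj c d" and cr: "crosses a b c d"
  shows "0 < orient 0 (P a - P b) (P c - P d) \<longleftrightarrow> (a, b, c, d) \<in> set orientations"
proof -
  have pos: "0 < orient 0 (P a - P b) (P c - P d)" if abcd: "(a, b, c, d) \<in> set orientations" for a b c d
  proof -
    obtain i j k l where o: "(i, j, k, l) \<in> set oriented_crossings"
      "(a, b, c, d) \<in> {(i, j, k, l), (j, i, l, k), (k, l, j, i), (l, k, i, j)}"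
      using abcd unfolding orientations_def by fastforce
    have chk: "sum_adj i j" "sum_adj k l" "distinct [i, j, k, l]" "crosses i j k l"
      using bspec[OF crossing_lists(3) o(1)] by auto
    have "pos Q i j l" using bspec[OF oriented_crossings_pos o(1)] by simp
    have "cross p {vx i, vx j} {vx k, vx l}" using cross_iff[OF chk(1,2)] chk(4) by simp
    then have m: "closed_segment (P i) (P j) \<inter> closed_segment (P k) (P l) \<noteq> {}"
      using segment_open_subset_closed unfolding cross_def edge_interior_pair comp_def by blast
    note mo = meeting_orient[OF chk(1-3) m]
    have "i < 16" "j < 16" "l < 16" using chk sum_adj_less by blast+
    then have "0 < orient (P i) (P j) (P l)"
      using pos_iff[of i j l] \<open>pos Q i j l\<close> mo(2) by (cases "orient (P i) (P j) (P l) = 0") auto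
    then have "0 < orient 0 (P j - P i) (P l - P k)" using mo(2) by (simp add: zero_less_mult_iff)
    then show ?thesis using o(2) by (auto simp: orient_def algebra_simps)
  qed
  have "orient 0 (P a - P b) (P d - P c) = - orient 0 (P a - P b) (P c - P d)"
    by (simp add: orient_def algebra_simps)
  then show ?thesis using pos[of a b c d] pos[of a b d c] crosses_cases[OF cr] by auto
qed

text \<open>All edges lie in the region, and its frontier consists of points on triangle sides,
  which are edges; then \<open>outside_eq_complement\<close> applies.\<close>

lemma region_outside: "outside (drawing_image antiprism_sum p) = - region P wheel"
proof (rule outside_eq_complement[OF region_compact _ _ complement_connected])
  have seg: "closed_segment (P a) (P b) \<subseteq> region P wheel" if "(a, b) \<in> set sum_edges" for a b
    using covered_segment bspec[OF dart_lists(3) that] by blast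
  have ends: "P a \<in> region P wheel" "P b \<in> region P wheel" if "(a, b) \<in> set sum_edges" for a b
    using seg[OF that] ends_in_segment[of "P a" "P b"] by blast+
  show "drawing_image antiprism_sum p \<subseteq> region P wheel"
  proof
    fix x assume "x \<in> drawing_image antiprism_sum p"
    then consider i where "i < 16" "x = P i" | e where "e \<in> edges antiprism_sum" "x \<in> edge_segment p e"
      by (auto simp: drawing_image_def verts_sum)
    then show "x \<in> region P wheel"
    proof cases
      case 1
      then obtain s where "s \<in> set sum_edges" "fst s = i \<or> snd s = i" using bspec[OF dart_lists(4), of i] by auto
      then show ?thesis using ends[of "fst s" "snd s"] 1(2) by auto
    next
      case 2
      then obtain a b where "(a, b) \<in> set sum_edges" "e = {vx a, vx b}" unfolding edges_sum by auto
      then show ?thesis using seg[of a b] 2(2) by (auto simp: edge_segment_pair)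
    qed
  qed
  show "frontier (region P wheel) \<subseteq> drawing_image antiprism_sum p"
  proof
    fix x assume "x \<in> frontier (region P wheel)"
    then have "x \<in> \<Union> (frontier ` (triangle P ` set wheel))"
      using frontier_Union_subset[of "triangle P ` set wheel"] unfolding region_def by auto
    then obtain t where t: "t \<in> set wheel" "x \<in> frontier (triangle P t)" by blast
    obtain a b c where abc: "t = (a, b, c)" by (metis prod_cases3)
    have E: "sum_adj a b" "sum_adj b c" "sum_adj c a" using bspec[OF wheel_ok t(1)] by (simp_all add: abc)
    have "frontier (triangle P t) = closed_segment (P a) (P b) \<union> closed_segment (P b) (P c) \<union> closed_segment (P c) (P a)"
      unfolding triangle_def prod.case abc by (rule frontier_of_triangle) simp
    moreover have "closed_segment (P i) (P j) \<subseteq> drawing_image antiprism_sum p" if "sum_adj i j" for i j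
    proof -
      have "{vx i, vx j} \<in> edges antiprism_sum" using edge_iff sum_adj_less that by blast
      then show ?thesis unfolding drawing_image_def using edge_segment_pair[of p "vx i" "vx j"] by auto
    qed
    ultimately show "x \<in> drawing_image antiprism_sum p" using E t(2) by blast
  qed
qed

abbreviation enters_region :: "complex \<Rightarrow> complex \<Rightarrow> bool" where
  "enters_region x y \<equiv> \<forall>\<^sub>F r in at_right 0. midpoint x y + of_real r * \<i> * (y - x) \<in> region P wheel"

lemma enters_left:
  assumes "left_side i j" "0 \<le> s" "s < t" "t \<le> 1" "x = P i + s *\<^sub>R (P j - P i)" "y = P i + t *\<^sub>R (P j - P i)"
  shows "enters_region x y"
proof -
  obtain k where k: "(i, j, k) \<in> set sides" using assms(1) unfolding left_side_def by auto
  obtain u where u: "u \<in> set wheel" "triangle P u = convex hull {P i, P j, P k}"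
    "u = (i, j, k) \<or> u = (k, i, j) \<or> u = (j, k, i)" by (rule sides_wheel[OF k])
  have "0 < orient (P i) (P j) (P k)"
    using u wheel_orient[of i j k] wheel_orient[of k i j] wheel_orient[of j k i] by (auto simp: orient_rotate)
  from eventually_left_in_triangle[OF this assms(2-6)] show ?thesis
    by eventually_elim (use u in \<open>auto simp: region_def\<close>)
qed

lemma enters_inner:
  assumes "(t, w) \<in> set inner" "y \<in> triangle P t" "y \<noteq> P w"
  shows "enters_region (P w) y" "enters_region y (P w)"
proof -
  have t: "t \<in> set wheel" using bspec[OF inner_ok assms(1)] by (cases t) auto
  have "open_segment (P w) y \<subseteq> interior (triangle P t)"
    by (rule in_interior_closure_convex_segment[OF triangle_convex inner_interior[OF assms(1)]])
       (use assms(2) closure_subset in blast)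
  moreover have "midpoint (P w) y \<in> open_segment (P w) y" using assms(3) by (simp add: midpoint_in_open_segment)
  ultimately have m: "midpoint (P w) y \<in> interior (triangle P t)" by blast
  have sub: "triangle P t \<subseteq> region P wheel" using t unfolding region_def by blast
  have ev: "\<forall>\<^sub>F r in at_right 0. midpoint (P w) y + of_real r * c \<in> region P wheel" for c
    using eventually_left_in_interior[OF m, of c] by eventually_elim (use sub in blast)
  show "enters_region (P w) y" using ev[of "\<i> * (y - P w)"] by (simp add: mult.assoc)
  show "enters_region y (P w)" using ev[of "\<i> * (P w - y)"] by (simp add: mult.assoc midpoint_sym)
qed

lemma inner_atE:
  assumes "inner_at w i j"
  obtains t where "(t, w) \<in> set inner" "i \<in> corners t" "j \<in> corners t"
  using assms unfolding inner_at_def by blast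

text \<open>The only triangle with both corners i and j lies on the right. Any other triangle meets
  it in a face containing at most one of i and j, so it misses the midpoint of ij.\<close>

lemma outer_dart:
  assumes "(i, j) \<in> set outer_darts"
  shows "\<forall>\<^sub>F r in at_right 0. midpoint (P i) (P j) + of_real r * \<i> * (P j - P i) \<notin> region P wheel"
proof -
  obtain k where E: "sum_adj i j" and k: "(j, i, k) \<in> set sides"
    and uniq: "\<And>s t. s \<in> set wheel \<Longrightarrow> t \<in> set wheel \<Longrightarrow> i \<in> corners s \<and> j \<in> corners s \<and> i \<in> corners t \<and> j \<in> corners t \<Longrightarrow> s = t"
    using bspec[OF dart_lists(2) assms, unfolded prod.case] by blast
  obtain u where u: "u \<in> set wheel" "triangle P u = convex hull {P j, P i, P k}" "corners u = {j, i, k}"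
    "u = (j, i, k) \<or> u = (k, j, i) \<or> u = (i, k, j)" by (rule sides_wheel[OF k])
  have o: "0 < orient (P j) (P i) (P k)"
    using u(1,4) wheel_orient[of j i k] wheel_orient[of k j i] wheel_orient[of i k j]
      orient_rotate[of "P j" "P i" "P k"] orient_rotate[of "P k" "P j" "P i"] by auto
  have F: "sum_adj k j" "sum_adj k i"
    using u(1,4) wheel_ok sum_adj_sym by fast+
  have ij: "P i \<noteq> P j" using P_inj[of i j] sum_adj_less[OF E] by simp
  have mij: "midpoint (P i) (P j) \<in> closed_segment (P i) (P j)" "midpoint (P i) (P j) \<noteq> P i" "midpoint (P i) (P j) \<noteq> P j"
    using ij midpoint_in_closed_segment[of "P i" "P j"] by (auto simp: midpoint_eq_endpoint)
  have "\<forall>\<^sub>F r in at_right 0. midpoint (P i) (P j) + of_real r * \<i> * (P j - P i) \<notin> triangle P t" if t: "t \<in> set wheel" for t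
  proof (cases "t = u")
    case True
    show ?thesis unfolding True u(2) by (rule eventually_right_not_in_triangle[OF o])
  next
    case False
    have "midpoint (P i) (P j) \<notin> triangle P t"
    proof
      assume "midpoint (P i) (P j) \<in> triangle P t"
      moreover have "midpoint (P i) (P j) \<in> triangle P u"
        using mij(1) closed_segment_subset[OF corners_hull corners_hull triangle_convex, of i u j P] u(3) by auto
      ultimately have m: "midpoint (P i) (P j) \<in> convex hull (P ` (corners u \<inter> corners t))"
        using wheel_meet[OF u(1) t] False by blast
      have "\<not> (i \<in> corners t \<and> j \<in> corners t)" using uniq[OF u(1) t] u(3) False by blast
      then obtain l where l: "l \<in> {i, j}" "corners u \<inter> corners t \<subseteq> {l, k}" unfolding u(3) by auto
      have "convex hull (P ` (corners u \<inter> corners t)) \<subseteq> closed_segment (P l) (P k)"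
        unfolding segment_convex_hull using image_mono[OF l(2), of P] by (intro hull_mono) (simp only: image_insert image_empty)
      then have "midpoint (P i) (P j) \<in> closed_segment (P i) (P k) \<or> midpoint (P i) (P j) \<in> closed_segment (P j) (P k)"
        using m l(1) by (elim insertE emptyE) (simp_all only: subset_iff simp_thms)
      moreover have "j \<noteq> k" "i \<noteq> k" using sum_adj_less F by blast+
      ultimately show False
        using adjacent_edges_meet[OF E sum_adj_sym[OF F(2)], of "midpoint (P i) (P j)"]
          adjacent_edges_meet[OF sum_adj_sym[OF E] sum_adj_sym[OF F(1)], of "midpoint (P i) (P j)"] mij
        by (auto simp: closed_segment_commute)
    qed
    then show ?thesis
      using eventually_left_not_in[OF compact_imp_closed[OF triangle_compact], of "midpoint (P i) (P j)" P t "\<i> * (P j - P i)"]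
      by (simp add: mult.assoc)
  qed
  then have "\<forall>\<^sub>F r in at_right 0. \<forall>t\<in>set wheel. midpoint (P i) (P j) + of_real r * \<i> * (P j - P i) \<notin> triangle P t"
    by (intro eventually_ball_finite) auto
  then show ?thesis by eventually_elim (auto simp: region_def)
qed

lemma enters_uncrossed:
  assumes "sum_adj i j" "(i, j) \<notin> set outer_darts" "\<forall>f\<in>edges antiprism_sum. \<not> cross p {vx i, vx j} f"
  shows "enters_region (P i) (P j)"
proof -
  have less: "i < 16" "j < 16" "i \<noteq> j" using sum_adj_less[OF assms(1)] by auto
  then have ne: "P i \<noteq> P j" using P_inj by simp
  have "sort_pair (i, j) \<noteq> s \<and> sort_pair (i, j) \<noteq> t" if st: "(s, t) \<in> set crossing_edges" for s t
  proof -
    have no: "\<not> cross_pair (sort_pair (i, j)) t" if "t \<in> set sum_edges" for t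
    proof
      obtain a b where ab: "t = (a, b)" by (cases t)
      have E: "sum_adj a b" "a < b" using that sum_edges_adj sum_edges_sorted unfolding ab by blast+
      assume "cross_pair (sort_pair (i, j)) t"
      then have "crosses i j a b" using E(2) by (simp add: crosses_def ab sort_pair_def)
      then have "cross p {vx i, vx j} {vx a, vx b}" using cross_iff[OF assms(1) E(1)] by simp
      then show False using assms(3) edge_iff E(1) sum_adj_less by blast
    qed
    show ?thesis
      using no[of s] no[of t] crossing_edges_in[OF st] st unfolding cross_pair_def by blast
  qed
  then have nc: "\<not> (\<exists>(s, t)\<in>set crossing_edges. sort_pair (i, j) = s \<or> sort_pair (i, j) = t)" by blast
  have "i \<in> set [0..<16]" "j \<in> set [0..<16]" using less by simp_all
  from mp[OF bspec[OF bspec[OF dart_lists(1) this(1)] this(2)] assms(1)]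
  consider "left_side i j" | "inner_at i j j" | "inner_at j i i" using assms(2) nc by argo
  then show ?thesis
  proof cases
    case 1
    then show ?thesis by (rule enters_left[where s = 0 and t = 1]) simp_all
  next
    case 2
    then obtain t where "(t, i) \<in> set inner" "j \<in> corners t" by (rule inner_atE)
    then show ?thesis using enters_inner(1)[of t i "P j"] corners_hull[of j t P] ne by simp
  next
    case 3
    then obtain t where "(t, j) \<in> set inner" "i \<in> corners t" by (rule inner_atE)
    then show ?thesis using enters_inner(2)[of t j "P i"] corners_hull[of i t P] ne by simp
  qed
qed

text \<open>A half-edge at a crossing either lies on a side between two triangles, or joins an inner
  vertex to a point of a side of its own triangle.\<close>

lemma enters_crossed:
  assumes E: "sum_adj i j" "sum_adj k l" and cr: "crosses i j k l"
    and x: "x \<in> open_segment (P i) (P j)" "x \<in> open_segment (P k) (P l)"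
  shows "enters_region (P i) x" "enters_region x (P i)"
proof -
  from crosses_cases[OF cr] consider "left_side i j" "left_side j i" | "inner_at i k l" by blast
  then have "enters_region (P i) x \<and> enters_region x (P i)"
  proof cases
    case 1
    obtain s where s: "0 < s" "s < 1" "x = (1 - s) *\<^sub>R P i + s *\<^sub>R P j" using x(1) by (auto simp: in_segment)
    have "enters_region (P i) x"
      by (rule enters_left[OF 1(1), where s = 0 and t = s]) (use s in \<open>simp_all add: algebra_simps\<close>)
    moreover have "enters_region x (P i)"
      by (rule enters_left[OF 1(2), where s = "1 - s" and t = 1]) (use s in \<open>simp_all add: algebra_simps\<close>)
    ultimately show ?thesis ..
  next
    case 2
    then obtain t where t: "(t, i) \<in> set inner" "k \<in> corners t" "l \<in> corners t" by (rule inner_atE)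
    have "x \<in> closed_segment (P k) (P l)" using x(2) segment_open_subset_closed by blast
    then have "x \<in> triangle P t"
      using closed_segment_subset[OF corners_hull[OF t(2)] corners_hull[OF t(3)] triangle_convex] by blast
    moreover have "x \<noteq> P i" using x(1) by (auto simp: open_segment_def)
    ultimately show ?thesis using enters_inner[OF t(1)] by blast
  qed
  then show "enters_region (P i) x" "enters_region x (P i)" by auto
qed

text \<open>To the left of any dart that is not listed the region begins immediately, so the points
  just left of it cannot be in the outer face.\<close>

lemma outer_face_iff:
  assumes "code_adj antiprism_sum p a b"
  shows "(node p a, node p b) \<in> outer_face (embedding_of antiprism_sum p) \<longleftrightarrow>
    (\<exists>(i, j)\<in>set outer_darts. a = Inl (vx i) \<and> b = Inl (vx j))" (is "_ \<longleftrightarrow> ?O")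
proof -
  let ?z = "\<lambda>r. midpoint (node p a) (node p b) + of_real r * \<i> * (node p b - node p a)"
  have eq: "(node p a, node p b) \<in> outer_face (embedding_of antiprism_sum p) \<longleftrightarrow>
      (\<forall>\<^sub>F r in at_right 0. ?z r \<notin> region P wheel)"
    using code_adj_imp_adj[OF assms] by (simp add: embedding_of_def region_outside)
  have out: "\<forall>\<^sub>F r in at_right 0. ?z r \<notin> region P wheel" if ?O
    using that outer_dart by (auto simp: node_def)
  have "\<forall>\<^sub>F r in at_right 0. ?z r \<in> region P wheel" if nO: "\<not> ?O"
  proof -
    consider (uncrossed) u v where "{u, v} \<in> edges antiprism_sum" "\<forall>f\<in>edges antiprism_sum. \<not> cross p {u, v} f"
        "a = Inl u" "b = Inl v"
      | (crossed) u e f where "e \<in> edges antiprism_sum" "f \<in> edges antiprism_sum" "cross p e f" "u \<in> e"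
        "a = Inl u \<and> b = Inr {e, f} \<or> a = Inr {e, f} \<and> b = Inl u"
      using assms unfolding code_adj_def by blast
    then show ?thesis
    proof cases
    case uv: (uncrossed u v)
    obtain i j where ij: "u = vx i" "v = vx j" "sum_adj i j" using edge_indices[OF uv(1)] by blast
    have "(i, j) \<notin> set outer_darts" using nO uv(3,4) ij by blast
    then show ?thesis using enters_uncrossed[OF ij(3)] uv(2-4) ij by (simp add: node_def)
  next
    case ef: (crossed u e f)
    obtain v where v: "e = {u, v}"
      using edge_pair[OF ef(1)] ef(4) by (metis (no_types) insert_commute insertE singletonD)
    obtain i j where ij: "u = vx i" "v = vx j" "sum_adj i j" using edge_indices[of u v] ef(1) v by blast
    obtain k l where kl: "f = {vx k, vx l}" "sum_adj k l" using edge_pair[OF ef(2)] by blast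
    have cr: "crosses i j k l" using cross_iff[OF ij(3) kl(2)] ef(3) by (simp add: v ij kl)
    have "crossing_point p {e, f} \<in> open_segment (P i) (P j)" "crossing_point p {e, f} \<in> open_segment (P k) (P l)"
      using crossing_point(1,2)[OF ef(1-3)] by (simp_all add: v ij kl edge_interior_pair)
    from enters_crossed[OF ij(3) kl(2) cr this] show ?thesis using ef(5) by (auto simp: node_def ij)
  qed
  qed
  moreover have "\<not> ((\<forall>\<^sub>F r in at_right 0. ?z r \<notin> region P wheel) \<and> (\<forall>\<^sub>F r in at_right 0. ?z r \<in> region P wheel))"
  proof
    assume "(\<forall>\<^sub>F r in at_right 0. ?z r \<notin> region P wheel) \<and> (\<forall>\<^sub>F r in at_right 0. ?z r \<in> region P wheel)"
    then have "\<forall>\<^sub>F r in at_right 0. ?z r \<notin> region P wheel \<and> ?z r \<in> region P wheel" by (simp only: eventually_conj_iff)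
    then have "\<forall>\<^sub>F r in at_right (0::real). False" by eventually_elim blast
    then show False by simp
  qed
  ultimately show ?thesis unfolding eq using out by blast
qed

end

lemma sum_drawings_same:
  assumes "sum_drawing p Q" "sum_drawing q R"
  shows "same_embedding antiprism_sum p q"
proof -
  interpret p: sum_drawing p Q by (rule assms(1))
  interpret q: sum_drawing q R by (rule assms(2))
  have cr: "cross p e f \<longleftrightarrow> cross q e f" if ef: "e \<in> edges antiprism_sum" "f \<in> edges antiprism_sum" for e f
  proof -
    obtain i j where ij: "e = {vx i, vx j}" "sum_adj i j" using edge_pair[OF ef(1)] by blast
    obtain k l where kl: "f = {vx k, vx l}" "sum_adj k l" using edge_pair[OF ef(2)] by blast
    show ?thesis unfolding ij kl using p.cross_iff[OF ij(2) kl(2)] q.cross_iff[OF ij(2) kl(2)] by simp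
  qed
  have "\<exists>h. embedding_iso (verts antiprism_sum) (embedding_of antiprism_sum p) (embedding_of antiprism_sum q) h"
  proof (rule one_plane_embedding_iso[OF p.one_plane_axioms q.one_plane_axioms cr])
    fix u v1 v2 v3
    assume e: "{u, v1} \<in> edges antiprism_sum" "{u, v2} \<in> edges antiprism_sum" "{u, v3} \<in> edges antiprism_sum"
    obtain i j1 where 1: "u = vx i" "v1 = vx j1" "sum_adj i j1" using edge_indices[OF e(1)] by blast
    have i: "i < 16" using sum_adj_less[OF 1(3)] by simp
    have nb: "\<exists>k < length (rotations ! i). v = vx (rotations ! i ! k)" if uv: "{u, v} \<in> edges antiprism_sum" for v
    proof -
      obtain i' j where *: "u = vx i'" "v = vx j" "sum_adj i' j" "i' < 16" "j < 16" using edge_indices[OF uv] by blast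
      have "i' = i" using *(1) 1(1) vx_inj[OF *(4) i] by simp
      then have "j \<in> set (rotations ! i)" using bspec[OF rotations_adj, of i] * i by auto
      then show ?thesis using *(2) by (metis in_set_conv_nth)
    qed
    obtain k1 k2 k3 where k: "k1 < length (rotations ! i)" "k2 < length (rotations ! i)" "k3 < length (rotations ! i)"
      "v1 = vx (rotations ! i ! k1)" "v2 = vx (rotations ! i ! k2)" "v3 = vx (rotations ! i ! k3)"
      using nb[OF e(1)] nb[OF e(2)] nb[OF e(3)] by blast
    show "ccw3 (p v1 - p u) (p v2 - p u) (p v3 - p u) \<longleftrightarrow> ccw3 (q v1 - q u) (q v2 - q u) (q v3 - q u)"
      using p.rotation_order[OF i k(1-3)] q.rotation_order[OF i k(1-3)] unfolding k(4-6) 1(1) comp_def by simp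
  next
    fix u v w z
    assume e: "{u, v} \<in> edges antiprism_sum" "{w, z} \<in> edges antiprism_sum" and c: "cross p {u, v} {w, z}"
    obtain i j where ij: "u = vx i" "v = vx j" "sum_adj i j" using edge_indices[OF e(1)] by blast
    obtain k l where kl: "w = vx k" "z = vx l" "sum_adj k l" using edge_indices[OF e(2)] by blast
    have "crosses i j k l" using p.cross_iff[OF ij(3) kl(3)] c unfolding ij kl by simp
    then show "0 < orient 0 (p u - p v) (p w - p z) \<longleftrightarrow> 0 < orient 0 (q u - q v) (q w - q z)"
      using p.crossing_sign[OF ij(3) kl(3)] q.crossing_sign[OF ij(3) kl(3)] unfolding ij kl comp_def by simp
  next
    fix a b assume p: "code_adj antiprism_sum p a b"
    have "code_adj antiprism_sum q a b \<longleftrightarrow> code_adj antiprism_sum p a b"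
      unfolding code_adj_def by (simp add: cr cong: conj_cong)
    then show "(node p a, node p b) \<in> outer_face (embedding_of antiprism_sum p) \<longleftrightarrow>
        (node q a, node q b) \<in> outer_face (embedding_of antiprism_sum q)"
      using p.outer_face_iff[OF p] q.outer_face_iff[of a b] p by simp
  qed
  then show ?thesis unfolding same_embedding_def by blast
qed

lemma straight_line_drawing_cnj:
  assumes "straight_line_drawing G p"
  shows "straight_line_drawing G (cnj \<circ> p)"
proof -
  have "overlap p e f" if ov: "overlap (cnj \<circ> p) e f" for e f
  proof -
    obtain x y where xy: "x \<noteq> y" "closed_segment x y \<subseteq> cnj ` edge_segment p e \<inter> cnj ` edge_segment p f"
      using ov unfolding overlap_def edge_segment_cnj by blast
    have "closed_segment (cnj x) (cnj y) \<subseteq> cnj ` (cnj ` edge_segment p e \<inter> cnj ` edge_segment p f)"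
      unfolding cnj_closed_segment by (rule image_mono[OF xy(2)])
    also have "\<dots> \<subseteq> edge_segment p e \<inter> edge_segment p f" by auto
    finally have "closed_segment (cnj x) (cnj y) \<subseteq> edge_segment p e \<inter> edge_segment p f" .
    then show ?thesis unfolding overlap_def using xy(1) by (metis complex_cnj_cancel_iff)
  qed
  moreover have "inj_on (cnj \<circ> p) (verts G)" using assms by (auto simp: straight_line_drawing_def inj_on_def)
  ultimately show ?thesis
    using assms unfolding straight_line_drawing_def edge_segment_cnj comp_apply cnj_mem_image by blast
qed

text \<open>If the first hub is negatively oriented, the mirror image of the drawing and of its
  perturbation has it positive, and \<open>standard_layout\<close> applies there.\<close>

lemma RAC_drawing_layout:
  assumes "RAC_drawing antiprism_sum p"
  obtains Q where "sum_drawing p Q" | Q where "sum_drawing (cnj \<circ> p) Q"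
proof -
  have S: "straight_line_drawing antiprism_sum p" using assms by (simp add: RAC_drawing_def)
  obtain Q where "generic_perturbation 16 (p \<circ> vx) Q" using generic_perturbation_exists by blast
  then interpret sum_signs "p \<circ> vx" Q using rac_signs_sum assms RAC_drawing_sum_iff by blast
  have main: "sum_drawing p' Q'" if "sum_signs (p' \<circ> vx) Q'" "pos Q' 8 0 1" "straight_line_drawing antiprism_sum p'" for p' Q'
  proof -
    interpret s: sum_signs "p' \<circ> vx" Q' by (rule that(1))
    show ?thesis by unfold_locales (use s.standard_layout[OF that(2)] that(3) in auto)
  qed
  show thesis
  proof (cases "pos Q 8 0 1")
    case True
    show thesis by (rule that(1), rule main) (use True S sum_signs_axioms in auto)
  next
    case False
    have "sum_signs ((cnj \<circ> p) \<circ> vx) (cnj \<circ> Q)"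
      unfolding sum_signs_def using rac_signs_cnj by (simp add: comp_assoc)
    moreover have "pos (cnj \<circ> Q) 8 0 1" using pos_cnj[of 8 0 1] False by simp
    ultimately show thesis using that(2) main straight_line_drawing_cnj[OF S] by blast
  qed
qed

theorem theorem2:
  "(\<exists>p. RAC_drawing antiprism_sum p) \<and>
   (\<forall>p q. RAC_drawing antiprism_sum p \<longrightarrow> RAC_drawing antiprism_sum q \<longrightarrow>
      same_embedding antiprism_sum p q)"
proof (intro conjI allI impI)
  show "\<exists>p. RAC_drawing antiprism_sum p" by (rule RAC_drawing_sum_exists)
  fix p q assume "RAC_drawing antiprism_sum p" "RAC_drawing antiprism_sum q"
  then show "same_embedding antiprism_sum p q"
    by (elim RAC_drawing_layout)
       (blast intro: sum_drawings_same same_embedding_cnj)+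
qed

end
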